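(* Let $\mathcal J=\{J_1,\dots,J_m\}$ be a cover of $I=\{1,\dots,n\}$ such that: (i) each $J\in\mathcal J$ is an interval $\{s,\dots,u\}$ with $1\le s\le u\le n$, and for $1\le j<k\le m$, $\min(J_j)<\min(J_k)$ and $\max(J_j)<\max(J_k)$; (ii) for $1\le j<k\le m$ with $k-j\ge2$, $\max(J_j)<\min(J_k)-1$; (iii) $|J|=L$ for all $J\in\mathcal J$ and $|J_{k-1}\cap J_k|=p$ for all consecutive $J_{k-1},J_k\in\mathcal J$ (so $n=(L-p)m+p$). Assume the strong mixing conditions: (S-1) there is a probability measure $\nu_0$ on $\mathsf X$ such that $m(x,\cdot)$ is the density of $M(x,\mathrm dx')$ with respect to $\nu_0$, and there are constants $\sigma_-,\sigma_+>0$ and an integer $h\ge1$ with $m(x,x')\le\sigma_+$ for all $x,x'\in\mathsf X$ and $\int\nu_0(\mathrm dx_2)\cdots\nu_0(\mathrm dx_h)\prod_{j=1}^hm(x_j,x_{j+1})\ge\sigma_-$ for all $x_1,x_{h+1}\in\mathsf X$; (S-2) there is a constant $\delta\ge1$ such that $\sup_xg(x,y)\le\delta^{1/h}\inf_xg(x,y)$ for all $y\in\mathsf Y$. Let $\alpha=1-\delta^{(1-h)/h}\sigma_-/\sigma_+\in[0,1)$, $c=(2\delta\sigma_+/\sigma_--1)^{-1}$ and $$\lambda=2\alpha^{\lfloor h^{-1}(p+1)\rfloor},\qquad\beta=\alpha^{\lfloor h^{-1}\rfloor}+\alpha^{\lfloor h^{-1}(L-p+1)\rfloor},\qquad\epsilon=1-\Bigl(1-\frac1{c(N-1)+1}\Bigr)^L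 ,$$ and suppose $\lambda<1$. Let $\mathcal P$ denote the Markov kernel corresponding to one complete sweep of either the Parallel (PAR) sampler or the Left-to-Right (L-R) sampler, where each block is updated by simulating from the Particle Gibbs kernel with $N\ge2$ particles and the bootstrap proposal $r(x,x')=m(x,x')$. Let $\mu$ and $\nu$ be two probability distributions on $\mathsf X^n$ and let $\Psi$ be an arbitrary coupling of $\mu$ and $\nu$. Then, for any $f:\mathsf X^n\to\mathbb R$ of finite oscillation and any $k\ge1$, $$|\mu\mathcal P^kf-\nu\mathcal P^kf|\le\lambda_{\rm PG}^k\times\Psi(X\ne Z)\sum_{i\in I}\mathrm{osc}_i(f),$$ where the constant $\lambda_{\rm PG}$ (not depending on $k,f,\mu,\nu,\Psi$) satisfies: (1) for the Particle Gibbs PAR sampler, $$\lambda_{\rm PG}\le\lambda(\beta\vee1)+\epsilon\bigl(2\lambda+25\epsilon+8(\beta\vee1)\bigr);$$ (2) for the Particle Gibbs L-R sampler, $$\lambda_{\rm PG}\le\lambda+\alpha^{\lfloor h^{-1}(L-p+1)\rfloor}+2\epsilon\,\frac{3(\beta\vee1)+1+\lambda}{1-2\epsilon-\alpha^{\lfloor h^{-1}(p+1)\rfloor}},$$ provided $2\epsilon+\alpha^{\lfloor h^{-1}(p+1)\rfloor}<1$.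
   Context: Setting: $\mathsf X$ is the state space and $\mathsf Y$ the observation space of a hidden Markov model with initial distribution $\mu_0$ (also denoting its density), transition kernel $M$ with density $m(x,x')$ with respect to a dominating measure, and observation density $g(x,y)$. Observations $y_{1:n}$ are fixed. The joint smoothing distribution $\phi$ is the probability distribution on $\mathsf X^n$ with density proportional to $\mu_0(x_1)g(x_1,y_1)\prod_{t=2}^n m(x_{t-1},x_t)g(x_t,y_t)$. Notation: $I=\{1,\dots,n\}$. For $J\subset I$: $J^c=I\setminus J$, $x_J=(x_i:i\in J)$, $\partial J=\{t\in J^c:t+1\in J\text{ or }t-1\in J\}$, $J^+=J\cup\partial J$. $a\vee b=\max(a,b)$. Kernels are composed as $(PQ)(x,\cdot)=\int P(x,\mathrm dy)Q(y,\cdot)$. Particle Gibbs (PG) kernel $Q^J_N(x^\star_{J^+},\mathrm dx'_J)$ for a block $J=\{s,\dots,u\}$, with $N$ particles and bootstrap proposal, is the law of the output of the following procedure, given current configuration $x^\star\in\mathsf X^n$. Draw $X^i_s\sim m(x^\star_{s-1},\cdot)$ independently for $i=1,\dots,N-1$ (from $\mu_0$ if $s=1$) and set $X^N_s=x^\star_s$. For $t=s,\dots,u$ weights are $\omega^i_t=g(X^i_t,y_t)$ if $t<u$, and at the final time $\omega^i_u=m(X^i_u,x^\star_{u+1})\,g(X^i_u,y_u)$ (the factor $m(\cdot,x^\star_{u+1})$ being omitted if $u=n$). For $t=s+1,\dots,u$ and independently for $i=1,\dots,N-1$: draw an ancestor index $A^i_t$ with $\mathbb P(A^i_t=j)=\omega^j_{t-1}/\sum_{\ell=1}^N\omega^\ell_{t-1}$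 and draw $X^i_t\sim m(X^{A^i_t}_{t-1},\cdot)$; set $X^N_t=x^\star_t$, $A^N_t=N$. Trajectories are $X^i_{s:t}=(X^{A^i_t}_{s:t-1},X^i_t)$. Finally draw $K$ with $\mathbb P(K=j)=\omega^j_u/\sum_\ell\omega^\ell_u$ and output $X'_J=X^K_{s:u}$. (Here $m(x,\cdot)$ as a sampling distribution means the law $M(x,\cdot)$.) The PG block update is $P^J(x,\mathrm dx')=Q^J_N(x_{J^+},\mathrm dx'_J)\,\delta_{x_{J^c}}(\mathrm dx'_{J^c})$ on $\mathsf X^n$. L-R sampler: $\mathcal P=P^{J_1}\cdots P^{J_m}$. PAR sampler: $\mathcal P=\mathcal P_{\rm odd}\mathcal P_{\rm even}$, where $\mathcal P_{\rm odd}=P^{J_1}P^{J_3}\cdots$ is the product of $P^{J_k}$ over odd $k\le m$ and $\mathcal P_{\rm even}=P^{J_2}P^{J_4}\cdots$ over even $k\le m$. For $f:\mathsf X^n\to\mathbb R$, $\mathrm{osc}_i(f)=\sup\{|f(x)-f(y)|:x_j=y_j\ \forall j\ne i\}$; $f$ has finite oscillation if $\sup_{x,z}|f(x)-f(z)|<\infty$. A coupling $\Psi$ of $\mu,\nu$ is a probability measure on $\mathsf X^n\times\mathsf X^n$ with marginals $\mu,\nu$; $\Psi(X\ne Z)=\int\Psi(\mathrm dx,\mathrm dz)\mathbb I_{[x\ne z]}$. *)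

theory Defs
  imports "HOL-Probability.Probability"
begin

section \<open>Hidden Markov models\<close>

text \<open>
  The state space and the observation space are the measurable spaces underlying the two dominating
  measures. The initial distribution, the transition kernel and the conditional observation laws are
  given by their densities.
\<close>

record ('x, 'y) hmm =
  state_ref :: "'x measure"
  obs_ref :: "'y measure"
  init_dens :: "'x \<Rightarrow> real"
  trans_dens :: "'x \<Rightarrow> 'x \<Rightarrow> real"
  obs_dens :: "'x \<Rightarrow> 'y \<Rightarrow> real"

definition init_law :: "('x, 'y) hmm \<Rightarrow> 'x measure" where
  "init_law H = density (state_ref H) (\<lambda>x. ennreal (init_dens H x))"

definition trans_law :: "('x, 'y) hmm \<Rightarrow> 'x \<Rightarrow> 'x measure" where
  "trans_law H x = density (state_ref H) (\<lambda>x'. ennreal (trans_dens H x x'))"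

definition hidden_markov_model :: "('x, 'y) hmm \<Rightarrow> bool" where
  "hidden_markov_model H \<longleftrightarrow>
     sigma_finite_measure (state_ref H) \<and> sigma_finite_measure (obs_ref H) \<and>
     init_dens H \<in> borel_measurable (state_ref H) \<and>
     (\<forall>x\<in>space (state_ref H). 0 \<le> init_dens H x) \<and>
     prob_space (init_law H) \<and>
     case_prod (trans_dens H) \<in> borel_measurable (state_ref H \<Otimes>\<^sub>M state_ref H) \<and>
     (\<forall>x\<in>space (state_ref H). \<forall>x'\<in>space (state_ref H). 0 \<le> trans_dens H x x') \<and>
     (\<forall>x\<in>space (state_ref H). prob_space (trans_law H x)) \<and>
     case_prod (obs_dens H) \<in> borel_measurable (state_ref H \<Otimes>\<^sub>M obs_ref H) \<and>
     (\<forall>x\<in>space (state_ref H). \<forall>y\<in>space (obs_ref H). 0 \<le> obs_dens H x y) \<and>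
     (\<forall>x\<in>space (state_ref H). (\<integral>\<^sup>+y. ennreal (obs_dens H x y) \<partial>obs_ref H) = 1)"

text \<open>
  Configurations indexed by a set of times; only the measurable structure is used, except in the
  definition of \<open>smoothing\<close>, where it is the product of the dominating measure.
\<close>

abbreviation path :: "('x, 'y) hmm \<Rightarrow> nat set \<Rightarrow> (nat \<Rightarrow> 'x) measure" where
  "path H T \<equiv> PiM T (\<lambda>_. state_ref H)"

definition smoothing_unnormalised ::
    "('x, 'y) hmm \<Rightarrow> nat \<Rightarrow> (nat \<Rightarrow> 'y) \<Rightarrow> (nat \<Rightarrow> 'x) \<Rightarrow> real" where
  "smoothing_unnormalised H n y x =
     init_dens H (x 1) * obs_dens H (x 1) (y 1) *
     (\<Prod>t=2..n. trans_dens H (x (t - 1)) (x t) * obs_dens H (x t) (y t))"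

text \<open>
  This is a probability measure iff the normalising constant is neither 0 nor infinite.
\<close>

definition smoothing :: "('x, 'y) hmm \<Rightarrow> nat \<Rightarrow> (nat \<Rightarrow> 'y) \<Rightarrow> (nat \<Rightarrow> 'x) measure" where
  "smoothing H n y = density (path H {1..n})
     (\<lambda>x. ennreal (smoothing_unnormalised H n y x) /
          (\<integral>\<^sup>+x'. ennreal (smoothing_unnormalised H n y x') \<partial>path H {1..n}))"


section \<open>Strong mixing conditions\<close>

definition mixing_S1 :: "('x, 'y) hmm \<Rightarrow> real \<Rightarrow> real \<Rightarrow> nat \<Rightarrow> bool" where
  "mixing_S1 H \<sigma>m \<sigma>p h \<longleftrightarrow>
     prob_space (state_ref H) \<and> 0 < \<sigma>m \<and> 0 < \<sigma>p \<and> 1 \<le> h \<and>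
     (\<forall>x\<in>space (state_ref H). \<forall>x'\<in>space (state_ref H). trans_dens H x x' \<le> \<sigma>p) \<and>
     (\<forall>a\<in>space (state_ref H). \<forall>b\<in>space (state_ref H).
        (\<integral>\<^sup>+z. (let x = z(1 := a, h + 1 := b)
               in ennreal (\<Prod>j=1..h. trans_dens H (x j) (x (j + 1)))) \<partial>path H {2..h})
        \<ge> ennreal \<sigma>m)"

text \<open>Suprema and infima are taken in the extended reals, so no boundedness is presupposed.\<close>

definition mixing_S2 :: "('x, 'y) hmm \<Rightarrow> real \<Rightarrow> nat \<Rightarrow> bool" where
  "mixing_S2 H \<delta> h \<longleftrightarrow>
     1 \<le> \<delta> \<and>
     (\<forall>y\<in>space (obs_ref H).
        (SUP x\<in>space (state_ref H). ennreal (obs_dens H x y))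
        \<le> ennreal (\<delta> powr (1 / real h)) * (INF x\<in>space (state_ref H). ennreal (obs_dens H x y)))"


section \<open>Markov kernels\<close>

definition kcomp :: "('a \<Rightarrow> 'a measure) \<Rightarrow> ('a \<Rightarrow> 'a measure) \<Rightarrow> 'a \<Rightarrow> 'a measure" where
  "kcomp P Q x = P x \<bind> Q"

definition kprod :: "'a measure \<Rightarrow> ('a \<Rightarrow> 'a measure) list \<Rightarrow> 'a \<Rightarrow> 'a measure" where
  "kprod S Ps = foldr kcomp Ps (return S)"

definition kpow :: "'a measure \<Rightarrow> ('a \<Rightarrow> 'a measure) \<Rightarrow> nat \<Rightarrow> 'a \<Rightarrow> 'a measure" where
  "kpow S P k = kprod S (replicate k P)"


section \<open>The Particle Gibbs kernel\<close>

text \<open>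
  The law on \<open>{1..N}\<close> with probabilities proportional to \<open>w\<close>. If all weights vanish the
  procedure is undefined; by convention the index \<open>N\<close> of the retained particle is then selected.
  With a transition density that may vanish, this can only happen at the final time of a block.
\<close>

definition categorical :: "nat \<Rightarrow> (nat \<Rightarrow> real) \<Rightarrow> nat measure" where
  "categorical N w = point_measure {1..N}
     (\<lambda>j. if (\<Sum>l=1..N. w l) = 0 then (if j = N then 1 else 0)
          else ennreal (w j / (\<Sum>l=1..N. w l)))"

text \<open>
  In the following, \<open>n\<close> is the time horizon, \<open>y\<close> the observations, \<open>N\<close> the number of particles,
  \<open>{s..u}\<close> the block and \<open>x\<close> the current configuration. The weight of a particle in state \<open>z\<close> at
  time \<open>t\<close>:
\<close>

definition pg_weight ::
    "('x, 'y) hmm \<Rightarrow> nat \<Rightarrow> (nat \<Rightarrow> 'y) \<Rightarrow> nat \<Rightarrow> (nat \<Rightarrow> 'x) \<Rightarrow> nat \<Rightarrow> 'x \<Rightarrow> real" where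
  "pg_weight H n y u x t z =
     (if t = u \<and> u < n then trans_dens H z (x (u + 1)) else 1) * obs_dens H z (y t)"

text \<open>
  A particle system at time \<open>t\<close> is the family of its \<open>N\<close> trajectories on \<open>{s..t}\<close>. Given the past,
  the particles are independent, so the joint law is a product measure over the particle index.
\<close>

definition pg_init ::
    "('x, 'y) hmm \<Rightarrow> nat \<Rightarrow> nat \<Rightarrow> (nat \<Rightarrow> 'x) \<Rightarrow> (nat \<Rightarrow> nat \<Rightarrow> 'x) measure" where
  "pg_init H N s x = PiM {1..N} (\<lambda>i.
     if i = N then return (path H {s..s}) (\<lambda>r\<in>{s..s}. x s)
     else distr (if s = 1 then init_law H else trans_law H (x (s - 1))) (path H {s..s})
            (\<lambda>z. \<lambda>r\<in>{s..s}. z))"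

definition pg_step ::
    "('x, 'y) hmm \<Rightarrow> nat \<Rightarrow> (nat \<Rightarrow> 'y) \<Rightarrow> nat \<Rightarrow> nat \<Rightarrow> nat \<Rightarrow> (nat \<Rightarrow> 'x) \<Rightarrow> nat \<Rightarrow>
      (nat \<Rightarrow> nat \<Rightarrow> 'x) \<Rightarrow> (nat \<Rightarrow> nat \<Rightarrow> 'x) measure" where
  "pg_step H n y N s u x t Z = PiM {1..N} (\<lambda>i.
     if i = N then return (path H {s..t}) ((Z N)(t := x t))
     else categorical N (\<lambda>a. pg_weight H n y u x (t - 1) (Z a (t - 1))) \<bind>
       (\<lambda>a. distr (trans_law H (Z a (t - 1))) (path H {s..t}) (\<lambda>z. (Z a)(t := z))))"

text \<open>The recursion argument counts the steps since time \<open>s\<close>.\<close>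

primrec pg_particles ::
    "('x, 'y) hmm \<Rightarrow> nat \<Rightarrow> (nat \<Rightarrow> 'y) \<Rightarrow> nat \<Rightarrow> nat \<Rightarrow> nat \<Rightarrow> (nat \<Rightarrow> 'x) \<Rightarrow> nat \<Rightarrow>
      (nat \<Rightarrow> nat \<Rightarrow> 'x) measure" where
  "pg_particles H n y N s u x 0 = pg_init H N s x"
| "pg_particles H n y N s u x (Suc d) =
     pg_particles H n y N s u x d \<bind> pg_step H n y N s u x (s + Suc d)"

definition pg_kernel ::
    "('x, 'y) hmm \<Rightarrow> nat \<Rightarrow> (nat \<Rightarrow> 'y) \<Rightarrow> nat \<Rightarrow> nat \<Rightarrow> nat \<Rightarrow> (nat \<Rightarrow> 'x) \<Rightarrow> (nat \<Rightarrow> 'x) measure" where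
  "pg_kernel H n y N s u x = pg_particles H n y N s u x (u - s) \<bind>
     (\<lambda>Z. distr (categorical N (\<lambda>j. pg_weight H n y u x u (Z j u))) (path H {s..u}) Z)"

definition pg_block ::
    "('x, 'y) hmm \<Rightarrow> nat \<Rightarrow> (nat \<Rightarrow> 'y) \<Rightarrow> nat \<Rightarrow> nat set \<Rightarrow> (nat \<Rightarrow> 'x) \<Rightarrow> (nat \<Rightarrow> 'x) measure" where
  "pg_block H n y N J x =
     distr (pg_kernel H n y N (Min J) (Max J) x) (path H {1..n}) (\<lambda>z. merge J ({1..n} - J) (z, x))"

definition pg_LR ::
    "('x, 'y) hmm \<Rightarrow> nat \<Rightarrow> (nat \<Rightarrow> 'y) \<Rightarrow> nat \<Rightarrow> (nat \<Rightarrow> nat set) \<Rightarrow> nat \<Rightarrow>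
      (nat \<Rightarrow> 'x) \<Rightarrow> (nat \<Rightarrow> 'x) measure" where
  "pg_LR H n y N J m = kprod (path H {1..n}) (map (\<lambda>k. pg_block H n y N (J k)) [1..<m + 1])"

definition pg_PAR ::
    "('x, 'y) hmm \<Rightarrow> nat \<Rightarrow> (nat \<Rightarrow> 'y) \<Rightarrow> nat \<Rightarrow> (nat \<Rightarrow> nat set) \<Rightarrow> nat \<Rightarrow>
      (nat \<Rightarrow> 'x) \<Rightarrow> (nat \<Rightarrow> 'x) measure" where
  "pg_PAR H n y N J m = kcomp
     (kprod (path H {1..n}) (map (\<lambda>k. pg_block H n y N (J k)) (filter odd [1..<m + 1])))
     (kprod (path H {1..n}) (map (\<lambda>k. pg_block H n y N (J k)) (filter even [1..<m + 1])))"


section \<open>Block covers, oscillations and couplings\<close>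

definition block_cover :: "nat \<Rightarrow> nat \<Rightarrow> nat \<Rightarrow> nat \<Rightarrow> (nat \<Rightarrow> nat set) \<Rightarrow> bool" where
  "block_cover n m L p J \<longleftrightarrow>
     (\<Union>k\<in>{1..m}. J k) = {1..n} \<and>
     (\<forall>k\<in>{1..m}. \<exists>s u. 1 \<le> s \<and> s \<le> u \<and> u \<le> n \<and> J k = {s..u}) \<and>
     (\<forall>j k. 1 \<le> j \<and> j < k \<and> k \<le> m \<longrightarrow> Min (J j) < Min (J k) \<and> Max (J j) < Max (J k)) \<and>
     (\<forall>j k. 1 \<le> j \<and> j < k \<and> k \<le> m \<and> 2 \<le> k - j \<longrightarrow> Max (J j) < Min (J k) - 1) \<and>
     (\<forall>k\<in>{1..m}. card (J k) = L) \<and>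
     (\<forall>k\<in>{2..m}. card (J (k - 1) \<inter> J k) = p)"

definition osc :: "'x measure \<Rightarrow> nat set \<Rightarrow> nat \<Rightarrow> ((nat \<Rightarrow> 'x) \<Rightarrow> real) \<Rightarrow> real" where
  "osc S I i f = Sup {\<bar>f x - f z\<bar> | x z.
     x \<in> space (PiM I (\<lambda>_. S)) \<and> z \<in> space (PiM I (\<lambda>_. S)) \<and> (\<forall>j\<in>I - {i}. x j = z j)}"

definition finite_oscillation :: "'a measure \<Rightarrow> ('a \<Rightarrow> real) \<Rightarrow> bool" where
  "finite_oscillation S f \<longleftrightarrow> bdd_above {\<bar>f x - f z\<bar> | x z. x \<in> space S \<and> z \<in> space S}"

definition coupling :: "'a measure \<Rightarrow> 'a measure \<Rightarrow> 'a measure \<Rightarrow> ('a \<times> 'a) measure \<Rightarrow> bool" where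
  "coupling S \<mu> \<nu> \<Psi> \<longleftrightarrow>
     prob_space \<Psi> \<and> sets \<Psi> = sets (S \<Otimes>\<^sub>M S) \<and> distr \<Psi> S fst = \<mu> \<and> distr \<Psi> S snd = \<nu>"

text \<open>
  In \<open>contracts_at_rate\<close>, the disagreement probability \<open>measure \<Psi> {w \<in> space \<Psi>. fst w \<noteq> snd w}\<close> is
  only meaningful if the diagonal of \<open>S \<Otimes>\<^sub>M S\<close> is measurable.
\<close>

definition contracts_at_rate ::
    "'x measure \<Rightarrow> nat set \<Rightarrow> ((nat \<Rightarrow> 'x) \<Rightarrow> (nat \<Rightarrow> 'x) measure) \<Rightarrow> real \<Rightarrow> bool" where
  "contracts_at_rate S I P r \<longleftrightarrow>
     (let X = PiM I (\<lambda>_. S) in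
      \<forall>\<mu>\<in>space (prob_algebra X). \<forall>\<nu>\<in>space (prob_algebra X). \<forall>\<Psi> f k.
        coupling X \<mu> \<nu> \<Psi> \<longrightarrow> f \<in> borel_measurable X \<longrightarrow> finite_oscillation X f \<longrightarrow> 1 \<le> k \<longrightarrow>
        \<bar>(\<integral>x. f x \<partial>(\<mu> \<bind> kpow X P k)) - (\<integral>x. f x \<partial>(\<nu> \<bind> kpow X P k))\<bar>
        \<le> r ^ k * (measure \<Psi> {w \<in> space \<Psi>. fst w \<noteq> snd w} * (\<Sum>i\<in>I. osc S I i f)))"

end

theory Submission
  imports Defs
begin

text \<open>
  Oscillations of functions on path space are transported through the block updates, and the theorem
  says that one sweep shrinks their sum. Two facts about a single block are combined.
  
  The first fact concerns the ideal update, which redraws the block from its conditional law given its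
  two neighbours. Conditionally, the block is a Markov chain with potentials, and under the mixing
  conditions the laws of two such chains after \<open>h\<close> steps have a common part of mass \<open>1 - \<alpha>\<close>. A change of
  a neighbour is therefore remembered at distance \<open>d\<close> with weight \<open>\<alpha> ^ (d div h)\<close> (\<open>chain_contraction\<close>,
  \<open>ideal_contraction_left\<close>, \<open>ideal_contraction_right\<close>). No coupling is constructed: the common part is
  compared on the diagonal and the rest under the product measure (\<open>minorised_transport\<close>).
  
  The second fact is that Particle Gibbs dominates \<open>1 - \<epsilon>\<close> times the ideal update (\<open>pg_minorisation\<close>).
  The output law, integrated against a nonnegative function, is the expectation of a self-normalised
  sum over the particles. By convexity of the reciprocal, one time step replaces the sum in the
  denominator by its mean, up to the retained and one tagged particle (\<open>one_step_lower_bound\<close>), and the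
  steps are chained backwards along the block (\<open>pg_kernel_lower_bound\<close>). What makes the loss per step
  small is that the weights times the likelihood of the future oscillate by a bounded factor only. For
  \<open>h \<ge> 2\<close> this can fail close to the right end of the block, where the transition density has no lower
  bound in the remaining number of steps. There the denominator is controlled by an upper bound on the
  densities alone, and the loss is recovered at the time \<open>h\<close> steps before the boundary
  (\<open>envelope_step\<close>).
  
  Hence an update with Particle Gibbs is a mixture of the ideal update and an error of weight \<open>\<epsilon>\<close>
  (\<open>block_difference\<close>). The error costs the full oscillation over the block, so it matters what is summed.
  The times are grouped into cores, which belong to one block, and overlaps, which belong to two; with
  oscillations over groups, the error of a block enters once for each of its at most three groups and
  not once for each site. An update of block \<open>k\<close> then acts on weights of groups: the weights inside
  the block are replaced by \<open>\<epsilon>\<close> times their sum plus the influence of the two adjacent cores, with factors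
  \<open>\<alpha> ^ ((p + 1) div h)\<close> for the core of the block, \<open>\<alpha> ^ (1 div h)\<close> for the near overlap and
  \<open>\<alpha> ^ ((L - p + 1) div h)\<close> for the far overlap (\<open>block_contracts\<close>).
  
  It remains to follow the weights, initially 1, through one sweep. In the parallel sampler the blocks of
  one parity do not interact, and two half sweeps give the rate (\<open>par_rate\<close>). In the Left-to-Right
  sampler the weights behind the current block are stationary, and the error accumulates as a geometric
  sum (\<open>lr_rate\<close>). A bound on the weights after a sweep is a contraction rate for the sum of all group
  oscillations; integrating the resulting uniform bound against \<open>\<Psi>\<close>, which only sees pairs of distinct
  configurations, gives the estimate of the theorem (\<open>contracts_rate\<close>).
\<close>

section \<open>Iterated integrals over lists of sites\<close>

text \<open>
  The list fixes the order in which the sites are integrated out, so that sites can be removed by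
  recursion; \<open>iter_perm\<close> changes the order when the proof needs another site to come first.
\<close>

primrec iter :: "'x measure \<Rightarrow> nat list \<Rightarrow> ((nat \<Rightarrow> 'x) \<Rightarrow> ennreal) \<Rightarrow> (nat \<Rightarrow> 'x) \<Rightarrow> ennreal" where
  "iter S [] F x = F x"
| "iter S (i # l) F x = (\<integral>\<^sup>+z. iter S l F (x(i := z)) \<partial>S)"

text \<open>
  The unnormalised path density of a chain that starts at the value of site \<open>j\<close> and visits the sites
  of the list: \<open>a\<close> is the transition density and \<open>e i\<close> the potential at site \<open>i\<close>. The sites need not
  be consecutive nor increasing, which lets the same lemmas treat the chain run backwards in time.
\<close>

primrec chain_weight ::
    "('x \<Rightarrow> 'x \<Rightarrow> ennreal) \<Rightarrow> (nat \<Rightarrow> 'x \<Rightarrow> ennreal) \<Rightarrow> nat \<Rightarrow> nat list \<Rightarrow> (nat \<Rightarrow> 'x) \<Rightarrow> ennreal" where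
  "chain_weight a e j [] x = 1"
| "chain_weight a e j (i # l) x = a (x j) (x i) * e i (x i) * chain_weight a e i l x"

text \<open>
  The mass of the path measure as a function of the starting value, with a terminal potential \<open>r\<close>:
  the backward information filter of the chain.
\<close>

primrec chain_total ::
    "'x measure \<Rightarrow> ('x \<Rightarrow> 'x \<Rightarrow> ennreal) \<Rightarrow> (nat \<Rightarrow> 'x \<Rightarrow> ennreal) \<Rightarrow> ('x \<Rightarrow> ennreal) \<Rightarrow> nat list \<Rightarrow> 'x \<Rightarrow> ennreal" where
  "chain_total S a e r [] z = r z"
| "chain_total S a e r (i # l) z = (\<integral>\<^sup>+v. a z v * e i v * chain_total S a e r l v \<partial>S)"

text \<open>
  The transition density of \<open>Suc k\<close> steps of the chain, so that \<open>step_dens S a (h - 1)\<close> is the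
  \<open>h\<close>-step density of the mixing condition.
\<close>

primrec step_dens :: "'x measure \<Rightarrow> ('x \<Rightarrow> 'x \<Rightarrow> ennreal) \<Rightarrow> nat \<Rightarrow> 'x \<Rightarrow> 'x \<Rightarrow> ennreal" where
  "step_dens S a 0 x z = a x z"
| "step_dens S a (Suc k) x z = (\<integral>\<^sup>+v. a x v * step_dens S a k v z \<partial>S)"

lemma iter_append: "iter S (l @ l') F = iter S l (iter S l' F)"
  by (induction l) (auto simp: fun_eq_iff)

locale sites = prob_space S for S :: "'x measure" +
  fixes I :: "nat set"
  assumes finite_I: "finite I"
begin

abbreviation X where "X \<equiv> PiM I (\<lambda>_. S)"

lemma upd_measurable [measurable (raw)]:
  assumes "i \<in> I" "f \<in> N \<rightarrow>\<^sub>M X" "g \<in> N \<rightarrow>\<^sub>M S"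
  shows "(\<lambda>x. (f x)(i := g x)) \<in> N \<rightarrow>\<^sub>M X"
  using assms by (intro measurable_fun_upd[where J=I]) auto

lemma upd_space [simp]: "x \<in> space X \<Longrightarrow> i \<in> I \<Longrightarrow> z \<in> space S \<Longrightarrow> x(i := z) \<in> space X"
  by (auto simp: space_PiM PiE_def extensional_def)

lemma comp_space: "x \<in> space X \<Longrightarrow> i \<in> I \<Longrightarrow> x i \<in> space S"
  by (auto simp: space_PiM)

lemma coord_measurable: "k \<in> I \<Longrightarrow> r \<in> borel_measurable S \<Longrightarrow> (\<lambda>y. r (y k)) \<in> borel_measurable X"
  by (rule measurable_compose[where N=S]) auto

lemma iter_measurable:
  assumes "set l \<subseteq> I" "F \<in> borel_measurable X"
  shows "iter S l F \<in> borel_measurable X"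
  using assms(1)
proof (induction l)
  case (Cons i l)
  have 1: "iter S l F \<in> borel_measurable X" using Cons by auto
  note [measurable (raw)] = measurable_compose[OF _ 1]
  have [simp]: "i \<in> I" using Cons.prems by auto
  have "(\<lambda>x. \<integral>\<^sup>+z. iter S l F (x(i := z)) \<partial>S) \<in> borel_measurable X"
    by measurable
  also have "(\<lambda>x. \<integral>\<^sup>+z. iter S l F (x(i := z)) \<partial>S) = iter S (i # l) F" by (simp add: fun_eq_iff)
  finally show ?case .
next
  case Nil
  have "iter S [] F = F" by (simp add: fun_eq_iff)
  then show ?case using assms by simp
qed

lemma iter_measurable' [measurable (raw)]:
  assumes "set l \<subseteq> I" "F \<in> borel_measurable X" "f \<in> N \<rightarrow>\<^sub>M X"
  shows "(\<lambda>w. iter S l F (f w)) \<in> borel_measurable N"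
  using measurable_compose[OF assms(3) iter_measurable[OF assms(1,2)]] by simp

text \<open>
  The two sides may start from configurations that differ off the integrated sites; both integrals run
  through the same values on the list, which is the synchronous coupling of the two path measures.
\<close>

lemma iter_mono2:
  assumes "set l \<subseteq> I" "x \<in> space X" "x' \<in> space X"
    and "\<And>y y'. y \<in> space X \<Longrightarrow> y' \<in> space X \<Longrightarrow> (\<And>i. i \<notin> set l \<Longrightarrow> y i = x i)
       \<Longrightarrow> (\<And>i. i \<notin> set l \<Longrightarrow> y' i = x' i) \<Longrightarrow> (\<And>i. i \<in> set l \<Longrightarrow> y i = y' i) \<Longrightarrow> F y \<le> G y'"
  shows "iter S l F x \<le> iter S l G x'"
  using assms
proof (induction l arbitrary: x x')
  case (Cons i l)
  show ?case
    unfolding iter.simps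
  proof (rule nn_integral_mono)
    fix z assume z: "z \<in> space S"
    show "iter S l F (x(i := z)) \<le> iter S l G (x'(i := z))"
    proof (rule Cons.IH)
      show "x(i := z) \<in> space X" "x'(i := z) \<in> space X" using Cons.prems z by (auto intro!: upd_space)
      fix y y' assume y: "y \<in> space X" "y' \<in> space X"
        and 1: "\<And>j. j \<notin> set l \<Longrightarrow> y j = (x(i := z)) j" and 2: "\<And>j. j \<notin> set l \<Longrightarrow> y' j = (x'(i := z)) j"
        and 3: "\<And>j. j \<in> set l \<Longrightarrow> y j = y' j"
      show "F y \<le> G y'"
      proof (rule Cons.prems(4)[OF y])
        fix j
        show "j \<notin> set (i # l) \<Longrightarrow> y j = x j" using 1[of j] by auto
        show "j \<notin> set (i # l) \<Longrightarrow> y' j = x' j" using 2[of j] by auto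
        show "j \<in> set (i # l) \<Longrightarrow> y j = y' j"
          using 1[of j] 2[of j] 3[of j] by (cases "j \<in> set l") auto
      qed
    qed (use Cons.prems in auto)
  qed
qed auto

lemma iter_mono:
  assumes "set l \<subseteq> I" "x \<in> space X"
    and "\<And>y. y \<in> space X \<Longrightarrow> (\<And>i. i \<notin> set l \<Longrightarrow> y i = x i) \<Longrightarrow> F y \<le> G y"
  shows "iter S l F x \<le> iter S l G x"
proof (rule iter_mono2[OF assms(1,2,2)])
  fix y y' assume y: "y \<in> space X" "y' \<in> space X"
        and 1: "\<And>i. i \<notin> set l \<Longrightarrow> y i = x i" and 2: "\<And>i. i \<notin> set l \<Longrightarrow> y' i = x i"
        and 3: "\<And>i. i \<in> set l \<Longrightarrow> y i = y' i"
  have "y = y'" using 1 2 3 by (metis ext)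
  then show "F y \<le> G y'" using assms(3)[OF y(1) 1] by auto
qed

lemma iter_cong:
  assumes "set l \<subseteq> I" "x \<in> space X"
    and "\<And>y. y \<in> space X \<Longrightarrow> (\<And>i. i \<notin> set l \<Longrightarrow> y i = x i) \<Longrightarrow> F y = G y"
  shows "iter S l F x = iter S l G x"
  by (rule antisym; rule iter_mono[OF assms(1,2)]) (auto simp: assms(3))

lemma iter_add:
  assumes "set l \<subseteq> I" "F \<in> borel_measurable X" "G \<in> borel_measurable X" "x \<in> space X"
  shows "iter S l (\<lambda>y. F y + G y) x = iter S l F x + iter S l G x"
  using assms(1,4)
proof (induction l arbitrary: x)
  case (Cons i l)
  have [measurable]: "F \<in> borel_measurable X" "G \<in> borel_measurable X" by fact+
  have [simp]: "i \<in> I" "set l \<subseteq> I" using Cons.prems by auto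
  have [measurable]: "x \<in> space X" by fact
  have "(\<integral>\<^sup>+z. iter S l (\<lambda>y. F y + G y) (x(i := z)) \<partial>S) =
    (\<integral>\<^sup>+z. iter S l F (x(i := z)) + iter S l G (x(i := z)) \<partial>S)"
    using Cons.prems by (intro nn_integral_cong, subst Cons.IH) simp_all
  also have "\<dots> = iter S (i # l) F x + iter S (i # l) G x"
    unfolding iter.simps using Cons.prems by (intro nn_integral_add) measurable
  finally show ?case by simp
qed simp

lemma iter_cmult:
  assumes "set l \<subseteq> I" "F \<in> borel_measurable X" "x \<in> space X"
  shows "iter S l (\<lambda>y. c * F y) x = c * iter S l F x"
  using assms(1,3)
proof (induction l arbitrary: x)
  case (Cons i l)
  have [measurable]: "F \<in> borel_measurable X" by fact
  have [simp]: "i \<in> I" "set l \<subseteq> I" using Cons.prems by auto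
  have [measurable]: "x \<in> space X" by fact
  have "(\<integral>\<^sup>+z. iter S l (\<lambda>y. c * F y) (x(i := z)) \<partial>S) = (\<integral>\<^sup>+z. c * iter S l F (x(i := z)) \<partial>S)"
    using Cons.prems by (intro nn_integral_cong, subst Cons.IH) simp_all
  also have "\<dots> = c * iter S (i # l) F x"
    unfolding iter.simps using Cons.prems by (intro nn_integral_cmult) measurable
  finally show ?case by simp
qed simp

lemma iter_pull:
  assumes "set l \<subseteq> I" "F \<in> borel_measurable X" "x \<in> space X"
    and "\<And>y. y \<in> space X \<Longrightarrow> (\<And>i. i \<notin> set l \<Longrightarrow> y i = x i) \<Longrightarrow> G y = G x"
  shows "iter S l (\<lambda>y. G y * F y) x = G x * iter S l F x"
  by (subst iter_cmult[OF assms(1-3), symmetric], rule iter_cong[OF assms(1,3)]) (simp add: assms(4))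

text \<open>
  Integrating a bilinear inequality in \<open>y\<close> and in \<open>y'\<close> separately, that is, against the product of the
  two measures. Comparisons of normalised integrals are kept in this cross-multiplied form throughout,
  because the normalising constants may vanish.
\<close>

lemma iter_bilinear:
  assumes l: "set l \<subseteq> I" "x \<in> space X" "x' \<in> space X"
    and [measurable]: "f \<in> borel_measurable X" "g \<in> borel_measurable X" "f' \<in> borel_measurable X" "g' \<in> borel_measurable X"
    and le: "\<And>y y'. y \<in> space X \<Longrightarrow> y' \<in> space X \<Longrightarrow> (\<And>i. i \<notin> set l \<Longrightarrow> y i = x i)
       \<Longrightarrow> (\<And>i. i \<notin> set l \<Longrightarrow> y' i = x' i) \<Longrightarrow> f y * g' y' \<le> f' y' * g y + K * g y * g' y'"
  shows "iter S l f x * iter S l g' x' \<le> iter S l f' x' * iter S l g x + K * iter S l g x * iter S l g' x'"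
proof -
  have *: "iter S l f x * g' y' \<le> f' y' * iter S l g x + K * iter S l g x * g' y'"
    if "y' \<in> space X" "\<And>i. i \<notin> set l \<Longrightarrow> y' i = x' i" for y'
  proof -
    have "iter S l f x * g' y' = iter S l (\<lambda>y. g' y' * f y) x"
      using l by (subst iter_cmult) (auto simp: mult.commute)
    also have "\<dots> \<le> iter S l (\<lambda>y. f' y' * g y + (K * g' y') * g y) x"
      by (rule iter_mono[OF l(1,2)]) (use le[OF _ that(1)] that(2) in \<open>auto simp: ac_simps\<close>)
    also have "\<dots> = f' y' * iter S l g x + K * iter S l g x * g' y'"
    proof -
      have 1: "iter S l (\<lambda>y. f' y' * g y) x = f' y' * iter S l g x"
        "iter S l (\<lambda>y. (K * g' y') * g y) x = (K * g' y') * iter S l g x"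
        using l by (auto intro!: iter_cmult)
      show ?thesis using l by (subst iter_add) (simp_all add: 1, simp add: ac_simps)
    qed
    finally show ?thesis .
  qed
  have "iter S l f x * iter S l g' x' = iter S l (\<lambda>y. iter S l f x * g' y) x'"
      using l by (subst iter_cmult) (auto simp: mult.commute)
  also have "\<dots> \<le> iter S l (\<lambda>y. iter S l g x * f' y + (K * iter S l g x) * g' y) x'"
    by (rule iter_mono[OF l(1,3)]) (use * in \<open>auto simp: ac_simps\<close>)
  also have "\<dots> = iter S l f' x' * iter S l g x + K * iter S l g x * iter S l g' x'"
    proof -
      have 1: "iter S l (\<lambda>y. iter S l g x * f' y) x' = iter S l g x * iter S l f' x'"
        "iter S l (\<lambda>y. (K * iter S l g x) * g' y) x' = (K * iter S l g x) * iter S l g' x'"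
        using l by (auto intro!: iter_cmult)
      show ?thesis using l by (subst iter_add) (simp_all add: 1, simp add: ac_simps)
    qed
  finally show ?thesis .
qed

lemma merge_measurable [measurable (raw)]:
  assumes "J \<subseteq> I" "f \<in> N \<rightarrow>\<^sub>M PiM J (\<lambda>_. S)" "g \<in> N \<rightarrow>\<^sub>M X"
  shows "(\<lambda>w. merge J (I - J) (f w, g w)) \<in> N \<rightarrow>\<^sub>M X"
proof -
  have [measurable]: "(\<lambda>x. restrict x (I - J)) \<in> X \<rightarrow>\<^sub>M PiM (I - J) (\<lambda>_. S)"
    by (rule measurable_restrict_subset) auto
  note [measurable] = assms(2,3)
  have "(\<lambda>w. merge J (I - J) (f w, restrict (g w) (I - J))) \<in> N \<rightarrow>\<^sub>M PiM (J \<union> (I - J)) (\<lambda>_. S)"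
    by measurable
  moreover have "J \<union> (I - J) = I" using assms(1) by auto
  moreover have "merge J (I - J) (f w, restrict (g w) (I - J)) = merge J (I - J) (f w, g w)" for w
    by (auto simp: merge_def fun_eq_iff)
  ultimately show ?thesis by simp
qed

lemma iter_PiM:
  assumes "distinct l" "set l \<subseteq> I" "F \<in> borel_measurable X" "x \<in> space X"
  shows "iter S l F x = (\<integral>\<^sup>+\<zeta>. F (merge (set l) (I - set l) (\<zeta>, x)) \<partial>PiM (set l) (\<lambda>_. S))"
  using assms(1,2,4)
proof (induction l arbitrary: x)
  case Nil
  interpret P: product_sigma_finite "\<lambda>_::nat. S" ..
  have "merge {} I (\<zeta>, x) = x" for \<zeta> :: "nat \<Rightarrow> 'x"
    using Nil by (auto simp: merge_def space_PiM PiE_def extensional_def fun_eq_iff)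
  then show ?case using P.nn_integral_empty[of "\<lambda>_. F x"] by simp
next
  case (Cons i l)
  interpret P: product_sigma_finite "\<lambda>_::nat. S" ..
  have [measurable]: "F \<in> borel_measurable X" by fact
  have [simp]: "i \<in> I" "set l \<subseteq> I" "i \<notin> set l" "distinct l" using Cons.prems by auto
  have "set l \<union> I = I" by (intro Un_absorb1) fact
  then have [simp]: "set l \<union> I = I" "insert i (set l \<union> I) = I" by (simp_all add: insert_absorb)
  have Fm: "(\<lambda>\<zeta>. F (merge (insert i (set l)) (I - insert i (set l)) (\<zeta>, x)))
      \<in> borel_measurable (PiM (insert i (set l)) (\<lambda>_. S))"
    using Cons.prems by (intro measurable_compose[OF _ \<open>F \<in> borel_measurable X\<close>] merge_measurable) auto
  have "iter S (i # l) F x = (\<integral>\<^sup>+z. (\<integral>\<^sup>+\<zeta>. F (merge (set l) (I - set l) (\<zeta>, x(i := z))) \<partial>PiM (set l) (\<lambda>_. S)) \<partial>S)"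
    unfolding iter.simps using Cons.prems by (intro nn_integral_cong, subst Cons.IH) simp_all
  also have "\<dots> = (\<integral>\<^sup>+z. (\<integral>\<^sup>+\<zeta>. F (merge (insert i (set l)) (I - insert i (set l)) (\<zeta>(i := z), x)) \<partial>PiM (set l) (\<lambda>_. S)) \<partial>S)"
    by (intro nn_integral_cong arg_cong[where f=F]) (auto simp: merge_def fun_eq_iff)
  also have "\<dots> = (\<integral>\<^sup>+\<zeta>. F (merge (insert i (set l)) (I - insert i (set l)) (\<zeta>, x)) \<partial>PiM (insert i (set l)) (\<lambda>_. S))"
    by (rule P.product_nn_integral_insert_rev[symmetric]) (use Fm in auto)
  finally show ?case by simp
qed

lemma iter_perm:
  assumes "distinct l" "distinct l'" "set l = set l'" "set l \<subseteq> I" "F \<in> borel_measurable X" "x \<in> space X"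
  shows "iter S l F x = iter S l' F x"
  using assms by (simp add: iter_PiM)

end

section \<open>Forgetting of a conditioned mixing chain\<close>

lemma ennreal_divide_mult_cancel: "s \<noteq> 0 \<Longrightarrow> s \<noteq> \<top> \<Longrightarrow> (x::ennreal) / s * s = x"
  by (metis ennreal_mult_divide_eq ennreal_times_divide mult.commute)

text \<open>
  The normalised versions of \<open>\<psi>\<close> and \<open>\<psi>'\<close> share the component \<open>\<theta> * \<eta> / e\<close>. On the common
  component the two integrands are compared at equal points, at cost \<open>K0\<close>; the two remainders, both of
  mass \<open>\<alpha>\<close>, are compared under their product measure, at cost \<open>K1\<close>. This is the estimate that a
  maximal coupling would give, without constructing a coupling.
\<close>

lemma minorised_transport:
  fixes \<psi> \<psi>' \<eta> D D' :: "'x \<Rightarrow> ennreal"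
  assumes [measurable]: "\<psi> \<in> borel_measurable S" "\<psi>' \<in> borel_measurable S" "\<eta> \<in> borel_measurable S"
    "D \<in> borel_measurable S" "D' \<in> borel_measurable S"
  defines "p \<equiv> \<integral>\<^sup>+z. \<psi> z \<partial>S" and "p' \<equiv> \<integral>\<^sup>+z. \<psi>' z \<partial>S" and "e \<equiv> \<integral>\<^sup>+z. \<eta> z \<partial>S"
  assumes p: "p \<noteq> 0" "p \<noteq> \<top>" "p' \<noteq> 0" "p' \<noteq> \<top>" "e \<noteq> 0" "e \<noteq> \<top>"
    and fin: "\<And>z. z \<in> space S \<Longrightarrow> \<psi> z \<noteq> \<top>" "\<And>z. z \<in> space S \<Longrightarrow> \<psi>' z \<noteq> \<top>"
    and D: "\<And>z. z \<in> space S \<Longrightarrow> D z \<le> M * \<psi> z" "\<And>z. z \<in> space S \<Longrightarrow> D' z \<le> M * \<psi>' z"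
    and \<theta>: "\<theta> + \<alpha> = 1"
    and min: "\<And>z. z \<in> space S \<Longrightarrow> \<theta> * \<eta> z * p \<le> \<psi> z * e" "\<And>z. z \<in> space S \<Longrightarrow> \<theta> * \<eta> z * p' \<le> \<psi>' z * e"
    and diag: "\<And>z. z \<in> space S \<Longrightarrow> D z * \<psi>' z \<le> D' z * \<psi> z + K0 * \<psi> z * \<psi>' z"
    and off: "\<And>z z'. z \<in> space S \<Longrightarrow> z' \<in> space S \<Longrightarrow> D z * \<psi>' z' \<le> D' z' * \<psi> z + K1 * \<psi> z * \<psi>' z'"
  shows "(\<integral>\<^sup>+z. D z \<partial>S) * p' \<le> (\<integral>\<^sup>+z. D' z \<partial>S) * p + (\<theta> * K0 + \<alpha> * K1) * p * p'"
proof -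
  define \<phi> where "\<phi> z = D z / \<psi> z" for z
  define \<phi>' where "\<phi>' z = D' z / \<psi>' z" for z
  define b where "b z = \<theta> * \<eta> z / e" for z
  define \<rho> where "\<rho> z = \<psi> z / p - b z" for z
  define \<rho>' where "\<rho>' z = \<psi>' z / p' - b z" for z
  have [measurable]: "\<phi> \<in> borel_measurable S" "\<phi>' \<in> borel_measurable S" "b \<in> borel_measurable S"
    "\<rho> \<in> borel_measurable S" "\<rho>' \<in> borel_measurable S"
    unfolding \<phi>_def \<phi>'_def b_def \<rho>_def \<rho>'_def by measurable
  have fin1: "\<theta> \<noteq> \<top>" "\<alpha> \<noteq> \<top>" using \<theta> by (auto simp: top_unique)
  have div_le: "x / s \<le> y / t" if "x * t \<le> y * s" "s \<noteq> 0" "s \<noteq> \<top>" "t \<noteq> 0" "t \<noteq> \<top>" for x y s t :: ennreal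
  proof -
    have "x = x / s * s" "y = y / t * t"
      using that by (simp_all add: ennreal_divide_mult_cancel)
    then have "s * t * (x / s) \<le> s * t * (y / t)"
      using that(1) by (metis mult.assoc mult.commute)
    then show ?thesis
      using that by (subst (asm) ennreal_mult_le_mult_iff) (auto simp: ennreal_mult_eq_top_iff)
  qed
  have b_le: "b z \<le> \<psi> z / p" "b z \<le> \<psi>' z / p'" if "z \<in> space S" for z
    unfolding b_def using div_le[of "\<theta> * \<eta> z" p "\<psi> z" e] div_le[of "\<theta> * \<eta> z" p' "\<psi>' z" e] min[OF that] p
    by auto
  have \<psi>_eq: "\<psi> z / p = b z + \<rho> z" "\<psi>' z / p' = b z + \<rho>' z" if "z \<in> space S" for z
    unfolding \<rho>_def \<rho>'_def using b_le[OF that] by (simp_all add: add_diff_inverse_ennreal)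
  have D_eq: "D z / p = \<phi> z * (b z + \<rho> z)" if "z \<in> space S" for z
  proof (cases "\<psi> z = 0")
    case True then show ?thesis using D(1)[OF that] \<psi>_eq(1)[OF that] by simp
  next
    case False
    then have "D z = \<phi> z * \<psi> z" unfolding \<phi>_def using fin(1)[OF that] by (simp add: ennreal_divide_mult_cancel)
    then show ?thesis unfolding \<psi>_eq(1)[OF that, symmetric] by (simp add: ennreal_times_divide)
  qed
  have D'_eq: "D' z / p' = \<phi>' z * (b z + \<rho>' z)" if "z \<in> space S" for z
  proof (cases "\<psi>' z = 0")
    case True then show ?thesis using D(2)[OF that] \<psi>_eq(2)[OF that] by simp
  next
    case False
    then have "D' z = \<phi>' z * \<psi>' z" unfolding \<phi>'_def using fin(2)[OF that] by (simp add: ennreal_divide_mult_cancel)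
    then show ?thesis unfolding \<psi>_eq(2)[OF that, symmetric] by (simp add: ennreal_times_divide)
  qed
  have gen: "\<phi> z \<le> \<phi>' z' + K" if "D z * \<psi>' z' \<le> D' z' * \<psi> z + K * \<psi> z * \<psi>' z'" "\<psi> z \<noteq> 0" "\<psi>' z' \<noteq> 0"
    "z \<in> space S" "z' \<in> space S" for z z' K
  proof -
    have "\<phi> z \<le> (D' z' + K * \<psi>' z') / \<psi>' z'"
      unfolding \<phi>_def by (rule div_le) (use that fin in \<open>auto simp: algebra_simps\<close>)
    also have "\<dots> = \<phi>' z' + K"
      unfolding \<phi>'_def using that fin(2)[OF that(5)]
      by (simp add: add_divide_distrib_ennreal ennreal_mult_divide_eq)
    finally show ?thesis .
  qed
  have int_b: "(\<integral>\<^sup>+z. b z \<partial>S) = \<theta>"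
    using p by (simp add: b_def nn_integral_divide nn_integral_cmult e_def[symmetric] ennreal_mult_divide_eq)
  have "(\<integral>\<^sup>+z. \<psi> z / p \<partial>S) = 1" "(\<integral>\<^sup>+z. \<psi>' z / p' \<partial>S) = 1"
    using p by (simp_all add: nn_integral_divide p_def[symmetric] p'_def[symmetric] less_top ennreal_divide_self)
  moreover have "(\<integral>\<^sup>+z. \<psi> z / p \<partial>S) = \<theta> + (\<integral>\<^sup>+z. \<rho> z \<partial>S)"
    by (subst int_b[symmetric], subst nn_integral_add[symmetric]) (auto intro!: nn_integral_cong simp: \<psi>_eq)
  moreover have "(\<integral>\<^sup>+z. \<psi>' z / p' \<partial>S) = \<theta> + (\<integral>\<^sup>+z. \<rho>' z \<partial>S)"
    by (subst int_b[symmetric], subst nn_integral_add[symmetric]) (auto intro!: nn_integral_cong simp: \<psi>_eq)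
  ultimately have "\<theta> + (\<integral>\<^sup>+z. \<rho> z \<partial>S) = \<theta> + \<alpha>" "\<theta> + (\<integral>\<^sup>+z. \<rho>' z \<partial>S) = \<theta> + \<alpha>"
    using \<theta> by simp_all
  then have int_\<rho>: "(\<integral>\<^sup>+z. \<rho> z \<partial>S) = \<alpha>" "(\<integral>\<^sup>+z. \<rho>' z \<partial>S) = \<alpha>"
    using fin1 by (simp_all only: ennreal_add_left_cancel) auto
  \<comment> \<open>common component, compared on the diagonal\<close>
  have diag_part: "(\<integral>\<^sup>+z. \<phi> z * b z \<partial>S) \<le> (\<integral>\<^sup>+z. \<phi>' z * b z \<partial>S) + \<theta> * K0"
  proof -
    have "(\<integral>\<^sup>+z. \<phi> z * b z \<partial>S) \<le> (\<integral>\<^sup>+z. \<phi>' z * b z + K0 * b z \<partial>S)"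
    proof (rule nn_integral_mono)
      fix z assume z: "z \<in> space S"
      show "\<phi> z * b z \<le> \<phi>' z * b z + K0 * b z"
      proof (cases "b z = 0")
        case False
        then have "\<psi> z \<noteq> 0" "\<psi>' z \<noteq> 0" using b_le[OF z] by auto
        from gen[OF diag[OF z] this z z] show ?thesis
          by (simp add: distrib_right[symmetric] mult_right_mono)
      qed simp
    qed
    also have "\<dots> = (\<integral>\<^sup>+z. \<phi>' z * b z \<partial>S) + \<theta> * K0"
      by (simp add: nn_integral_add nn_integral_cmult int_b mult.commute)
    finally show ?thesis .
  qed
  \<comment> \<open>the two remainders, compared at independent points\<close>
  have off_part: "(\<integral>\<^sup>+z. \<phi> z * \<rho> z \<partial>S) \<le> (\<integral>\<^sup>+z. \<phi>' z * \<rho>' z \<partial>S) + \<alpha> * K1"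
  proof (cases "\<alpha> = 0")
    case True
    then have "AE z in S. \<rho> z = 0" using int_\<rho>(1) by (simp add: nn_integral_0_iff_AE)
    then have "(\<integral>\<^sup>+z. \<phi> z * \<rho> z \<partial>S) = 0" by (subst nn_integral_0_iff_AE) auto
    then show ?thesis by simp
  next
    case False
    have "\<alpha> * (\<integral>\<^sup>+z. \<phi> z * \<rho> z \<partial>S) = (\<integral>\<^sup>+z. (\<integral>\<^sup>+z'. \<phi> z * \<rho> z * \<rho>' z' \<partial>S) \<partial>S)"
      by (simp add: nn_integral_cmult int_\<rho> nn_integral_multc mult.commute)
    also have "\<dots> \<le> (\<integral>\<^sup>+z. (\<integral>\<^sup>+z'. \<rho> z * (\<phi>' z' * \<rho>' z') + \<rho> z * (K1 * \<rho>' z') \<partial>S) \<partial>S)"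
    proof (intro nn_integral_mono)
      fix z z' assume z: "z \<in> space S" "z' \<in> space S"
      show "\<phi> z * \<rho> z * \<rho>' z' \<le> \<rho> z * (\<phi>' z' * \<rho>' z') + \<rho> z * (K1 * \<rho>' z')"
      proof (cases "\<rho> z = 0 \<or> \<rho>' z' = 0")
        case False
        then have "\<psi> z \<noteq> 0" "\<psi>' z' \<noteq> 0" unfolding \<rho>_def \<rho>'_def by auto
        from gen[OF off[OF z] this z] have "\<phi> z * (\<rho> z * \<rho>' z') \<le> (\<phi>' z' + K1) * (\<rho> z * \<rho>' z')"
          by (rule mult_right_mono) simp
        then show ?thesis by (simp add: algebra_simps)
      qed auto
    qed
    also have "\<dots> = \<alpha> * ((\<integral>\<^sup>+z. \<phi>' z * \<rho>' z \<partial>S) + \<alpha> * K1)"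
      by (simp add: nn_integral_add nn_integral_cmult int_\<rho> nn_integral_multc) (simp add: algebra_simps)
    finally show ?thesis using False fin1 by (simp add: ennreal_mult_le_mult_iff)
  qed
  have eq: "(\<integral>\<^sup>+z. D z \<partial>S) / p = (\<integral>\<^sup>+z. \<phi> z * b z \<partial>S) + (\<integral>\<^sup>+z. \<phi> z * \<rho> z \<partial>S)"
    unfolding nn_integral_divide[OF \<open>D \<in> borel_measurable S\<close>, symmetric]
    by (subst nn_integral_add[symmetric]) (auto intro!: nn_integral_cong simp: D_eq distrib_left)
  have eq': "(\<integral>\<^sup>+z. D' z \<partial>S) / p' = (\<integral>\<^sup>+z. \<phi>' z * b z \<partial>S) + (\<integral>\<^sup>+z. \<phi>' z * \<rho>' z \<partial>S)"
    unfolding nn_integral_divide[OF \<open>D' \<in> borel_measurable S\<close>, symmetric]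
    by (subst nn_integral_add[symmetric]) (auto intro!: nn_integral_cong simp: D'_eq distrib_left)
  have "(\<integral>\<^sup>+z. D z \<partial>S) / p \<le> (\<integral>\<^sup>+z. D' z \<partial>S) / p' + (\<theta> * K0 + \<alpha> * K1)"
    unfolding eq eq' using add_mono[OF diag_part off_part] by (simp add: algebra_simps)
  from mult_right_mono[OF this, of "p * p'"]
  have "(\<integral>\<^sup>+z. D z \<partial>S) / p * (p * p') \<le> (\<integral>\<^sup>+z. D' z \<partial>S) / p' * (p * p') + (\<theta> * K0 + \<alpha> * K1) * (p * p')"
    by (simp add: algebra_simps)
  moreover have "(\<integral>\<^sup>+z. D z \<partial>S) / p * (p * p') = (\<integral>\<^sup>+z. D z \<partial>S) * p'"
    using p by (simp add: mult.assoc[symmetric] ennreal_divide_mult_cancel)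
  moreover have "(\<integral>\<^sup>+z. D' z \<partial>S) / p' * (p * p') = (\<integral>\<^sup>+z. D' z \<partial>S) * p"
    using p by (simp add: mult.commute[of p] mult.assoc[symmetric] ennreal_divide_mult_cancel)
  ultimately show ?thesis by (simp add: mult.assoc)
qed

lemma enlarge_coefficient: "A \<le> B + K * c * d \<Longrightarrow> K \<le> K' \<Longrightarrow> A \<le> B + K' * c * (d::ennreal)"
  by (erule order_trans) (intro add_left_mono mult_right_mono; simp)

lemma chain_weight_append:
  "chain_weight a e j (l @ l') y = chain_weight a e j l y * chain_weight a e (last (j # l)) l' y"
  by (induction l arbitrary: j) (auto simp: mult.assoc)

lemma chain_weight_cong:
  "(\<And>i. i \<in> set (j # l) \<Longrightarrow> y i = y' i) \<Longrightarrow> chain_weight a e j l y = chain_weight a e j l y'"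
  by (induction l arbitrary: j) auto

context sites begin

lemma chain_weight_measurable:
  assumes a [measurable]: "case_prod a \<in> borel_measurable (S \<Otimes>\<^sub>M S)"
    and "\<And>i. i \<in> I \<Longrightarrow> e i \<in> borel_measurable S" "set (j # l) \<subseteq> I"
  shows "chain_weight a e j l \<in> borel_measurable X"
  using assms(3)
proof (induction l arbitrary: j)
  case (Cons i l)
  have [simp]: "i \<in> I" "j \<in> I" using Cons.prems by auto
  have [measurable]: "e i \<in> borel_measurable S" using assms(2) by auto
  have [measurable]: "chain_weight a e i l \<in> borel_measurable X" using Cons by auto
  have "(\<lambda>x. a (x j) (x i) * e i (x i) * chain_weight a e i l x) \<in> borel_measurable X"
    by measurable
  also have "(\<lambda>x. a (x j) (x i) * e i (x i) * chain_weight a e i l x) = chain_weight a e j (i # l)"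
    by (simp add: fun_eq_iff)
  finally show ?case .
next
  case Nil
  have "chain_weight a e j [] = (\<lambda>_. 1)" by (simp add: fun_eq_iff)
  then show ?case by simp
qed

lemma iter_chain_Cons:
  assumes a: "case_prod a \<in> borel_measurable (S \<Otimes>\<^sub>M S)"
    and e: "\<And>i. i \<in> I \<Longrightarrow> e i \<in> borel_measurable S"
    and l: "set (i # l) \<subseteq> I" "set (j # l') \<subseteq> I" "i \<notin> set l" "j \<notin> set (i # l)"
    and G: "G \<in> borel_measurable X" and x: "x \<in> space X"
  shows "iter S (i # l) (\<lambda>y. chain_weight a e j (i # l') y * G y) x =
    (\<integral>\<^sup>+z. a (x j) z * e i z * iter S l (\<lambda>y. chain_weight a e i l' y * G y) (x(i := z)) \<partial>S)"
  unfolding iter.simps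
proof (rule nn_integral_cong)
  fix z assume z: "z \<in> space S"
  have [measurable]: "chain_weight a e i l' \<in> borel_measurable X"
    using l by (intro chain_weight_measurable a e) auto
  note [measurable] = G
  have "iter S l (\<lambda>y. chain_weight a e j (i # l') y * G y) (x(i := z)) =
      iter S l (\<lambda>y. (a (y j) (y i) * e i (y i)) * (chain_weight a e i l' y * G y)) (x(i := z))"
    by (simp add: mult.assoc)
  also have "\<dots> = (a ((x(i := z)) j) ((x(i := z)) i) * e i ((x(i := z)) i)) *
      iter S l (\<lambda>y. chain_weight a e i l' y * G y) (x(i := z))"
    using l x z by (intro iter_pull) auto
  also have "\<dots> = a (x j) z * e i z * iter S l (\<lambda>y. chain_weight a e i l' y * G y) (x(i := z))"
    using l by auto
  finally show "iter S l (\<lambda>y. chain_weight a e j (i # l') y * G y) (x(i := z)) = \<dots>" .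
qed

lemma chain_total_measurable:
  assumes a [measurable]: "case_prod a \<in> borel_measurable (S \<Otimes>\<^sub>M S)"
    and "\<And>i. i \<in> I \<Longrightarrow> e i \<in> borel_measurable S" "set l \<subseteq> I" and r: "r \<in> borel_measurable S"
  shows "chain_total S a e r l \<in> borel_measurable S"
  using assms(3)
proof (induction l)
  case (Cons i l)
  have [measurable]: "e i \<in> borel_measurable S" using assms(2) Cons by auto
  have [measurable]: "chain_total S a e r l \<in> borel_measurable S" using Cons by auto
  have "(\<lambda>z. \<integral>\<^sup>+v. a z v * e i v * chain_total S a e r l v \<partial>S) \<in> borel_measurable S"
    by measurable
  also have "(\<lambda>z. \<integral>\<^sup>+v. a z v * e i v * chain_total S a e r l v \<partial>S) = chain_total S a e r (i # l)"
    by (simp add: fun_eq_iff)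
  finally show ?case .
next
  case Nil
  have "chain_total S a e r [] = r" by (simp add: fun_eq_iff)
  then show ?case using r by simp
qed

lemma iter_chain_total:
  assumes a: "case_prod a \<in> borel_measurable (S \<Otimes>\<^sub>M S)"
    and e: "\<And>i. i \<in> I \<Longrightarrow> e i \<in> borel_measurable S" and r: "r \<in> borel_measurable S"
    and l: "set (j # l) \<subseteq> I" "distinct (j # l)" "x \<in> space X"
  shows "iter S l (\<lambda>y. chain_weight a e j l y * r (y (last (j # l)))) x = chain_total S a e r l (x j)"
  using l
proof (induction l arbitrary: j x)
  case (Cons i l)
  have [simp]: "last (i # l) \<in> I" using Cons.prems by (metis last_in_set list.discI set_subset_Cons subset_iff)
  define rl where "rl y = r (y (last (i # l)))" for y
  have rl: "rl \<in> borel_measurable X"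
    unfolding rl_def by (rule coord_measurable) fact+
  have "iter S (i # l) (\<lambda>y. chain_weight a e j (i # l) y * rl y) x =
    (\<integral>\<^sup>+z. a (x j) z * e i z * iter S l (\<lambda>y. chain_weight a e i l y * rl y) (x(i := z)) \<partial>S)"
    using Cons.prems by (intro iter_chain_Cons a e rl) auto
  also have "\<dots> = (\<integral>\<^sup>+z. a (x j) z * e i z * chain_total S a e r l z \<partial>S)"
    unfolding rl_def using Cons.prems by (intro nn_integral_cong) (subst Cons.IH; auto)
  finally show ?case by (simp add: rl_def)
qed auto

text \<open>
  The potentials oscillate at most by the factor \<open>D\<close>, so the potentials at the integrated sites can be
  replaced by constants; what is left is the multi-step transition density between the two end sites.
\<close>

lemma iter_chain_bridge:
  assumes a: "case_prod a \<in> borel_measurable (S \<Otimes>\<^sub>M S)"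
    and e: "\<And>i. i \<in> I \<Longrightarrow> e i \<in> borel_measurable S"
    and e_lo: "\<And>i z. i \<in> I \<Longrightarrow> z \<in> space S \<Longrightarrow> \<gamma> i \<le> e i z"
    and e_hi: "\<And>i z. i \<in> I \<Longrightarrow> z \<in> space S \<Longrightarrow> e i z \<le> D * \<gamma> i"
    and l: "set (j # bs @ [i]) \<subseteq> I" "distinct (j # bs @ [i])" "x \<in> space X"
  shows "(\<Prod>b\<leftarrow>bs. \<gamma> b) * (e i (x i) * step_dens S a (length bs) (x j) (x i))
      \<le> iter S bs (chain_weight a e j (bs @ [i])) x" (is ?lower)
    and "iter S bs (chain_weight a e j (bs @ [i])) x
      \<le> D ^ length bs * (\<Prod>b\<leftarrow>bs. \<gamma> b) * (e i (x i) * step_dens S a (length bs) (x j) (x i))" (is ?upper)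
proof -
  have sm: "(\<lambda>v. step_dens S a k v z) \<in> borel_measurable S" if [measurable]: "z \<in> space S" for k z
  proof -
    note [measurable] = a
    show ?thesis
    proof (induction k)
      case (Suc k) note [measurable] = this
      show ?case by simp
    qed simp
  qed
  have "?lower \<and> ?upper" using l
  proof (induction bs arbitrary: j x)
    case Nil then show ?case by (simp add: mult.commute)
  next
    case (Cons b bs)
    note [measurable] = a e
    have [simp]: "b \<in> I" "i \<in> I" "j \<in> I" "b \<noteq> i" "i \<noteq> b" "x i \<in> space S" "x j \<in> space S" "set bs \<subseteq> I"
      using Cons.prems by (auto simp: comp_space)
    have [measurable]: "(\<lambda>v. step_dens S a (length bs) v (x i)) \<in> borel_measurable S" by (rule sm) simp
    have [measurable]: "e b \<in> borel_measurable S" "(\<lambda>v. a (x j) v) \<in> borel_measurable S" by (auto intro!: e)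
    define it where "it z = iter S bs (\<lambda>y. chain_weight a e b (bs @ [i]) y * 1) (x(b := z))" for z
    have eq: "iter S (b # bs) (chain_weight a e j ((b # bs) @ [i])) x = (\<integral>\<^sup>+z. a (x j) z * e b z * it z \<partial>S)"
      using Cons.prems iter_chain_Cons[where e=e, OF a e, where i=b and l=bs and j=j and l'="bs @ [i]" and G="\<lambda>_. 1" and x=x] by (simp add: it_def del: iter.simps chain_weight.simps)
    have IH: "(\<Prod>b\<leftarrow>bs. \<gamma> b) * (e i (x i) * step_dens S a (length bs) z (x i)) \<le> it z"
      "it z \<le> D ^ length bs * (\<Prod>b\<leftarrow>bs. \<gamma> b) * (e i (x i) * step_dens S a (length bs) z (x i))"
      if "z \<in> space S" for z
    proof -
      have "x(b := z) \<in> space X" "(x(b := z)) i = x i" "(x(b := z)) b = z"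
        using Cons.prems that by simp_all
      moreover have "set (b # bs @ [i]) \<subseteq> I" "distinct (b # bs @ [i])" using Cons.prems by auto
      ultimately show "(\<Prod>b\<leftarrow>bs. \<gamma> b) * (e i (x i) * step_dens S a (length bs) z (x i)) \<le> it z"
        "it z \<le> D ^ length bs * (\<Prod>b\<leftarrow>bs. \<gamma> b) * (e i (x i) * step_dens S a (length bs) z (x i))"
        using Cons.IH[of b "x(b := z)"] unfolding it_def mult_1_right by metis+
    qed
    have "(\<Prod>b\<leftarrow>b#bs. \<gamma> b) * (e i (x i) * step_dens S a (length (b#bs)) (x j) (x i)) =
       (\<integral>\<^sup>+z. a (x j) z * \<gamma> b * ((\<Prod>b\<leftarrow>bs. \<gamma> b) * (e i (x i) * step_dens S a (length bs) z (x i))) \<partial>S)"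
      by (simp add: nn_integral_cmult[symmetric]) (simp add: ac_simps)
    also have "\<dots> \<le> (\<integral>\<^sup>+z. a (x j) z * e b z * it z \<partial>S)"
      by (intro nn_integral_mono mult_mono e_lo IH) auto
    finally have 1: "(\<Prod>b\<leftarrow>b#bs. \<gamma> b) * (e i (x i) * step_dens S a (length (b#bs)) (x j) (x i)) \<le> \<dots>" .
    have "(\<integral>\<^sup>+z. a (x j) z * e b z * it z \<partial>S) \<le>
      (\<integral>\<^sup>+z. a (x j) z * (D * \<gamma> b) * (D ^ length bs * (\<Prod>b\<leftarrow>bs. \<gamma> b) * (e i (x i) * step_dens S a (length bs) z (x i))) \<partial>S)"
      by (intro nn_integral_mono mult_mono e_hi IH) auto
    also have "\<dots> = D ^ length (b#bs) * (\<Prod>b\<leftarrow>b#bs. \<gamma> b) * (e i (x i) * step_dens S a (length (b#bs)) (x j) (x i))"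
      by (simp add: nn_integral_cmult[symmetric]) (simp add: ac_simps)
    finally show ?case using 1 unfolding eq by auto
  qed
  then show ?lower ?upper by auto
qed

end

text \<open>
  A chain with potentials between \<open>\<gamma> i\<close> and \<open>D * \<gamma> i\<close> whose \<open>h\<close>-step density lies between \<open>lo\<close> and
  \<open>hi\<close>. The requirement on \<open>\<theta>\<close> says that, whatever the starting value and the potentials at the \<open>h - 1\<close>
  intermediate sites, the law of the chain after \<open>h\<close> steps has a common component of mass \<open>\<theta>\<close>; hence
  \<open>\<alpha> = 1 - \<theta>\<close> is its contraction coefficient.
\<close>

locale mixing_chain = sites S I for S :: "'x measure" and I :: "nat set" +
  fixes a :: "'x \<Rightarrow> 'x \<Rightarrow> ennreal" and e :: "nat \<Rightarrow> 'x \<Rightarrow> ennreal" and \<gamma> :: "nat \<Rightarrow> ennreal"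
    and D lo hi \<sigma> \<theta> \<alpha> :: ennreal and r :: "'x \<Rightarrow> ennreal" and h :: nat
  assumes a_meas: "case_prod a \<in> borel_measurable (S \<Otimes>\<^sub>M S)"
    and e_meas: "\<And>i. i \<in> I \<Longrightarrow> e i \<in> borel_measurable S"
    and e_lo: "\<And>i z. i \<in> I \<Longrightarrow> z \<in> space S \<Longrightarrow> \<gamma> i \<le> e i z"
    and e_hi: "\<And>i z. i \<in> I \<Longrightarrow> z \<in> space S \<Longrightarrow> e i z \<le> D * \<gamma> i"
    and \<gamma>: "\<And>i. i \<in> I \<Longrightarrow> \<gamma> i \<noteq> \<top>"
    and D: "D \<noteq> \<top>"
    and a_le: "\<And>x z. x \<in> space S \<Longrightarrow> z \<in> space S \<Longrightarrow> a x z \<le> \<sigma>" and \<sigma>: "\<sigma> \<noteq> \<top>"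
    and h: "1 \<le> h"
    and step_lo: "\<And>x z. x \<in> space S \<Longrightarrow> z \<in> space S \<Longrightarrow> lo \<le> step_dens S a (h - 1) x z"
    and step_hi: "\<And>x z. x \<in> space S \<Longrightarrow> z \<in> space S \<Longrightarrow> step_dens S a (h - 1) x z \<le> hi"
    and hi: "hi \<noteq> \<top>"
    and r_meas: "r \<in> borel_measurable S" and r_fin: "\<And>z. z \<in> space S \<Longrightarrow> r z \<noteq> \<top>" "(\<integral>\<^sup>+z. r z \<partial>S) \<noteq> \<top>"
    and \<theta>: "\<theta> * (D ^ (h - 1) * hi) \<le> lo" "\<theta> + \<alpha> = 1"
begin

definition end_weight :: "nat \<Rightarrow> nat list \<Rightarrow> (nat \<Rightarrow> 'x) \<Rightarrow> ennreal" where
  "end_weight j l y = r (y (last (j # l)))"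

lemma end_weight_measurable: "set (j # l) \<subseteq> I \<Longrightarrow> end_weight j l \<in> borel_measurable X"
  using coord_measurable[OF _ r_meas, of "last (j # l)"] last_in_set[of "j # l"]
  by (auto simp: end_weight_def[abs_def])

definition chain_int :: "((nat \<Rightarrow> 'x) \<Rightarrow> ennreal) \<Rightarrow> nat \<Rightarrow> nat list \<Rightarrow> (nat \<Rightarrow> 'x) \<Rightarrow> ennreal" where
  "chain_int F j l x = iter S l (\<lambda>y. chain_weight a e j l y * (end_weight j l y * F y)) x"

lemma chain_int_one:
  assumes "set (j # l) \<subseteq> I" "distinct (j # l)" "x \<in> space X"
  shows "chain_int (\<lambda>_. 1) j l x = chain_total S a e r l (x j)"
  using iter_chain_total[OF a_meas e_meas r_meas assms] by (simp add: chain_int_def end_weight_def)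

lemma chain_total_finite:
  assumes "set l \<subseteq> I" "i \<in> I" "z \<in> space S"
  shows "chain_total S a e r l z \<noteq> \<top>" "(\<integral>\<^sup>+z. e i z * chain_total S a e r l z \<partial>S) \<noteq> \<top>"
proof -
  have "(\<forall>z\<in>space S. chain_total S a e r l z \<noteq> \<top>) \<and> (\<forall>i\<in>I. (\<integral>\<^sup>+z. e i z * chain_total S a e r l z \<partial>S) \<noteq> \<top>)"
    using assms(1)
  proof (induction l)
    case Nil
    have "(\<integral>\<^sup>+z. e i z * r z \<partial>S) \<noteq> \<top>" if "i \<in> I" for i
    proof -
      have "(\<integral>\<^sup>+z. e i z * r z \<partial>S) \<le> (\<integral>\<^sup>+z. (D * \<gamma> i) * r z \<partial>S)"
        using that by (intro nn_integral_mono mult_right_mono e_hi) auto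
      also have "\<dots> = (D * \<gamma> i) * (\<integral>\<^sup>+z. r z \<partial>S)" using r_meas by (rule nn_integral_cmult)
      also have "\<dots> < \<top>" using that D \<gamma> r_fin by (simp add: ennreal_mult_less_top less_top[symmetric] ennreal_mult_eq_top_iff)
      finally show ?thesis by simp
    qed
    then show ?case using r_fin by simp
  next
    case (Cons j l)
    note [measurable] = a_meas
    have [measurable]: "chain_total S a e r l \<in> borel_measurable S" "e j \<in> borel_measurable S"
      using Cons by (auto intro!: chain_total_measurable a_meas e_meas r_meas)
    define T where "T = \<sigma> * (\<integral>\<^sup>+v. e j v * chain_total S a e r l v \<partial>S)"
    have T: "T \<noteq> \<top>" using Cons \<sigma> by (auto simp: T_def ennreal_mult_eq_top_iff)
    have le: "chain_total S a e r (j # l) z \<le> T" if "z \<in> space S" for z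
    proof -
      have "chain_total S a e r (j # l) z \<le> (\<integral>\<^sup>+v. \<sigma> * (e j v * chain_total S a e r l v) \<partial>S)"
        unfolding chain_total.simps mult.assoc using that by (intro nn_integral_mono mult_right_mono a_le) auto
      also have "\<dots> = T" unfolding T_def by (rule nn_integral_cmult) simp
      finally show ?thesis .
    qed
    have "(\<integral>\<^sup>+z. e i z * chain_total S a e r (j # l) z \<partial>S) \<noteq> \<top>" if "i \<in> I" for i
    proof -
      have "(\<integral>\<^sup>+z. e i z * chain_total S a e r (j # l) z \<partial>S) \<le> (\<integral>\<^sup>+z. (D * \<gamma> i) * T \<partial>S)"
        using that le by (intro nn_integral_mono mult_mono e_hi) auto
      also have "\<dots> < \<top>" using that D \<gamma> T by (simp add: emeasure_space_1 ennreal_mult_less_top less_top[symmetric] ennreal_mult_eq_top_iff)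
      finally show ?thesis by simp
    qed
    then show ?case using le T by (metis top_unique)
  qed
  then show "chain_total S a e r l z \<noteq> \<top>" "(\<integral>\<^sup>+z. e i z * chain_total S a e r l z \<partial>S) \<noteq> \<top>"
    using assms by auto
qed

lemma chain_int_mono_add:
  assumes l: "set (j # l) \<subseteq> I" "distinct (j # l)" and x: "x \<in> space X" "x' \<in> space X" "x j = x' j"
    and [measurable]: "F \<in> borel_measurable X" "F' \<in> borel_measurable X"
    and le: "\<And>y y'. y \<in> space X \<Longrightarrow> y' \<in> space X \<Longrightarrow> (\<And>i. i \<notin> set l \<Longrightarrow> y i = x i) \<Longrightarrow> (\<And>i. i \<notin> set l \<Longrightarrow> y' i = x' i)
       \<Longrightarrow> (\<And>i. i \<in> set l \<Longrightarrow> y i = y' i) \<Longrightarrow> F y \<le> F' y' + K"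
  shows "chain_int F j l x \<le> chain_int F' j l x' + K * chain_total S a e r l (x' j)"
proof -
  have [measurable]: "end_weight j l \<in> borel_measurable X"
    by (intro end_weight_measurable l)
  have [measurable]: "chain_weight a e j l \<in> borel_measurable X"
    by (intro chain_weight_measurable a_meas e_meas l)
  have "chain_int F j l x \<le>
      iter S l (\<lambda>y. chain_weight a e j l y * (end_weight j l y * F' y) + K * (chain_weight a e j l y * (end_weight j l y * 1))) x'"
    unfolding chain_int_def
  proof (rule iter_mono2)
    fix y y' assume y: "y \<in> space X" "y' \<in> space X" and 1: "\<And>i. i \<notin> set l \<Longrightarrow> y i = x i"
      and 2: "\<And>i. i \<notin> set l \<Longrightarrow> y' i = x' i" and 3: "\<And>i. i \<in> set l \<Longrightarrow> y i = y' i"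
    have 4: "y i = y' i" if "i \<in> set (j # l)" for i
      using that 1 2 3 x(3) by (cases "i \<in> set l") auto
    then have 5: "chain_weight a e j l y = chain_weight a e j l y'" by (rule chain_weight_cong)
    have 6: "end_weight j l y = end_weight j l y'"
      unfolding end_weight_def by (rule arg_cong[where f=r], rule 4[OF last_in_set]) simp
    have "chain_weight a e j l y * (end_weight j l y * F y) \<le> chain_weight a e j l y' * (end_weight j l y' * (F' y' + K))"
      unfolding 5 6 by (intro mult_left_mono le y 1 2 3) auto
    then show "chain_weight a e j l y * (end_weight j l y * F y)
      \<le> chain_weight a e j l y' * (end_weight j l y' * F' y') + K * (chain_weight a e j l y' * (end_weight j l y' * 1))"
      by (simp add: algebra_simps)
  qed (use l x in auto)
  also have "\<dots> = chain_int F' j l x' + K * chain_int (\<lambda>_. 1) j l x'"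
    unfolding chain_int_def using l x by (subst iter_add) (auto simp: iter_cmult)
  finally show ?thesis using chain_int_one l x by simp
qed

text \<open>
  A discrepancy that enters at the start of the chain is felt by the site at distance \<open>d\<close> only with
  weight \<open>\<alpha> ^ (d div h)\<close>. The discrepancy of \<open>F\<close> and \<open>F'\<close> is bounded by a sum over a family \<open>A\<close>, in
  which \<open>g\<close> costs \<open>c g\<close> and is free as long as the two configurations agree from a position below \<open>d g\<close> on.
  
  The induction removes \<open>h\<close> sites at a time. The law of the \<open>h\<close>-th site has a component of mass \<open>\<theta>\<close> that
  does not depend on the start; there the two chains are continued with equal values and only the terms
  with \<open>d g < h\<close> are paid. On the remaining mass \<open>\<alpha>\<close> the induction hypothesis applies to the rest of the
  chain, in which every distance has decreased by \<open>h\<close>.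
\<close>

theorem chain_contraction:
  assumes "set (j # l) \<subseteq> I" "distinct (j # l)" "x \<in> space X" "x' \<in> space X"
    and [measurable]: "F \<in> borel_measurable X" "F' \<in> borel_measurable X"
    and bd: "\<And>y. y \<in> space X \<Longrightarrow> F y \<le> M" "\<And>y. y \<in> space X \<Longrightarrow> F' y \<le> M"
    and A: "finite A"
    and hyp: "\<And>y y' k. y \<in> space X \<Longrightarrow> y' \<in> space X \<Longrightarrow> (\<And>i. i \<notin> set l \<Longrightarrow> y i = x i) \<Longrightarrow> (\<And>i. i \<notin> set l \<Longrightarrow> y' i = x' i)
       \<Longrightarrow> k \<le> length l \<Longrightarrow> (\<And>t. k \<le> t \<Longrightarrow> t < length l \<Longrightarrow> y (l ! t) = y' (l ! t))
       \<Longrightarrow> F y \<le> F' y' + (\<Sum>g | g \<in> A \<and> d g \<le> k. c g)"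
  shows "chain_int F j l x * chain_int (\<lambda>_. 1) j l x' \<le> chain_int F' j l x' * chain_int (\<lambda>_. 1) j l x
     + (\<Sum>g\<in>A. c g * \<alpha> ^ (d g div h)) * chain_int (\<lambda>_. 1) j l x * chain_int (\<lambda>_. 1) j l x'"
  using assms(1-4) hyp
proof (induction "length l" arbitrary: l j x x' d rule: less_induct)
  case less
  note l = less.prems(1,2) and x = less.prems(3,4) and hyp = less.prems(5)
  have [measurable]: "end_weight j l \<in> borel_measurable X"
    by (intro end_weight_measurable l)
  have [measurable]: "chain_weight a e j l \<in> borel_measurable X"
    by (intro chain_weight_measurable a_meas e_meas l)
  show ?case
  proof (cases "length l < h")
    case True
    define K where "K = (\<Sum>g | g \<in> A \<and> d g \<le> length l. c g)"
    have "chain_int F j l x * chain_int (\<lambda>_. 1) j l x' \<le> chain_int F' j l x' * chain_int (\<lambda>_. 1) j l x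
     + K * chain_int (\<lambda>_. 1) j l x * chain_int (\<lambda>_. 1) j l x'"
      unfolding chain_int_def
    proof (rule iter_bilinear)
      fix y y' assume y: "y \<in> space X" "y' \<in> space X" "\<And>i. i \<notin> set l \<Longrightarrow> y i = x i" "\<And>i. i \<notin> set l \<Longrightarrow> y' i = x' i"
      have "F y \<le> F' y' + K" unfolding K_def by (rule hyp[OF y]) auto
      then have "F y * (chain_weight a e j l y * end_weight j l y * (chain_weight a e j l y' * end_weight j l y'))
        \<le> (F' y' + K) * (chain_weight a e j l y * end_weight j l y * (chain_weight a e j l y' * end_weight j l y'))"
        by (rule mult_right_mono) simp
      then show "chain_weight a e j l y * (end_weight j l y * F y) * (chain_weight a e j l y' * (end_weight j l y' * 1)) \<le>
         chain_weight a e j l y' * (end_weight j l y' * F' y') * (chain_weight a e j l y * (end_weight j l y * 1)) +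
         K * (chain_weight a e j l y * (end_weight j l y * 1)) * (chain_weight a e j l y' * (end_weight j l y' * 1))"
        by (simp add: algebra_simps)
    qed (use l x in auto)
    moreover have "K \<le> (\<Sum>g\<in>A. c g * \<alpha> ^ (d g div h))"
    proof -
      have "K = (\<Sum>g | g \<in> A \<and> d g \<le> length l. c g * \<alpha> ^ (d g div h))"
        unfolding K_def using True by (intro sum.cong) auto
      also have "\<dots> \<le> (\<Sum>g\<in>A. c g * \<alpha> ^ (d g div h))" using A by (intro sum_mono2) auto
      finally show ?thesis .
    qed
    ultimately show ?thesis by (rule enlarge_coefficient)
  next
    case False
    define bs where "bs = take (h - 1) l"
    define i where "i = l ! (h - 1)"
    define l' where "l' = drop h l"
    have l_eq: "l = bs @ i # l'"
      using False h unfolding bs_def i_def l'_def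
      using id_take_nth_drop[of "h - 1" l] by simp
    have len: "length bs = h - 1" "length l = h + length l'" "length l' < length l"
      using False h by (auto simp: bs_def l'_def)
    have last_eq: "end_weight j l = end_weight i l'" by (simp add: l_eq end_weight_def fun_eq_iff)
    have sub: "set (i # l') \<subseteq> I" "distinct (i # l')" "i \<in> I" "set bs \<subseteq> I" "i \<notin> set bs" "j \<notin> set bs" "j \<in> I" "i \<noteq> j"
      "set (j # bs @ [i]) \<subseteq> I" "distinct (j # bs @ [i])" "set l' \<inter> set bs = {}" "j \<notin> set l'" "set l' \<subseteq> I" "distinct l"
      using l by (auto simp: l_eq)
    define H where "H = chain_total S a e r l'"
    define w where "w = chain_weight a e j (bs @ [i])"
    define E where "E F = chain_int F i l'" for F
    have wm [measurable]: "w \<in> borel_measurable X"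
      unfolding w_def by (intro chain_weight_measurable a_meas e_meas sub)
    have Hm [measurable]: "H \<in> borel_measurable S"
      unfolding H_def by (intro chain_total_measurable a_meas e_meas r_meas sub)
    have [measurable]: "end_weight i l' \<in> borel_measurable X"
      by (intro end_weight_measurable sub)
    have cwm [measurable]: "chain_weight a e i l' \<in> borel_measurable X"
      by (intro chain_weight_measurable a_meas e_meas sub)
    have Em: "E G \<in> borel_measurable X" if [measurable]: "G \<in> borel_measurable X" for G
      unfolding E_def chain_int_def using sub by (intro iter_measurable) measurable
    have E1: "E (\<lambda>_. 1) y = H (y i)" if "y \<in> space X" for y
      unfolding E_def H_def by (intro chain_int_one sub that)
    \<comment> \<open>integrate the site \<open>i\<close> last\<close>
    have split: "chain_int G j l y = (\<integral>\<^sup>+z. iter S bs (\<lambda>y. w y * E G y) (y(i := z)) \<partial>S)"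
      if [measurable]: "G \<in> borel_measurable X" and y: "y \<in> space X" for G y
    proof -
      have "chain_int G j l y = iter S (i # bs @ l') (\<lambda>y. chain_weight a e j l y * (end_weight j l y * G y)) y"
        unfolding chain_int_def
      proof (rule iter_perm)
        show "distinct l" "set l \<subseteq> I" "y \<in> space X" by (fact sub(14), use l in simp, fact y)
        show "distinct (i # bs @ l')" "set l = set (i # bs @ l')" using sub by (auto simp: l_eq)
      qed measurable
      also have "\<dots> = (\<integral>\<^sup>+z. iter S bs (iter S l' (\<lambda>y. chain_weight a e j l y * (end_weight j l y * G y))) (y(i := z)) \<partial>S)"
        by (simp add: iter_append)
      also have "\<dots> = (\<integral>\<^sup>+z. iter S bs (\<lambda>y. w y * E G y) (y(i := z)) \<partial>S)"
      proof (intro nn_integral_cong iter_cong)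
        fix z y' assume z: "z \<in> space S" and y': "y' \<in> space X"
        have "iter S l' (\<lambda>y. chain_weight a e j l y * (end_weight j l y * G y)) y' =
            iter S l' (\<lambda>y. w y * (chain_weight a e i l' y * (end_weight i l' y * G y))) y'"
          unfolding last_eq unfolding l_eq w_def
          using chain_weight_append[of a e j "bs @ [i]" l'] by (simp add: mult.assoc)
        also have "\<dots> = w y' * E G y'"
          unfolding E_def chain_int_def
          by (intro iter_pull sub y', measurable) (use sub in \<open>auto simp: w_def intro!: chain_weight_cong; blast\<close>)
        finally show "iter S l' (\<lambda>y. chain_weight a e j l y * (end_weight j l y * G y)) y' = w y' * E G y'" .
      qed (use sub y in auto)
      finally show ?thesis .
    qed
    define Dn where "Dn G y z = iter S bs (\<lambda>y. w y * E G y) (y(i := z))" for G y z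
    have Dm [measurable]: "Dn G y \<in> borel_measurable S" if "G \<in> borel_measurable X" "y \<in> space X" for G y
    proof -
      note [measurable] = Em[OF that(1)]
      have [simp]: "i \<in> I" "set bs \<subseteq> I" by (fact sub)+
      show ?thesis unfolding Dn_def using that by measurable
    qed
    define \<psi> where "\<psi> y = Dn (\<lambda>_. 1) y" for y
    define \<kappa> where "\<kappa> y z = iter S bs w (y(i := z))" for y z
    have \<psi>_eq: "\<psi> y z = \<kappa> y z * H z" if "y \<in> space X" "z \<in> space S" for y z
    proof -
      have "\<psi> y z = iter S bs (\<lambda>y. H z * w y) (y(i := z))"
        unfolding \<psi>_def Dn_def using that sub
        by (intro iter_cong) (auto simp: E1 mult.commute)
      also have "\<dots> = H z * \<kappa> y z" unfolding \<kappa>_def using that sub by (intro iter_cmult) auto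
      finally show ?thesis by (simp add: mult.commute)
    qed
    define \<Gamma> where "\<Gamma> = (\<Prod>b\<leftarrow>bs. \<gamma> b)"
    have \<Gamma>: "\<Gamma> \<noteq> \<top>"
    proof -
      have "(\<Prod>b\<leftarrow>bs. \<gamma> b) \<noteq> \<top>" if "set bs \<subseteq> I" for bs
        using that \<gamma> by (induction bs) (auto simp: ennreal_mult_eq_top_iff)
      then show ?thesis using sub by (simp add: \<Gamma>_def)
    qed
    have \<kappa>_lo: "\<Gamma> * (e i z * lo) \<le> \<kappa> y z" and \<kappa>_hi: "\<kappa> y z \<le> D ^ (h - 1) * \<Gamma> * (e i z * hi)"
      if "y \<in> space X" "z \<in> space S" for y z
    proof -
      have y: "y(i := z) \<in> space X" "y j \<in> space S" using that sub by (auto simp: comp_space)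
      have yz: "(y(i := z)) i = z" "(y(i := z)) j = y j" using sub(8) by simp_all
      have br: "\<Gamma> * (e i z * step_dens S a (h - 1) (y j) z) \<le> \<kappa> y z"
        "\<kappa> y z \<le> D ^ (h - 1) * \<Gamma> * (e i z * step_dens S a (h - 1) (y j) z)"
        using iter_chain_bridge[where e=e and \<gamma>=\<gamma>, OF a_meas e_meas e_lo e_hi sub(9,10) y(1)]
        unfolding yz len(1) \<kappa>_def w_def \<Gamma>_def by simp_all
      have "\<Gamma> * (e i z * lo) \<le> \<Gamma> * (e i z * step_dens S a (h - 1) (y j) z)"
        by (intro mult_left_mono step_lo y that) auto
      also have "\<dots> \<le> \<kappa> y z" by (rule br)
      finally show "\<Gamma> * (e i z * lo) \<le> \<kappa> y z" .
      have "\<kappa> y z \<le> D ^ (h - 1) * \<Gamma> * (e i z * step_dens S a (h - 1) (y j) z)"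
        by (rule br)
      also have "\<dots> \<le> D ^ (h - 1) * \<Gamma> * (e i z * hi)"
        by (intro mult_left_mono step_hi y that) auto
      finally show "\<kappa> y z \<le> D ^ (h - 1) * \<Gamma> * (e i z * hi)" .
    qed
    define \<eta> where "\<eta> z = e i z * H z" for z
    have [measurable]: "e i \<in> borel_measurable S" by (intro e_meas sub)
    have [measurable]: "\<eta> \<in> borel_measurable S" unfolding \<eta>_def by measurable
    have \<psi>m: "\<psi> x \<in> borel_measurable S" "\<psi> x' \<in> borel_measurable S"
      "Dn F x \<in> borel_measurable S" "Dn F' x' \<in> borel_measurable S"
      unfolding \<psi>_def using x by (auto intro!: Dm)
    define T where "T = (\<integral>\<^sup>+z. \<eta> z \<partial>S)"
    have T: "T \<noteq> \<top>" unfolding T_def \<eta>_def H_def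
      using chain_total_finite(2)[OF sub(13,3)] comp_space[OF x(1) sub(3)] by simp
    have int_\<psi>: "chain_int (\<lambda>_. 1) j l y = (\<integral>\<^sup>+z. \<psi> y z \<partial>S)" if "y \<in> space X" for y
      using split[OF _ that, of "\<lambda>_. 1"] by (simp add: \<psi>_def Dn_def)
    have int_\<psi>_le: "(\<integral>\<^sup>+z. \<psi> y z \<partial>S) \<le> D ^ (h - 1) * \<Gamma> * hi * T" if "y \<in> space X" for y
    proof -
      have "(\<integral>\<^sup>+z. \<psi> y z \<partial>S) \<le> (\<integral>\<^sup>+z. (D ^ (h - 1) * \<Gamma> * hi) * \<eta> z \<partial>S)"
      proof (rule nn_integral_mono)
        fix z assume "z \<in> space S"
        then show "\<psi> y z \<le> (D ^ (h - 1) * \<Gamma> * hi) * \<eta> z"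
          using mult_right_mono[OF \<kappa>_hi[OF that, of z], of "H z"] that by (simp add: \<psi>_eq \<eta>_def ac_simps)
      qed
      also have "\<dots> = D ^ (h - 1) * \<Gamma> * hi * T" unfolding T_def by (rule nn_integral_cmult) simp
      finally show ?thesis .
    qed
    \<comment> \<open>cost if the chains agree from the \<open>h\<close>-th site on, and cost of the rest of the chain otherwise\<close>
    define K0 where "K0 = (\<Sum>g | g \<in> A \<and> d g \<le> h - 1. c g)"
    define K1 where "K1 = (\<Sum>g\<in>A. c g * \<alpha> ^ ((d g - h) div h))"
    \<comment> \<open>lifts a comparison of the continuations, given the values at \<open>i\<close>, to the skipped sites before \<open>i\<close>\<close>
    have coupled: "Dn F x z * \<psi> x' z' \<le> Dn F' x' z' * \<psi> x z + K * \<psi> x z * \<psi> x' z'"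
      if z: "z \<in> space S" "z' \<in> space S"
      and le: "\<And>y y'. y \<in> space X \<Longrightarrow> y' \<in> space X \<Longrightarrow> y i = z \<Longrightarrow> y' i = z'
        \<Longrightarrow> (\<And>t. t \<notin> set l \<Longrightarrow> y t = x t) \<Longrightarrow> (\<And>t. t \<notin> set l \<Longrightarrow> y' t = x' t)
        \<Longrightarrow> E F y * H z' \<le> E F' y' * H z + K * H z * H z'" for z z' K
      unfolding Dn_def \<psi>_def
    proof (rule iter_bilinear)
      fix y y' assume y: "y \<in> space X" "y' \<in> space X" "\<And>t. t \<notin> set bs \<Longrightarrow> y t = (x(i := z)) t" "\<And>t. t \<notin> set bs \<Longrightarrow> y' t = (x'(i := z')) t"
      have [simp]: "y i = z" "y' i = z'" using y(3,4)[of i] sub by auto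
      have "E F y * H z' \<le> E F' y' * H z + K * H z * H z'"
        by (rule le[OF y(1,2)]) (use y(3,4) in \<open>auto simp: l_eq\<close>)
      then have "w y * w y' * (E F y * H z') \<le> w y * w y' * (E F' y' * H z + K * H z * H z')"
        by (rule mult_left_mono) simp
      then show "w y * E F y * (w y' * E (\<lambda>_. 1) y') \<le> w y' * E F' y' * (w y * E (\<lambda>_. 1) y) + K * (w y * E (\<lambda>_. 1) y) * (w y' * E (\<lambda>_. 1) y')"
        by (simp add: E1 y(1,2) algebra_simps)
    qed (use sub x z in \<open>auto intro!: borel_measurable_times_ennreal wm Em\<close>)
    show ?thesis
    proof (cases "(\<integral>\<^sup>+z. \<psi> x z \<partial>S) = 0 \<or> (\<integral>\<^sup>+z. \<psi> x' z \<partial>S) = 0")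
      case True
      have "chain_int F j l x \<le> M * chain_int (\<lambda>_. 1) j l x"
      proof -
        have "chain_int F j l x \<le> iter S l (\<lambda>y. M * (chain_weight a e j l y * (end_weight j l y * 1))) x"
          unfolding chain_int_def
        proof (rule iter_mono)
          fix y assume "y \<in> space X"
          then have "F y * (chain_weight a e j l y * end_weight j l y) \<le> M * (chain_weight a e j l y * end_weight j l y)"
            by (intro mult_right_mono bd) auto
          then show "chain_weight a e j l y * (end_weight j l y * F y) \<le> M * (chain_weight a e j l y * (end_weight j l y * 1))"
            by (simp add: ac_simps)
        qed (use l x in auto)
        also have "\<dots> = M * chain_int (\<lambda>_. 1) j l x"
          unfolding chain_int_def using l x by (intro iter_cmult) auto
        finally show ?thesis .
      qed
      then show ?thesis using True int_\<psi> x by auto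
    next
      case False
      have T0: "T \<noteq> 0" using False int_\<psi>_le[OF x(1)] by auto
      have fin: "(\<integral>\<^sup>+z. \<psi> y z \<partial>S) \<noteq> \<top>" if "y \<in> space X" for y
      proof -
        have "D ^ (h - 1) * \<Gamma> * hi * T < \<top>" using D \<Gamma> hi T
          by (simp add: ennreal_mult_less_top less_top[symmetric] ennreal_mult_eq_top_iff power_eq_top_ennreal)
        then show ?thesis using int_\<psi>_le[OF that] by (auto simp: top_unique)
      qed
      have "(\<integral>\<^sup>+z. Dn F x z \<partial>S) * (\<integral>\<^sup>+z. \<psi> x' z \<partial>S) \<le> (\<integral>\<^sup>+z. Dn F' x' z \<partial>S) * (\<integral>\<^sup>+z. \<psi> x z \<partial>S)
        + (\<theta> * K0 + \<alpha> * K1) * (\<integral>\<^sup>+z. \<psi> x z \<partial>S) * (\<integral>\<^sup>+z. \<psi> x' z \<partial>S)"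
      proof (rule minorised_transport[where M=M and \<eta>=\<eta>])
        fix z assume z: "z \<in> space S"
        have "\<kappa> y z \<noteq> \<top>" if "y \<in> space X" for y
        proof -
          have "D ^ (h - 1) * \<Gamma> * (e i z * hi) < \<top>" using D \<Gamma> hi e_hi[OF sub(3) z] \<gamma>[OF sub(3)]
            by (auto simp add: ennreal_mult_less_top less_top[symmetric] power_eq_top_ennreal top_unique ennreal_mult_eq_top_iff)
          then show ?thesis using \<kappa>_hi[OF that z] by (auto simp: top_unique)
        qed
        moreover have "H z \<noteq> \<top>" unfolding H_def by (rule chain_total_finite(1)[OF sub(13,3) z])
        ultimately show "\<psi> x z \<noteq> \<top>" "\<psi> x' z \<noteq> \<top>" using x z by (auto simp: \<psi>_eq ennreal_mult_eq_top_iff)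
        have bound: "Dn G y z \<le> M * \<psi> y z" if [measurable]: "G \<in> borel_measurable X"
          and G: "\<And>y. y \<in> space X \<Longrightarrow> G y \<le> M" and y: "y \<in> space X" for G y
        proof -
          have EG: "E G y' \<le> M * E (\<lambda>_. 1) y'" if "y' \<in> space X" for y'
          proof -
            have "E G y' \<le> iter S l' (\<lambda>y. M * (chain_weight a e i l' y * (end_weight i l' y * 1))) y'"
              unfolding chain_int_def E_def
            proof (rule iter_mono)
              fix y assume "y \<in> space X"
              then have "G y * (chain_weight a e i l' y * end_weight i l' y) \<le> M * (chain_weight a e i l' y * end_weight i l' y)"
                by (intro mult_right_mono G) auto
              then show "chain_weight a e i l' y * (end_weight i l' y * G y) \<le> M * (chain_weight a e i l' y * (end_weight i l' y * 1))"
                by (simp add: ac_simps)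
            qed (use sub that in auto)
            also have "\<dots> = M * E (\<lambda>_. 1) y'"
              unfolding chain_int_def E_def using sub that by (intro iter_cmult) auto
            finally show ?thesis .
          qed
          have "Dn G y z \<le> iter S bs (\<lambda>y. M * (w y * E (\<lambda>_. 1) y)) (y(i := z))"
            unfolding Dn_def
          proof (rule iter_mono)
            fix y' assume "y' \<in> space X"
            from mult_left_mono[OF EG[OF this], of "w y'"]
            show "w y' * E G y' \<le> M * (w y' * E (\<lambda>_. 1) y')" by (simp add: ac_simps)
          qed (use sub y z in auto)
          also have "\<dots> = M * \<psi> y z"
            unfolding \<psi>_def Dn_def using sub y z by (intro iter_cmult) (auto intro!: borel_measurable_times_ennreal wm Em)
          finally show ?thesis .
        qed
        show "Dn F x z \<le> M * \<psi> x z" "Dn F' x' z \<le> M * \<psi> x' z" using bd x by (auto intro!: bound)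
        have minor: "\<theta> * \<eta> z * (\<integral>\<^sup>+z. \<psi> y' z \<partial>S) \<le> \<psi> y z * T" if "y \<in> space X" "y' \<in> space X" for y y'
        proof -
          have "\<theta> * \<eta> z * (\<integral>\<^sup>+z. \<psi> y' z \<partial>S) \<le> \<theta> * \<eta> z * (D ^ (h - 1) * \<Gamma> * hi * T)"
            by (intro mult_left_mono int_\<psi>_le that) auto
          also have "\<dots> = (\<theta> * (D ^ (h - 1) * hi)) * (\<Gamma> * \<eta> z * T)" by (simp add: ac_simps)
          also have "\<dots> \<le> lo * (\<Gamma> * \<eta> z * T)" by (intro mult_right_mono \<theta>) auto
          also have "\<dots> = \<Gamma> * (e i z * lo) * (H z * T)" by (simp add: \<eta>_def ac_simps)
          also have "\<dots> \<le> \<kappa> y z * (H z * T)" by (intro mult_right_mono \<kappa>_lo z that) auto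
          also have "\<dots> = \<psi> y z * T" using that z by (simp add: \<psi>_eq ac_simps)
          finally show ?thesis .
        qed
        show "\<theta> * \<eta> z * (\<integral>\<^sup>+z. \<psi> x z \<partial>S) \<le> \<psi> x z * (\<integral>\<^sup>+z. \<eta> z \<partial>S)"
            "\<theta> * \<eta> z * (\<integral>\<^sup>+z. \<psi> x' z \<partial>S) \<le> \<psi> x' z * (\<integral>\<^sup>+z. \<eta> z \<partial>S)"
          using minor x unfolding T_def by auto
        show "Dn F x z * \<psi> x' z \<le> Dn F' x' z * \<psi> x z + K0 * \<psi> x z * \<psi> x' z"
        proof (rule coupled[OF z z])
          fix y y' assume y: "y \<in> space X" "y' \<in> space X" "y i = z" "y' i = z"
            and off: "\<And>t. t \<notin> set l \<Longrightarrow> y t = x t" "\<And>t. t \<notin> set l \<Longrightarrow> y' t = x' t"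
          have "E F y \<le> E F' y' + K0 * H (y' i)"
            unfolding E_def H_def
          proof (rule chain_int_mono_add)
            fix v v' assume v: "v \<in> space X" "v' \<in> space X" "\<And>t. t \<notin> set l' \<Longrightarrow> v t = y t" "\<And>t. t \<notin> set l' \<Longrightarrow> v' t = y' t"
              "\<And>t. t \<in> set l' \<Longrightarrow> v t = v' t"
            have "v (l ! t) = v' (l ! t)" if "h - 1 \<le> t" "t < length l" for t
            proof (cases "t = h - 1")
              case True
              then have "l ! t = i" by (simp add: i_def)
              moreover have "v i = v' i" using v(3,4)[of i] y sub by auto
              ultimately show ?thesis by simp
            next
              case False
              then have "l ! t = l' ! (t - h)" "t - h < length l'" using that h by (auto simp: l'_def)
              then show ?thesis using v(5) by simp
            qed
            then show "F v \<le> F' v' + K0"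
              unfolding K0_def using v(3,4) off False len
              by (intro hyp v(1,2)) (auto simp: l_eq)
          qed (use sub y in auto)
          then have "E F y * H z \<le> (E F' y' + K0 * H z) * H z" using y by (intro mult_right_mono) auto
          then show "E F y * H z \<le> E F' y' * H z + K0 * H z * H z" by (simp add: algebra_simps)
        qed
        fix z' assume z': "z' \<in> space S"
        show "Dn F x z * \<psi> x' z' \<le> Dn F' x' z' * \<psi> x z + K1 * \<psi> x z * \<psi> x' z'"
        proof (rule coupled[OF z z'])
          fix y y' assume y: "y \<in> space X" "y' \<in> space X" "y i = z" "y' i = z'"
            and off: "\<And>t. t \<notin> set l \<Longrightarrow> y t = x t" "\<And>t. t \<notin> set l \<Longrightarrow> y' t = x' t"
          have "chain_int F i l' y * chain_int (\<lambda>_. 1) i l' y' \<le> chain_int F' i l' y' * chain_int (\<lambda>_. 1) i l' y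
             + (\<Sum>g\<in>A. c g * \<alpha> ^ ((d g - h) div h)) * chain_int (\<lambda>_. 1) i l' y * chain_int (\<lambda>_. 1) i l' y'"
          proof (rule less.hyps[OF len(3) sub(1,2) y(1,2)])
            fix v v' k assume v: "v \<in> space X" "v' \<in> space X" "\<And>t. t \<notin> set l' \<Longrightarrow> v t = y t" "\<And>t. t \<notin> set l' \<Longrightarrow> v' t = y' t"
              and k: "k \<le> length l'" and agree: "\<And>t. k \<le> t \<Longrightarrow> t < length l' \<Longrightarrow> v (l' ! t) = v' (l' ! t)"
            have "{g \<in> A. d g - h \<le> k} = {g \<in> A. d g \<le> k + h}" by auto
            moreover have "F v \<le> F' v' + (\<Sum>g | g \<in> A \<and> d g \<le> k + h. c g)"
            proof (rule hyp[OF v(1,2)])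
              fix t assume t: "k + h \<le> t" "t < length l"
              have "l ! t = l' ! (t - h)" using t by (simp add: l'_def)
              moreover have "k \<le> t - h" "t - h < length l'" using t len(2) by linarith+
              ultimately show "v (l ! t) = v' (l ! t)" using agree by simp
            qed (use v(3,4) off len k in \<open>auto simp: l_eq\<close>)
            ultimately show "F v \<le> F' v' + (\<Sum>g | g \<in> A \<and> d g - h \<le> k. c g)" by simp
          qed
          from this[folded E_def K1_def] show "E F y * H z' \<le> E F' y' * H z + K1 * H z * H z'"
            by (simp only: E1[OF y(1)] E1[OF y(2)] y(3,4))
        qed
      qed (use False fin x T[unfolded T_def] T0[unfolded T_def] \<theta> \<psi>m in auto)
      moreover have "\<theta> * K0 + \<alpha> * K1 \<le> (\<Sum>g\<in>A. c g * \<alpha> ^ (d g div h))"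
      proof -
        have "K0 = (\<Sum>g\<in>A. if d g \<le> h - 1 then c g else 0)"
          unfolding K0_def using A by (simp add: sum.inter_filter)
        then have "\<theta> * K0 + \<alpha> * K1 = (\<Sum>g\<in>A. \<theta> * (if d g \<le> h - 1 then c g else 0) + \<alpha> * (c g * \<alpha> ^ ((d g - h) div h)))"
          by (simp add: K1_def sum_distrib_left sum.distrib)
        also have "\<dots> \<le> (\<Sum>g\<in>A. c g * \<alpha> ^ (d g div h))"
        proof (rule sum_mono)
          fix g
          show "\<theta> * (if d g \<le> h - 1 then c g else 0) + \<alpha> * (c g * \<alpha> ^ ((d g - h) div h)) \<le> c g * \<alpha> ^ (d g div h)"
          proof (cases "d g < h")
            case True
            then have "\<theta> * c g + \<alpha> * c g = c g" using \<theta>(2) by (simp add: distrib_right[symmetric])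
            moreover have "d g \<le> h - 1" using True by linarith
            ultimately show ?thesis using True by simp
          next
            case False
            then have "d g div h = Suc ((d g - h) div h)" using h by (simp add: le_div_geq)
            moreover have "\<not> d g \<le> h - 1" using False h by linarith
            ultimately show ?thesis by (simp add: ac_simps)
          qed
        qed
        finally show ?thesis .
      qed
      ultimately have "(\<integral>\<^sup>+z. Dn F x z \<partial>S) * (\<integral>\<^sup>+z. \<psi> x' z \<partial>S) \<le> (\<integral>\<^sup>+z. Dn F' x' z \<partial>S) * (\<integral>\<^sup>+z. \<psi> x z \<partial>S)
        + (\<Sum>g\<in>A. c g * \<alpha> ^ (d g div h)) * (\<integral>\<^sup>+z. \<psi> x z \<partial>S) * (\<integral>\<^sup>+z. \<psi> x' z \<partial>S)"
        by (rule enlarge_coefficient)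
      then show ?thesis using split[OF _ x(1), of F] split[OF _ x(2), of F'] x by (simp add: int_\<psi> Dn_def)
    qed
  qed
qed

end

section \<open>A lower bound for self-normalised sums\<close>

text \<open>
  \<open>1 / Y\<close> is convex, hence above its tangent at \<open>Y0\<close>; the tangent term is moved to the other side to
  avoid subtraction.
\<close>

lemma reciprocal_above_tangent:
  fixes Y Y0 c :: ennreal
  assumes "Y0 \<noteq> 0" "Y0 \<noteq> \<top>"
  shows "c / Y0 + c / Y0 \<le> c / Y + c * Y / (Y0 * Y0)"
proof -
  obtain y0 where y0: "Y0 = ennreal y0" "0 < y0"
    using assms by (cases Y0) (auto simp: less_le)
  have "1 / Y0 + 1 / Y0 \<le> 1 / Y + Y / (Y0 * Y0)"
  proof (cases Y)
    case top
    then show ?thesis using y0 by (simp add: divide_ennreal_def ennreal_mult_eq_top_iff ennreal_top_mult ennreal_mult[symmetric] inverse_ennreal)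
  next
    case (real r)
    show ?thesis
    proof (cases "r = 0")
      case True
      then show ?thesis using real by simp
    next
      case False
      then have r: "0 < r" using real by auto
      have "0 \<le> (r - y0)\<^sup>2" by simp
      then have "2 * (r * y0) \<le> y0 * y0 + r * r" by (simp add: power2_eq_square algebra_simps)
      then have "1 / y0 + 1 / y0 \<le> 1 / r + r / (y0 * y0)"
        using r y0(2) by (simp add: field_simps)
      moreover have "1 / Y0 = ennreal (1 / y0)" "1 / Y = ennreal (1 / r)" "Y / (Y0 * Y0) = ennreal (r / (y0 * y0))"
        using real y0 r by (simp_all add: divide_ennreal ennreal_1[symmetric] ennreal_mult[symmetric] del: ennreal_1)
      ultimately show ?thesis using r y0(2) by (simp add: ennreal_plus[symmetric] del: ennreal_plus)
    qed
  qed
  from mult_left_mono[OF this, of c] show ?thesis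
    by (simp add: distrib_left ennreal_times_divide)
qed

text \<open>
  Jensen's inequality for \<open>1 / Y\<close>, where \<open>Y\<close> is the sum of the weights \<open>b\<close>: each of the \<open>N - 1\<close> free
  particles contributes \<open>a\<close> divided by the mean of \<open>Y\<close>. In this mean the contributing particle and the
  retained particle \<open>q\<close> cannot be averaged, because one is correlated with \<open>a\<close> and the other one is
  fixed; they enter through the supremum \<open>B\<close>, the other \<open>N - 2\<close> through their expectation.
\<close>

lemma one_step_lower_bound:
  fixes \<rho> T :: "'q measure" and a b :: "'q \<Rightarrow> ennreal"
  assumes N: "2 \<le> N" and \<rho>: "prob_space \<rho>" "sets \<rho> = sets T" and q: "q \<in> space T"
    and [measurable]: "a \<in> borel_measurable T" "b \<in> borel_measurable T"
    and b: "\<And>z. z \<in> space T \<Longrightarrow> b z \<le> B" and a: "(\<integral>\<^sup>+z. a z \<partial>\<rho>) \<noteq> \<top>"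
    and Y0: "B + B + of_nat (N - 2) * (\<integral>\<^sup>+z. b z \<partial>\<rho>) \<le> Y0" "Y0 \<noteq> 0" "Y0 \<noteq> \<top>"
  shows "of_nat (N - 1) * (\<integral>\<^sup>+z. a z \<partial>\<rho>) / Y0
     \<le> (\<integral>\<^sup>+Z. (\<Sum>j=1..N. a (Z j)) / (\<Sum>l=1..N. b (Z l)) \<partial>PiM {1..N} (\<lambda>i. if i = N then return T q else \<rho>))"
proof -
  interpret \<rho>: prob_space \<rho> by fact
  define Q where "Q i = (if i = N then return T q else \<rho>)" for i
  have prob_Q: "prob_space (Q i)" for i unfolding Q_def using q \<rho> by (auto intro: prob_space_return)
  interpret Q: product_prob_space Q "{1..N}"
    by (intro product_prob_spaceI prob_Q)
  have sets_Q [measurable_cong]: "sets (Q i) = sets T" for i unfolding Q_def using \<rho> by auto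
  note space_Q = sets_eq_imp_space_eq[OF sets_Q]
  note [measurable_cong] = \<rho>(2)
  define P where "P = PiM {1..N} Q"
  have sP: "Z j \<in> space T" if "Z \<in> space P" "j \<in> {1..N}" for Z j
    using that space_Q by (auto simp: P_def space_PiM PiE_iff)
  have Zm: "(\<lambda>Z. f (Z j)) \<in> borel_measurable P" if "j \<in> {1..N}" and [measurable]: "f \<in> borel_measurable T" for j and f :: "'q \<Rightarrow> ennreal"
  proof -
    have "f \<in> borel_measurable (Q j)" by measurable
    then show ?thesis unfolding P_def using that by (auto intro!: measurable_compose[OF measurable_component_singleton])
  qed
  have one: "(\<integral>\<^sup>+Z. f (Z j) \<partial>P) = (\<integral>\<^sup>+z. f z \<partial>\<rho>)" if j: "j \<in> {1..N-1}" and fm [measurable]: "f \<in> borel_measurable T" for f j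
  proof -
    have "(\<integral>\<^sup>+Z. f (Z j) \<partial>P) = (\<integral>\<^sup>+Z. (\<Prod>i\<in>{1..N}. (if i = j then f (Z i) else 1)) \<partial>P)"
      using j N by (intro nn_integral_cong) (auto simp add: prod.delta)
    also have "\<dots> = (\<Prod>i\<in>{1..N}. \<integral>\<^sup>+z. (if i = j then f z else 1) \<partial>Q i)"
      unfolding P_def by (subst Q.product_nn_integral_prod[symmetric]) auto
    also have "\<dots> = (\<Prod>i\<in>{1..N}. if i = j then \<integral>\<^sup>+z. f z \<partial>\<rho> else 1)"
      using j N prob_Q by (intro prod.cong) (auto simp: Q_def prob_space.emeasure_space_1)
    also have "\<dots> = (\<integral>\<^sup>+z. f z \<partial>\<rho>)" using j N by (auto simp add: prod.delta)
    finally show ?thesis .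
  qed
  have two: "(\<integral>\<^sup>+Z. a (Z j) * b (Z l) \<partial>P) = (\<integral>\<^sup>+z. a z \<partial>\<rho>) * (\<integral>\<^sup>+z. b z \<partial>\<rho>)"
    if j: "j \<in> {1..N-1}" "l \<in> {1..N-1}" "j \<noteq> l" for j l
  proof -
    have "(\<integral>\<^sup>+Z. a (Z j) * b (Z l) \<partial>P) =
       (\<integral>\<^sup>+Z. (\<Prod>i\<in>{1..N}. (if i = j then a (Z i) else 1) * (if i = l then b (Z i) else 1)) \<partial>P)"
      using j N by (intro nn_integral_cong) (auto simp add: prod.delta prod.distrib)
    also have "\<dots> = (\<Prod>i\<in>{1..N}. \<integral>\<^sup>+z. (if i = j then a z else 1) * (if i = l then b z else 1) \<partial>Q i)"
      unfolding P_def by (subst Q.product_nn_integral_prod[symmetric]) auto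
    also have "\<dots> = (\<Prod>i\<in>{1..N}. (if i = j then \<integral>\<^sup>+z. a z \<partial>\<rho> else 1) * (if i = l then \<integral>\<^sup>+z. b z \<partial>\<rho> else 1))"
      using j N prob_Q by (intro prod.cong) (auto simp: Q_def prob_space.emeasure_space_1)
    also have "\<dots> = (\<integral>\<^sup>+z. a z \<partial>\<rho>) * (\<integral>\<^sup>+z. b z \<partial>\<rho>)" using j N by (auto simp add: prod.delta prod.distrib)
    finally show ?thesis .
  qed
  define A where "A = (\<integral>\<^sup>+z. a z \<partial>\<rho>)"
  have A: "A \<noteq> \<top>" unfolding A_def by (rule a)
  define Y where "Y Z = (\<Sum>l=1..N. b (Z l))" for Z :: "nat \<Rightarrow> 'q"
  have Ym [measurable]: "Y \<in> borel_measurable P" unfolding Y_def by (intro borel_measurable_sum Zm) auto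
  have each: "A / Y0 \<le> (\<integral>\<^sup>+Z. a (Z j) / Y Z \<partial>P)" if j: "j \<in> {1..N-1}" for j
  proof -
    have jN: "j \<in> {1..N}" using j by auto
    have [measurable]: "(\<lambda>Z. a (Z j)) \<in> borel_measurable P" by (intro Zm jN) simp
    have Yle: "Y Z \<le> B + B + (\<Sum>l\<in>{1..N-1} - {j}. b (Z l))" if Z: "Z \<in> space P" for Z
    proof -
      define R where "R = {1..N-1} - {j}"
      have R: "{1..N} = insert N (insert j R)" "N \<notin> insert j R" "j \<notin> R" "finite R"
        using j N by (auto simp: R_def)
      have "Y Z = b (Z N) + (b (Z j) + (\<Sum>l\<in>{1..N-1} - {j}. b (Z l)))"
        unfolding Y_def R(1) R_def[symmetric] using R(2-4) by simp
      also have "\<dots> \<le> B + (B + (\<Sum>l\<in>{1..N-1} - {j}. b (Z l)))"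
        using sP[OF Z] jN N by (intro add_mono b order_refl) auto
      finally show ?thesis by (simp add: add.assoc)
    qed
    have "(\<integral>\<^sup>+Z. a (Z j) * Y Z \<partial>P) \<le> (\<integral>\<^sup>+Z. (B + B) * a (Z j) + (\<Sum>l\<in>{1..N-1} - {j}. a (Z j) * b (Z l)) \<partial>P)"
    proof (rule nn_integral_mono)
      fix Z assume "Z \<in> space P"
      from mult_left_mono[OF Yle[OF this], of "a (Z j)"]
      show "a (Z j) * Y Z \<le> (B + B) * a (Z j) + (\<Sum>l\<in>{1..N-1} - {j}. a (Z j) * b (Z l))"
        by (simp add: distrib_left distrib_right sum_distrib_left mult.commute)
    qed
    also have "\<dots> = (B + B) * A + (\<Sum>l\<in>{1..N-1} - {j}. A * (\<integral>\<^sup>+z. b z \<partial>\<rho>))"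
    proof (subst nn_integral_add)
      show "(\<lambda>Z. \<Sum>l\<in>{1..N-1} - {j}. a (Z j) * b (Z l)) \<in> borel_measurable P"
        using jN by (intro borel_measurable_sum borel_measurable_times_ennreal Zm) auto
      have "(\<integral>\<^sup>+Z. (\<Sum>l\<in>{1..N-1} - {j}. a (Z j) * b (Z l)) \<partial>P) = (\<Sum>l\<in>{1..N-1} - {j}. (\<integral>\<^sup>+Z. a (Z j) * b (Z l) \<partial>P))"
        using jN by (intro nn_integral_sum borel_measurable_times_ennreal Zm) auto
      also have "\<dots> = (\<Sum>l\<in>{1..N-1} - {j}. A * (\<integral>\<^sup>+z. b z \<partial>\<rho>))"
        unfolding A_def using j by (intro sum.cong two) auto
      finally show "(\<integral>\<^sup>+Z. (B + B) * a (Z j) \<partial>P) + (\<integral>\<^sup>+Z. (\<Sum>l\<in>{1..N-1} - {j}. a (Z j) * b (Z l)) \<partial>P)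
         = (B + B) * A + (\<Sum>l\<in>{1..N-1} - {j}. A * (\<integral>\<^sup>+z. b z \<partial>\<rho>))"
        using one[OF j, of a] by (simp add: nn_integral_cmult A_def)
    qed simp
    also have "\<dots> = A * (B + B + of_nat (N - 2) * (\<integral>\<^sup>+z. b z \<partial>\<rho>))"
    proof -
      have "card ({1..N-1} - {j}) = N - 2" using j by simp
      then show ?thesis by (simp add: algebra_simps)
    qed
    also have "\<dots> \<le> A * Y0" by (intro mult_left_mono Y0) simp
    finally have aY: "(\<integral>\<^sup>+Z. a (Z j) * Y Z \<partial>P) \<le> A * Y0" .
    have "A / Y0 + A / Y0 = (\<integral>\<^sup>+Z. a (Z j) / Y0 + a (Z j) / Y0 \<partial>P)"
      using one[OF j, of a] by (simp add: nn_integral_add nn_integral_divide A_def)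
    also have "\<dots> \<le> (\<integral>\<^sup>+Z. a (Z j) / Y Z + a (Z j) * Y Z / (Y0 * Y0) \<partial>P)"
      by (intro nn_integral_mono reciprocal_above_tangent Y0)
    also have "\<dots> = (\<integral>\<^sup>+Z. a (Z j) / Y Z \<partial>P) + (\<integral>\<^sup>+Z. a (Z j) * Y Z \<partial>P) / (Y0 * Y0)"
      by (simp add: nn_integral_add nn_integral_divide)
    also have "\<dots> \<le> (\<integral>\<^sup>+Z. a (Z j) / Y Z \<partial>P) + A * Y0 / (Y0 * Y0)"
      by (intro add_left_mono divide_right_mono_ennreal aY)
    also have "A * Y0 / (Y0 * Y0) = A / Y0"
    proof -
      obtain y0 r where "Y0 = ennreal y0" "0 < y0" "A = ennreal r" "0 \<le> r"
        using Y0(2,3) A by (cases Y0; cases A) (auto simp: less_le)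
      then show ?thesis by (simp add: ennreal_mult[symmetric] divide_ennreal)
    qed
    finally have "A / Y0 + A / Y0 \<le> A / Y0 + (\<integral>\<^sup>+Z. a (Z j) / Y Z \<partial>P)" by (simp add: add.commute)
    moreover have "A / Y0 \<noteq> \<top>" using A Y0 by (simp add: ennreal_divide_eq_top_iff)
    ultimately show ?thesis by (simp add: ennreal_add_left_cancel_le)
  qed
  have "of_nat (N - 1) * A / Y0 = (\<Sum>j\<in>{1..N-1}. A / Y0)"
    by (simp add: ennreal_times_divide)
  also have "\<dots> \<le> (\<Sum>j\<in>{1..N-1}. (\<integral>\<^sup>+Z. a (Z j) / Y Z \<partial>P))" by (intro sum_mono each) auto
  also have "\<dots> = (\<integral>\<^sup>+Z. (\<Sum>j\<in>{1..N-1}. a (Z j) / Y Z) \<partial>P)"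
    by (intro nn_integral_sum[symmetric] borel_measurable_divide_ennreal Zm Ym) auto
  also have "\<dots> \<le> (\<integral>\<^sup>+Z. (\<Sum>j=1..N. a (Z j)) / Y Z \<partial>P)"
  proof (rule nn_integral_mono)
    fix Z
    have "(\<Sum>j\<in>{1..N-1}. a (Z j) / Y Z) = (\<Sum>j\<in>{1..N-1}. a (Z j)) / Y Z"
      by (simp add: divide_ennreal_def sum_distrib_right)
    also have "\<dots> \<le> (\<Sum>j=1..N. a (Z j)) / Y Z" by (intro divide_right_mono_ennreal sum_mono2) auto
    finally show "(\<Sum>j\<in>{1..N-1}. a (Z j) / Y Z) \<le> (\<Sum>j=1..N. a (Z j)) / Y Z" .
  qed
  finally show ?thesis unfolding A_def P_def Q_def Y_def .
qed

section \<open>The hidden Markov model under strong mixing\<close>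

lemma (in sites) step_dens_measurable:
  assumes a [measurable]: "case_prod a \<in> borel_measurable (S \<Otimes>\<^sub>M S)"
  shows "case_prod (step_dens S a k) \<in> borel_measurable (S \<Otimes>\<^sub>M S)"
proof (induction k)
  case 0
  have "case_prod (step_dens S a 0) = case_prod a" by (auto simp: fun_eq_iff)
  then show ?case by simp
next
  case (Suc k)
  note [measurable] = Suc
  have "(\<lambda>w. \<integral>\<^sup>+v. a (fst w) v * step_dens S a k v (snd w) \<partial>S) \<in> borel_measurable (S \<Otimes>\<^sub>M S)"
    by measurable
  then show ?case by (simp add: case_prod_beta)
qed

lemma (in sites) step_dens_rev:
  assumes a [measurable]: "case_prod a \<in> borel_measurable (S \<Otimes>\<^sub>M S)" and xz [measurable]: "x \<in> space S" "z \<in> space S"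
  shows "step_dens S a (Suc k) x z = (\<integral>\<^sup>+v. step_dens S a k x v * a v z \<partial>S)"
  using xz
proof (induction k arbitrary: x)
  case (Suc k)
  note [measurable] = step_dens_measurable[OF a]
  have [measurable]: "x \<in> space S" "z \<in> space S" by fact+
  interpret SS: pair_sigma_finite S S ..
  have "step_dens S a (Suc (Suc k)) x z = (\<integral>\<^sup>+v. a x v * (\<integral>\<^sup>+w. step_dens S a k v w * a w z \<partial>S) \<partial>S)"
    unfolding step_dens.simps(2)[of S a "Suc k"] using Suc by (intro nn_integral_cong) (simp only:)
  also have "\<dots> = (\<integral>\<^sup>+v. (\<integral>\<^sup>+w. a x v * (step_dens S a k v w * a w z) \<partial>S) \<partial>S)"
    by (intro nn_integral_cong) (simp add: nn_integral_cmult)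
  also have "\<dots> = (\<integral>\<^sup>+w. (\<integral>\<^sup>+v. a x v * (step_dens S a k v w * a w z) \<partial>S) \<partial>S)"
    by (rule SS.Fubini') measurable
  also have "\<dots> = (\<integral>\<^sup>+w. step_dens S a (Suc k) x w * a w z \<partial>S)"
    by (intro nn_integral_cong) (simp add: nn_integral_multc[symmetric] mult.assoc)
  finally show ?case .
qed simp

lemma (in sites) step_dens_transpose:
  assumes a [measurable]: "case_prod a \<in> borel_measurable (S \<Otimes>\<^sub>M S)" and "x \<in> space S" "z \<in> space S"
  shows "step_dens S (\<lambda>x z. a z x) k x z = step_dens S a k z x"
  using assms(2)
proof (induction k arbitrary: x)
  case (Suc k)
  have "step_dens S (\<lambda>x z. a z x) (Suc k) x z = (\<integral>\<^sup>+v. step_dens S a k z v * a v x \<partial>S)"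
    using Suc by (simp add: mult.commute cong: nn_integral_cong)
  then show ?case using step_dens_rev[OF a assms(3) Suc.prems] by simp
qed simp

lemma chain_weight_prod:
  "chain_weight a (\<lambda>_ _. 1) j [j + 1..<j + 1 + k] y = (\<Prod>i=j..<j + k. a (y i) (y (i + 1)))"
proof (induction k arbitrary: j)
  case (Suc k)
  have "[j + 1..<j + 1 + Suc k] = (j + 1) # [(j + 1) + 1..<(j + 1) + 1 + k]" by (simp add: upt_conv_Cons)
  then have "chain_weight a (\<lambda>_ _. 1) j [j + 1..<j + 1 + Suc k] y =
     a (y j) (y (j + 1)) * (\<Prod>i=j + 1..<j + 1 + k. a (y i) (y (i + 1)))"
    using Suc[of "j + 1"] by simp
  also have "\<dots> = (\<Prod>i=j..<j + Suc k. a (y i) (y (i + 1)))"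
    by (subst (2) prod.atLeast_Suc_lessThan) auto
  finally show ?case .
qed simp

text \<open>
  The observation density varies by at most the factor \<open>D = \<delta> powr (1 / h)\<close> at each time, so \<open>h\<close>
  consecutive observations cost a factor \<open>\<delta>\<close>. Below, \<open>\<gamma> t\<close> is the infimum of the observation density
  at the observed value.
\<close>

locale pg_model =
  fixes H :: "('x, 'y) hmm" and y :: "nat \<Rightarrow> 'y" and n N h :: nat and \<sigma>m \<sigma>p \<delta> :: real
  assumes hmm: "hidden_markov_model H"
    and obs: "\<forall>t\<in>{1..n}. y t \<in> space (obs_ref H)"
    and smoothing: "prob_space (smoothing H n y)"
    and S1: "mixing_S1 H \<sigma>m \<sigma>p h"
    and S2: "mixing_S2 H \<delta> h"
    and N: "2 \<le> N"
begin

abbreviation S where "S \<equiv> state_ref H"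
definition m where "m x z = ennreal (trans_dens H x z)"
definition g where "g t z = ennreal (obs_dens H z (y t))"
definition mu where "mu z = ennreal (init_dens H z)"
definition \<gamma> where "\<gamma> t = (INF z\<in>space S. g t z)"
definition D where "D = ennreal (\<delta> powr (1 / real h))"

lemma h: "1 \<le> h" and \<sigma>m: "0 < \<sigma>m" and \<sigma>p: "0 < \<sigma>p" and \<delta>: "1 \<le> \<delta>"
  using S1 S2 by (auto simp: mixing_S1_def mixing_S2_def)

sublocale sites S "{1..n}"
proof -
  interpret prob_space S using S1 by (simp add: mixing_S1_def)
  show "sites S {1..n}" by unfold_locales auto
qed

lemma trans_meas [measurable]: "case_prod (trans_dens H) \<in> borel_measurable (S \<Otimes>\<^sub>M S)"
  and init_meas [measurable]: "init_dens H \<in> borel_measurable S"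
  and obs_meas: "case_prod (obs_dens H) \<in> borel_measurable (S \<Otimes>\<^sub>M obs_ref H)"
  and trans_nonneg: "x \<in> space S \<Longrightarrow> z \<in> space S \<Longrightarrow> 0 \<le> trans_dens H x z"
  and init_nonneg: "x \<in> space S \<Longrightarrow> 0 \<le> init_dens H x"
  and obs_nonneg: "x \<in> space S \<Longrightarrow> t \<in> {1..n} \<Longrightarrow> 0 \<le> obs_dens H x (y t)"
  using hmm obs by (auto simp: hidden_markov_model_def)

lemma obs_meas' [measurable (raw)]:
  assumes "t \<in> {1..n}" "f \<in> M \<rightarrow>\<^sub>M S"
  shows "(\<lambda>w. obs_dens H (f w) (y t)) \<in> borel_measurable M"
proof -
  have [measurable]: "y t \<in> space (obs_ref H)" using assms obs by auto
  have "(\<lambda>w. case_prod (obs_dens H) (f w, y t)) \<in> borel_measurable M"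
    using obs_meas assms(2) by measurable
  then show ?thesis by simp
qed

lemma m_meas [measurable]: "case_prod m \<in> borel_measurable (S \<Otimes>\<^sub>M S)"
  unfolding m_def by measurable

lemma mT_meas [measurable]: "case_prod (\<lambda>x z. m z x) \<in> borel_measurable (S \<Otimes>\<^sub>M S)"
  by measurable

lemma g_meas [measurable]: "t \<in> {1..n} \<Longrightarrow> g t \<in> borel_measurable S"
  unfolding g_def by measurable

lemma mu_meas [measurable]: "mu \<in> borel_measurable S"
  unfolding mu_def by measurable

lemma m_int: "x \<in> space S \<Longrightarrow> (\<integral>\<^sup>+z. m x z \<partial>S) = 1"
proof -
  assume x [measurable]: "x \<in> space S"
  then have "prob_space (trans_law H x)" using hmm by (auto simp: hidden_markov_model_def)
  then have "emeasure (trans_law H x) (space S) = 1"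
    using prob_space.emeasure_space_1[of "trans_law H x"] by (simp add: trans_law_def)
  moreover have "emeasure (trans_law H x) (space S) = (\<integral>\<^sup>+z. m x z * indicator (space S) z \<partial>S)"
    unfolding trans_law_def m_def by (rule emeasure_density) auto
  moreover have "\<dots> = (\<integral>\<^sup>+z. m x z \<partial>S)" by (intro nn_integral_cong) simp
  ultimately show ?thesis by simp
qed

lemma mu_int: "(\<integral>\<^sup>+z. mu z \<partial>S) = 1"
proof -
  have "prob_space (init_law H)" using hmm by (auto simp: hidden_markov_model_def)
  then have "emeasure (init_law H) (space S) = 1"
    using prob_space.emeasure_space_1[of "init_law H"] by (simp add: init_law_def)
  moreover have "emeasure (init_law H) (space S) = (\<integral>\<^sup>+z. mu z * indicator (space S) z \<partial>S)"
    unfolding init_law_def mu_def by (rule emeasure_density) auto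
  moreover have "\<dots> = (\<integral>\<^sup>+z. mu z \<partial>S)" by (intro nn_integral_cong) simp
  ultimately show ?thesis by simp
qed

lemma m_le: "x \<in> space S \<Longrightarrow> z \<in> space S \<Longrightarrow> m x z \<le> ennreal \<sigma>p"
  using S1 by (auto simp: m_def mixing_S1_def intro!: ennreal_leI)

lemma step_le: "x \<in> space S \<Longrightarrow> z \<in> space S \<Longrightarrow> step_dens S m k x z \<le> ennreal \<sigma>p"
proof (induction k arbitrary: x)
  case (Suc k)
  have "step_dens S m (Suc k) x z \<le> (\<integral>\<^sup>+v. m x v * ennreal \<sigma>p \<partial>S)"
    unfolding step_dens.simps using Suc by (intro nn_integral_mono mult_left_mono) auto
  also have "\<dots> = ennreal \<sigma>p" using Suc.prems by (subst nn_integral_multc) (auto simp: m_int)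
  finally show ?case .
qed (simp add: m_le)

lemma step_ge_base:
  assumes ab: "a \<in> space S" "b \<in> space S"
  shows "ennreal \<sigma>m \<le> step_dens S m (h - 1) a b"
proof -
  interpret B: sites S "{1..h + 1}" by unfold_locales auto
  define x0 where "x0 = (\<lambda>i\<in>{1..h + 1}. if i = 1 then a else b)"
  have x0: "x0 \<in> space B.X" using ab by (auto simp: x0_def space_PiM)
  have x0_simps: "x0 1 = a" "x0 (h + 1) = b" using h by (auto simp: x0_def)
  define F where "F = chain_weight m (\<lambda>_ _. 1) 1 ([2..<h + 1] @ [h + 1])"
  have F: "F v = (\<Prod>j=1..h. m (v j) (v (j + 1)))" for v
  proof -
    have "[2..<h + 1] @ [h + 1] = [1 + 1..<1 + 1 + h]" using h upt_Suc_append[of 2 "h + 1"] by (simp add: numeral_2_eq_2 del: upt_Suc)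
    moreover have "{1..<1 + h} = {1..h}" by auto
    ultimately show ?thesis unfolding F_def using chain_weight_prod[of m 1 h v] by simp
  qed
  have "ennreal \<sigma>m \<le> (\<integral>\<^sup>+z. (let x = z(1 := a, h + 1 := b)
               in ennreal (\<Prod>j=1..h. trans_dens H (x j) (x (j + 1)))) \<partial>path H {2..h})"
    using S1 ab by (auto simp: mixing_S1_def)
  also have "\<dots> = (\<integral>\<^sup>+\<zeta>. F (merge {2..h} ({1..h + 1} - {2..h}) (\<zeta>, x0)) \<partial>path H {2..h})"
  proof (rule nn_integral_cong)
    fix z assume z: "z \<in> space (path H {2..h})"
    have "ennreal (\<Prod>j=1..h. trans_dens H ((z(1 := a, h + 1 := b)) j) ((z(1 := a, h + 1 := b)) (j + 1)))
        = (\<Prod>j=1..h. m ((z(1 := a, h + 1 := b)) j) ((z(1 := a, h + 1 := b)) (j + 1)))"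
      unfolding m_def using z ab
      by (intro prod_ennreal[symmetric] trans_nonneg) (auto simp: space_PiM PiE_iff)
    also have "\<dots> = F (merge {2..h} ({1..h + 1} - {2..h}) (z, x0))"
      unfolding F by (intro prod.cong arg_cong2[where f=m]) (auto simp: merge_def x0_def)
    finally show "(let x = z(1 := a, h + 1 := b) in ennreal (\<Prod>j=1..h. trans_dens H (x j) (x (j + 1)))) = \<dots>"
      by (simp add: Let_def)
  qed
  also have "\<dots> = iter S [2..<h + 1] F x0"
  proof -
    have "set [2..<h + 1] = {2..h}" by auto
    moreover have "F \<in> borel_measurable B.X"
      unfolding F_def by (intro B.chain_weight_measurable m_meas) auto
    ultimately show ?thesis using B.iter_PiM[of "[2..<h + 1]" F x0] x0 by simp
  qed
  also have "\<dots> \<le> 1 ^ length [2..<h + 1] * (\<Prod>b\<leftarrow>[2..<h + 1]. 1) * (1 * step_dens S m (length [2..<h + 1]) (x0 1) (x0 (h + 1)))"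
    unfolding F_def using x0 h by (intro B.iter_chain_bridge(2)[where \<gamma>="\<lambda>_. 1"] m_meas) auto
  also have "\<dots> = step_dens S m (h - 1) a b"
  proof -
    have "(\<Prod>b\<leftarrow>l. 1) = (1::ennreal)" for l :: "nat list" by (induction l) auto
    then show ?thesis by (simp only: x0_simps power_one mult_1 length_upt) simp
  qed
  finally show ?thesis .
qed

text \<open>
  Every number of at least \<open>h\<close> steps inherits the lower bound, as the mean of an \<open>h\<close>-step density.
\<close>

lemma step_ge: "x \<in> space S \<Longrightarrow> z \<in> space S \<Longrightarrow> h - 1 \<le> k \<Longrightarrow> ennreal \<sigma>m \<le> step_dens S m k x z"
proof (induction k arbitrary: x)
  case 0
  then show ?case using step_ge_base[of x z] by simp
next
  case (Suc k)
  show ?case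
  proof (cases "h - 1 = Suc k")
    case True then show ?thesis using step_ge_base[of x z] Suc.prems by simp
  next
    case False
    have "ennreal \<sigma>m = (\<integral>\<^sup>+v. m x v * ennreal \<sigma>m \<partial>S)"
      using Suc.prems by (subst nn_integral_multc) (auto simp: m_int)
    also have "\<dots> \<le> step_dens S m (Suc k) x z"
      unfolding step_dens.simps using Suc False by (intro nn_integral_mono mult_left_mono Suc.IH) auto
    finally show ?thesis .
  qed
qed

lemma g_le: "t \<in> {1..n} \<Longrightarrow> z \<in> space S \<Longrightarrow> g t z \<le> D * \<gamma> t"
proof -
  assume t: "t \<in> {1..n}" and z: "z \<in> space S"
  have "g t z \<le> (SUP x\<in>space S. ennreal (obs_dens H x (y t)))"
    unfolding g_def using z by (intro SUP_upper)
  also have "\<dots> \<le> D * \<gamma> t"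
    using S2 obs t by (auto simp: mixing_S2_def D_def \<gamma>_def g_def)
  finally show ?thesis .
qed

lemma g_ge: "z \<in> space S \<Longrightarrow> \<gamma> t \<le> g t z"
  unfolding \<gamma>_def by (intro INF_lower)

lemma \<gamma>_fin: "\<gamma> t \<noteq> \<top>"
proof -
  obtain z where "z \<in> space S" using not_empty by auto
  from g_ge[OF this, of t] show ?thesis by (auto simp: g_def top_unique)
qed

lemma D_fin: "D \<noteq> \<top>" by (simp add: D_def)
lemma D_ge: "1 \<le> D" unfolding D_def ennreal_1[symmetric] using \<delta> h by (intro ennreal_leI ge_one_powr_ge_zero) auto

text \<open>
  If the infimum vanished, then by the ratio bound the observation density would vanish identically at
  that time, and the smoothing distribution could not be normalised.
\<close>

lemma \<gamma>_pos: "t \<in> {1..n} \<Longrightarrow> \<gamma> t \<noteq> 0"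
proof
  assume t: "t \<in> {1..n}" and 0: "\<gamma> t = 0"
  have g0: "obs_dens H z (y t) = 0" if "z \<in> space S" for z
    using g_le[OF t that] obs_nonneg[OF that t] by (simp add: 0 g_def ennreal_eq_0_iff)
  have su: "smoothing_unnormalised H n y x = 0" if "x \<in> space X" for x
  proof -
    have "obs_dens H (x t) (y t) = 0" using that t by (intro g0 comp_space)
    moreover have "t = 1 \<or> t \<in> {2..n}" using t by auto
    ultimately show ?thesis by (auto simp: smoothing_unnormalised_def intro!: prod_zero)
  qed
  define Z where "Z = (\<integral>\<^sup>+x'. ennreal (smoothing_unnormalised H n y x') \<partial>X)"
  have meas: "(\<lambda>x. ennreal (smoothing_unnormalised H n y x) / Z) \<in> borel_measurable X"
    by (subst measurable_cong[where g="\<lambda>_. 0"]) (simp_all add: su)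
  have "emeasure (smoothing H n y) (space X) = (\<integral>\<^sup>+x. (ennreal (smoothing_unnormalised H n y x) / Z) * indicator (space X) x \<partial>X)"
    unfolding smoothing_def Z_def[symmetric] by (rule emeasure_density[OF meas]) simp
  also have "\<dots> = (\<integral>\<^sup>+x. 0 \<partial>X)" by (intro nn_integral_cong) (simp add: su)
  finally have "emeasure (smoothing H n y) (space (smoothing H n y)) = 0"
    by (simp add: smoothing_def)
  then show False using prob_space.emeasure_space_1[OF smoothing] by simp
qed

text \<open>
  The mass common to all laws of the chain after \<open>h\<close> steps: the ratio of the bounds on the \<open>h\<close>-step
  density, reduced by the \<open>h - 1\<close> intermediate observations.
\<close>

definition \<theta> where "\<theta> = \<delta> powr ((1 - real h) / real h) * \<sigma>m / \<sigma>p"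

lemma \<sigma>_le: "\<sigma>m \<le> \<sigma>p"
proof -
  obtain z where "z \<in> space S" using not_empty by auto
  then have "ennreal \<sigma>m \<le> ennreal \<sigma>p" using order_trans[OF step_ge[of z z "h - 1"] step_le[of z z "h - 1"]] by simp
  then show ?thesis using \<sigma>p by simp
qed

lemma D_power: "D ^ k = ennreal (\<delta> powr (real k / real h))"
  using \<delta> by (simp add: D_def ennreal_power powr_realpow[symmetric] powr_powr)

lemma \<theta>: "0 < \<theta>" "\<theta> \<le> 1"
proof -
  show "0 < \<theta>" unfolding \<theta>_def using \<sigma>m \<sigma>p \<delta> by simp
  have "\<delta> powr ((1 - real h) / real h) \<le> \<delta> powr 0" using \<delta> h by (intro powr_mono) (auto simp: divide_nonpos_pos)
  then have "\<delta> powr ((1 - real h) / real h) \<le> 1" using \<delta> by simp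
  then have "\<delta> powr ((1 - real h) / real h) * \<sigma>m \<le> 1 * \<sigma>p"
    using \<sigma>_le \<sigma>m by (intro mult_mono) auto
  then show "\<theta> \<le> 1" unfolding \<theta>_def using \<sigma>p by simp
qed

lemma \<theta>_D: "ennreal \<theta> * (D ^ (h - 1) * ennreal \<sigma>p) \<le> ennreal \<sigma>m"
proof -
  have "\<theta> * (\<delta> powr (real (h - 1) / real h) * \<sigma>p) = (\<delta> powr ((1 - real h) / real h) * \<delta> powr (real (h - 1) / real h)) * \<sigma>m"
    using \<sigma>p by (simp add: \<theta>_def)
  also have "\<delta> powr ((1 - real h) / real h) * \<delta> powr (real (h - 1) / real h) = \<delta> powr ((1 - real h) / real h + real (h - 1) / real h)"
    by (rule powr_add[symmetric])
  also have "(1 - real h) / real h + real (h - 1) / real h = 0" using h by (simp add: of_nat_diff add_divide_distrib[symmetric])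
  finally show ?thesis using \<theta> \<sigma>p \<delta> by (simp add: D_power ennreal_mult[symmetric])
qed

lemma forward_chain:
  assumes "r \<in> borel_measurable S" "\<And>z. z \<in> space S \<Longrightarrow> r z \<noteq> \<top>" "(\<integral>\<^sup>+z. r z \<partial>S) \<noteq> \<top>"
  shows "mixing_chain S {1..n} m g \<gamma> D (ennreal \<sigma>m) (ennreal \<sigma>p) (ennreal \<sigma>p) (ennreal \<theta>) (ennreal (1 - \<theta>)) r h"
proof (intro mixing_chain.intro mixing_chain_axioms.intro)
  show "sites S {1..n}" by (rule sites_axioms)
  show "ennreal \<theta> + ennreal (1 - \<theta>) = 1" using \<theta> by (simp add: ennreal_plus[symmetric] del: ennreal_plus)
  show "\<And>i. i \<in> {1..n} \<Longrightarrow> g i \<in> borel_measurable S" by (rule g_meas)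
  show "\<And>i z. i \<in> {1..n} \<Longrightarrow> z \<in> space S \<Longrightarrow> \<gamma> i \<le> g i z" by (rule g_ge)
  show "\<And>i z. i \<in> {1..n} \<Longrightarrow> z \<in> space S \<Longrightarrow> g i z \<le> D * \<gamma> i" by (rule g_le)
  show "\<And>i. i \<in> {1..n} \<Longrightarrow> \<gamma> i \<noteq> \<top>" by (rule \<gamma>_fin)
  show "D \<noteq> \<top>" "1 \<le> h" by (fact D_fin h)+
  show "ennreal \<theta> * (D ^ (h - 1) * ennreal \<sigma>p) \<le> ennreal \<sigma>m" by (rule \<theta>_D)
  show "r \<in> borel_measurable S" "\<And>z. z \<in> space S \<Longrightarrow> r z \<noteq> \<top>" "(\<integral>\<^sup>+z. r z \<partial>S) \<noteq> \<top>" by (fact assms)+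
  show "case_prod m \<in> borel_measurable (S \<Otimes>\<^sub>M S)" by (rule m_meas)
qed (auto intro: m_le step_ge step_le)

text \<open>
  Reversing time transposes the transition density and leaves the bounds on the multi-step densities
  unchanged, so the same contraction propagates from right to left.
\<close>

lemma reversed_chain:
  assumes "r \<in> borel_measurable S" "\<And>z. z \<in> space S \<Longrightarrow> r z \<noteq> \<top>" "(\<integral>\<^sup>+z. r z \<partial>S) \<noteq> \<top>"
  shows "mixing_chain S {1..n} (\<lambda>x z. m z x) g \<gamma> D (ennreal \<sigma>m) (ennreal \<sigma>p) (ennreal \<sigma>p) (ennreal \<theta>) (ennreal (1 - \<theta>)) r h"
proof (intro mixing_chain.intro mixing_chain_axioms.intro)
  show "sites S {1..n}" by (rule sites_axioms)
  show "ennreal \<theta> + ennreal (1 - \<theta>) = 1" using \<theta> by (simp add: ennreal_plus[symmetric] del: ennreal_plus)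
  show "\<And>i. i \<in> {1..n} \<Longrightarrow> g i \<in> borel_measurable S" by (rule g_meas)
  show "\<And>i z. i \<in> {1..n} \<Longrightarrow> z \<in> space S \<Longrightarrow> \<gamma> i \<le> g i z" by (rule g_ge)
  show "\<And>i z. i \<in> {1..n} \<Longrightarrow> z \<in> space S \<Longrightarrow> g i z \<le> D * \<gamma> i" by (rule g_le)
  show "\<And>i. i \<in> {1..n} \<Longrightarrow> \<gamma> i \<noteq> \<top>" by (rule \<gamma>_fin)
  show "D \<noteq> \<top>" "1 \<le> h" by (fact D_fin h)+
  show "ennreal \<theta> * (D ^ (h - 1) * ennreal \<sigma>p) \<le> ennreal \<sigma>m" by (rule \<theta>_D)
  show "r \<in> borel_measurable S" "\<And>z. z \<in> space S \<Longrightarrow> r z \<noteq> \<top>" "(\<integral>\<^sup>+z. r z \<partial>S) \<noteq> \<top>" by (fact assms)+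
  show "(\<lambda>(x, z). m z x) \<in> borel_measurable (S \<Otimes>\<^sub>M S)" by (rule mT_meas)
qed (auto intro: m_le step_ge step_le simp: step_dens_transpose[OF m_meas])

end

section \<open>Measurability of the Particle Gibbs kernel\<close>

lemma measurable_PiM_kernel:
  assumes J: "finite J" and K: "\<And>i. i \<in> J \<Longrightarrow> K i \<in> L \<rightarrow>\<^sub>M prob_algebra (M i)"
  shows "(\<lambda>x. PiM J (\<lambda>i. K i x)) \<in> L \<rightarrow>\<^sub>M prob_algebra (PiM J M)"
proof (rule measurable_prob_algebra_generated[OF sets_PiM Int_stable_prod_algebra prod_algebra_sets_into_space])
  have Kx: "prob_space (K i x)" "sets (K i x) = sets (M i)" if "x \<in> space L" "i \<in> J" for x i
    using measurable_space[OF K[OF that(2)] that(1)] by (auto simp: space_prob_algebra)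
  define K' where "K' x i = (if i \<in> J then K i x else return (count_space UNIV) undefined)" for x i
  have K'x: "prob_space (K' x i)" if "x \<in> space L" for x i
    unfolding K'_def using Kx[OF that] by (auto intro: prob_space_return)
  have eq: "PiM J (\<lambda>i. K i x) = PiM J (K' x)" for x unfolding K'_def by (rule PiM_cong) auto
  fix x assume x: "x \<in> space L"
  interpret product_prob_space "K' x" J by (intro product_prob_spaceI K'x x)
  show "prob_space (PiM J (\<lambda>i. K i x))" unfolding eq by (rule prob_space_PiM) (rule K'x[OF x])
  show "sets (PiM J (\<lambda>i. K i x)) = sets (PiM J M)" by (rule sets_PiM_cong) (auto simp: Kx x)
next
  fix A assume "A \<in> prod_algebra J M"
  then obtain E where E: "A = PiE J E" "\<And>i. i \<in> J \<Longrightarrow> E i \<in> sets (M i)"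
    unfolding prod_algebra_eq_finite[OF J] by auto
  have Kx: "prob_space (K i x)" "sets (K i x) = sets (M i)" if "x \<in> space L" "i \<in> J" for x i
    using measurable_space[OF K[OF that(2)] that(1)] by (auto simp: space_prob_algebra)
  define K' where "K' x i = (if i \<in> J then K i x else return (count_space UNIV) undefined)" for x i
  have K'x: "prob_space (K' x i)" if "x \<in> space L" for x i
    unfolding K'_def using Kx[OF that] by (auto intro: prob_space_return)
  have "emeasure (PiM J (\<lambda>i. K i x)) A = (\<Prod>i\<in>J. emeasure (K i x) (E i))" if x: "x \<in> space L" for x
  proof -
    have eq: "PiM J (\<lambda>i. K i x) = PiM J (K' x)" unfolding K'_def by (rule PiM_cong) auto
    interpret product_prob_space "K' x" J by (intro product_prob_spaceI K'x x)
    have "emeasure (PiM J (K' x)) (PiE J E) = (\<Prod>i\<in>J. emeasure (K' x i) (E i))"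
      using J E Kx x by (intro emeasure_PiM) (auto simp: K'_def)
    also have "\<dots> = (\<Prod>i\<in>J. emeasure (K i x) (E i))" by (intro prod.cong) (auto simp: K'_def)
    finally show ?thesis unfolding eq E(1) .
  qed
  moreover have "(\<lambda>x. \<Prod>i\<in>J. emeasure (K i x) (E i)) \<in> borel_measurable L"
  proof (rule borel_measurable_prod_ennreal)
    fix i assume i: "i \<in> J"
    note [measurable] = measurable_prob_algebraD[OF K[OF i]]
    show "(\<lambda>x. emeasure (K i x) (E i)) \<in> borel_measurable L"
      by (rule emeasure_measurable_subprob_algebra2[where N="M i"]) (use E(2)[OF i] in auto)
  qed
  ultimately show "(\<lambda>x. emeasure (PiM J (\<lambda>i. K i x)) A) \<in> borel_measurable L"
    by (simp cong: measurable_cong)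
qed

lemma categorical_kernel:
  assumes N: "1 \<le> N" and w: "\<And>j. j \<in> {1..N} \<Longrightarrow> w j \<in> borel_measurable L"
    "\<And>j x. j \<in> {1..N} \<Longrightarrow> x \<in> space L \<Longrightarrow> 0 \<le> w j x"
  shows "(\<lambda>x. categorical N (\<lambda>j. w j x)) \<in> L \<rightarrow>\<^sub>M prob_algebra (count_space {1..N})"
proof -
  have prob: "prob_space (categorical N (\<lambda>j. w j x))" if x: "x \<in> space L" for x
  proof -
    have nonneg: "\<And>j. j \<in> {1..N} \<Longrightarrow> 0 \<le> w j x" using w(2) x by auto
    define W where "W = (\<Sum>l=1..N. w l x)"
    have W: "0 \<le> W" unfolding W_def by (intro sum_nonneg nonneg)
    have "(\<Sum>j\<in>{1..N}. if W = 0 then if j = N then 1 else 0 else ennreal (w j x / W)) = 1"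
    proof (cases "W = 0")
      case True then show ?thesis using N by (simp add: sum.delta)
    next
      case False
      have "(\<Sum>j\<in>{1..N}. ennreal (w j x / W)) = ennreal (\<Sum>j\<in>{1..N}. w j x / W)"
        using nonneg W by (intro sum_ennreal) auto
      also have "(\<Sum>j\<in>{1..N}. w j x / W) = 1" using False by (simp add: sum_divide_distrib[symmetric] W_def)
      finally show ?thesis using False by simp
    qed
    then show ?thesis
      unfolding categorical_def W_def[symmetric]
      by (intro prob_spaceI) (simp add: emeasure_point_measure_finite space_point_measure)
  qed
  show ?thesis
  proof (rule measurable_prob_algebraI[OF prob measurable_subprob_algebra])
    fix x assume "x \<in> space L"
    then show "subprob_space (categorical N (\<lambda>j. w j x))" by (intro prob_space_imp_subprob_space prob)
    show "sets (categorical N (\<lambda>j. w j x)) = sets (count_space {1..N})"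
      by (simp add: categorical_def sets_point_measure)
  next
    fix A assume A: "A \<in> sets (count_space {1..N})"
    have [measurable]: "w j \<in> borel_measurable L" if "j \<in> {1..N}" for j using w that by auto
    have [measurable]: "(\<lambda>x. \<Sum>l=1..N. w l x) \<in> borel_measurable L" by (intro borel_measurable_sum) auto
    have eq: "emeasure (categorical N (\<lambda>j. w j x)) A = (\<Sum>j\<in>A. if (\<Sum>l=1..N. w l x) = 0
       then (if j = N then 1 else 0) else ennreal (w j x / (\<Sum>l=1..N. w l x)))" for x
      using A finite_subset[of A "{1..N}"] by (simp add: categorical_def emeasure_point_measure_finite)
    have "(\<lambda>x. if (\<Sum>l=1..N. w l x) = 0 then (if j = N then 1 else 0) else ennreal (w j x / (\<Sum>l=1..N. w l x)))
      \<in> borel_measurable L" if "j \<in> A" for j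
    proof -
      have "j \<in> {1..N}" using A that by auto
      then have [measurable]: "w j \<in> borel_measurable L" using w by auto
      show ?thesis by measurable
    qed
    then show "(\<lambda>x. emeasure (categorical N (\<lambda>j. w j x)) A) \<in> borel_measurable L"
      unfolding eq by (intro borel_measurable_sum)
  qed
qed

context pg_model begin

lemma pg_weight_measurable:
  assumes [measurable]: "fx \<in> L \<rightarrow>\<^sub>M X" "fz \<in> L \<rightarrow>\<^sub>M S" and t: "t \<in> {1..n}"
  shows "(\<lambda>w. pg_weight H n y u (fx w) t (fz w)) \<in> borel_measurable L"
proof -
  have 1: "(\<lambda>w. obs_dens H (fz w) (y t)) \<in> borel_measurable L" using t by measurable
  show ?thesis
  proof (cases "t = u \<and> u < n")
    case True
    then have u1: "u + 1 \<in> {1..n}" by auto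
    have [measurable]: "(\<lambda>w. fx w (u + 1)) \<in> L \<rightarrow>\<^sub>M S"
      using measurable_compose[OF assms(1) measurable_component_singleton[OF u1]] .
    have "(\<lambda>w. trans_dens H (fz w) (fx w (u + 1))) \<in> borel_measurable L" by measurable
    then show ?thesis using True 1 by (simp add: pg_weight_def)
  next
    case False
    show ?thesis unfolding pg_weight_def if_not_P[OF False] using 1 by simp
  qed
qed

lemma pg_weight_nonneg:
  "x \<in> space X \<Longrightarrow> z \<in> space S \<Longrightarrow> t \<in> {1..n} \<Longrightarrow> 0 \<le> pg_weight H n y u x t z"
  by (auto simp: pg_weight_def intro!: mult_nonneg_nonneg trans_nonneg obs_nonneg comp_space)

lemma density_kernel:
  assumes [measurable]: "case_prod f \<in> borel_measurable (L \<Otimes>\<^sub>M S)"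
    and "\<And>x. x \<in> space L \<Longrightarrow> prob_space (density S (f x))"
  shows "(\<lambda>x. density S (f x)) \<in> L \<rightarrow>\<^sub>M prob_algebra S"
proof (rule measurable_prob_algebraI[OF assms(2) measurable_subprob_algebra])
  fix x assume "x \<in> space L"
  then show "subprob_space (density S (f x))" by (intro prob_space_imp_subprob_space assms)
next
  fix A assume [measurable]: "A \<in> sets S"
  have "(\<lambda>x. \<integral>\<^sup>+z. f x z * indicator A z \<partial>S) \<in> borel_measurable L" by measurable
  then show "(\<lambda>x. emeasure (density S (f x)) A) \<in> borel_measurable L"
    by (simp add: emeasure_density cong: measurable_cong)
qed auto

lemma trans_law_kernel: "trans_law H \<in> S \<rightarrow>\<^sub>M prob_algebra S"
proof -
  have "(\<lambda>x. density S (m x)) \<in> S \<rightarrow>\<^sub>M prob_algebra S"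
  proof (rule density_kernel)
    fix x assume "x \<in> space S"
    then have "prob_space (trans_law H x)" using hmm by (auto simp: hidden_markov_model_def)
    then show "prob_space (density S (m x))" by (simp add: trans_law_def m_def[abs_def])
  qed simp
  then show ?thesis by (simp add: trans_law_def[abs_def] m_def[abs_def])
qed

lemma init_law_prob: "init_law H \<in> space (prob_algebra S)"
  using hmm by (auto simp: hidden_markov_model_def space_prob_algebra init_law_def)

lemma trans_law_kernel': "f \<in> L \<rightarrow>\<^sub>M S \<Longrightarrow> (\<lambda>w. trans_law H (f w)) \<in> L \<rightarrow>\<^sub>M prob_algebra S"
  using measurable_compose[OF _ trans_law_kernel] .

lemma return_kernel: "f \<in> L \<rightarrow>\<^sub>M M \<Longrightarrow> (\<lambda>w. return M (f w)) \<in> L \<rightarrow>\<^sub>M prob_algebra M"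
  using measurable_compose[OF _ measurable_return_prob_space] .

lemma singleton_path: "(\<lambda>z. \<lambda>r\<in>{s..s}. z) \<in> S \<rightarrow>\<^sub>M path H {s..s}"
  by (rule measurable_restrict) auto

lemma pg_init_kernel:
  assumes s: "s \<in> {1..n}"
  shows "(\<lambda>x. pg_init H N s x) \<in> X \<rightarrow>\<^sub>M prob_algebra (PiM {1..N} (\<lambda>_. path H {s..s}))"
  unfolding pg_init_def
proof (rule measurable_PiM_kernel)
  fix i assume "i \<in> {1..N}"
  note [measurable] = singleton_path
  have 1: "(\<lambda>x. return (path H {s..s}) (\<lambda>r\<in>{s..s}. x s)) \<in> X \<rightarrow>\<^sub>M prob_algebra (path H {s..s})"
    by (rule return_kernel) (use measurable_compose[OF measurable_component_singleton[OF s] singleton_path] in simp)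
  have 2: "(\<lambda>x. if s = 1 then init_law H else trans_law H (x (s - 1))) \<in> X \<rightarrow>\<^sub>M prob_algebra S"
  proof (cases "s = 1")
    case True
    then show ?thesis using init_law_prob by simp
  next
    case False
    then have "s - 1 \<in> {1..n}" using s by auto
    then show ?thesis using False by (simp add: trans_law_kernel')
  qed
  have 3: "(\<lambda>x. distr (if s = 1 then init_law H else trans_law H (x (s - 1))) (path H {s..s}) (\<lambda>z. \<lambda>r\<in>{s..s}. z))
     \<in> X \<rightarrow>\<^sub>M prob_algebra (path H {s..s})"
    by (rule measurable_distr_prob_space2[OF 2]) measurable
  show "(\<lambda>x. if i = N then return (path H {s..s}) (\<lambda>r\<in>{s..s}. x s)
     else distr (if s = 1 then init_law H else trans_law H (x (s - 1))) (path H {s..s}) (\<lambda>z. \<lambda>r\<in>{s..s}. z))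
     \<in> X \<rightarrow>\<^sub>M prob_algebra (path H {s..s})"
    using 1 3 by (cases "i = N") simp_all
qed simp

lemma pg_move_kernel:
  assumes t: "s < t" "t \<le> n" "1 \<le> s"
    and fx: "fx \<in> L \<rightarrow>\<^sub>M X" and fZ: "fZ \<in> L \<rightarrow>\<^sub>M PiM {1..N} (\<lambda>_. path H {s..t - 1})"
  shows "(\<lambda>w. categorical N (\<lambda>a. pg_weight H n y u (fx w) (t - 1) (fZ w a (t - 1))) \<bind>
       (\<lambda>a. distr (trans_law H (fZ w a (t - 1))) (path H {s..t}) (\<lambda>z. (fZ w a)(t := z)))) \<in> L \<rightarrow>\<^sub>M prob_algebra (path H {s..t})"
proof (rule measurable_bind_prob_space2)
  have t1: "t - 1 \<in> {s..t - 1}" "t - 1 \<in> {1..n}" using t by auto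
  have Za: "(\<lambda>w. fZ w a) \<in> L \<rightarrow>\<^sub>M path H {s..t - 1}" if "a \<in> {1..N}" for a
    using measurable_compose[OF fZ measurable_component_singleton[OF that]] .
  have Zat: "(\<lambda>w. fZ w a (t - 1)) \<in> L \<rightarrow>\<^sub>M S" if "a \<in> {1..N}" for a
    using measurable_compose[OF Za[OF that] measurable_component_singleton[OF t1(1)]] .
  show "(\<lambda>w. categorical N (\<lambda>a. pg_weight H n y u (fx w) (t - 1) (fZ w a (t - 1)))) \<in> L \<rightarrow>\<^sub>M prob_algebra (count_space {1..N})"
  proof (rule categorical_kernel)
    fix j assume j: "j \<in> {1..N}"
    show "(\<lambda>w. pg_weight H n y u (fx w) (t - 1) (fZ w j (t - 1))) \<in> borel_measurable L"
      by (intro pg_weight_measurable fx Zat j t1)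
    fix w assume "w \<in> space L"
    then show "0 \<le> pg_weight H n y u (fx w) (t - 1) (fZ w j (t - 1))"
      using measurable_space[OF fx] measurable_space[OF Zat[OF j]] t1 by (intro pg_weight_nonneg) auto
  qed (use N in simp)
  have K: "(\<lambda>w. distr (trans_law H (fZ w a (t - 1))) (path H {s..t}) (\<lambda>z. (fZ w a)(t := z))) \<in> L \<rightarrow>\<^sub>M prob_algebra (path H {s..t})"
    if a: "a \<in> {1..N}" for a
  proof (rule measurable_distr_prob_space2[OF trans_law_kernel'[OF Zat[OF a]]])
    have "(\<lambda>w. (fZ (fst w) a)(t := snd w)) \<in> L \<Otimes>\<^sub>M S \<rightarrow>\<^sub>M path H {s..t}"
      using t measurable_compose[OF measurable_fst Za[OF a]]
      by (intro measurable_fun_upd[where J="{s..t - 1}"]) auto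
    then show "(\<lambda>(w, z). (fZ w a)(t := z)) \<in> L \<Otimes>\<^sub>M S \<rightarrow>\<^sub>M path H {s..t}" by (simp add: case_prod_beta)
  qed
  have "(\<lambda>w. (\<lambda>a v. distr (trans_law H (fZ (fst v) a (t - 1))) (path H {s..t}) (\<lambda>z. (fZ (fst v) a)(t := z))) (snd w) w)
      \<in> L \<Otimes>\<^sub>M count_space {1..N} \<rightarrow>\<^sub>M prob_algebra (path H {s..t})"
    proof (rule measurable_compose_countable'[where I="{1..N}" and g=snd and
        f="\<lambda>a v. distr (trans_law H (fZ (fst v) a (t - 1))) (path H {s..t}) (\<lambda>z. (fZ (fst v) a)(t := z))"])
      fix a assume a: "a \<in> {1..N}"
      show "(\<lambda>v. distr (trans_law H (fZ (fst v) a (t - 1))) (path H {s..t}) (\<lambda>z. (fZ (fst v) a)(t := z))) \<in> L \<Otimes>\<^sub>M count_space {1..N} \<rightarrow>\<^sub>M prob_algebra (path H {s..t})"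
        using measurable_compose[OF measurable_fst K[OF a]] .
    qed (auto intro: measurable_snd)
  then show "(\<lambda>(w, a). distr (trans_law H (fZ w a (t - 1))) (path H {s..t}) (\<lambda>z. (fZ w a)(t := z)))
     \<in> L \<Otimes>\<^sub>M count_space {1..N} \<rightarrow>\<^sub>M prob_algebra (path H {s..t})"
    by (simp add: case_prod_beta)
qed

lemma pg_step_kernel:
  assumes t: "s < t" "t \<le> n" "1 \<le> s"
  shows "(\<lambda>(x, Z). pg_step H n y N s u x t Z) \<in> X \<Otimes>\<^sub>M PiM {1..N} (\<lambda>_. path H {s..t - 1})
     \<rightarrow>\<^sub>M prob_algebra (PiM {1..N} (\<lambda>_. path H {s..t}))"
proof -
  let ?L = "X \<Otimes>\<^sub>M PiM {1..N} (\<lambda>_. path H {s..t - 1})"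
  have "(\<lambda>w. pg_step H n y N s u (fst w) t (snd w)) \<in> ?L \<rightarrow>\<^sub>M prob_algebra (PiM {1..N} (\<lambda>_. path H {s..t}))"
    unfolding pg_step_def
  proof (rule measurable_PiM_kernel)
    fix i assume "i \<in> {1..N}"
    have NN: "N \<in> {1..N}" using N by auto
    have tn: "t \<in> {1..n}" using t by auto
    have "(\<lambda>w. (snd w N)(t := fst w t)) \<in> ?L \<rightarrow>\<^sub>M path H {s..t}"
      using t measurable_compose[OF measurable_snd measurable_component_singleton[OF NN]]
        measurable_compose[OF measurable_fst measurable_component_singleton[OF tn]]
      by (intro measurable_fun_upd[where J="{s..t - 1}"]) auto
    then have 1: "(\<lambda>w. return (path H {s..t}) ((snd w N)(t := fst w t))) \<in> ?L \<rightarrow>\<^sub>M prob_algebra (path H {s..t})"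
      by (rule return_kernel)
    show "(\<lambda>w. if i = N then return (path H {s..t}) ((snd w N)(t := fst w t))
     else categorical N (\<lambda>a. pg_weight H n y u (fst w) (t - 1) (snd w a (t - 1))) \<bind>
       (\<lambda>a. distr (trans_law H (snd w a (t - 1))) (path H {s..t}) (\<lambda>z. (snd w a)(t := z)))) \<in> ?L \<rightarrow>\<^sub>M prob_algebra (path H {s..t})"
      using 1 pg_move_kernel[OF t measurable_fst measurable_snd] by (cases "i = N") simp_all
  qed simp
  then show ?thesis by (simp add: case_prod_beta)
qed

lemma pg_particles_kernel:
  assumes s: "1 \<le> s" "s + d \<le> n"
  shows "(\<lambda>x. pg_particles H n y N s u x d) \<in> X \<rightarrow>\<^sub>M prob_algebra (PiM {1..N} (\<lambda>_. path H {s..s + d}))"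
  using s(2)
proof (induction d)
  case 0
  then show ?case using pg_init_kernel[of s] s by simp
next
  case (Suc d)
  have "(\<lambda>x. pg_particles H n y N s u x d \<bind> pg_step H n y N s u x (s + Suc d)) \<in>
     X \<rightarrow>\<^sub>M prob_algebra (PiM {1..N} (\<lambda>_. path H {s..s + Suc d}))"
    using Suc pg_step_kernel[of s "s + Suc d" u] s by (intro measurable_bind_prob_space2[where N="PiM {1..N} (\<lambda>_. path H {s..s + d})"]) auto
  then show ?case by simp
qed

lemma pg_select_kernel:
  assumes u: "1 \<le> s" "s \<le> u" "u \<le> n"
  shows "(\<lambda>(x, Z). distr (categorical N (\<lambda>j. pg_weight H n y u x u (Z j u))) (path H {s..u}) Z)
     \<in> X \<Otimes>\<^sub>M PiM {1..N} (\<lambda>_. path H {s..u}) \<rightarrow>\<^sub>M prob_algebra (path H {s..u})"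
proof -
  let ?L = "X \<Otimes>\<^sub>M PiM {1..N} (\<lambda>_. path H {s..u})"
  have Zj: "(\<lambda>w. snd w j) \<in> ?L \<rightarrow>\<^sub>M path H {s..u}" if "j \<in> {1..N}" for j
    using measurable_compose[OF measurable_snd measurable_component_singleton[OF that]] .
  have uu: "u \<in> {s..u}" "u \<in> {1..n}" using u by auto
  have Zju: "(\<lambda>w. snd w j u) \<in> ?L \<rightarrow>\<^sub>M S" if "j \<in> {1..N}" for j
    using measurable_compose[OF Zj[OF that] measurable_component_singleton[OF uu(1)]] .
  have "(\<lambda>w. distr (categorical N (\<lambda>j. pg_weight H n y u (fst w) u (snd w j u))) (path H {s..u}) (snd w)) \<in> ?L \<rightarrow>\<^sub>M prob_algebra (path H {s..u})"
  proof (rule measurable_distr_prob_space2[where M="count_space {1..N}"])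
    show "(\<lambda>w. categorical N (\<lambda>j. pg_weight H n y u (fst w) u (snd w j u))) \<in> ?L \<rightarrow>\<^sub>M prob_algebra (count_space {1..N})"
    proof (rule categorical_kernel)
      fix j assume j: "j \<in> {1..N}"
      show "(\<lambda>w. pg_weight H n y u (fst w) u (snd w j u)) \<in> borel_measurable ?L"
        by (intro pg_weight_measurable measurable_fst Zju j uu)
      fix w assume w: "w \<in> space ?L"
      then have "fst w \<in> space X" by (auto simp: space_pair_measure)
      moreover have "snd w j u \<in> space S" using measurable_space[OF Zju[OF j] w] .
      ultimately show "0 \<le> pg_weight H n y u (fst w) u (snd w j u)"
        using uu by (intro pg_weight_nonneg) auto
    qed (use N in simp)
    have "(\<lambda>v. (\<lambda>j v. snd (fst v) j) (snd v) v) \<in> ?L \<Otimes>\<^sub>M count_space {1..N} \<rightarrow>\<^sub>M path H {s..u}"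
      proof (rule measurable_compose_countable'[where I="{1..N}" and g=snd and f="\<lambda>a v. snd (fst v) a"])
      fix a assume a: "a \<in> {1..N}"
      show "(\<lambda>v. snd (fst v) a) \<in> ?L \<Otimes>\<^sub>M count_space {1..N} \<rightarrow>\<^sub>M path H {s..u}"
        using measurable_compose[OF measurable_fst Zj[OF a]] .
    qed (auto intro: measurable_snd)
    then show "(\<lambda>(w, j). snd w j) \<in> ?L \<Otimes>\<^sub>M count_space {1..N} \<rightarrow>\<^sub>M path H {s..u}" by (simp add: case_prod_beta)
  qed
  then show ?thesis by (simp add: case_prod_beta)
qed

lemma pg_kernel_kernel:
  assumes u: "1 \<le> s" "s \<le> u" "u \<le> n"
  shows "(\<lambda>x. pg_kernel H n y N s u x) \<in> X \<rightarrow>\<^sub>M prob_algebra (path H {s..u})"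
  unfolding pg_kernel_def
  using pg_particles_kernel[of s "u - s" u] pg_select_kernel[OF u] u
  by (intro measurable_bind_prob_space2[where N="PiM {1..N} (\<lambda>_. path H {s..u})"]) auto

lemma pg_block_kernel:
  assumes u: "1 \<le> s" "s \<le> u" "u \<le> n"
  shows "pg_block H n y N {s..u} \<in> X \<rightarrow>\<^sub>M prob_algebra X"
proof -
  have "(\<lambda>x. distr (pg_kernel H n y N s u x) X (\<lambda>z. merge {s..u} ({1..n} - {s..u}) (z, x))) \<in> X \<rightarrow>\<^sub>M prob_algebra X"
  proof (rule measurable_distr_prob_space2[OF pg_kernel_kernel[OF u]])
    have "(\<lambda>w. merge {s..u} ({1..n} - {s..u}) (snd w, fst w)) \<in> X \<Otimes>\<^sub>M path H {s..u} \<rightarrow>\<^sub>M X"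
      using u by (intro merge_measurable) auto
    then show "(\<lambda>(x, z). merge {s..u} ({1..n} - {s..u}) (z, x)) \<in> X \<Otimes>\<^sub>M path H {s..u} \<rightarrow>\<^sub>M X"
      by (simp add: case_prod_beta)
  qed
  moreover have "Min {s..u} = s" "Max {s..u} = u" using u by (auto simp: Min_eq_iff Max_eq_iff)
  ultimately show ?thesis by (simp add: pg_block_def[abs_def])
qed

end

section \<open>Block weights and the ideal block update\<close>

lemma nn_integral_categorical:
  assumes w: "\<And>j. j \<in> {1..N} \<Longrightarrow> 0 \<le> w j" and W: "(\<Sum>l=1..N. w l) \<noteq> 0"
  shows "(\<integral>\<^sup>+j. f j \<partial>categorical N w) = (\<Sum>j=1..N. ennreal (w j) * f j) / (\<Sum>l=1..N. ennreal (w l))"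
proof -
  define V where "V = (\<Sum>l=1..N. w l)"
  have "0 \<le> V" unfolding V_def by (intro sum_nonneg w)
  then have V: "0 < V" using W by (simp add: V_def less_le)
  have VE: "(\<Sum>l=1..N. ennreal (w l)) = ennreal V" unfolding V_def using w by (intro sum_ennreal) auto
  have "(\<integral>\<^sup>+j. f j \<partial>categorical N w) = (\<Sum>j=1..N. ennreal (w j / V) * f j)"
    using V unfolding categorical_def V_def[symmetric]
    by (subst nn_integral_point_measure_finite) (auto simp: mult.commute intro!: sum.cong)
  also have "\<dots> = (\<Sum>j=1..N. ennreal (w j) * f j) / ennreal V"
    unfolding divide_ennreal_def sum_distrib_right
    by (intro sum.cong) (use w V in \<open>auto simp: divide_ennreal[symmetric] divide_ennreal_def ac_simps\<close>)
  finally show ?thesis unfolding VE .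
qed

lemma nn_integral_categorical_bind:
  assumes w: "\<And>j. j \<in> {1..N} \<Longrightarrow> 0 \<le> w j" and W: "(\<Sum>l=1..N. w l) \<noteq> 0" and N: "1 \<le> N"
    and K: "\<And>j. j \<in> {1..N} \<Longrightarrow> K j \<in> space (prob_algebra T)" and f: "f \<in> borel_measurable T"
  shows "(\<integral>\<^sup>+z. f z \<partial>(categorical N w \<bind> K)) =
    (\<Sum>j=1..N. ennreal (w j) * (\<integral>\<^sup>+z. f z \<partial>K j)) / (\<Sum>l=1..N. ennreal (w l))"
proof -
  have "(\<lambda>j. K j) \<in> count_space {1..N} \<rightarrow>\<^sub>M subprob_algebra T"
    using K by (auto simp: space_prob_algebra space_subprob_algebra prob_space_imp_subprob_space)
  moreover have "sets (categorical N w) = sets (count_space {1..N})"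
    by (simp add: categorical_def sets_point_measure)
  ultimately have "(\<lambda>j. K j) \<in> categorical N w \<rightarrow>\<^sub>M subprob_algebra T"
    using measurable_cong_sets by blast
  then have "(\<integral>\<^sup>+z. f z \<partial>(categorical N w \<bind> K)) = (\<integral>\<^sup>+j. (\<integral>\<^sup>+z. f z \<partial>K j) \<partial>categorical N w)"
    by (intro nn_integral_bind[OF f])
  then show ?thesis using nn_integral_categorical[OF w W] by simp
qed

lemma ennreal_ratio_cancel:
  assumes "W \<noteq> 0" "W \<noteq> (\<top>::ennreal)"
  shows "c * (A / W) / (B / W) = c * A / B"
proof -
  have 1: "c * (A / W) = (c * A) / W" by (simp add: ennreal_times_divide)
  obtain r where r: "W = ennreal r" "0 < r" using assms by (cases W) (auto simp: less_le)
  have "inverse (B / W) = inverse B * W"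
  proof (cases "B = 0 \<or> B = \<top>")
    case True
    then show ?thesis using r assms
      by (auto simp: divide_ennreal_def ennreal_top_mult inverse_ennreal ennreal_mult_eq_top_iff)
  next
    case False
    then obtain b where b: "B = ennreal b" "0 < b" by (cases B) (auto simp: less_le)
    show ?thesis using r b by (simp add: divide_ennreal inverse_ennreal ennreal_mult[symmetric] field_simps)
  qed
  then have "c * (A / W) / (B / W) = (c * A) * (inverse W * W) * inverse B"
    unfolding 1 by (simp add: divide_ennreal_def ac_simps)
  also have "inverse W * W = 1" using r by (simp add: inverse_ennreal ennreal_mult[symmetric])
  finally show ?thesis by (simp add: divide_ennreal_def)
qed

context pg_model begin

text \<open>
  The data of a block \<open>{s..u}\<close> given its surroundings \<open>x\<close>: \<open>lft\<close> and \<open>rgt\<close> are the transition factors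
  across its two ends, \<open>pw\<close> is the particle weight at time \<open>t\<close>, and \<open>fut\<close> integrates \<open>F\<close> over the part of
  the block after \<open>t\<close> with total mass \<open>tot\<close>. Then \<open>ideal\<close> is the integral of \<open>F\<close> against the unnormalised
  conditional law of the block given its boundary, that is, the Gibbs update that Particle Gibbs
  approximates.
\<close>

definition rgt where "rgt x u z = (if u < n then m z (x (u + 1)) else 1)"
definition lft where "lft x s z = (if s = 1 then mu z else m (x (s - 1)) z)"
definition pw where "pw x u t z = g t z * (if t = u then rgt x u z else 1)"
definition fut where "fut x u t F = iter S [t + 1..<u + 1] (\<lambda>v. chain_weight m (pw x u) t [t + 1..<u + 1] v * F v)"
definition tot where "tot x u t = chain_total S m (pw x u) (\<lambda>_. 1) [t + 1..<u + 1]"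
definition ideal where "ideal s u F x = (\<integral>\<^sup>+z. lft x s z * pw x u s z * fut x u s F (x(s := z)) \<partial>S)"

lemma ennreal_pg_weight:
  assumes "x \<in> space X" "z \<in> space S" "t \<in> {1..n}" "u \<le> n"
  shows "ennreal (pg_weight H n y u x t z) = pw x u t z"
  using assms obs_nonneg[of z t] trans_nonneg[of z "x (u + 1)"] comp_space[of x "u + 1"]
  by (auto simp: pg_weight_def pw_def rgt_def m_def g_def ennreal_mult[symmetric] mult.commute)

lemma rgt_meas: "x \<in> space X \<Longrightarrow> rgt x u \<in> borel_measurable S"
proof (cases "u < n")
  case True
  assume x: "x \<in> space X"
  then have [measurable]: "x (u + 1) \<in> space S" using True by (intro comp_space) auto
  have "(\<lambda>z. m z (x (u + 1))) \<in> borel_measurable S" by measurable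
  then show ?thesis using True by (simp add: rgt_def[abs_def])
qed (simp add: rgt_def[abs_def])

lemma lft_meas: "x \<in> space X \<Longrightarrow> s \<in> {1..n} \<Longrightarrow> lft x s \<in> borel_measurable S"
proof (cases "s = 1")
  case False
  assume x: "x \<in> space X" "s \<in> {1..n}"
  then have [measurable]: "x (s - 1) \<in> space S" using False by (intro comp_space) auto
  have "(\<lambda>z. m (x (s - 1)) z) \<in> borel_measurable S" by measurable
  then show ?thesis using False by (simp add: lft_def[abs_def])
next
  case True
  then have "lft x s = mu" by (simp add: lft_def fun_eq_iff)
  then show ?thesis by simp
qed

lemma lft_int: "x \<in> space X \<Longrightarrow> s \<in> {1..n} \<Longrightarrow> (\<integral>\<^sup>+z. lft x s z \<partial>S) = 1"
proof (cases "s = 1")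
  case False
  assume x: "x \<in> space X" "s \<in> {1..n}"
  then have "x (s - 1) \<in> space S" using False by (intro comp_space) auto
  from m_int[OF this] show ?thesis using False by (simp add: lft_def)
qed (simp add: lft_def mu_int)

lemma pw_meas: "x \<in> space X \<Longrightarrow> t \<in> {1..n} \<Longrightarrow> pw x u t \<in> borel_measurable S"
proof -
  assume x: "x \<in> space X" and t: "t \<in> {1..n}"
  note [measurable] = rgt_meas[OF x] g_meas[OF t]
  have "(\<lambda>z. g t z * (if t = u then rgt x u z else 1)) \<in> borel_measurable S" by measurable
  then show ?thesis by (simp add: pw_def[abs_def])
qed

text \<open>
  A crude bound on the particle weight that also covers the factor 1 at a right end without successor.
\<close>

definition W where "W t = D * \<gamma> t * (ennreal \<sigma>p + 1)"

lemma W_fin: "W t \<noteq> \<top>"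
  by (simp add: W_def ennreal_mult_eq_top_iff D_fin \<gamma>_fin)

lemma pw_le: "x \<in> space X \<Longrightarrow> t \<in> {1..n} \<Longrightarrow> z \<in> space S \<Longrightarrow> pw x u t z \<le> W t"
proof -
  assume x: "x \<in> space X" and t: "t \<in> {1..n}" and z: "z \<in> space S"
  have "rgt x u z \<le> ennreal \<sigma>p + 1"
    using m_le[OF z, of "x (u + 1)"] comp_space[OF x, of "u + 1"] add_increasing2[of 1 "m z (x (u + 1))" "ennreal \<sigma>p"]
    by (auto simp: rgt_def)
  then have "(if t = u then rgt x u z else 1) \<le> ennreal \<sigma>p + 1" by simp
  then show ?thesis unfolding pw_def W_def using g_le[OF t z] by (intro mult_mono) auto
qed

lemma upt_step: "t < u \<Longrightarrow> [t + 1..<u + 1] = (t + 1) # [t + 1 + 1..<u + 1]"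
  by (simp add: upt_conv_Cons)

lemma fut_end: "fut x u u F = F"
  by (simp add: fut_def fun_eq_iff)

lemma tot_end: "tot x u u z = 1"
  by (simp add: tot_def)

lemma fut_measurable:
  assumes "x \<in> space X" "1 \<le> t" "t \<le> u" "u \<le> n" and [measurable]: "F \<in> borel_measurable X"
  shows "fut x u t F \<in> borel_measurable X"
proof -
  have [measurable]: "chain_weight m (pw x u) t [t + 1..<u + 1] \<in> borel_measurable X"
    using assms by (intro chain_weight_measurable pw_meas) auto
  have 1: "(\<lambda>v. chain_weight m (pw x u) t [t + 1..<u + 1] v * F v) \<in> borel_measurable X" by measurable
  show ?thesis unfolding fut_def using assms by (intro iter_measurable 1) auto
qed

lemma fut_step:
  assumes "x \<in> space X" "1 \<le> t" "t < u" "u \<le> n" and F: "F \<in> borel_measurable X" and v: "v \<in> space X"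
  shows "fut x u t F v = (\<integral>\<^sup>+z. m (v t) z * pw x u (t + 1) z * fut x u (t + 1) F (v(t + 1 := z)) \<partial>S)"
  unfolding fut_def upt_step[OF assms(3)]
  by (rule iter_chain_Cons[OF m_meas _ _ _ _ _ F v]) (use assms in \<open>auto intro!: pw_meas\<close>)

lemma tot_step: "t < u \<Longrightarrow> tot x u t v = (\<integral>\<^sup>+z. m v z * pw x u (t + 1) z * tot x u (t + 1) z \<partial>S)"
  unfolding tot_def by (subst upt_step) simp_all

lemma tot_meas: "x \<in> space X \<Longrightarrow> u \<le> n \<Longrightarrow> tot x u t \<in> borel_measurable S"
  unfolding tot_def by (intro chain_total_measurable pw_meas m_meas) auto

lemma fut_one:
  assumes "x \<in> space X" "1 \<le> t" "t \<le> u" "u \<le> n" "v \<in> space X"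
  shows "fut x u t (\<lambda>_. 1) v = tot x u t (v t)"
proof -
  have "iter S [t + 1..<u + 1] (\<lambda>v. chain_weight m (pw x u) t [t + 1..<u + 1] v * 1) v =
      chain_total S m (pw x u) (\<lambda>_. 1) [t + 1..<u + 1] (v t)"
    using assms by (intro iter_chain_total[OF m_meas, where r="\<lambda>_. 1"]) (auto intro!: pw_meas simp del: upt_Suc)
  then show ?thesis by (simp only: fut_def tot_def)
qed

lemma fut_le:
  assumes "x \<in> space X" "1 \<le> t" "t \<le> u" "u \<le> n" "v \<in> space X" and F: "F \<in> borel_measurable X"
    and C: "\<And>v. v \<in> space X \<Longrightarrow> F v \<le> C"
  shows "fut x u t F v \<le> C * tot x u t (v t)"
proof -
  have [measurable]: "chain_weight m (pw x u) t [t + 1..<u + 1] \<in> borel_measurable X"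
    using assms by (intro chain_weight_measurable pw_meas) auto
  have 1: "(\<lambda>v. chain_weight m (pw x u) t [t + 1..<u + 1] v * 1) \<in> borel_measurable X" by measurable
  have "fut x u t F v \<le> iter S [t + 1..<u + 1] (\<lambda>v. C * (chain_weight m (pw x u) t [t + 1..<u + 1] v * 1)) v"
    unfolding fut_def
  proof (rule iter_mono)
    fix w assume "w \<in> space X"
    from mult_left_mono[OF C[OF this], of "chain_weight m (pw x u) t [t + 1..<u + 1] w"]
    show "chain_weight m (pw x u) t [t + 1..<u + 1] w * F w \<le> C * (chain_weight m (pw x u) t [t + 1..<u + 1] w * 1)"
      by (simp add: mult.commute)
  qed (use assms in auto)
  also have "\<dots> = C * fut x u t (\<lambda>_. 1) v"
    unfolding fut_def by (rule iter_cmult[OF _ 1 assms(5)]) (use assms in auto)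
  finally show ?thesis using fut_one assms by simp
qed

lemma tot_fin:
  assumes "x \<in> space X" "1 \<le> t" "t \<le> u" "u \<le> n" "z \<in> space S"
  shows "tot x u t z \<noteq> \<top>"
proof -
  have "\<exists>K. K \<noteq> \<top> \<and> (\<forall>z\<in>space S. tot x u t z \<le> K)"
    using assms(3,2)
  proof (induction t rule: inc_induct)
    case base
    show ?case by (rule exI[of _ 1]) (simp add: tot_end)
  next
    case (step t)
    then obtain K where K: "K \<noteq> \<top>" "\<And>z. z \<in> space S \<Longrightarrow> tot x u (Suc t) z \<le> K" by auto
    have "tot x u t v \<le> W (t + 1) * K" if v: "v \<in> space S" for v
    proof -
      have [measurable]: "m v \<in> borel_measurable S" using v by measurable
      have "tot x u t v \<le> (\<integral>\<^sup>+z. m v z * (W (t + 1) * K) \<partial>S)"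
        unfolding tot_step[OF step(2)] mult.assoc using step K(2) assms
        by (intro nn_integral_mono mult_left_mono mult_mono pw_le) auto
      also have "\<dots> = W (t + 1) * K" using v by (subst nn_integral_multc) (auto simp: m_int)
      finally show ?thesis .
    qed
    moreover have "W (t + 1) * K \<noteq> \<top>" using K W_fin by (simp add: ennreal_mult_eq_top_iff)
    ultimately show ?case by blast
  qed
  then show ?thesis using assms(5) by (auto simp: top_unique)
qed

abbreviation over where "over s t x \<zeta> \<equiv> merge {s..t} ({1..n} - {s..t}) (\<zeta>, x)"

lemma over_extend:
  assumes "s \<le> t" shows "over s (t + 1) x (\<zeta>(t + 1 := z)) = (over s t x \<zeta>)(t + 1 := z)"
  using assms by (auto simp: merge_def fun_eq_iff)

end

section \<open>Propagating a lower bound through the particle system\<close>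

context pg_model begin

text \<open>
  One time step, for the self-normalised sum whose numerator is the conditional expectation of the
  target given the particles and whose denominator uses an arbitrary positive function \<open>d t\<close> in place of
  the normalising mass. Given the past, the free particles are independent with common law \<open>\<rho>\<close>, so
  \<open>one_step_lower_bound\<close> applies. The numerator is reproduced, since \<open>fut\<close> is harmonic for the weighted
  dynamics; the condition \<open>le\<close> on \<open>d\<close> is what makes the denominator reproduce itself.
\<close>

lemma pg_step_lower_bound:
  assumes x: "x \<in> space X" and su: "1 \<le> s" "s < t" "t \<le> u" "u \<le> n"
    and F: "F \<in> borel_measurable X" "\<And>v. v \<in> space X \<Longrightarrow> F v \<le> C" "C \<noteq> \<top>"
    and d [measurable]: "d t \<in> borel_measurable S"
    and Sd: "\<And>z. z \<in> space S \<Longrightarrow> pw x u t z * d t z \<le> B"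
    and le: "\<And>v. v \<in> space S \<Longrightarrow> B + B + of_nat (N - 2) * (\<integral>\<^sup>+z. m v z * (pw x u t z * d t z) \<partial>S) \<le> d (t - 1) v"
    and d0: "\<And>v. v \<in> space S \<Longrightarrow> d (t - 1) v \<noteq> 0" and dfin: "\<And>v. v \<in> space S \<Longrightarrow> d (t - 1) v \<noteq> \<top>"
    and Z: "Z \<in> space (PiM {1..N} (\<lambda>_. path H {s..t - 1}))"
  shows "of_nat (N - 1) * (\<Sum>j=1..N. pw x u (t - 1) (Z j (t - 1)) * fut x u (t - 1) F (over s (t - 1) x (Z j)))
        / (\<Sum>l=1..N. pw x u (t - 1) (Z l (t - 1)) * d (t - 1) (Z l (t - 1)))
     \<le> (\<integral>\<^sup>+Z. (\<Sum>j=1..N. pw x u t (Z j t) * fut x u t F (over s t x (Z j))) / (\<Sum>l=1..N. pw x u t (Z l t) * d t (Z l t))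
         \<partial>pg_step H n y N s u x t Z)"
proof -
  have tI: "t \<in> {1..n}" "t - 1 \<in> {1..n}" "t \<in> {s..t}" "t - 1 \<in> {s..t - 1}" "t - 1 + 1 = t" using su by auto
  have Zj: "Z j \<in> space (path H {s..t - 1})" if "j \<in> {1..N}" for j using Z that by (auto simp: space_PiM)
  have Zjt: "Z j (t - 1) \<in> space S" if "j \<in> {1..N}" for j using Zj[OF that] tI(4) by (auto simp: space_PiM PiE_iff)
  define T where "T = path H {s..t}"
  define w where "w j = pg_weight H n y u x (t - 1) (Z j (t - 1))" for j
  define \<omega> where "\<omega> j = pw x u (t - 1) (Z j (t - 1))" for j
  have w\<omega>: "ennreal (w j) = \<omega> j" "0 \<le> w j" "0 < w j" if "j \<in> {1..N}" for j
  proof -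
    show 1: "ennreal (w j) = \<omega> j" unfolding w_def \<omega>_def by (rule ennreal_pg_weight) (use x Zjt that tI su in auto)
    have "\<omega> j = g (t - 1) (Z j (t - 1))" unfolding \<omega>_def pw_def using su by auto
    moreover have "g (t - 1) (Z j (t - 1)) \<noteq> 0"
      using \<gamma>_pos[OF tI(2)] g_ge[OF Zjt[OF that], of "t - 1"] by auto
    ultimately show "0 < w j" using 1 by (metis ennreal_eq_0_iff not_less)
    then show "0 \<le> w j" by simp
  qed
  have sumw: "(\<Sum>l=1..N. w l) \<noteq> 0"
  proof -
    have "0 < (\<Sum>l=1..N. w l)" using w\<omega>(3) N by (intro sum_pos) auto
    then show ?thesis by simp
  qed
  define V where "V = (\<Sum>l=1..N. \<omega> l)"
  have V: "V = (\<Sum>l=1..N. ennreal (w l))" unfolding V_def using w\<omega>(1) by (intro sum.cong) auto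
  have VE: "V = ennreal (\<Sum>l=1..N. w l)" unfolding V using w\<omega>(2) by (intro sum_ennreal) auto
  have V0: "V \<noteq> 0" "V \<noteq> \<top>" unfolding VE using sumw sum_nonneg[of "{1..N}" w] w\<omega>(2) by (auto simp: ennreal_eq_0_iff less_le)
  define K where "K a = distr (trans_law H (Z a (t - 1))) T (\<lambda>z. (Z a)(t := z))" for a
  define \<rho> where "\<rho> = categorical N w \<bind> K"
  have upd: "(\<lambda>z. (Z a)(t := z)) \<in> S \<rightarrow>\<^sub>M T" if "a \<in> {1..N}" for a
    unfolding T_def using Zj[OF that] su by (intro measurable_fun_upd[where J="{s..t - 1}"]) auto
  have K: "K j \<in> space (prob_algebra T)" if "j \<in> {1..N}" for j
  proof -
    have 1: "trans_law H (Z j (t - 1)) \<in> space (prob_algebra S)"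
      using measurable_space[OF trans_law_kernel Zjt[OF that]] .
    then have 2: "prob_space (trans_law H (Z j (t - 1)))" by (simp add: space_prob_algebra)
    have "prob_space (K j)" unfolding K_def by (rule prob_space.prob_space_distr[OF 2]) (use upd[OF that] 1 in \<open>auto simp: space_prob_algebra cong: measurable_cong_sets\<close>)
    then show ?thesis by (simp add: space_prob_algebra K_def)
  qed
  have intK: "(\<integral>\<^sup>+\<zeta>. f \<zeta> \<partial>K j) = (\<integral>\<^sup>+z. m (Z j (t - 1)) z * f ((Z j)(t := z)) \<partial>S)"
    if j: "j \<in> {1..N}" and f: "f \<in> borel_measurable T" for f j
  proof -
    have [measurable]: "(\<lambda>z. f ((Z j)(t := z))) \<in> borel_measurable S" using measurable_compose[OF upd[OF j] f] .
    have [measurable]: "Z j (t - 1) \<in> space S" by (rule Zjt[OF j])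
    have "(\<integral>\<^sup>+\<zeta>. f \<zeta> \<partial>K j) = (\<integral>\<^sup>+z. f ((Z j)(t := z)) \<partial>trans_law H (Z j (t - 1)))"
      unfolding K_def by (rule nn_integral_distr) (use upd[OF j] f in \<open>auto simp: trans_law_def cong: measurable_cong_sets\<close>)
    also have "\<dots> = (\<integral>\<^sup>+z. ennreal (trans_dens H (Z j (t - 1)) z) * f ((Z j)(t := z)) \<partial>S)"
      unfolding trans_law_def by (rule nn_integral_density) measurable
    finally show ?thesis by (simp add: m_def)
  qed
  have int\<rho>: "(\<integral>\<^sup>+\<zeta>. f \<zeta> \<partial>\<rho>) = (\<Sum>j=1..N. \<omega> j * (\<integral>\<^sup>+z. m (Z j (t - 1)) z * f ((Z j)(t := z)) \<partial>S)) / V"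
    if f: "f \<in> borel_measurable T" for f
  proof -
    have "(\<integral>\<^sup>+\<zeta>. f \<zeta> \<partial>\<rho>) = (\<Sum>j=1..N. ennreal (w j) * (\<integral>\<^sup>+z. f z \<partial>K j)) / (\<Sum>l=1..N. ennreal (w l))"
      unfolding \<rho>_def using N by (intro nn_integral_categorical_bind[OF w\<omega>(2) sumw _ K f]) auto
    also have "\<dots> = (\<Sum>j=1..N. \<omega> j * (\<integral>\<^sup>+z. m (Z j (t - 1)) z * f ((Z j)(t := z)) \<partial>S)) / V"
      unfolding V using intK[OF _ f] w\<omega>(1) by (intro arg_cong2[where f="(/)"] sum.cong) auto
    finally show ?thesis .
  qed
  have \<rho>: "\<rho> \<in> space (prob_algebra T)"
    using measurable_space[OF pg_move_kernel[OF su(2) _ su(1), where L=X and fx="\<lambda>_. x" and fZ="\<lambda>_. Z" and u=u] x] x Z su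
    unfolding \<rho>_def w_def K_def T_def by simp
  define a where "a \<zeta> = pw x u t (\<zeta> t) * fut x u t F (over s t x \<zeta>)" for \<zeta>
  define b where "b \<zeta> = pw x u t (\<zeta> t) * d t (\<zeta> t)" for \<zeta>
  have ct: "(\<lambda>\<zeta>. \<zeta> t) \<in> T \<rightarrow>\<^sub>M S" unfolding T_def by (rule measurable_component_singleton) (rule tI)
  note [measurable] = pw_meas[OF x tI(1)]
  have "(\<lambda>z. pw x u t z * d t z) \<in> borel_measurable S" by measurable
  from measurable_compose[OF ct this] have bm: "b \<in> borel_measurable T" unfolding b_def .
  have overm: "over s t x \<in> T \<rightarrow>\<^sub>M X" unfolding T_def using x su by (intro merge_measurable[where g="\<lambda>_. x"]) auto
  have t1: "1 \<le> t" using su by linarith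
  have am: "a \<in> borel_measurable T" unfolding a_def
    by (rule borel_measurable_times_ennreal[OF measurable_compose[OF ct pw_meas[OF x tI(1)]]
      measurable_compose[OF overm fut_measurable[OF x t1 su(3,4) F(1)]]])
  have ov: "over s (t - 1) x (Z j) \<in> space X" "over s (t - 1) x (Z j) (t - 1) = Z j (t - 1)" if "j \<in> {1..N}" for j
  proof -
    have "over s (t - 1) x \<in> path H {s..t - 1} \<rightarrow>\<^sub>M X" using x su by (intro merge_measurable[where g="\<lambda>_. x"]) auto
    then show "over s (t - 1) x (Z j) \<in> space X" by (rule measurable_space[OF _ Zj[OF that]])
    show "over s (t - 1) x (Z j) (t - 1) = Z j (t - 1)" using tI by (auto simp: merge_def)
  qed
  have "over s t x ((Z j)(t := z)) = (over s (t - 1) x (Z j))(t := z)" for j z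
    using over_extend[where s=s and t="t - 1" and x=x and \<zeta>="Z j" and z=z] su by simp
  then have step: "(\<integral>\<^sup>+z. m (Z j (t - 1)) z * a ((Z j)(t := z)) \<partial>S) = fut x u (t - 1) F (over s (t - 1) x (Z j))" if "j \<in> {1..N}" for j
    using fut_step[OF x _ _ su(4) F(1) ov(1)[OF that], where t="t - 1"] ov(2)[OF that] su
    by (simp add: a_def mult.assoc)
  have int_a: "(\<integral>\<^sup>+\<zeta>. a \<zeta> \<partial>\<rho>) = (\<Sum>j=1..N. \<omega> j * fut x u (t - 1) F (over s (t - 1) x (Z j))) / V"
    unfolding int\<rho>[OF am] using step by (intro arg_cong2[where f="(/)"] sum.cong) auto
  have a_fin: "(\<integral>\<^sup>+\<zeta>. a \<zeta> \<partial>\<rho>) \<noteq> \<top>"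
  proof -
    have "\<omega> j * fut x u (t - 1) F (over s (t - 1) x (Z j)) \<noteq> \<top>" if j: "j \<in> {1..N}" for j
    proof -
      have "fut x u (t - 1) F (over s (t - 1) x (Z j)) \<le> C * tot x u (t - 1) (Z j (t - 1))"
        using fut_le[OF x _ _ su(4) ov(1)[OF j] F(1,2), where t="t - 1"] ov(2)[OF j] su by simp
      moreover have "tot x u (t - 1) (Z j (t - 1)) \<noteq> \<top>" by (rule tot_fin) (use x su Zjt j in auto)
      ultimately have "fut x u (t - 1) F (over s (t - 1) x (Z j)) \<noteq> \<top>" using F(3) by (auto simp: top_unique ennreal_mult_eq_top_iff)
      then show ?thesis using w\<omega>(1)[OF j] by (auto simp: ennreal_mult_eq_top_iff)
    qed
    then show ?thesis unfolding int_a using V0 by (simp add: ennreal_divide_eq_top_iff)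
  qed
  define Y where "Y = (\<Sum>j=1..N. \<omega> j * d (t - 1) (Z j (t - 1)))"
  have Y0: "B + B + of_nat (N - 2) * (\<integral>\<^sup>+\<zeta>. b \<zeta> \<partial>\<rho>) \<le> Y / V"
  proof -
    define q where "q j = (\<integral>\<^sup>+z. m (Z j (t - 1)) z * (pw x u t z * d t z) \<partial>S)" for j
    have "(\<integral>\<^sup>+\<zeta>. b \<zeta> \<partial>\<rho>) = (\<Sum>j=1..N. \<omega> j * q j) / V"
      unfolding int\<rho>[OF bm] by (simp add: b_def q_def)
    moreover have "c = V * c / V" for c using V0 by (simp add: ennreal_mult_divide_eq mult.commute[of V])
    then have "B + B = V * (B + B) / V" .
    ultimately have "B + B + of_nat (N - 2) * (\<integral>\<^sup>+\<zeta>. b \<zeta> \<partial>\<rho>) = (V * (B + B) + of_nat (N - 2) * (\<Sum>j=1..N. \<omega> j * q j)) / V"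
      by (simp add: ennreal_times_divide add_divide_distrib_ennreal)
    also have "V * (B + B) + of_nat (N - 2) * (\<Sum>j=1..N. \<omega> j * q j) = (\<Sum>j=1..N. \<omega> j * (B + B + of_nat (N - 2) * q j))"
      unfolding V_def by (simp add: sum_distrib_left sum_distrib_right sum.distrib distrib_left ac_simps)
    also have "\<dots> / V \<le> Y / V" unfolding Y_def q_def
      by (intro divide_right_mono_ennreal sum_mono mult_left_mono le Zjt) auto
    finally show ?thesis .
  qed
  have Y1: "Y / V \<noteq> 0"
  proof -
    have "\<omega> N * d (t - 1) (Z N (t - 1)) \<noteq> 0" using d0[OF Zjt[of N]] w\<omega>(1,3)[of N] N
      by (metis atLeastAtMost_iff ennreal_eq_0_iff linorder_not_less mult_eq_0_iff order_refl order_trans one_le_numeral)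
    then have "Y \<noteq> 0" unfolding Y_def using N by (subst sum_eq_0_iff) auto
    then show ?thesis using V0 by (simp add: divide_ennreal_def)
  qed
  have Y2: "Y / V \<noteq> \<top>"
  proof -
    have "\<omega> j * d (t - 1) (Z j (t - 1)) \<noteq> \<top>" if "j \<in> {1..N}" for j
      using w\<omega>(1)[OF that] dfin[OF Zjt[OF that]] by (auto simp: ennreal_mult_eq_top_iff)
    then show ?thesis using V0 by (simp add: Y_def ennreal_divide_eq_top_iff)
  qed
  have qN: "(Z N)(t := x t) \<in> space T"
    using measurable_space[OF upd[of N] comp_space[OF x tI(1)]] N by simp
  have "of_nat (N - 1) * (\<integral>\<^sup>+\<zeta>. a \<zeta> \<partial>\<rho>) / (Y / V) \<le> (\<integral>\<^sup>+Z. (\<Sum>j=1..N. a (Z j)) / (\<Sum>l=1..N. b (Z l))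
     \<partial>PiM {1..N} (\<lambda>i. if i = N then return T ((Z N)(t := x t)) else \<rho>))"
  proof (rule one_step_lower_bound[OF N _ _ qN am bm _ a_fin Y0 Y1 Y2])
    show "prob_space \<rho>" "sets \<rho> = sets T" using \<rho> by (auto simp: space_prob_algebra)
    show "b \<zeta> \<le> B" if "\<zeta> \<in> space T" for \<zeta>
      unfolding b_def using measurable_space[OF ct that] by (rule Sd)
  qed
  moreover have "of_nat (N - 1) * (\<integral>\<^sup>+\<zeta>. a \<zeta> \<partial>\<rho>) / (Y / V) =
     of_nat (N - 1) * (\<Sum>j=1..N. \<omega> j * fut x u (t - 1) F (over s (t - 1) x (Z j))) / Y"
    unfolding int_a by (rule ennreal_ratio_cancel[OF V0])
  ultimately show ?thesis
    unfolding pg_step_def a_def b_def Y_def \<omega>_def \<rho>_def w_def K_def T_def by (simp only:)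
qed

text \<open>
  The same step at the first time of the block, where the particles are drawn from the left boundary.
\<close>

lemma pg_init_lower_bound:
  assumes x: "x \<in> space X" and su: "1 \<le> s" "s \<le> u" "u \<le> n"
    and F: "F \<in> borel_measurable X" "\<And>v. v \<in> space X \<Longrightarrow> F v \<le> C" "C \<noteq> \<top>"
    and d [measurable]: "d \<in> borel_measurable S"
    and Sd: "\<And>z. z \<in> space S \<Longrightarrow> pw x u s z * d z \<le> B"
    and Y0: "B + B + of_nat (N - 2) * (\<integral>\<^sup>+z. lft x s z * (pw x u s z * d z) \<partial>S) \<le> Y0" "Y0 \<noteq> 0" "Y0 \<noteq> \<top>"
    and fin: "ideal s u F x \<noteq> \<top>"
  shows "of_nat (N - 1) * ideal s u F x / Y0
     \<le> (\<integral>\<^sup>+Z. (\<Sum>j=1..N. pw x u s (Z j s) * fut x u s F (over s s x (Z j))) / (\<Sum>l=1..N. pw x u s (Z l s) * d (Z l s))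
         \<partial>pg_init H N s x)"
proof -
  have sI: "s \<in> {1..n}" "s \<in> {s..s}" using su by auto
  define T where "T = path H {s..s}"
  define \<iota> where "\<iota> = (if s = 1 then init_law H else trans_law H (x (s - 1)))"
  define \<rho> where "\<rho> = distr \<iota> T (\<lambda>z. \<lambda>r\<in>{s..s}. z)"
  have \<iota>: "\<iota> = density S (lft x s)"
    by (auto simp: \<iota>_def lft_def[abs_def] init_law_def trans_law_def mu_def m_def)
  have \<iota>p: "\<iota> \<in> space (prob_algebra S)"
  proof (cases "s = 1")
    case False
    then have "x (s - 1) \<in> space S" using x su by (intro comp_space) auto
    then show ?thesis using False measurable_space[OF trans_law_kernel] by (simp add: \<iota>_def)
  qed (simp add: \<iota>_def init_law_prob)
  then have prob_\<iota>: "prob_space \<iota>" by (simp add: space_prob_algebra)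
  have upd: "(\<lambda>z. \<lambda>r\<in>{s..s}. z) \<in> S \<rightarrow>\<^sub>M T" unfolding T_def by (rule singleton_path)
  have upd\<iota>: "(\<lambda>z. \<lambda>r\<in>{s..s}. z) \<in> \<iota> \<rightarrow>\<^sub>M T" using upd \<iota> by (simp cong: measurable_cong_sets)
  have int\<rho>: "(\<integral>\<^sup>+\<zeta>. f \<zeta> \<partial>\<rho>) = (\<integral>\<^sup>+z. lft x s z * f (\<lambda>r\<in>{s..s}. z) \<partial>S)" if f: "f \<in> borel_measurable T" for f
  proof -
    have [measurable]: "(\<lambda>z. f (\<lambda>r\<in>{s..s}. z)) \<in> borel_measurable S" using measurable_compose[OF upd f] .
    note [measurable] = lft_meas[OF x sI(1)]
    have "(\<integral>\<^sup>+\<zeta>. f \<zeta> \<partial>\<rho>) = (\<integral>\<^sup>+z. f (\<lambda>r\<in>{s..s}. z) \<partial>\<iota>)"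
      unfolding \<rho>_def by (rule nn_integral_distr[OF upd\<iota>]) (use f in simp)
    also have "\<dots> = (\<integral>\<^sup>+z. lft x s z * f (\<lambda>r\<in>{s..s}. z) \<partial>S)"
      unfolding \<iota> by (rule nn_integral_density) measurable
    finally show ?thesis .
  qed
  define a where "a \<zeta> = pw x u s (\<zeta> s) * fut x u s F (over s s x \<zeta>)" for \<zeta>
  define b where "b \<zeta> = pw x u s (\<zeta> s) * d (\<zeta> s)" for \<zeta>
  have ct: "(\<lambda>\<zeta>. \<zeta> s) \<in> T \<rightarrow>\<^sub>M S" unfolding T_def by (rule measurable_component_singleton) (rule sI)
  note [measurable] = pw_meas[OF x sI(1)]
  have "(\<lambda>z. pw x u s z * d z) \<in> borel_measurable S" by measurable
  from measurable_compose[OF ct this] have bm: "b \<in> borel_measurable T" unfolding b_def .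
  have overm: "over s s x \<in> T \<rightarrow>\<^sub>M X" unfolding T_def using x su by (intro merge_measurable[where g="\<lambda>_. x"]) auto
  have am: "a \<in> borel_measurable T" unfolding a_def
    by (rule borel_measurable_times_ennreal[OF measurable_compose[OF ct pw_meas[OF x sI(1)]]
      measurable_compose[OF overm fut_measurable[OF x su F(1)]]])
  have "over s s x (\<lambda>r\<in>{s..s}. z) = x(s := z)" for z
    using x sI by (auto simp: merge_def fun_eq_iff space_PiM PiE_def extensional_def)
  then have int_a: "(\<integral>\<^sup>+\<zeta>. a \<zeta> \<partial>\<rho>) = ideal s u F x"
    unfolding int\<rho>[OF am] by (simp add: a_def ideal_def mult.assoc)
  have int_b: "(\<integral>\<^sup>+\<zeta>. b \<zeta> \<partial>\<rho>) = (\<integral>\<^sup>+z. lft x s z * (pw x u s z * d z) \<partial>S)"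
    unfolding int\<rho>[OF bm] by (simp add: b_def)
  have qN: "(\<lambda>r\<in>{s..s}. x s) \<in> space T"
    using measurable_space[OF upd comp_space[OF x sI(1)]] .
  have "of_nat (N - 1) * (\<integral>\<^sup>+\<zeta>. a \<zeta> \<partial>\<rho>) / Y0 \<le> (\<integral>\<^sup>+Z. (\<Sum>j=1..N. a (Z j)) / (\<Sum>l=1..N. b (Z l))
     \<partial>PiM {1..N} (\<lambda>i. if i = N then return T (\<lambda>r\<in>{s..s}. x s) else \<rho>))"
  proof (rule one_step_lower_bound[OF N _ _ qN am bm _ _ _ Y0(2,3)])
    show "prob_space \<rho>" unfolding \<rho>_def by (rule prob_space.prob_space_distr[OF prob_\<iota> upd\<iota>])
    show "sets \<rho> = sets T" by (simp add: \<rho>_def)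
    show "b \<zeta> \<le> B" if "\<zeta> \<in> space T" for \<zeta>
      unfolding b_def using measurable_space[OF ct that] by (rule Sd)
    show "B + B + of_nat (N - 2) * (\<integral>\<^sup>+\<zeta>. b \<zeta> \<partial>\<rho>) \<le> Y0" unfolding int_b by (rule Y0)
    show "(\<integral>\<^sup>+\<zeta>. a \<zeta> \<partial>\<rho>) \<noteq> \<top>" unfolding int_a by (rule fin)
  qed
  then show ?thesis
    unfolding int_a unfolding pg_init_def a_def b_def \<rho>_def \<iota>_def T_def by (simp only:)
qed

text \<open>
  At the end of the block \<open>d\<close> is 1 and the self-normalised sum is the conditional expectation of the
  output given the particles, by the definition of the final selection. The steps are then chained
  back to the first time. The functions \<open>d\<close> remain free here, since the right choice depends on the
  distance to the end of the block.
\<close>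

lemma pg_kernel_lower_bound:
  assumes x: "x \<in> space X" and su: "1 \<le> s" "s \<le> u" "u \<le> n"
    and F: "F \<in> borel_measurable X" "\<And>v. v \<in> space X \<Longrightarrow> F v \<le> C" "C \<noteq> \<top>"
    and d: "\<And>t. d t \<in> borel_measurable S"
    and du: "\<And>z. z \<in> space S \<Longrightarrow> d u z = 1"
    and Sd: "\<And>t z. t \<in> {s..u} \<Longrightarrow> z \<in> space S \<Longrightarrow> pw x u t z * d t z \<le> B t"
    and le: "\<And>t v. t \<in> {s<..u} \<Longrightarrow> v \<in> space S \<Longrightarrow>
        B t + B t + of_nat (N - 2) * (\<integral>\<^sup>+z. m v z * (pw x u t z * d t z) \<partial>S) \<le> d (t - 1) v"
    and d0: "\<And>t v. t \<in> {s..<u} \<Longrightarrow> v \<in> space S \<Longrightarrow> d t v \<noteq> 0"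
    and dfin: "\<And>t v. t \<in> {s..<u} \<Longrightarrow> v \<in> space S \<Longrightarrow> d t v \<noteq> \<top>"
    and Y0: "B s + B s + of_nat (N - 2) * (\<integral>\<^sup>+z. lft x s z * (pw x u s z * d s z) \<partial>S) \<le> Y0" "Y0 \<noteq> 0" "Y0 \<noteq> \<top>"
    and fin: "ideal s u F x \<noteq> \<top>"
  shows "of_nat (N - 1) ^ (u - s + 1) * ideal s u F x / Y0
     \<le> (\<integral>\<^sup>+\<zeta>. F (over s u x \<zeta>) \<partial>pg_kernel H n y N s u x)"
proof -
  define P where "P t = PiM {1..N} (\<lambda>_::nat. path H {s..t})" for t
  \<comment> \<open>the self-normalised sum whose expectation is bounded from below\<close>
  define Lf where "Lf t Z = (\<Sum>j=1..N. pw x u t (Z j t) * fut x u t F (over s t x (Z j)))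
     / (\<Sum>l=1..N. pw x u t (Z l t) * d t (Z l t))" for t and Z :: "nat \<Rightarrow> nat \<Rightarrow> 'x"
  have overm: "over s t x \<in> path H {s..t} \<rightarrow>\<^sub>M X" if "t \<le> n" for t
    using x su that by (intro merge_measurable[where g="\<lambda>_. x"]) auto
  have Zj: "(\<lambda>Z. Z j) \<in> P t \<rightarrow>\<^sub>M path H {s..t}" if "j \<in> {1..N}" for j t
    unfolding P_def by (rule measurable_component_singleton[OF that])
  have Zjt: "(\<lambda>Z. Z j t) \<in> P t \<rightarrow>\<^sub>M S" if "j \<in> {1..N}" "s \<le> t" for j t
    using measurable_compose[OF Zj[OF that(1)] measurable_component_singleton[of t "{s..t}"]] that by auto
  have Lfm: "Lf t \<in> borel_measurable (P t)" if t: "s \<le> t" "t \<le> u" for t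
  proof -
    have tI: "t \<in> {1..n}" "1 \<le> t" "t \<le> n" using t su by auto
    have 1: "(\<lambda>Z. pw x u t (Z j t)) \<in> borel_measurable (P t)" if j: "j \<in> {1..N}" for j
      by (rule measurable_compose[OF Zjt[OF j t(1)] pw_meas[OF x tI(1)]])
    have 2: "(\<lambda>Z. d t (Z j t)) \<in> borel_measurable (P t)" if j: "j \<in> {1..N}" for j
      by (rule measurable_compose[OF Zjt[OF j t(1)] d])
    have 3: "(\<lambda>Z. fut x u t F (over s t x (Z j))) \<in> borel_measurable (P t)" if j: "j \<in> {1..N}" for j
      by (rule measurable_compose[OF measurable_compose[OF Zj[OF j] overm[OF tI(3)]] fut_measurable[OF x tI(2) t(2) su(3) F(1)]])
    show ?thesis unfolding Lf_def
      by (intro borel_measurable_divide_ennreal borel_measurable_sum borel_measurable_times_ennreal 1 2 3)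
  qed
  have part: "pg_particles H n y N s u x k \<in> space (prob_algebra (P (s + k)))" if "s + k \<le> u" for k
    unfolding P_def using that su by (intro measurable_space[OF pg_particles_kernel x]) auto
  have stepk: "(\<lambda>Z. pg_step H n y N s u x (s + Suc k) Z) \<in> P (s + k) \<rightarrow>\<^sub>M prob_algebra (P (s + Suc k))" if "s + Suc k \<le> u" for k
  proof -
    have "(\<lambda>Z. (x, Z)) \<in> P (s + k) \<rightarrow>\<^sub>M X \<Otimes>\<^sub>M P (s + k)" using x by (intro measurable_Pair) auto
    moreover have "(\<lambda>(x, Z). pg_step H n y N s u x (s + Suc k) Z) \<in> X \<Otimes>\<^sub>M P (s + k) \<rightarrow>\<^sub>M prob_algebra (P (s + Suc k))"
      using pg_step_kernel[of s "s + Suc k" u] that su by (simp add: P_def)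
    ultimately have "(\<lambda>Z. (\<lambda>(x, Z). pg_step H n y N s u x (s + Suc k) Z) (x, Z)) \<in> P (s + k) \<rightarrow>\<^sub>M prob_algebra (P (s + Suc k))"
      by (rule measurable_compose)
    then show ?thesis by simp
  qed
  have main: "of_nat (N - 1) ^ (k + 1) * ideal s u F x / Y0 \<le> (\<integral>\<^sup>+Z. Lf (s + k) Z \<partial>pg_particles H n y N s u x k)"
    if "s + k \<le> u" for k
    using that
  proof (induction k)
    case 0
    have "of_nat (N - 1) * ideal s u F x / Y0 \<le> (\<integral>\<^sup>+Z. Lf s Z \<partial>pg_init H N s x)"
      unfolding Lf_def
      by (rule pg_init_lower_bound[OF x su F d _ Y0 fin]) (use Sd su in auto)
    then show ?case by simp
  next
    case (Suc k)
    let ?M = "pg_particles H n y N s u x k"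
    have sM: "sets ?M = sets (P (s + k))" using part[of k] Suc.prems by (simp add: space_prob_algebra)
    have "(\<integral>\<^sup>+Z. Lf (s + Suc k) Z \<partial>pg_particles H n y N s u x (Suc k)) =
       (\<integral>\<^sup>+Z. (\<integral>\<^sup>+Z'. Lf (s + Suc k) Z' \<partial>pg_step H n y N s u x (s + Suc k) Z) \<partial>?M)"
      unfolding pg_particles.simps
    proof (rule nn_integral_bind[OF Lfm])
      show "(\<lambda>Z. pg_step H n y N s u x (s + Suc k) Z) \<in> ?M \<rightarrow>\<^sub>M subprob_algebra (P (s + Suc k))"
        using measurable_prob_algebraD[OF stepk] Suc.prems measurable_cong_sets[OF sM refl] by blast
    qed (use Suc.prems in auto)
    moreover have "(\<integral>\<^sup>+Z. of_nat (N - 1) * Lf (s + k) Z \<partial>?M) \<le> (\<integral>\<^sup>+Z. (\<integral>\<^sup>+Z'. Lf (s + Suc k) Z' \<partial>pg_step H n y N s u x (s + Suc k) Z) \<partial>?M)"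
    proof (rule nn_integral_mono)
      fix Z assume "Z \<in> space ?M"
      then have Z: "Z \<in> space (PiM {1..N} (\<lambda>_. path H {s..s + Suc k - 1}))"
        using sets_eq_imp_space_eq[OF sM] by (simp add: P_def)
      have t: "s < s + Suc k" "s + Suc k \<le> u" "s + Suc k - 1 \<in> {s..<u}" "s + Suc k \<in> {s<..u}" "s + Suc k \<in> {s..u}"
        using Suc.prems by auto
      from pg_step_lower_bound[where d=d, OF x su(1) t(1,2) su(3) F d Sd[OF t(5)] le[OF t(4)] d0[OF t(3)] dfin[OF t(3)] Z]
      show "of_nat (N - 1) * Lf (s + k) Z \<le> (\<integral>\<^sup>+Z'. Lf (s + Suc k) Z' \<partial>pg_step H n y N s u x (s + Suc k) Z)"
        unfolding Lf_def by (simp add: ennreal_times_divide)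
    qed
    moreover have "(\<integral>\<^sup>+Z. of_nat (N - 1) * Lf (s + k) Z \<partial>?M) = of_nat (N - 1) * (\<integral>\<^sup>+Z. Lf (s + k) Z \<partial>?M)"
      by (rule nn_integral_cmult) (use Lfm[of "s + k"] Suc.prems measurable_cong_sets[OF sM refl] in auto)
    moreover have "of_nat (N - 1) * (of_nat (N - 1) ^ (k + 1) * ideal s u F x / Y0) \<le> of_nat (N - 1) * (\<integral>\<^sup>+Z. Lf (s + k) Z \<partial>?M)"
      using Suc by (intro mult_left_mono Suc.IH) auto
    moreover have "of_nat (N - 1) * (of_nat (N - 1) ^ (k + 1) * ideal s u F x / Y0) = of_nat (N - 1) ^ (Suc k + 1) * ideal s u F x / Y0"
      by (simp add: ennreal_times_divide mult.assoc)
    ultimately show ?case by simp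
  qed
  let ?M = "pg_particles H n y N s u x (u - s)"
  have sM: "sets ?M = sets (P u)" "?M \<in> space (prob_algebra (P u))" using part[of "u - s"] su by (simp_all add: space_prob_algebra)
  define sel where "sel Z = distr (categorical N (\<lambda>j. pg_weight H n y u x u (Z j u))) (path H {s..u}) Z" for Z
  have Fo: "(\<lambda>\<zeta>. F (over s u x \<zeta>)) \<in> borel_measurable (path H {s..u})"
    by (rule measurable_compose[OF overm[OF su(3)] F(1)])
  have selk: "sel \<in> P u \<rightarrow>\<^sub>M prob_algebra (path H {s..u})"
  proof -
    have "(\<lambda>Z. (x, Z)) \<in> P u \<rightarrow>\<^sub>M X \<Otimes>\<^sub>M P u" using x by (intro measurable_Pair) auto
    from measurable_compose[OF this pg_select_kernel[OF su, folded P_def]]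
    have "(\<lambda>Z. distr (categorical N (\<lambda>j. pg_weight H n y u x u (Z j u))) (path H {s..u}) Z) \<in> P u \<rightarrow>\<^sub>M prob_algebra (path H {s..u})"
      by simp
    then show ?thesis unfolding sel_def .
  qed
  have "(\<integral>\<^sup>+\<zeta>. F (over s u x \<zeta>) \<partial>pg_kernel H n y N s u x) = (\<integral>\<^sup>+Z. (\<integral>\<^sup>+\<zeta>. F (over s u x \<zeta>) \<partial>sel Z) \<partial>?M)"
    unfolding pg_kernel_def sel_def[symmetric]
  proof (rule nn_integral_bind[OF Fo])
    show "sel \<in> ?M \<rightarrow>\<^sub>M subprob_algebra (path H {s..u})"
      using measurable_prob_algebraD[OF selk] measurable_cong_sets[OF sM(1) refl] by blast
  qed
  moreover have "(\<integral>\<^sup>+Z. Lf u Z \<partial>?M) \<le> (\<integral>\<^sup>+Z. (\<integral>\<^sup>+\<zeta>. F (over s u x \<zeta>) \<partial>sel Z) \<partial>?M)"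
  proof (rule nn_integral_mono)
    fix Z assume "Z \<in> space ?M"
    then have Z: "Z \<in> space (P u)" using sets_eq_imp_space_eq[OF sM(1)] by simp
    define w where "w j = pg_weight H n y u x u (Z j u)" for j
    have uI: "u \<in> {1..n}" using su by auto
    have Zju: "Z j u \<in> space S" if "j \<in> {1..N}" for j using measurable_space[OF Zjt[OF that su(2)] Z] .
    have w: "ennreal (w j) = pw x u u (Z j u)" "0 \<le> w j" if "j \<in> {1..N}" for j
      unfolding w_def by (rule ennreal_pg_weight pg_weight_nonneg; use x Zju that uI su in auto)+
    have Zm: "Z \<in> categorical N w \<rightarrow>\<^sub>M path H {s..u}"
    proof -
      have "Z \<in> count_space {1..N} \<rightarrow>\<^sub>M path H {s..u}" using measurable_space[OF Zj Z] by auto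
      moreover have "sets (categorical N w) = sets (count_space {1..N})"
        by (simp add: categorical_def sets_point_measure)
      ultimately show ?thesis using measurable_cong_sets by blast
    qed
    have eq: "Lf u Z = (\<Sum>j=1..N. ennreal (w j) * F (over s u x (Z j))) / (\<Sum>l=1..N. ennreal (w l))"
      unfolding Lf_def fut_end using w du Zju by (intro arg_cong2[where f="(/)"] sum.cong) auto
    \<comment> \<open>if all final weights vanish, the sum is 0 and the bound is trivial, whatever the selected index\<close>
    show "Lf u Z \<le> (\<integral>\<^sup>+\<zeta>. F (over s u x \<zeta>) \<partial>sel Z)"
    proof (cases "(\<Sum>l=1..N. w l) = 0")
      case True
      then have "w j = 0" if "j \<in> {1..N}" for j using w(2) that by (subst (asm) sum_nonneg_eq_0_iff) auto
      then have "Lf u Z = 0" unfolding eq by (simp cong: sum.cong)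
      then show ?thesis by simp
    next
      case False
      have "(\<integral>\<^sup>+\<zeta>. F (over s u x \<zeta>) \<partial>sel Z) = (\<integral>\<^sup>+j. F (over s u x (Z j)) \<partial>categorical N w)"
        unfolding sel_def w_def[symmetric] by (rule nn_integral_distr[OF Zm]) (use Fo in simp)
      also have "\<dots> = Lf u Z" unfolding eq by (rule nn_integral_categorical[OF w(2) False])
      finally show ?thesis by simp
    qed
  qed
  ultimately show ?thesis using main[of "u - s"] su by simp
qed

end

section \<open>Minorisation of Particle Gibbs by the ideal block update\<close>

text \<open>
  Of the binomial expansion of \<open>(q + 2 * b) ^ k\<close> every term but the first has a factor \<open>b\<close>; this is how
  the additive form of the envelope below is absorbed into its multiplicative form.
\<close>

lemma power_split_le:
  fixes b :: ennreal assumes b: "1 \<le> b"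
  shows "of_nat (q ^ k) + of_nat ((q + 2) ^ k - q ^ k) * b \<le> (of_nat q + 2 * b) ^ k"
proof (induction k)
  case (Suc k)
  define c where "c = (q + 2) ^ k - q ^ k"
  have c: "(q + 2) ^ k = q ^ k + c" unfolding c_def by (simp add: power_mono)
  have c': "(q + 2) ^ Suc k - q ^ Suc k = q * c + 2 * q ^ k + 2 * c"
    using c by (simp add: algebra_simps)
  have "of_nat (q ^ Suc k) + of_nat ((q + 2) ^ Suc k - q ^ Suc k) * b
      = of_nat q * of_nat (q ^ k) + of_nat q * of_nat c * b + 2 * b * of_nat (q ^ k) + 2 * of_nat c * b"
    unfolding c' by (simp add: algebra_simps)
  also have "\<dots> \<le> of_nat q * of_nat (q ^ k) + of_nat q * of_nat c * b + 2 * b * of_nat (q ^ k) + 2 * of_nat c * b * b"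
    using mult_left_mono[OF b, of "2 * of_nat c * b"] by (intro add_left_mono) simp
  also have "\<dots> = (of_nat q + 2 * b) * (of_nat (q ^ k) + of_nat c * b)"
    by (simp add: algebra_simps)
  also have "\<dots> \<le> (of_nat q + 2 * b) * (of_nat q + 2 * b) ^ k"
    using Suc unfolding c_def by (intro mult_left_mono) auto
  finally show ?case by simp
qed simp

context pg_model begin

text \<open>
  \<open>R x u t\<close> is the backward information filter: the likelihood of the later observations in the block
  and of the right boundary, as a function of the state at time \<open>t\<close>. It differs from \<open>tot\<close> only at
  \<open>t = u\<close>, where the right boundary factor is counted in \<open>R\<close> and not in \<open>pw\<close>.
\<close>

definition R where "R x u t = chain_total S m g (rgt x u) [t + 1..<u + 1]"

lemma R_end: "R x u u z = rgt x u z" by (simp add: R_def)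

lemma R_step: "t < u \<Longrightarrow> R x u t v = (\<integral>\<^sup>+z. m v z * (g (t + 1) z * R x u (t + 1) z) \<partial>S)"
  unfolding R_def by (subst upt_step) (simp_all add: mult.assoc)

lemma R_meas: "x \<in> space X \<Longrightarrow> u \<le> n \<Longrightarrow> R x u t \<in> borel_measurable S"
  unfolding R_def by (intro chain_total_measurable m_meas g_meas rgt_meas) auto

lemma pw_tot: "t \<le> u \<Longrightarrow> pw x u t z * tot x u t z = g t z * R x u t z"
proof (induction t arbitrary: z rule: inc_induct)
  case base
  then show ?case by (simp add: pw_def tot_end R_end)
next
  case (step t)
  have "tot x u t z = R x u t z"
    unfolding tot_step[OF step(2)] R_step[OF step(2)] mult.assoc using step.IH by simp
  then show ?case using step(2) by (simp add: pw_def)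
qed

lemma tot_R: "t < u \<Longrightarrow> tot x u t z = R x u t z"
  by (simp add: tot_step R_step mult.assoc pw_tot)

lemma tot_int: "t < u \<Longrightarrow> tot x u t v = (\<integral>\<^sup>+z. m v z * (g (t + 1) z * R x u (t + 1) z) \<partial>S)"
  by (simp only: tot_R R_step)

lemma ideal_one:
  assumes "x \<in> space X" "1 \<le> s" "s \<le> u" "u \<le> n"
  shows "ideal s u (\<lambda>_. 1) x = (\<integral>\<^sup>+z. lft x s z * (g s z * R x u s z) \<partial>S)"
  unfolding ideal_def
proof (rule nn_integral_cong)
  fix z assume z: "z \<in> space S"
  have "fut x u s (\<lambda>_. 1) (x(s := z)) = tot x u s z"
    using fut_one[of x s u "x(s := z)"] assms upd_space[OF assms(1) _ z, of s] by simp
  then show "lft x s z * pw x u s z * fut x u s (\<lambda>_. 1) (x(s := z)) = lft x s z * (g s z * R x u s z)"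
    using pw_tot[of s u x z] assms by (simp add: mult.assoc)
qed

text \<open>
  Replacing the next \<open>k\<close> observation factors by constants costs \<open>D ^ k\<close> and turns the filter into an
  average of a later filter against the transition density of \<open>Suc k\<close> steps.
\<close>

lemma R_bridge:
  assumes x: "x \<in> space X" and u: "u \<le> n"
  shows "t + k + 1 \<le> u \<Longrightarrow> v \<in> space S \<Longrightarrow>
    (\<Prod>r\<in>{t<..t + k}. \<gamma> r) * (\<integral>\<^sup>+z. step_dens S m k v z * (g (t + k + 1) z * R x u (t + k + 1) z) \<partial>S) \<le> R x u t v
    \<and> R x u t v \<le> D ^ k * (\<Prod>r\<in>{t<..t + k}. \<gamma> r) * (\<integral>\<^sup>+z. step_dens S m k v z * (g (t + k + 1) z * R x u (t + k + 1) z) \<partial>S)"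
proof (induction k arbitrary: t v)
  case 0
  then show ?case by (simp add: R_step)
next
  case (Suc k)
  define q where "q z = g (t + Suc k + 1) z * R x u (t + Suc k + 1) z" for z
  have [measurable]: "q \<in> borel_measurable S"
    unfolding q_def using Suc.prems u by (intro borel_measurable_times_ennreal g_meas R_meas x) auto
  note [measurable] = step_dens_measurable[OF m_meas, of k] Suc.prems(2)
  define G where "G = (\<Prod>r\<in>{t + 1<..t + 1 + k}. \<gamma> r)"
  define J where "J z = (\<integral>\<^sup>+w. step_dens S m k z w * q w \<partial>S)" for z
  have [measurable]: "J \<in> borel_measurable S" unfolding J_def by measurable
  have G: "(\<Prod>r\<in>{t<..t + Suc k}. \<gamma> r) = \<gamma> (t + 1) * G"
  proof -
    have "{t<..t + Suc k} = insert (t + 1) {t + 1<..t + 1 + k}" by auto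
    then show ?thesis unfolding G_def by simp
  qed
  have IH: "G * J z \<le> R x u (t + 1) z \<and> R x u (t + 1) z \<le> D ^ k * G * J z" if "z \<in> space S" for z
    using Suc.IH[of "t + 1" z] that Suc.prems unfolding G_def J_def q_def by (simp add: add.commute add.left_commute)
  interpret SS: pair_sigma_finite S S ..
  have swap: "(\<integral>\<^sup>+z. step_dens S m (Suc k) v z * q z \<partial>S) = (\<integral>\<^sup>+z. m v z * J z \<partial>S)"
  proof -
    have "(\<integral>\<^sup>+z. step_dens S m (Suc k) v z * q z \<partial>S) = (\<integral>\<^sup>+z. (\<integral>\<^sup>+w. m v w * step_dens S m k w z * q z \<partial>S) \<partial>S)"
      by (intro nn_integral_cong) (simp add: nn_integral_multc)
    also have "\<dots> = (\<integral>\<^sup>+w. (\<integral>\<^sup>+z. m v w * step_dens S m k w z * q z \<partial>S) \<partial>S)"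
      by (rule SS.Fubini') measurable
    also have "\<dots> = (\<integral>\<^sup>+w. m v w * J w \<partial>S)"
      unfolding J_def by (intro nn_integral_cong) (simp add: nn_integral_cmult[symmetric] mult.assoc)
    finally show ?thesis .
  qed
  have t1: "t + 1 \<in> {1..n}" "t < u" using Suc.prems u by auto
  have "\<gamma> (t + 1) * G * (\<integral>\<^sup>+z. m v z * J z \<partial>S) = (\<integral>\<^sup>+z. m v z * (\<gamma> (t + 1) * (G * J z)) \<partial>S)"
    by (subst nn_integral_cmult[symmetric]) (auto simp: ac_simps)
  also have "\<dots> \<le> R x u t v"
    unfolding R_step[OF t1(2)] using IH by (intro nn_integral_mono mult_left_mono mult_mono g_ge) auto
  finally have 1: "\<gamma> (t + 1) * G * (\<integral>\<^sup>+z. m v z * J z \<partial>S) \<le> R x u t v" .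
  have "R x u t v \<le> (\<integral>\<^sup>+z. m v z * ((D * \<gamma> (t + 1)) * (D ^ k * G * J z)) \<partial>S)"
    unfolding R_step[OF t1(2)] using IH t1 by (intro nn_integral_mono mult_left_mono mult_mono g_le) auto
  also have "\<dots> = D ^ Suc k * (\<gamma> (t + 1) * G) * (\<integral>\<^sup>+z. m v z * J z \<partial>S)"
    by (subst nn_integral_cmult[symmetric]) (auto simp: ac_simps)
  finally show ?case using 1 unfolding G swap[unfolded q_def] by simp
qed

lemma R_right:
  assumes x: "x \<in> space X" and u: "u < n" "t \<le> u" and v: "v \<in> space S"
  shows "(\<Prod>r\<in>{t<..u}. \<gamma> r) * step_dens S m (u - t) v (x (u + 1)) \<le> R x u t v"
    "R x u t v \<le> D ^ (u - t) * (\<Prod>r\<in>{t<..u}. \<gamma> r) * step_dens S m (u - t) v (x (u + 1))"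
proof -
  have xu [measurable]: "x (u + 1) \<in> space S" using u by (intro comp_space[OF x]) auto
  have "(\<Prod>r\<in>{t<..u}. \<gamma> r) * step_dens S m (u - t) v (x (u + 1)) \<le> R x u t v
    \<and> R x u t v \<le> D ^ (u - t) * (\<Prod>r\<in>{t<..u}. \<gamma> r) * step_dens S m (u - t) v (x (u + 1))"
    using u(2) v
  proof (induction t arbitrary: v rule: inc_induct)
    case base
    then show ?case using u by (simp add: R_end rgt_def)
  next
    case (step t)
    note [measurable] = step_dens_measurable[OF m_meas, of "u - Suc t"] step.prems
    define G where "G = (\<Prod>r\<in>{t + 1<..u}. \<gamma> r)"
    define J where "J z = step_dens S m (u - Suc t) z (x (u + 1))" for z
    have [measurable]: "J \<in> borel_measurable S" unfolding J_def by measurable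
    have G: "(\<Prod>r\<in>{t<..u}. \<gamma> r) = \<gamma> (t + 1) * G"
    proof -
      have "{t<..u} = insert (t + 1) {t + 1<..u}" using step by auto
      then show ?thesis unfolding G_def by simp
    qed
    have IH: "G * J z \<le> R x u (t + 1) z \<and> R x u (t + 1) z \<le> D ^ (u - Suc t) * G * J z" if "z \<in> space S" for z
      using step.IH[OF that] unfolding G_def J_def by simp
    have ut: "u - t = Suc (u - Suc t)" using step by auto
    have sd: "step_dens S m (u - t) v (x (u + 1)) = (\<integral>\<^sup>+z. m v z * J z \<partial>S)"
      unfolding ut by (simp add: J_def)
    have t1: "t + 1 \<in> {1..n}" "t < u" using step u by auto
    have "\<gamma> (t + 1) * G * (\<integral>\<^sup>+z. m v z * J z \<partial>S) = (\<integral>\<^sup>+z. m v z * (\<gamma> (t + 1) * (G * J z)) \<partial>S)"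
      by (subst nn_integral_cmult[symmetric]) (auto simp: ac_simps)
    also have "\<dots> \<le> R x u t v"
      unfolding R_step[OF t1(2)] using IH by (intro nn_integral_mono mult_left_mono mult_mono g_ge) auto
    finally have 1: "\<gamma> (t + 1) * G * (\<integral>\<^sup>+z. m v z * J z \<partial>S) \<le> R x u t v" .
    have "R x u t v \<le> (\<integral>\<^sup>+z. m v z * ((D * \<gamma> (t + 1)) * (D ^ (u - Suc t) * G * J z)) \<partial>S)"
      unfolding R_step[OF t1(2)] using IH t1 by (intro nn_integral_mono mult_left_mono mult_mono g_le) auto
    also have "\<dots> = D ^ (u - t) * (\<gamma> (t + 1) * G) * (\<integral>\<^sup>+z. m v z * J z \<partial>S)"
      unfolding ut by (subst nn_integral_cmult[symmetric]) (auto simp: ac_simps)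
    finally show ?case using 1 unfolding G sd by simp
  qed
  then show "(\<Prod>r\<in>{t<..u}. \<gamma> r) * step_dens S m (u - t) v (x (u + 1)) \<le> R x u t v"
    "R x u t v \<le> D ^ (u - t) * (\<Prod>r\<in>{t<..u}. \<gamma> r) * step_dens S m (u - t) v (x (u + 1))" by auto
qed

lemma R_end_block:
  assumes x: "x \<in> space X" and t: "t \<le> n" and v: "v \<in> space S"
  shows "(\<Prod>r\<in>{t<..n}. \<gamma> r) \<le> R x n t v" "R x n t v \<le> D ^ (n - t) * (\<Prod>r\<in>{t<..n}. \<gamma> r)"
proof -
  have "(\<Prod>r\<in>{t<..n}. \<gamma> r) \<le> R x n t v \<and> R x n t v \<le> D ^ (n - t) * (\<Prod>r\<in>{t<..n}. \<gamma> r)"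
    using t v
  proof (induction t arbitrary: v rule: inc_induct)
    case base
    then show ?case by (simp add: R_end rgt_def)
  next
    case (step t)
    note [measurable] = step.prems
    define G where "G = (\<Prod>r\<in>{t + 1<..n}. \<gamma> r)"
    have G: "(\<Prod>r\<in>{t<..n}. \<gamma> r) = \<gamma> (t + 1) * G"
    proof -
      have "{t<..n} = insert (t + 1) {t + 1<..n}" using step by auto
      then show ?thesis unfolding G_def by simp
    qed
    have IH: "G \<le> R x n (t + 1) z \<and> R x n (t + 1) z \<le> D ^ (n - Suc t) * G" if "z \<in> space S" for z
      using step.IH[OF that] unfolding G_def by simp
    have nt: "n - t = Suc (n - Suc t)" using step by auto
    have t1: "t + 1 \<in> {1..n}" "t < n" using step by auto
    have c: "(\<integral>\<^sup>+z. m v z * c \<partial>S) = c" for c using step.prems by (simp add: nn_integral_multc m_int)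
    have "(\<integral>\<^sup>+z. m v z * (\<gamma> (t + 1) * G) \<partial>S) \<le> R x n t v"
      unfolding R_step[OF t1(2)] using IH by (intro nn_integral_mono mult_left_mono mult_mono g_ge) auto
    then have 1: "\<gamma> (t + 1) * G \<le> R x n t v" unfolding c .
    have "R x n t v \<le> (\<integral>\<^sup>+z. m v z * ((D * \<gamma> (t + 1)) * (D ^ (n - Suc t) * G)) \<partial>S)"
      unfolding R_step[OF t1(2)] using IH t1 by (intro nn_integral_mono mult_left_mono mult_mono g_le) auto
    also have "\<dots> = D ^ (n - t) * (\<gamma> (t + 1) * G)"
      unfolding nt c by (simp add: ac_simps)
    finally show ?case using 1 unfolding G by simp
  qed
  then show "(\<Prod>r\<in>{t<..n}. \<gamma> r) \<le> R x n t v" "R x n t v \<le> D ^ (n - t) * (\<Prod>r\<in>{t<..n}. \<gamma> r)" by auto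
qed

text \<open>
  The filter depends on its argument only through the law of the chain \<open>h\<close> steps later, whose densities
  differ at most by the factor \<open>\<sigma>p / \<sigma>m\<close>, up to the \<open>h - 1\<close> observations in between. This needs \<open>h\<close>
  steps before the right boundary; at the end of the time horizon there is no boundary factor, and the
  observations alone are to be compared.
\<close>

lemma R_ratio:
  assumes x: "x \<in> space X" and u: "t \<le> u" "u \<le> n" and early: "u = n \<or> t + h \<le> u + 1"
    and v: "v \<in> space S" "v' \<in> space S"
  shows "ennreal \<sigma>m * R x u t v \<le> D ^ (h - 1) * ennreal \<sigma>p * R x u t v'"
proof -
  consider "t + h \<le> u" | "u < n" "t + h = u + 1" | "u = n" "u < t + h" using early u by linarith
  then show ?thesis
  proof cases
    case 1
    then have le: "t + (h - 1) + 1 \<le> u" "t + (h - 1) + 1 = t + h" using h by auto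
    define J where "J = (\<integral>\<^sup>+z. g (t + h) z * R x u (t + h) z \<partial>S)"
    define G where "G = (\<Prod>r\<in>{t<..t + (h - 1)}. \<gamma> r)"
    note [measurable] = R_meas[OF x u(2), of "t + h"] step_dens_measurable[OF m_meas, of "h - 1"] v
    have [measurable]: "g (t + h) \<in> borel_measurable S" using 1 u h by (intro g_meas) auto
    define I where "I v = (\<integral>\<^sup>+z. step_dens S m (h - 1) v z * (g (t + h) z * R x u (t + h) z) \<partial>S)" for v
    have lo: "ennreal \<sigma>m * J \<le> I v'" unfolding J_def I_def
      by (subst nn_integral_cmult[symmetric]) (auto intro!: nn_integral_mono mult_right_mono step_ge v)
    have hi: "I v \<le> ennreal \<sigma>p * J" unfolding J_def I_def
      by (subst nn_integral_cmult[symmetric]) (auto intro!: nn_integral_mono mult_right_mono step_le v)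
    have "R x u t v \<le> D ^ (h - 1) * G * I v"
      using R_bridge[OF x u(2) le(1) v(1)] unfolding le(2) G_def I_def by simp
    also have "\<dots> \<le> D ^ (h - 1) * G * (ennreal \<sigma>p * J)" by (intro mult_left_mono hi) auto
    finally have "ennreal \<sigma>m * R x u t v \<le> ennreal \<sigma>m * (D ^ (h - 1) * G * (ennreal \<sigma>p * J))" by (intro mult_left_mono) auto
    also have "\<dots> = D ^ (h - 1) * ennreal \<sigma>p * (G * (ennreal \<sigma>m * J))" by (simp add: ac_simps)
    also have "\<dots> \<le> D ^ (h - 1) * ennreal \<sigma>p * (G * I v')" by (intro mult_left_mono lo) auto
    also have "\<dots> \<le> D ^ (h - 1) * ennreal \<sigma>p * R x u t v'"
      using R_bridge[OF x u(2) le(1) v(2)] unfolding le(2) G_def I_def by (intro mult_left_mono) auto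
    finally show ?thesis .
  next
    case 2
    then have ut: "u - t = h - 1" by auto
    define G where "G = (\<Prod>r\<in>{t<..u}. \<gamma> r)"
    have xu: "x (u + 1) \<in> space S" using 2 by (intro comp_space[OF x]) auto
    have "R x u t v \<le> D ^ (h - 1) * G * step_dens S m (h - 1) v (x (u + 1))"
      using R_right(2)[OF x 2(1) u(1) v(1)] unfolding ut G_def .
    also have "\<dots> \<le> D ^ (h - 1) * G * ennreal \<sigma>p" by (intro mult_left_mono step_le v xu) auto
    finally have "ennreal \<sigma>m * R x u t v \<le> ennreal \<sigma>m * (D ^ (h - 1) * G * ennreal \<sigma>p)" by (intro mult_left_mono) auto
    also have "\<dots> = D ^ (h - 1) * ennreal \<sigma>p * (G * ennreal \<sigma>m)" by (simp add: ac_simps)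
    also have "\<dots> \<le> D ^ (h - 1) * ennreal \<sigma>p * (G * step_dens S m (h - 1) v' (x (u + 1)))"
      by (intro mult_left_mono step_ge v xu) auto
    also have "\<dots> \<le> D ^ (h - 1) * ennreal \<sigma>p * R x u t v'"
      using R_right(1)[OF x 2(1) u(1) v(2)] unfolding ut G_def by (intro mult_left_mono) auto
    finally show ?thesis .
  next
    case 3
    define G where "G = (\<Prod>r\<in>{t<..n}. \<gamma> r)"
    have "R x u t v \<le> D ^ (n - t) * G" using R_end_block(2)[OF x, of t v] u v 3 by (simp add: G_def)
    also have "\<dots> \<le> D ^ (h - 1) * G" using 3 D_ge by (intro mult_right_mono power_increasing) auto
    finally have "ennreal \<sigma>m * R x u t v \<le> ennreal \<sigma>p * (D ^ (h - 1) * G)"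
      using \<sigma>_le \<sigma>m by (intro mult_mono ennreal_leI) auto
    also have "\<dots> = D ^ (h - 1) * ennreal \<sigma>p * G" by (simp add: ac_simps)
    also have "\<dots> \<le> D ^ (h - 1) * ennreal \<sigma>p * R x u t v'"
      using R_end_block(1)[OF x, of t v'] u v 3 by (intro mult_left_mono) (auto simp: G_def)
    finally show ?thesis .
  qed
qed

text \<open>
  The oscillation of observation times filter: one factor \<open>D\<close> from the observation at time \<open>t\<close> completes
  \<open>D ^ (h - 1)\<close> to \<open>\<delta>\<close>.
\<close>

definition Bc where "Bc = ennreal (\<delta> * \<sigma>p / \<sigma>m)"

lemma Bc_cancel:
  assumes "ennreal \<sigma>m * a \<le> ennreal (\<delta> * \<sigma>p) * b"
  shows "a \<le> Bc * b"
proof -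
  have "ennreal (1 / \<sigma>m) * (ennreal \<sigma>m * a) \<le> ennreal (1 / \<sigma>m) * (ennreal (\<delta> * \<sigma>p) * b)"
    by (rule mult_left_mono[OF assms]) simp
  then show ?thesis using \<sigma>m \<sigma>p \<delta>
    by (simp add: mult.assoc[symmetric] ennreal_mult[symmetric] Bc_def)
qed

lemma Bc_ge: "1 \<le> Bc"
proof -
  have "1 * \<sigma>m \<le> \<delta> * \<sigma>p" using \<delta> \<sigma>_le \<sigma>m by (intro mult_mono) auto
  then have "1 \<le> \<delta> * \<sigma>p / \<sigma>m" using \<sigma>m by simp
  then show ?thesis unfolding Bc_def by (metis ennreal_1 ennreal_leI)
qed

lemma D_h: "D * (D ^ (h - 1) * ennreal \<sigma>p) = ennreal (\<delta> * \<sigma>p)"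
proof -
  have "D * D ^ (h - 1) = D ^ h" using h by (metis Suc_diff_1 less_eq_Suc_le power_Suc One_nat_def)
  also have "\<dots> = ennreal \<delta>" using h \<delta> by (simp add: D_power)
  finally show ?thesis using \<delta> \<sigma>p by (simp add: mult.assoc[symmetric] ennreal_mult[symmetric])
qed

lemma gR_ratio:
  assumes x: "x \<in> space X" and u: "1 \<le> t" "t \<le> u" "u \<le> n" and early: "u = n \<or> t + h \<le> u + 1"
    and v: "v \<in> space S" "v' \<in> space S"
  shows "g t v * R x u t v \<le> Bc * (g t v' * R x u t v')"
proof (rule Bc_cancel)
  have tI: "t \<in> {1..n}" using u by auto
  have "ennreal \<sigma>m * (g t v * R x u t v) = g t v * (ennreal \<sigma>m * R x u t v)" by (simp add: ac_simps)
  also have "\<dots> \<le> (D * g t v') * (D ^ (h - 1) * ennreal \<sigma>p * R x u t v')"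
  proof (rule mult_mono[OF _ R_ratio[OF x u(2,3) early v]])
    have "g t v \<le> D * \<gamma> t" by (rule g_le[OF tI v(1)])
    also have "\<dots> \<le> D * g t v'" by (intro mult_left_mono g_ge v) auto
    finally show "g t v \<le> D * g t v'" .
  qed auto
  also have "\<dots> = (D * (D ^ (h - 1) * ennreal \<sigma>p)) * (g t v' * R x u t v')" by (simp add: ac_simps)
  finally show "ennreal \<sigma>m * (g t v * R x u t v) \<le> ennreal (\<delta> * \<sigma>p) * (g t v' * R x u t v')" unfolding D_h .
qed

lemma gR_average:
  assumes x: "x \<in> space X" and u: "1 \<le> t" "t \<le> u" "u \<le> n" and early: "u = n \<or> t + h \<le> u + 1"
    and q: "q \<in> borel_measurable S" "(\<integral>\<^sup>+z. q z \<partial>S) = 1"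
  shows "(SUP z\<in>space S. g t z * R x u t z) \<le> Bc * (\<integral>\<^sup>+z. q z * (g t z * R x u t z) \<partial>S)"
proof (rule SUP_least)
  fix v assume v: "v \<in> space S"
  note [measurable] = q(1) R_meas[OF x u(3)] g_meas[of t]
  have [measurable]: "g t \<in> borel_measurable S" using u by (intro g_meas) auto
  have "g t v * R x u t v = (\<integral>\<^sup>+z. q z * (g t v * R x u t v) \<partial>S)" by (simp add: nn_integral_multc q(2))
  also have "\<dots> \<le> (\<integral>\<^sup>+z. q z * (Bc * (g t z * R x u t z)) \<partial>S)"
    by (intro nn_integral_mono mult_left_mono gR_ratio x u early v) auto
  also have "\<dots> = Bc * (\<integral>\<^sup>+z. q z * (g t z * R x u t z) \<partial>S)"
    by (subst nn_integral_cmult[symmetric]) (auto simp: ac_simps)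
  finally show "g t v * R x u t v \<le> \<dots>" .
qed

lemma R_pos:
  assumes x: "x \<in> space X" and u: "t \<le> u" "u \<le> n" and early: "u = n \<or> t + h \<le> u + 1" and v: "v \<in> space S"
  shows "R x u t v \<noteq> 0"
proof (cases "u = n")
  case True
  have "(\<Prod>r\<in>{t<..n}. \<gamma> r) \<noteq> 0" using \<gamma>_pos by simp
  then show ?thesis using R_end_block(1)[OF x, of t v] u v True by auto
next
  case False
  then have u': "u < n" "h - 1 \<le> u - t" using u early by auto
  have xu: "x (u + 1) \<in> space S" using u' by (intro comp_space[OF x]) auto
  have "(\<Prod>r\<in>{t<..u}. \<gamma> r) \<noteq> 0" using \<gamma>_pos u by simp
  moreover have "step_dens S m (u - t) v (x (u + 1)) \<noteq> 0" using step_ge[OF v xu u'(2)] \<sigma>m by (auto simp: ennreal_eq_0_iff)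
  ultimately show ?thesis using R_right(1)[OF x u'(1) u(1) v] by auto
qed

end

context pg_model begin

text \<open>
  A uniform upper bound on the filter, which uses only the upper bounds on the transition and
  observation densities.
\<close>

definition \<Lambda> where "\<Lambda> u t = ennreal \<sigma>p * (\<Prod>r\<in>{t<..u}. D * \<gamma> r)"
text \<open>
  The growth of the denominator per time step: \<open>N - 2\<close> averaged particles, and two particles that are
  bounded by the supremum, which is at most \<open>Bc\<close> times the mean.
\<close>

definition K where "K = of_nat (N - 2) + 2 * Bc"

text \<open>
  Times less than \<open>h\<close> steps before the right boundary, at which \<open>R_ratio\<close> is not available: the filter
  may even vanish there, since the transition density has no lower bound in fewer than \<open>h\<close> steps.
\<close>

definition late where "late u t \<longleftrightarrow> u < n \<and> u + 1 < t + h"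

text \<open>
  The function \<open>d\<close> for \<open>pg_kernel_lower_bound\<close>. Far from the right boundary it is \<open>K ^ (u - t)\<close> times the
  normalising mass. At late times the supremum of the weights cannot be compared with their mean; there
  the recursion is solved with the uniform bound \<open>\<Lambda>\<close> for the supremum, which gives a multiple of the mass
  for the \<open>N - 2\<close> averaged particles and a multiple of \<open>\<Lambda>\<close> for the rest.
\<close>

definition envelope where
  "envelope x u t z = (if late u t
     then of_nat ((N - 2) ^ (u - t)) * tot x u t z + of_nat (N ^ (u - t) - (N - 2) ^ (u - t)) * \<Lambda> u t
     else K ^ (u - t) * tot x u t z)"

definition bound where
  "bound x u t = (if late u t then of_nat (N ^ (u - t)) * \<Lambda> u (t - 1)
     else K ^ (u - t) * (SUP z\<in>space S. g t z * R x u t z))"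

lemma N2: "N = (N - 2) + 2" using N by simp

lemma K_fin: "K \<noteq> \<top>" by (simp add: K_def Bc_def ennreal_mult_eq_top_iff)

lemma \<Lambda>_fin: "\<Lambda> u t \<noteq> \<top>"
proof -
  have "(\<Prod>r\<in>A. D * \<gamma> r) \<noteq> \<top>" if "finite A" for A
    using that by (induction A) (auto simp: ennreal_mult_eq_top_iff D_fin \<gamma>_fin)
  then show ?thesis by (simp add: \<Lambda>_def ennreal_mult_eq_top_iff)
qed

lemma \<Lambda>_pos: "t < u \<Longrightarrow> u \<le> n \<Longrightarrow> \<Lambda> u t \<noteq> 0"
  using \<gamma>_pos D_ge \<sigma>p by (auto simp: \<Lambda>_def ennreal_eq_0_iff)

lemma \<Lambda>_step: "1 \<le> t \<Longrightarrow> t \<le> u \<Longrightarrow> \<Lambda> u (t - 1) = D * \<gamma> t * \<Lambda> u t"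
proof -
  assume "1 \<le> t" "t \<le> u"
  then have "{t - 1<..u} = insert t {t<..u}" by auto
  then show ?thesis by (simp add: \<Lambda>_def ac_simps)
qed

lemma R_le_\<Lambda>:
  assumes "x \<in> space X" "u < n" "t \<le> u" "v \<in> space S"
  shows "R x u t v \<le> \<Lambda> u t"
proof -
  have xu: "x (u + 1) \<in> space S" using assms by (intro comp_space[of x]) auto
  have "R x u t v \<le> D ^ (u - t) * (\<Prod>r\<in>{t<..u}. \<gamma> r) * step_dens S m (u - t) v (x (u + 1))"
    by (rule R_right(2)[OF assms])
  also have "\<dots> \<le> D ^ (u - t) * (\<Prod>r\<in>{t<..u}. \<gamma> r) * ennreal \<sigma>p" by (intro mult_left_mono step_le assms xu) auto
  also have "\<dots> = \<Lambda> u t" by (simp add: \<Lambda>_def prod.distrib ac_simps)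
  finally show ?thesis .
qed

lemma envelope_meas: "x \<in> space X \<Longrightarrow> u \<le> n \<Longrightarrow> envelope x u t \<in> borel_measurable S"
proof -
  assume "x \<in> space X" "u \<le> n"
  from tot_meas[OF this] have [measurable]: "tot x u t \<in> borel_measurable S" .
  show ?thesis unfolding envelope_def[abs_def] by measurable
qed

lemma envelope_end: "envelope x u u z = 1"
  by (simp add: envelope_def tot_end)

text \<open>
  In the product with the particle weight the right boundary factor at \<open>t = u\<close> is absorbed into \<open>R\<close>, so
  that one formula covers the whole block.
\<close>

lemma pw_envelope:
  assumes "t \<le> u"
  shows "pw x u t z * envelope x u t z = (if late u t
     then g t z * (of_nat ((N - 2) ^ (u - t)) * R x u t z + of_nat (N ^ (u - t) - (N - 2) ^ (u - t)) * \<Lambda> u t)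
     else K ^ (u - t) * (g t z * R x u t z))"
proof (cases "late u t \<and> t < u")
  case True
  then show ?thesis by (simp add: envelope_def tot_R pw_def)
next
  case False
  have "pw x u t z * (K ^ (u - t) * tot x u t z) = K ^ (u - t) * (pw x u t z * tot x u t z)"
    by (simp add: ac_simps)
  then show ?thesis using False assms pw_tot[OF assms, of x z]
    by (cases "t = u") (auto simp: envelope_def)
qed

lemma pw_envelope_le:
  assumes x: "x \<in> space X" and u: "1 \<le> t" "t \<le> u" "u \<le> n" and z: "z \<in> space S"
  shows "pw x u t z * envelope x u t z \<le> bound x u t"
proof (cases "late u t")
  case True
  have tI: "t \<in> {1..n}" using u by auto
  have "pw x u t z * envelope x u t z
     = g t z * (of_nat ((N - 2) ^ (u - t)) * R x u t z + of_nat (N ^ (u - t) - (N - 2) ^ (u - t)) * \<Lambda> u t)"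
    using pw_envelope[OF u(2)] True by simp
  also have "\<dots> \<le> (D * \<gamma> t) * (of_nat ((N - 2) ^ (u - t)) * \<Lambda> u t + of_nat (N ^ (u - t) - (N - 2) ^ (u - t)) * \<Lambda> u t)"
    using True by (intro mult_mono add_mono mult_left_mono g_le tI z R_le_\<Lambda> x u) (auto simp: late_def)
  also have "\<dots> = of_nat ((N - 2) ^ (u - t) + (N ^ (u - t) - (N - 2) ^ (u - t))) * \<Lambda> u (t - 1)"
    unfolding \<Lambda>_step[OF u(1,2)] by (simp add: algebra_simps)
  also have "(N - 2) ^ (u - t) + (N ^ (u - t) - (N - 2) ^ (u - t)) = N ^ (u - t)"
    by (simp add: power_mono)
  finally show ?thesis using True by (simp add: bound_def)
next
  case False
  then show ?thesis unfolding pw_envelope[OF u(2)] bound_def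
    using z by (auto intro!: mult_left_mono SUP_upper)
qed

lemma early_iff: "1 \<le> t \<Longrightarrow> u \<le> n \<Longrightarrow> \<not> late u t \<longleftrightarrow> u = n \<or> t + h \<le> u + 1"
  by (auto simp: late_def)

lemma early_average:
  assumes x: "x \<in> space X" and u: "1 \<le> t" "t \<le> u" "u \<le> n" "\<not> late u t"
    and q: "q \<in> borel_measurable S" "(\<integral>\<^sup>+z. q z \<partial>S) = 1"
  shows "bound x u t + bound x u t + of_nat (N - 2) * (\<integral>\<^sup>+z. q z * (pw x u t z * envelope x u t z) \<partial>S)
    \<le> K ^ (u - t + 1) * (\<integral>\<^sup>+z. q z * (g t z * R x u t z) \<partial>S)"
proof -
  define J where "J = (\<integral>\<^sup>+z. q z * (g t z * R x u t z) \<partial>S)"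
  define G where "G = (SUP z\<in>space S. g t z * R x u t z)"
  have [measurable]: "g t \<in> borel_measurable S" using u by (intro g_meas) auto
  note [measurable] = q(1) R_meas[OF x u(3), of t]
  have G: "G \<le> Bc * J" unfolding G_def J_def
    by (rule gR_average[OF x u(1-3) _ q]) (use u early_iff in auto)
  have "(\<integral>\<^sup>+z. q z * (pw x u t z * envelope x u t z) \<partial>S) = (\<integral>\<^sup>+z. K ^ (u - t) * (q z * (g t z * R x u t z)) \<partial>S)"
    unfolding pw_envelope[OF u(2)] using u(4) by (simp add: ac_simps)
  also have "\<dots> = K ^ (u - t) * J" unfolding J_def by (rule nn_integral_cmult) measurable
  finally have "bound x u t + bound x u t + of_nat (N - 2) * (\<integral>\<^sup>+z. q z * (pw x u t z * envelope x u t z) \<partial>S)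
     = K ^ (u - t) * (G + G + of_nat (N - 2) * J)"
    using u(4) by (simp add: bound_def G_def algebra_simps)
  also have "\<dots> \<le> K ^ (u - t) * (Bc * J + Bc * J + of_nat (N - 2) * J)"
    by (intro mult_left_mono add_mono G) auto
  also have "\<dots> = K ^ (u - t + 1) * J"
    unfolding K_def by (simp add: algebra_simps mult_2)
  finally show ?thesis unfolding J_def .
qed

lemma late_average:
  assumes x: "x \<in> space X" and u: "1 < t" "t \<le> u" "u \<le> n" "late u t" and v: "v \<in> space S"
  shows "bound x u t + bound x u t + of_nat (N - 2) * (\<integral>\<^sup>+z. m v z * (pw x u t z * envelope x u t z) \<partial>S)
    \<le> of_nat ((N - 2) ^ (u - t + 1)) * tot x u (t - 1) v
      + of_nat (N ^ (u - t + 1) - (N - 2) ^ (u - t + 1)) * \<Lambda> u (t - 1)"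
proof -
  have tI: "t \<in> {1..n}" using u by auto
  note [measurable] = R_meas[OF x u(3), of t] g_meas[OF tI] v
  define k where "k = u - t"
  define q where "q = N - 2"
  define c where "c = N ^ k - q ^ k"
  have c: "N ^ k = q ^ k + c" unfolding c_def q_def by (simp add: power_mono)
  have c': "N ^ (k + 1) - q ^ (k + 1) = 2 * N ^ k + q * c"
  proof -
    have "N ^ (k + 1) = (q + 2) * N ^ k" using N2 by (simp add: q_def)
    also have "\<dots> = q * (q ^ k + c) + 2 * N ^ k" using c by (simp add: algebra_simps)
    finally show ?thesis by (simp add: algebra_simps)
  qed
  have "(\<integral>\<^sup>+z. m v z * (pw x u t z * envelope x u t z) \<partial>S)
      \<le> (\<integral>\<^sup>+z. of_nat (q ^ k) * (m v z * (g t z * R x u t z)) + m v z * (of_nat c * \<Lambda> u (t - 1)) \<partial>S)"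
  proof (rule nn_integral_mono)
    fix z assume z: "z \<in> space S"
    have "m v z * (pw x u t z * envelope x u t z) =
       of_nat (q ^ k) * (m v z * (g t z * R x u t z)) + m v z * (of_nat c * (g t z * \<Lambda> u t))"
      unfolding pw_envelope[OF u(2)] using u(4) by (simp add: k_def q_def c_def algebra_simps)
    also have "\<dots> \<le> of_nat (q ^ k) * (m v z * (g t z * R x u t z)) + m v z * (of_nat c * (D * \<gamma> t * \<Lambda> u t))"
      by (intro add_left_mono mult_left_mono mult_right_mono g_le tI z) auto
    finally show "m v z * (pw x u t z * envelope x u t z) \<le>
      of_nat (q ^ k) * (m v z * (g t z * R x u t z)) + m v z * (of_nat c * \<Lambda> u (t - 1))"
      using \<Lambda>_step[of t u] u by simp
  qed
  also have "\<dots> = of_nat (q ^ k) * tot x u (t - 1) v + of_nat c * \<Lambda> u (t - 1)"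
  proof -
    have "tot x u (t - 1) v = (\<integral>\<^sup>+z. m v z * (g t z * R x u t z) \<partial>S)"
      using tot_int[of "t - 1" u x v] u by simp
    moreover have "(\<integral>\<^sup>+z. m v z * (of_nat c * \<Lambda> u (t - 1)) \<partial>S) = of_nat c * \<Lambda> u (t - 1)"
      using m_int[OF v] by (subst nn_integral_multc) auto
    ultimately show ?thesis by (simp add: nn_integral_add nn_integral_cmult)
  qed
  finally have "bound x u t + bound x u t + of_nat (N - 2) * (\<integral>\<^sup>+z. m v z * (pw x u t z * envelope x u t z) \<partial>S)
    \<le> bound x u t + bound x u t + of_nat q * (of_nat (q ^ k) * tot x u (t - 1) v + of_nat c * \<Lambda> u (t - 1))"
    unfolding q_def by (intro add_left_mono mult_left_mono) auto
  also have "\<dots> = of_nat (q ^ (k + 1)) * tot x u (t - 1) v + of_nat (2 * N ^ k + q * c) * \<Lambda> u (t - 1)"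
    using u(4) by (simp add: bound_def k_def[symmetric] algebra_simps mult_2)
  finally show ?thesis unfolding c'[symmetric] unfolding k_def q_def .
qed

text \<open>
  Within either regime the recursion holds by construction. At the first time that is not late, exactly
  \<open>h\<close> steps before the right boundary, the \<open>h\<close>-step lower bound makes \<open>\<Lambda>\<close> comparable with the
  normalising mass at last, and \<open>power_split_le\<close> shows that all late steps together have cost no more
  than a power of \<open>K\<close>.
\<close>

lemma envelope_step:
  assumes x: "x \<in> space X" and u: "1 < t" "t \<le> u" "u \<le> n" and v: "v \<in> space S"
  shows "bound x u t + bound x u t + of_nat (N - 2) * (\<integral>\<^sup>+z. m v z * (pw x u t z * envelope x u t z) \<partial>S)
    \<le> envelope x u (t - 1) v"
proof (cases "late u t")
  case False
  have [measurable]: "(\<lambda>z. m v z) \<in> borel_measurable S" using v by measurable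
  have "\<not> late u (t - 1)" using False by (auto simp: late_def)
  moreover have "tot x u (t - 1) v = (\<integral>\<^sup>+z. m v z * (g t z * R x u t z) \<partial>S)"
    using tot_int[of "t - 1" u x v] u by simp
  moreover have "u - (t - 1) = u - t + 1" using u by simp
  ultimately show ?thesis
    using early_average[OF x _ u(2,3) False _ m_int[OF v]] u by (simp add: envelope_def)
next
  case True
  have ut: "u - (t - 1) = u - t + 1" using u by simp
  note la = late_average[OF x u True v]
  show ?thesis
  proof (cases "late u (t - 1)")
    case True
    then show ?thesis using la unfolding envelope_def ut by simp
  next
    case False
    then have u': "u < n" "t + h = u + 2" using True u by (auto simp: late_def)
    have k: "u - (t - 1) = h - 1" "h - 1 \<le> u - (t - 1)" using u' u by auto
    have xu: "x (u + 1) \<in> space S" using u' by (intro comp_space[OF x]) auto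
    have "\<Lambda> u (t - 1) \<le> Bc * tot x u (t - 1) v"
    proof (rule Bc_cancel)
      define G where "G = (\<Prod>r\<in>{t - 1<..u}. \<gamma> r)"
      have "ennreal \<sigma>m * \<Lambda> u (t - 1) = D ^ (h - 1) * ennreal \<sigma>p * (G * ennreal \<sigma>m)"
        using k(1) unfolding \<Lambda>_def G_def by (simp add: prod.distrib ac_simps)
      also have "\<dots> \<le> D * (D ^ (h - 1) * ennreal \<sigma>p) * (G * step_dens S m (u - (t - 1)) v (x (u + 1)))"
      proof (rule mult_mono)
        show "D ^ (h - 1) * ennreal \<sigma>p \<le> D * (D ^ (h - 1) * ennreal \<sigma>p)"
          using mult_right_mono[OF D_ge, of "D ^ (h - 1) * ennreal \<sigma>p"] by simp
        show "G * ennreal \<sigma>m \<le> G * step_dens S m (u - (t - 1)) v (x (u + 1))"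
          by (intro mult_left_mono step_ge v xu k) auto
      qed auto
      also have "\<dots> \<le> D * (D ^ (h - 1) * ennreal \<sigma>p) * tot x u (t - 1) v"
        using R_right(1)[OF x u'(1) _ v, of "t - 1"] u tot_R[of "t - 1" u x v] unfolding G_def by (intro mult_left_mono) auto
      finally show "ennreal \<sigma>m * \<Lambda> u (t - 1) \<le> ennreal (\<delta> * \<sigma>p) * tot x u (t - 1) v" unfolding D_h .
    qed
    then have "of_nat ((N - 2) ^ (u - t + 1)) * tot x u (t - 1) v
      + of_nat (N ^ (u - t + 1) - (N - 2) ^ (u - t + 1)) * \<Lambda> u (t - 1)
      \<le> of_nat ((N - 2) ^ (u - t + 1)) * tot x u (t - 1) v
      + of_nat (N ^ (u - t + 1) - (N - 2) ^ (u - t + 1)) * (Bc * tot x u (t - 1) v)"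
      by (intro add_left_mono mult_left_mono) auto
    also have "\<dots> = (of_nat ((N - 2) ^ (u - t + 1)) + of_nat (((N - 2) + 2) ^ (u - t + 1) - (N - 2) ^ (u - t + 1)) * Bc) * tot x u (t - 1) v"
      using N2 by (simp add: distrib_right mult.assoc)
    also have "\<dots> \<le> K ^ (u - t + 1) * tot x u (t - 1) v"
      unfolding K_def by (intro mult_right_mono power_split_le Bc_ge) auto
    also have "\<dots> = envelope x u (t - 1) v" unfolding envelope_def ut using False by simp
    finally show ?thesis using la by (rule order_trans[rotated])
  qed
qed

lemma ideal_one_bounds:
  assumes x: "x \<in> space X" and su: "1 \<le> s" "s \<le> u" "u \<le> n" and early: "u = n \<or> s + h \<le> u + 1"
  shows "ideal s u (\<lambda>_. 1) x \<noteq> 0" "ideal s u (\<lambda>_. 1) x \<noteq> \<top>"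
proof -
  have sI: "s \<in> {1..n}" using su by auto
  note [measurable] = lft_meas[OF x sI] R_meas[OF x su(3), of s] g_meas[OF sI] pw_meas[OF x sI]
  obtain v where v: "v \<in> space S" using not_empty by auto
  have "g s v * R x u s v \<noteq> 0" using R_pos[OF x su(2,3) early v] \<gamma>_pos[OF sI] g_ge[OF v, of s] by auto
  moreover have "g s v * R x u s v \<le> Bc * ideal s u (\<lambda>_. 1) x"
    unfolding ideal_one[OF x su]
    by (rule order_trans[OF SUP_upper[OF v] gR_average[OF x su early _ lft_int[OF x sI]]]) measurable
  ultimately show "ideal s u (\<lambda>_. 1) x \<noteq> 0" by auto
  have "ideal s u (\<lambda>_. 1) x \<le> (\<integral>\<^sup>+z. lft x s z * (Bc * (g s v * R x u s v)) \<partial>S)"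
    unfolding ideal_one[OF x su] by (intro nn_integral_mono mult_left_mono gR_ratio x su early v) auto
  also have "\<dots> = Bc * (g s v * R x u s v)" by (subst nn_integral_multc) (auto simp: lft_int[OF x sI])
  also have "\<dots> = Bc * (pw x u s v * tot x u s v)" using pw_tot[OF su(2)] by simp
  also have "\<dots> < \<top>"
  proof -
    have "pw x u s v \<noteq> \<top>" using pw_le[OF x sI v, of u] W_fin[of s] by (auto simp: top_unique)
    then show ?thesis using tot_fin[OF x su v]
      by (simp add: Bc_def less_top[symmetric] ennreal_mult_eq_top_iff)
  qed
  finally show "ideal s u (\<lambda>_. 1) x \<noteq> \<top>" by simp
qed

lemma ideal_le:
  assumes x: "x \<in> space X" and su: "1 \<le> s" "s \<le> u" "u \<le> n"
    and F: "F \<in> borel_measurable X" "\<And>v. v \<in> space X \<Longrightarrow> F v \<le> C"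
  shows "ideal s u F x \<le> C * ideal s u (\<lambda>_. 1) x"
proof -
  have sI: "s \<in> {1..n}" using su by auto
  note [measurable] = lft_meas[OF x sI] R_meas[OF x su(3), of s] g_meas[OF sI]
  have "ideal s u F x \<le> (\<integral>\<^sup>+z. C * (lft x s z * (g s z * R x u s z)) \<partial>S)"
    unfolding ideal_def
  proof (rule nn_integral_mono)
    fix z assume z: "z \<in> space S"
    have "fut x u s F (x(s := z)) \<le> C * tot x u s z"
      using fut_le[OF x su upd_space[OF x sI z] F] by simp
    then have "lft x s z * pw x u s z * fut x u s F (x(s := z)) \<le> lft x s z * pw x u s z * (C * tot x u s z)"
      by (rule mult_left_mono) simp
    also have "\<dots> = C * (lft x s z * (pw x u s z * tot x u s z))" by (simp add: ac_simps)
    finally show "lft x s z * pw x u s z * fut x u s F (x(s := z)) \<le> C * (lft x s z * (g s z * R x u s z))"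
      unfolding pw_tot[OF su(2)] .
  qed
  also have "\<dots> = C * ideal s u (\<lambda>_. 1) x" unfolding ideal_one[OF x su] by (rule nn_integral_cmult) measurable
  finally show ?thesis .
qed

text \<open>
  Particle Gibbs dominates the normalised ideal update up to the factor \<open>((N - 1) / K) ^ (u - s + 1)\<close>:
  each time step contributes \<open>N - 1\<close> free particles and a factor \<open>K\<close> in the denominator. The block must be
  long enough for its first time not to be late, or end at the time horizon.
\<close>

theorem pg_minorisation:
  assumes x: "x \<in> space X" and su: "1 \<le> s" "s \<le> u" "u \<le> n" and early: "u = n \<or> s + h \<le> u + 1"
    and F: "F \<in> borel_measurable X" "\<And>v. v \<in> space X \<Longrightarrow> F v \<le> C" "C \<noteq> \<top>"
  shows "of_nat (N - 1) ^ (u - s + 1) * ideal s u F x / (K ^ (u - s + 1) * ideal s u (\<lambda>_. 1) x)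
     \<le> (\<integral>\<^sup>+\<zeta>. F (over s u x \<zeta>) \<partial>pg_kernel H n y N s u x)"
proof (rule pg_kernel_lower_bound[where d="envelope x u" and B="bound x u", OF x su F envelope_meas[OF x su(3)] envelope_end])
  have sI: "s \<in> {1..n}" using su by auto
  have es: "\<not> late u s" using early early_iff su by auto
  note ib = ideal_one_bounds[OF x su early]
  have K0: "K \<noteq> 0" using Bc_ge by (auto simp: K_def)
  show "bound x u s + bound x u s + of_nat (N - 2) * (\<integral>\<^sup>+z. lft x s z * (pw x u s z * envelope x u s z) \<partial>S)
     \<le> K ^ (u - s + 1) * ideal s u (\<lambda>_. 1) x"
    unfolding ideal_one[OF x su] by (rule early_average[OF x su es lft_meas[OF x sI] lft_int[OF x sI]])
  show "K ^ (u - s + 1) * ideal s u (\<lambda>_. 1) x \<noteq> 0" using K0 ib by simp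
  show "K ^ (u - s + 1) * ideal s u (\<lambda>_. 1) x \<noteq> \<top>"
    using K_fin ib by (simp add: ennreal_mult_eq_top_iff power_eq_top_ennreal)
  show "ideal s u F x \<noteq> \<top>" using ideal_le[OF x su F(1,2)] ib F(3)
    by (auto simp: top_unique ennreal_mult_eq_top_iff)
  show "pw x u t z * envelope x u t z \<le> bound x u t" if "t \<in> {s..u}" "z \<in> space S" for t z
    using that su by (intro pw_envelope_le x) auto
  show "bound x u t + bound x u t + of_nat (N - 2) * (\<integral>\<^sup>+z. m v z * (pw x u t z * envelope x u t z) \<partial>S)
    \<le> envelope x u (t - 1) v" if "t \<in> {s<..u}" "v \<in> space S" for t v
    using that su by (intro envelope_step x) auto
  show "envelope x u t v \<noteq> 0" if "t \<in> {s..<u}" "v \<in> space S" for t v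
  proof (cases "late u t")
    case True
    have "(N - 2) ^ (u - t) < N ^ (u - t)" using N that by (intro power_strict_mono) auto
    then show ?thesis using True \<Lambda>_pos[of t u] that su N by (auto simp add: envelope_def)
  next
    case False
    then show ?thesis using R_pos[OF x, of t u v] tot_R[of t u x v] that su early_iff[of t u] K0 by (auto simp: envelope_def)
  qed
  show "envelope x u t v \<noteq> \<top>" if "t \<in> {s..<u}" "v \<in> space S" for t v
    using tot_fin[OF x _ _ su(3) that(2), of t] that su K_fin \<Lambda>_fin
    by (auto simp: envelope_def ennreal_mult_eq_top_iff power_eq_top_ennreal of_nat_power[symmetric] simp del: of_nat_power)
qed

end

section \<open>The ideal block update forgets its boundary\<close>

context pg_model begin

definition block_weight where
  "block_weight s u x v = lft x s (v s) * (g s (v s) * (chain_weight m g s [s + 1..<u + 1] v * rgt x u (v u)))"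

lemma pw_chain_weight:
  "t \<le> u \<Longrightarrow> pw x u t (v t) * chain_weight m (pw x u) t [t + 1..<u + 1] v
     = g t (v t) * (chain_weight m g t [t + 1..<u + 1] v * rgt x u (v u))"
proof (induction t rule: inc_induct)
  case base
  then show ?case by (simp add: pw_def)
next
  case (step t)
  have e: "[t + 1..<u + 1] = (t + 1) # [t + 1 + 1..<u + 1]" using step by (intro upt_step) auto
  have "pw x u t (v t) = g t (v t)" using step by (simp add: pw_def)
  then show ?case unfolding e using step.IH by (simp add: mult.assoc del: upt_Suc)
qed

lemma block_weight_meas:
  assumes x: "x \<in> space X" and su: "1 \<le> s" "s \<le> u" "u \<le> n"
  shows "block_weight s u x \<in> borel_measurable X"
proof -
  have sI: "s \<in> {1..n}" "u \<in> {1..n}" using su by auto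
  have 1: "chain_weight m g s [s + 1..<u + 1] \<in> borel_measurable X"
    using su by (intro chain_weight_measurable m_meas g_meas) auto
  show ?thesis unfolding block_weight_def[abs_def]
    by (intro borel_measurable_times_ennreal 1 coord_measurable sI lft_meas rgt_meas g_meas x)
qed

lemma ideal_iter:
  assumes x: "x \<in> space X" and su: "1 \<le> s" "s \<le> u" "u \<le> n" and F [measurable]: "F \<in> borel_measurable X"
  shows "ideal s u F x = iter S [s..<u + 1] (\<lambda>v. block_weight s u x v * F v) x"
proof -
  have sI: "s \<in> {1..n}" using su by auto
  have e: "[s..<u + 1] = s # [s + 1..<u + 1]" using su by (simp add: upt_conv_Cons)
  have 1: "chain_weight m (pw x u) s [s + 1..<u + 1] \<in> borel_measurable X"
    using su by (intro chain_weight_measurable m_meas pw_meas x) auto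
  have 2: "(\<lambda>v. chain_weight m (pw x u) s [s + 1..<u + 1] v * F v) \<in> borel_measurable X"
    by (intro borel_measurable_times_ennreal 1 F)
  show ?thesis unfolding e iter.simps ideal_def
  proof (rule nn_integral_cong)
    fix z assume z: "z \<in> space S"
    have xz: "x(s := z) \<in> space X" by (rule upd_space[OF x sI z])
    have sub: "set [s + 1..<u + 1] \<subseteq> {1..n}" using su by auto
    have "iter S [s + 1..<u + 1] (\<lambda>v. block_weight s u x v * F v) (x(s := z)) =
       iter S [s + 1..<u + 1] (\<lambda>v. (lft x s z * pw x u s z) * (chain_weight m (pw x u) s [s + 1..<u + 1] v * F v)) (x(s := z))"
    proof (rule iter_cong[OF sub xz])
      fix v assume "\<And>i. i \<notin> set [s + 1..<u + 1] \<Longrightarrow> v i = (x(s := z)) i"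
      from this[of s] have vs: "v s = z" by simp
      show "block_weight s u x v * F v = (lft x s z * pw x u s z) * (chain_weight m (pw x u) s [s + 1..<u + 1] v * F v)"
        unfolding block_weight_def unfolding pw_chain_weight[OF su(2), of x v, symmetric] unfolding vs by (simp only: mult.assoc)
    qed
    also have "\<dots> = (lft x s z * pw x u s z) * fut x u s F (x(s := z))"
      unfolding fut_def by (rule iter_cmult[OF sub 2 xz])
    finally show "lft x s z * pw x u s z * fut x u s F (x(s := z)) = iter S [s + 1..<u + 1] (\<lambda>v. block_weight s u x v * F v) (x(s := z))"
      by simp
  qed
qed

lemma rgt_int_fin: "x \<in> space X \<Longrightarrow> (\<integral>\<^sup>+z. rgt x u z \<partial>S) \<noteq> \<top>"
proof -
  assume x: "x \<in> space X"
  have "(\<integral>\<^sup>+z. rgt x u z \<partial>S) \<le> (\<integral>\<^sup>+z. ennreal \<sigma>p + 1 \<partial>S)"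
  proof (rule nn_integral_mono)
    fix z assume z: "z \<in> space S"
    show "rgt x u z \<le> ennreal \<sigma>p + 1"
      using m_le[OF z, of "x (u + 1)"] comp_space[OF x, of "u + 1"] add_increasing2[of 1 "m z (x (u + 1))" "ennreal \<sigma>p"]
      by (auto simp: rgt_def)
  qed
  then show ?thesis by (auto simp: emeasure_space_1 top_unique)
qed

text \<open>
  Given its boundary, the block is a chain started at the left neighbour \<open>s - 1\<close>, with observation
  densities as potentials and the right boundary as terminal potential, so \<open>chain_contraction\<close> applies.
\<close>

lemma ideal_contraction_left:
  assumes x: "x \<in> space X" "x' \<in> space X" and su: "1 < s" "s \<le> u" "u \<le> n"
    and right: "u < n \<Longrightarrow> x (u + 1) = x' (u + 1)"
    and F [measurable]: "F \<in> borel_measurable X" and M: "\<And>v. v \<in> space X \<Longrightarrow> F v \<le> M"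
    and A: "finite A"
    and hyp: "\<And>v v' k. v \<in> space X \<Longrightarrow> v' \<in> space X \<Longrightarrow> (\<And>i. i \<notin> {s..u} \<Longrightarrow> v i = x i)
       \<Longrightarrow> (\<And>i. i \<notin> {s..u} \<Longrightarrow> v' i = x' i) \<Longrightarrow> (\<And>i. i \<in> {s + k..u} \<Longrightarrow> v i = v' i)
       \<Longrightarrow> F v \<le> F v' + (\<Sum>g | g \<in> A \<and> d g \<le> k. c g)"
  shows "ideal s u F x * ideal s u (\<lambda>_. 1) x' \<le> ideal s u F x' * ideal s u (\<lambda>_. 1) x
     + (\<Sum>g\<in>A. c g * ennreal (1 - \<theta>) ^ (d g div h)) * ideal s u (\<lambda>_. 1) x * ideal s u (\<lambda>_. 1) x'"
proof -
  define l where "l = [s..<u + 1]"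
  have l: "set l = {s..u}" "distinct l" "length l = u - s + 1" "last ((s - 1) # l) = u" "\<And>t. t < length l \<Longrightarrow> l ! t = s + t"
    using su by (auto simp: l_def simp del: upt_Suc)
  have e: "[s..<u + 1] = s # [s + 1..<u + 1]" using su by (simp add: upt_conv_Cons)
  interpret FC: mixing_chain S "{1..n}" m g \<gamma> D "ennreal \<sigma>m" "ennreal \<sigma>p" "ennreal \<sigma>p" "ennreal \<theta>" "ennreal (1 - \<theta>)" "rgt x u" h
  proof (rule forward_chain[OF rgt_meas[OF x(1)] _ rgt_int_fin[OF x(1)]])
    show "rgt x u z \<noteq> \<top>" for z by (auto simp: rgt_def m_def)
  qed
  have same: "rgt x u = rgt x' u" using right by (auto simp: rgt_def fun_eq_iff)
  have eq: "ideal s u G v = FC.chain_int G (s - 1) l v"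
    if [measurable]: "G \<in> borel_measurable X" and v: "v \<in> space X" "rgt v u = rgt x u" for G v
    unfolding ideal_iter[OF v(1) _ su(2,3) that(1), OF less_imp_le[OF su(1)]] FC.chain_int_def FC.end_weight_def l(4)
    unfolding l_def[symmetric]
  proof (rule iter_cong)
    fix w assume "\<And>i. i \<notin> set l \<Longrightarrow> w i = v i"
    from this[of "s - 1"] have w: "w (s - 1) = v (s - 1)" using su by (auto simp: l)
    have "chain_weight m g (s - 1) l w = m (w (s - 1)) (w s) * (g s (w s) * chain_weight m g s [s + 1..<u + 1] w)"
      unfolding l_def e by (simp add: mult.assoc del: upt_Suc)
    then show "block_weight s u v w * G w = chain_weight m g (s - 1) l w * (rgt x u (w u) * G w)"
      unfolding block_weight_def v(2) w using su by (simp add: lft_def mult.assoc del: upt_Suc)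
  qed (use su v in \<open>auto simp: l\<close>)
  have "FC.chain_int F (s - 1) l x * FC.chain_int (\<lambda>_. 1) (s - 1) l x' \<le> FC.chain_int F (s - 1) l x' * FC.chain_int (\<lambda>_. 1) (s - 1) l x
     + (\<Sum>g\<in>A. c g * ennreal (1 - \<theta>) ^ (d g div h)) * FC.chain_int (\<lambda>_. 1) (s - 1) l x * FC.chain_int (\<lambda>_. 1) (s - 1) l x'"
  proof (rule FC.chain_contraction[OF _ _ x F F M M A])
    show "set ((s - 1) # l) \<subseteq> {1..n}" "distinct ((s - 1) # l)" using su by (auto simp: l)
    fix v v' k assume v: "v \<in> space X" "v' \<in> space X" "\<And>i. i \<notin> set l \<Longrightarrow> v i = x i" "\<And>i. i \<notin> set l \<Longrightarrow> v' i = x' i"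
      and k: "k \<le> length l" and agree: "\<And>t. k \<le> t \<Longrightarrow> t < length l \<Longrightarrow> v (l ! t) = v' (l ! t)"
    show "F v \<le> F v' + (\<Sum>g | g \<in> A \<and> d g \<le> k. c g)"
    proof (rule hyp[OF v(1,2)])
      fix i assume i: "i \<in> {s + k..u}"
      then have "k \<le> i - s" "i - s < length l" "s + (i - s) = i" using l(3) by auto
      then show "v i = v' i" using agree[of "i - s"] l(5)[of "i - s"] by simp
    qed (use v(3,4) l in auto)
  qed
  then show ?thesis
    unfolding eq[OF F x(1) refl] eq[OF F x(2) same[symmetric]]
      eq[OF borel_measurable_const x(1) refl] eq[OF borel_measurable_const x(2) same[symmetric]] .
qed

lemma chain_weight_rev:
  assumes "s \<le> u"
  shows "chain_weight (\<lambda>x z. m z x) g (u + 1) (rev [s..<u + 1]) v =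
     g s (v s) * (chain_weight m g s [s + 1..<u + 1] v * m (v u) (v (u + 1)))"
  using assms
proof (induction u rule: dec_induct)
  case base
  then show ?case by (simp add: mult.commute)
next
  case (step u)
  have 1: "rev [s..<Suc u + 1] = Suc u # rev [s..<u + 1]" using step by simp
  have 2: "[s + 1..<Suc u + 1] = [s + 1..<u + 1] @ [Suc u]" using step by simp
  have 3: "last (s # [s + 1..<u + 1]) = u" using step by (cases "s = u") (auto simp: last_upt)
  have "chain_weight m g s [s + 1..<Suc u + 1] v = chain_weight m g s [s + 1..<u + 1] v * (m (v u) (v (Suc u)) * g (Suc u) (v (Suc u)))"
    unfolding 2 chain_weight_append 3 by simp
  then show ?case unfolding 1 chain_weight.simps using step.IH by (simp add: ac_simps del: upt_Suc)
qed

text \<open>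
  For a change at the right neighbour the chain is read backwards, starting at \<open>u + 1\<close>; the left boundary
  becomes the terminal potential.
\<close>

lemma ideal_contraction_right:
  assumes x: "x \<in> space X" "x' \<in> space X" and su: "1 \<le> s" "s \<le> u" "u < n"
    and left: "1 < s \<Longrightarrow> x (s - 1) = x' (s - 1)"
    and F [measurable]: "F \<in> borel_measurable X" and M: "\<And>v. v \<in> space X \<Longrightarrow> F v \<le> M"
    and A: "finite A"
    and hyp: "\<And>v v' k. v \<in> space X \<Longrightarrow> v' \<in> space X \<Longrightarrow> (\<And>i. i \<notin> {s..u} \<Longrightarrow> v i = x i)
       \<Longrightarrow> (\<And>i. i \<notin> {s..u} \<Longrightarrow> v' i = x' i) \<Longrightarrow> (\<And>i. i \<in> {s..u} \<Longrightarrow> i + k \<le> u \<Longrightarrow> v i = v' i)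
       \<Longrightarrow> F v \<le> F v' + (\<Sum>g | g \<in> A \<and> d g \<le> k. c g)"
  shows "ideal s u F x * ideal s u (\<lambda>_. 1) x' \<le> ideal s u F x' * ideal s u (\<lambda>_. 1) x
     + (\<Sum>g\<in>A. c g * ennreal (1 - \<theta>) ^ (d g div h)) * ideal s u (\<lambda>_. 1) x * ideal s u (\<lambda>_. 1) x'"
proof -
  define l where "l = rev [s..<u + 1]"
  have sI: "s \<in> {1..n}" using su by auto
  have l: "set l = {s..u}" "distinct l" "length l = u - s + 1"
    using su by (auto simp: l_def simp del: upt_Suc)
  have l_nth: "l ! t = u - t" if "t < length l" for t
    using that su unfolding l_def by (subst rev_nth) (auto simp del: upt_Suc)
  have l_last: "last ((u + 1) # l) = s"
    using su by (simp add: l_def upt_conv_Cons del: upt_Suc)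
  interpret RC: mixing_chain S "{1..n}" "\<lambda>x z. m z x" g \<gamma> D "ennreal \<sigma>m" "ennreal \<sigma>p" "ennreal \<sigma>p" "ennreal \<theta>" "ennreal (1 - \<theta>)" "lft x s" h
  proof (rule reversed_chain[OF lft_meas[OF x(1) sI]])
    show "lft x s z \<noteq> \<top>" for z by (auto simp: lft_def m_def mu_def)
    show "(\<integral>\<^sup>+z. lft x s z \<partial>S) \<noteq> \<top>" using lft_int[OF x(1) sI] by simp
  qed
  have same: "lft x s = lft x' s" using left su by (auto simp: lft_def fun_eq_iff)
  have eq: "ideal s u G v = RC.chain_int G (u + 1) l v"
    if [measurable]: "G \<in> borel_measurable X" and v: "v \<in> space X" "lft v s = lft x s" for G v
  proof -
    have "ideal s u G v = iter S l (\<lambda>w. block_weight s u v w * G w) v"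
      unfolding ideal_iter[OF v(1) su(1,2) less_imp_le[OF su(3)] that(1)]
    proof (rule iter_perm)
      show "(\<lambda>w. block_weight s u v w * G w) \<in> borel_measurable X"
        using su v by (intro borel_measurable_times_ennreal block_weight_meas that(1)) auto
    qed (use su v in \<open>auto simp: l simp del: upt_Suc\<close>)
    also have "\<dots> = RC.chain_int G (u + 1) l v"
      unfolding RC.chain_int_def RC.end_weight_def l_last
    proof (rule iter_cong)
      fix w assume "\<And>i. i \<notin> set l \<Longrightarrow> w i = v i"
      from this[of "u + 1"] have w: "w (u + 1) = v (u + 1)" by (auto simp: l)
      show "block_weight s u v w * G w = chain_weight (\<lambda>x z. m z x) g (u + 1) l w * (lft x s (w s) * G w)"
        unfolding l_def chain_weight_rev[OF su(2)] block_weight_def v(2) w using su by (simp add: rgt_def ac_simps del: upt_Suc)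
    qed (use su v in \<open>auto simp: l\<close>)
    finally show ?thesis .
  qed
  have "RC.chain_int F (u + 1) l x * RC.chain_int (\<lambda>_. 1) (u + 1) l x' \<le> RC.chain_int F (u + 1) l x' * RC.chain_int (\<lambda>_. 1) (u + 1) l x
     + (\<Sum>g\<in>A. c g * ennreal (1 - \<theta>) ^ (d g div h)) * RC.chain_int (\<lambda>_. 1) (u + 1) l x * RC.chain_int (\<lambda>_. 1) (u + 1) l x'"
  proof (rule RC.chain_contraction[OF _ _ x F F M M A])
    show "set ((u + 1) # l) \<subseteq> {1..n}" "distinct ((u + 1) # l)" using su by (auto simp: l)
    fix v v' k assume v: "v \<in> space X" "v' \<in> space X" "\<And>i. i \<notin> set l \<Longrightarrow> v i = x i" "\<And>i. i \<notin> set l \<Longrightarrow> v' i = x' i"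
      and k: "k \<le> length l" and agree: "\<And>t. k \<le> t \<Longrightarrow> t < length l \<Longrightarrow> v (l ! t) = v' (l ! t)"
    show "F v \<le> F v' + (\<Sum>g | g \<in> A \<and> d g \<le> k. c g)"
    proof (rule hyp[OF v(1,2)])
      fix i assume i: "i \<in> {s..u}" "i + k \<le> u"
      have "l ! (u - i) = i" using l_nth[of "u - i"] i l(3) by simp
      then show "v i = v' i" using agree[of "u - i"] i l(3) by simp
    qed (use v(3,4) l in auto)
  qed
  then show ?thesis
    unfolding eq[OF F x(1) refl] eq[OF F x(2) same[symmetric]]
      eq[OF borel_measurable_const x(1) refl] eq[OF borel_measurable_const x(2) same[symmetric]] .
qed

lemma ideal_cong:
  assumes x: "x \<in> space X" "x' \<in> space X" and su: "1 \<le> s" "s \<le> u" "u \<le> n"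
    and same: "\<And>i. i \<notin> {s..u} \<Longrightarrow> x i = x' i" and F: "F \<in> borel_measurable X"
  shows "ideal s u F x = ideal s u F x'"
proof -
  have l: "set [s..<u + 1] = {s..u}" "set [s..<u + 1] \<subseteq> {1..n}" using su by auto
  have "lft x s = lft x' s" "rgt x u = rgt x' u"
    using same[of "s - 1"] same[of "u + 1"] su by (auto simp: lft_def rgt_def fun_eq_iff)
  then have bw: "block_weight s u x = block_weight s u x'" by (simp add: block_weight_def fun_eq_iff)
  have *: "iter S [s..<u + 1] G v \<le> iter S [s..<u + 1] G v'"
    if v: "v \<in> space X" "v' \<in> space X" and eq: "\<And>i. i \<notin> {s..u} \<Longrightarrow> v i = v' i" for v v' G
  proof (rule iter_mono2[OF l(2) v])
    fix w w' assume "\<And>i. i \<notin> set [s..<u + 1] \<Longrightarrow> w i = v i" "\<And>i. i \<notin> set [s..<u + 1] \<Longrightarrow> w' i = v' i"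
      "\<And>i. i \<in> set [s..<u + 1] \<Longrightarrow> w i = w' i"
    then have "w = w'" using eq unfolding l by (metis ext)
    then show "G w \<le> G w'" by simp
  qed
  show ?thesis
    unfolding ideal_iter[OF x(1) su F] ideal_iter[OF x(2) su F] bw
    by (intro antisym * x) (simp_all add: same)
qed

end

section \<open>Comparison of two Particle Gibbs updates\<close>

lemma ennreal_positive_real:
  assumes "(x :: ennreal) \<noteq> 0" "x \<noteq> \<top>" obtains r where "x = ennreal r" "0 < r"
  using assms by (cases x) (auto simp: less_le)

context pg_model begin

text \<open>
  The factor of \<open>pg_minorisation\<close> for a block of length \<open>L\<close>, that is, \<open>1 - \<epsilon>\<close> in the rate.
\<close>

definition \<kappa> where "\<kappa> L = ((real N - 1) / (real N - 2 + 2 * (\<delta> * \<sigma>p / \<sigma>m))) ^ L"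

lemma B_ge: "1 \<le> \<delta> * \<sigma>p / \<sigma>m"
proof -
  have "1 * \<sigma>m \<le> \<delta> * \<sigma>p" using \<delta> \<sigma>_le \<sigma>m by (intro mult_mono) auto
  then show ?thesis using \<sigma>m by simp
qed

lemma K_real: "K = ennreal (real N - 2 + 2 * (\<delta> * \<sigma>p / \<sigma>m))"
proof -
  have two: "2 * ennreal b = ennreal (2 * b)" if "0 \<le> b" for b
    using that by (simp add: ennreal_mult)
  have "K = ennreal (real (N - 2)) + ennreal (2 * (\<delta> * \<sigma>p / \<sigma>m))"
    unfolding K_def Bc_def ennreal_of_nat_eq_real_of_nat using B_ge by (subst two) auto
  also have "\<dots> = ennreal (real (N - 2) + 2 * (\<delta> * \<sigma>p / \<sigma>m))"
    using B_ge by (subst ennreal_plus) auto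
  finally show ?thesis using N by (simp add: of_nat_diff)
qed

lemma \<kappa>: "0 \<le> \<kappa> L" "\<kappa> L \<le> 1"
proof -
  have "real N - 1 \<le> real N - 2 + 2 * (\<delta> * \<sigma>p / \<sigma>m)" using B_ge by simp
  moreover have "0 < real N - 1" using N by simp
  ultimately have "0 \<le> (real N - 1) / (real N - 2 + 2 * (\<delta> * \<sigma>p / \<sigma>m))"
    "(real N - 1) / (real N - 2 + 2 * (\<delta> * \<sigma>p / \<sigma>m)) \<le> 1" by auto
  then show "0 \<le> \<kappa> L" "\<kappa> L \<le> 1" unfolding \<kappa>_def by (auto intro: power_le_one)
qed

lemma \<kappa>_ennreal: "ennreal (\<kappa> L) * K ^ L = of_nat (N - 1) ^ L"
proof -
  have k: "0 < real N - 2 + 2 * (\<delta> * \<sigma>p / \<sigma>m)" using B_ge N by simp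
  have "ennreal (\<kappa> L) * K ^ L = ennreal (\<kappa> L * (real N - 2 + 2 * (\<delta> * \<sigma>p / \<sigma>m)) ^ L)"
    unfolding K_real using k \<kappa> by (simp add: ennreal_power ennreal_mult)
  also have "\<kappa> L * (real N - 2 + 2 * (\<delta> * \<sigma>p / \<sigma>m)) ^ L = (real N - 1) ^ L"
    unfolding \<kappa>_def power_mult_distrib[symmetric] using k by simp
  also have "ennreal ((real N - 1) ^ L) = of_nat (N - 1) ^ L"
    using N by (simp add: ennreal_power[symmetric] ennreal_of_nat_eq_real_of_nat of_nat_diff)
  finally show ?thesis .
qed

abbreviation block_mean where "block_mean s u f x \<equiv> (\<integral>v. f v \<partial>pg_block H n y N {s..u} x)"

lemma block_mean_eq:
  assumes su: "1 \<le> s" "s \<le> u" "u \<le> n" and x: "x \<in> space X" and f: "(f :: _ \<Rightarrow> real) \<in> borel_measurable X"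
  shows "block_mean s u f x = (\<integral>\<zeta>. f (over s u x \<zeta>) \<partial>pg_kernel H n y N s u x)"
proof -
  have k: "pg_kernel H n y N s u x \<in> space (prob_algebra (path H {s..u}))"
    using measurable_space[OF pg_kernel_kernel[OF su] x] .
  have MM: "Min {s..u} = s" "Max {s..u} = u" using su by (auto simp: Min_eq_iff Max_eq_iff)
  have "over s u x \<in> path H {s..u} \<rightarrow>\<^sub>M X" using x su by (intro merge_measurable[where g="\<lambda>_. x"]) auto
  then have "over s u x \<in> pg_kernel H n y N s u x \<rightarrow>\<^sub>M X"
    using k by (simp add: space_prob_algebra cong: measurable_cong_sets)
  then show ?thesis unfolding pg_block_def MM using f by (intro integral_distr)
qed

text \<open>
  By the minorisation, Particle Gibbs is a mixture that uses the ideal update with weight \<open>\<kappa>\<close>. The ideal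
  parts differ at most by \<open>C\<close>, the remainders at most by the range of \<open>f\<close>. The decomposition is never
  formed: the minorisation is applied to \<open>b - f\<close> at \<open>x\<close> and to \<open>f - a\<close> at \<open>x'\<close>, and the two resulting
  bounds are added.
\<close>

lemma block_difference:
  assumes x: "x \<in> space X" "x' \<in> space X" and su: "1 \<le> s" "s \<le> u" "u \<le> n" and early: "u = n \<or> s + h \<le> u + 1"
    and f [measurable]: "(f :: _ \<Rightarrow> real) \<in> borel_measurable X" and fB: "\<And>v. v \<in> space X \<Longrightarrow> \<bar>f v\<bar> \<le> M"
    and range: "\<And>v. v \<in> space X \<Longrightarrow> (\<forall>i. i \<notin> {s..u} \<longrightarrow> v i = x i) \<or> (\<forall>i. i \<notin> {s..u} \<longrightarrow> v i = x' i) \<Longrightarrow> a \<le> f v \<and> f v \<le> b"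
    and C: "0 \<le> C"
    and contr: "\<And>F. F = (\<lambda>v. ennreal (f v - a)) \<Longrightarrow> ideal s u F x * ideal s u (\<lambda>_. 1) x' \<le> ideal s u F x' * ideal s u (\<lambda>_. 1) x
        + ennreal C * ideal s u (\<lambda>_. 1) x * ideal s u (\<lambda>_. 1) x'"
  shows "block_mean s u f x - block_mean s u f x' \<le> \<kappa> (u - s + 1) * C + (1 - \<kappa> (u - s + 1)) * (b - a)"
proof -
  let ?L = "u - s + 1"
  define F1 where "F1 v = ennreal (f v - a)" for v
  define F2 where "F2 v = ennreal (b - f v)" for v
  have [measurable]: "F1 \<in> borel_measurable X" "F2 \<in> borel_measurable X" unfolding F1_def F2_def by measurable
  have F1B: "F1 v \<le> ennreal (M + \<bar>a\<bar>)" and F2B: "F2 v \<le> ennreal (M + \<bar>b\<bar>)" if "v \<in> space X" for v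
  proof -
    have "f v - a \<le> M + \<bar>a\<bar>" "b - f v \<le> M + \<bar>b\<bar>" using fB[OF that] by linarith+
    then show "F1 v \<le> ennreal (M + \<bar>a\<bar>)" "F2 v \<le> ennreal (M + \<bar>b\<bar>)"
      unfolding F1_def F2_def by (simp_all only: ennreal_leI)
  qed
  have ab: "a \<le> b" using range[OF x(1)] by force
  define I where "I = ideal s u (\<lambda>_. 1) x"
  define I' where "I' = ideal s u (\<lambda>_. 1) x'"
  have I: "I \<noteq> 0" "I \<noteq> \<top>" "I' \<noteq> 0" "I' \<noteq> \<top>" unfolding I_def I'_def by (intro ideal_one_bounds x su early)+
  have subl: "set [s..<u + 1] \<subseteq> {1..n}" using su by auto
  have add: "ideal s u F1 x + ideal s u F2 x = ennreal (b - a) * I"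
  proof -
    have bw: "block_weight s u x \<in> borel_measurable X" by (rule block_weight_meas[OF x(1) su])
    have "ideal s u F1 x + ideal s u F2 x = iter S [s..<u + 1] (\<lambda>v. block_weight s u x v * F1 v + block_weight s u x v * F2 v) x"
      unfolding ideal_iter[OF x(1) su \<open>F1 \<in> _\<close>] ideal_iter[OF x(1) su \<open>F2 \<in> _\<close>]
      by (rule iter_add[symmetric, OF subl _ _ x(1)]) (use bw in measurable)
    also have "\<dots> = iter S [s..<u + 1] (\<lambda>v. ennreal (b - a) * (block_weight s u x v * 1)) x"
    proof (rule iter_cong[OF subl x(1)])
      fix v assume v: "v \<in> space X" "\<And>i. i \<notin> set [s..<u + 1] \<Longrightarrow> v i = x i"
      have "a \<le> f v \<and> f v \<le> b" by (rule range[OF v(1)]) (use v(2) in auto)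
      then have "F1 v + F2 v = ennreal (b - a)" unfolding F1_def F2_def by (subst ennreal_plus[symmetric]) auto
      then show "block_weight s u x v * F1 v + block_weight s u x v * F2 v = ennreal (b - a) * (block_weight s u x v * 1)"
        unfolding distrib_left[symmetric] mult_1_right by (simp only: mult.commute)
    qed
    also have "\<dots> = ennreal (b - a) * I"
      unfolding I_def ideal_iter[OF x(1) su borel_measurable_const]
      by (rule iter_cmult[OF subl _ x(1)]) (use bw in measurable)
    finally show ?thesis .
  qed
  define q1 where "q1 = ideal s u F1 x / I"
  define q2 where "q2 = ideal s u F2 x / I"
  define q1' where "q1' = ideal s u F1 x' / I'"
  have q12: "q1 + q2 = ennreal (b - a)"
    unfolding q1_def q2_def add_divide_distrib_ennreal[symmetric] add using I by (simp add: ennreal_mult_divide_eq)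
  have q1_le: "q1 \<le> q1' + ennreal C"
  proof -
    have eqs: "q1 * I = ideal s u F1 x" "q1' * I' = ideal s u F1 x'"
      unfolding q1_def q1'_def using I by (simp_all add: ennreal_divide_mult_cancel)
    have "(I * I') * q1 \<le> (I * I') * (q1' + ennreal C)"
      using contr[of F1] unfolding I_def[symmetric] I'_def[symmetric] eqs[symmetric]
      by (simp add: F1_def[abs_def] algebra_simps)
    then show ?thesis using I by (subst (asm) ennreal_mult_le_mult_iff) (auto simp: ennreal_mult_eq_top_iff)
  qed
  have overm: "over s u w \<in> path H {s..u} \<rightarrow>\<^sub>M X" if "w \<in> space X" for w
    using that su by (intro merge_measurable[where g="\<lambda>_. w"]) auto
  have ker: "sets (pg_kernel H n y N s u w) = sets (path H {s..u})" "prob_space (pg_kernel H n y N s u w)" if "w \<in> space X" for w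
    using measurable_space[OF pg_kernel_kernel[OF su] that] by (auto simp: space_prob_algebra)
  have minor: "ennreal (\<kappa> ?L) * (ideal s u F w / ideal s u (\<lambda>_. 1) w) \<le> (\<integral>\<^sup>+\<zeta>. F (over s u w \<zeta>) \<partial>pg_kernel H n y N s u w)"
    if w: "w \<in> space X" and F: "F \<in> borel_measurable X" "\<And>v. v \<in> space X \<Longrightarrow> F v \<le> ennreal B" for w F B
  proof -
    have "K \<noteq> 0" using Bc_ge by (auto simp: K_def)
    then have K0: "K ^ ?L \<noteq> 0" "K ^ ?L \<noteq> \<top>" using K_fin unfolding power_eq_top_ennreal by simp_all
    have "of_nat (N - 1) ^ ?L * ideal s u F w / (K ^ ?L * ideal s u (\<lambda>_. 1) w) = ennreal (\<kappa> ?L) * (ideal s u F w / ideal s u (\<lambda>_. 1) w)"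
    proof -
      obtain k where k: "K ^ ?L = ennreal k" "0 < k" by (rule ennreal_positive_real[OF K0])
      obtain i where i: "ideal s u (\<lambda>_. 1) w = ennreal i" "0 < i"
        by (rule ennreal_positive_real[OF ideal_one_bounds[OF w su early]])
      have "inverse (K ^ ?L * ideal s u (\<lambda>_. 1) w) = inverse (K ^ ?L) * inverse (ideal s u (\<lambda>_. 1) w)"
        using k i by (simp add: ennreal_mult[symmetric] inverse_ennreal)
      moreover have "K ^ ?L * inverse (K ^ ?L) = 1" using k by (simp add: ennreal_mult[symmetric] inverse_ennreal)
      moreover have "a * k * A * (k' * i') = a * (A * i') * (k * k')" for a k A k' i' :: ennreal
        by (simp only: ac_simps)
      ultimately show ?thesis unfolding \<kappa>_ennreal[symmetric] divide_ennreal_def by (simp only: mult_1_right)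
    qed
    then show ?thesis using pg_minorisation[OF w su early F] by simp
  qed
  have bd: "a \<le> f (over s u w \<zeta>) \<and> f (over s u w \<zeta>) \<le> b" if "w = x \<or> w = x'" "\<zeta> \<in> space (path H {s..u})" for w \<zeta>
  proof (rule range)
    show "over s u w \<zeta> \<in> space X" using measurable_space[OF overm that(2)] that(1) x by auto
    have "over s u w \<zeta> i = w i" if "i \<notin> {s..u}" for i
      using that \<open>w = x \<or> w = x'\<close> x by (auto simp: merge_def space_PiM PiE_def extensional_def)
    then show "(\<forall>i. i \<notin> {s..u} \<longrightarrow> over s u w \<zeta> i = x i) \<or> (\<forall>i. i \<notin> {s..u} \<longrightarrow> over s u w \<zeta> i = x' i)"
      using that(1) by auto
  qed
  have ints: "integrable (pg_kernel H n y N s u w) (\<lambda>\<zeta>. f (over s u w \<zeta>))" if w: "w = x \<or> w = x'" for w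
  proof -
    have wX: "w \<in> space X" using w x by auto
    interpret p: prob_space "pg_kernel H n y N s u w" by (rule ker(2)[OF wX])
    have "(\<lambda>\<zeta>. f (over s u w \<zeta>)) \<in> borel_measurable (path H {s..u})" using measurable_compose[OF overm[OF wX] f] .
    then show ?thesis
      using fB measurable_space[OF overm[OF wX]] sets_eq_imp_space_eq[OF ker(1)[OF wX]] ker(1)[OF wX]
      by (intro p.integrable_const_bound[where B=M]) (auto cong: measurable_cong_sets)
  qed
  have up: "\<kappa> ?L * enn2real q2 \<le> b - block_mean s u f x"
  proof -
    interpret p: prob_space "pg_kernel H n y N s u x" by (rule ker(2)[OF x(1)])
    have "ennreal (\<kappa> ?L) * q2 \<le> (\<integral>\<^sup>+\<zeta>. F2 (over s u x \<zeta>) \<partial>pg_kernel H n y N s u x)"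
      unfolding q2_def I_def by (rule minor[OF x(1) _ F2B]) measurable
    also have "\<dots> = ennreal (\<integral>\<zeta>. b - f (over s u x \<zeta>) \<partial>pg_kernel H n y N s u x)"
      unfolding F2_def using ints[of x] bd[of x] sets_eq_imp_space_eq[OF ker(1)[OF x(1)]]
      by (intro nn_integral_eq_integral) auto
    also have "(\<integral>\<zeta>. b - f (over s u x \<zeta>) \<partial>pg_kernel H n y N s u x) = b - block_mean s u f x"
      unfolding block_mean_eq[OF su x(1) f] using ints[of x] by (simp add: p.prob_space)
    finally have "ennreal (\<kappa> ?L) * q2 \<le> ennreal (b - block_mean s u f x)" .
    moreover have "0 \<le> b - block_mean s u f x"
      unfolding block_mean_eq[OF su x(1) f] using ints[of x] bd[of x] sets_eq_imp_space_eq[OF ker(1)[OF x(1)]]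
        p.integral_le_const[of "\<lambda>\<zeta>. f (over s u x \<zeta>)" b] by auto
    moreover have "q2 = ennreal (enn2real q2)" using q12 by (metis ennreal_add_eq_top ennreal_enn2real ennreal_neq_top less_top)
    ultimately show ?thesis using \<kappa> by (metis ennreal_le_iff ennreal_mult enn2real_nonneg)
  qed
  have lo: "\<kappa> ?L * (enn2real q1 - C) \<le> block_mean s u f x' - a"
  proof -
    interpret p: prob_space "pg_kernel H n y N s u x'" by (rule ker(2)[OF x(2)])
    have "ennreal (\<kappa> ?L) * q1' \<le> (\<integral>\<^sup>+\<zeta>. F1 (over s u x' \<zeta>) \<partial>pg_kernel H n y N s u x')"
      unfolding q1'_def I'_def by (rule minor[OF x(2) _ F1B]) measurable
    also have "\<dots> = ennreal (\<integral>\<zeta>. f (over s u x' \<zeta>) - a \<partial>pg_kernel H n y N s u x')"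
      unfolding F1_def using ints[of x'] bd[of x'] sets_eq_imp_space_eq[OF ker(1)[OF x(2)]]
      by (intro nn_integral_eq_integral) auto
    also have "(\<integral>\<zeta>. f (over s u x' \<zeta>) - a \<partial>pg_kernel H n y N s u x') = block_mean s u f x' - a"
      unfolding block_mean_eq[OF su x(2) f] using ints[of x'] by (simp add: p.prob_space)
    finally have 1: "ennreal (\<kappa> ?L) * q1' \<le> ennreal (block_mean s u f x' - a)" .
    have 2: "0 \<le> block_mean s u f x' - a"
      unfolding block_mean_eq[OF su x(2) f] using ints[of x'] bd[of x'] sets_eq_imp_space_eq[OF ker(1)[OF x(2)]]
        p.integral_ge_const[of "\<lambda>\<zeta>. f (over s u x' \<zeta>)" a] by auto
    have 3: "q1 = ennreal (enn2real q1)" using q12 by (metis ennreal_add_eq_top ennreal_enn2real ennreal_neq_top less_top)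
    have "ennreal (\<kappa> ?L * enn2real q1) = ennreal (\<kappa> ?L) * q1" using \<kappa> 3 by (metis ennreal_mult enn2real_nonneg)
    also have "\<dots> \<le> ennreal (\<kappa> ?L) * (q1' + ennreal C)" by (intro mult_left_mono q1_le) auto
    also have "\<dots> \<le> ennreal (block_mean s u f x' - a) + ennreal (\<kappa> ?L * C)"
      using 1 \<kappa> C by (simp add: distrib_left ennreal_mult add_right_mono)
    also have "\<dots> = ennreal (block_mean s u f x' - a + \<kappa> ?L * C)" using 2 \<kappa> C by (simp add: ennreal_plus)
    finally have "\<kappa> ?L * enn2real q1 \<le> block_mean s u f x' - a + \<kappa> ?L * C"
      using 2 \<kappa> C by (subst (asm) ennreal_le_iff) auto
    then show ?thesis by (simp add: algebra_simps)
  qed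
  have "enn2real q1 + enn2real q2 = b - a"
  proof -
    have "q1 \<noteq> \<top>" "q2 \<noteq> \<top>" using q12 by (auto simp: ennreal_add_eq_top[symmetric])
    then have "enn2real (q1 + q2) = enn2real q1 + enn2real q2" by (intro enn2real_plus) (auto simp: less_top)
    then show ?thesis using q12 ab by simp
  qed
  then have e: "enn2real q2 = b - a - enn2real q1" by simp
  show ?thesis using up lo unfolding e by (simp add: algebra_simps)
qed

end

section \<open>Oscillations over groups of sites\<close>

lemma range_in_interval:
  fixes V :: "real set"
  assumes V: "V \<noteq> {}" and le: "\<And>p q. p \<in> V \<Longrightarrow> q \<in> V \<Longrightarrow> p - q \<le> T"
  shows "\<exists>a b. (\<forall>p\<in>V. a \<le> p \<and> p \<le> b) \<and> b - a = T"
proof -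
  obtain q0 where q0: "q0 \<in> V" using V by auto
  have bdd: "bdd_above V" using le[OF _ q0] by (intro bdd_aboveI[of _ "q0 + T"]) (simp add: algebra_simps)
  have "Sup V - T \<le> p \<and> p \<le> Sup V" if "p \<in> V" for p
  proof
    have "Sup V \<le> p + T" using le[OF _ that] by (intro cSup_least V) (simp add: algebra_simps)
    then show "Sup V - T \<le> p" by simp
    show "p \<le> Sup V" using that bdd by (rule cSup_upper)
  qed
  then show ?thesis by (intro exI[of _ "Sup V - T"] exI[of _ "Sup V"]) simp
qed

context sites begin

text \<open>
  \<open>B g\<close> bounds the oscillation of \<open>f\<close> when all sites of the group \<open>grp g\<close> are changed at once. The bounds
  are data rather than suprema, so that they can be propagated without attainment or finiteness
  questions.
\<close>

definition group_bound :: "'g set \<Rightarrow> ('g \<Rightarrow> nat set) \<Rightarrow> ('g \<Rightarrow> real) \<Rightarrow> ((nat \<Rightarrow> 'x) \<Rightarrow> real) \<Rightarrow> bool" where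
  "group_bound G grp B f \<longleftrightarrow>
     (\<forall>g\<in>G. \<forall>x\<in>space X. \<forall>z\<in>space X. (\<forall>i. i \<notin> grp g \<longrightarrow> x i = z i) \<longrightarrow> f x - f z \<le> B g)"

text \<open>
  Groups are changed one after the other, through hybrid configurations.
\<close>

lemma group_bound_union:
  assumes gb: "group_bound G grp B f"
  shows "finite A \<Longrightarrow> A \<subseteq> G \<Longrightarrow> x \<in> space X \<Longrightarrow> z \<in> space X \<Longrightarrow> (\<And>i. i \<notin> (\<Union>g\<in>A. grp g) \<Longrightarrow> x i = z i)
    \<Longrightarrow> f x - f z \<le> (\<Sum>g\<in>A. B g)"
proof (induction A arbitrary: x rule: finite_induct)
  case empty
  then have "x = z" by auto
  then show ?case by simp
next
  case (insert g A)
  define w where "w i = (if i \<in> grp g then z i else x i)" for i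
  have w: "w \<in> space X" using insert.prems by (auto simp: w_def space_PiM PiE_def extensional_def)
  have "f x - f w \<le> B g" using gb insert.prems w unfolding group_bound_def by (auto simp: w_def)
  moreover have "f w - f z \<le> (\<Sum>g\<in>A. B g)"
  proof (rule insert.IH)
    fix i assume "i \<notin> (\<Union>g\<in>A. grp g)"
    then show "w i = z i" using insert.prems(4)[of i] by (auto simp: w_def)
  qed (use insert.prems w in auto)
  ultimately show ?case using insert.hyps by simp
qed

end

context pg_model begin

text \<open>
  The procedure reads only the retained trajectory and the two neighbours of the block.
\<close>

lemma pg_kernel_cong:
  assumes su: "1 \<le> s" "s \<le> u" "u \<le> n"
    and same: "\<And>i. i \<in> {s..u} \<Longrightarrow> x i = x' i" "s \<noteq> 1 \<Longrightarrow> x (s - 1) = x' (s - 1)" "u < n \<Longrightarrow> x (u + 1) = x' (u + 1)"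
  shows "pg_kernel H n y N s u x = pg_kernel H n y N s u x'"
proof -
  have w: "pg_weight H n y u x t = pg_weight H n y u x' t" for t
    using same(3) by (auto simp: pg_weight_def fun_eq_iff)
  have "pg_particles H n y N s u x d = pg_particles H n y N s u x' d" if "s + d \<le> u" for d
    using that
  proof (induction d)
    case 0
    have "x s = x' s" using su same(1) by auto
    moreover have "(if s = 1 then init_law H else trans_law H (x (s - 1))) = (if s = 1 then init_law H else trans_law H (x' (s - 1)))"
      using same(2) by auto
    ultimately show ?case unfolding pg_particles.simps pg_init_def by (simp only:)
  next
    case (Suc d)
    have "x (s + Suc d) = x' (s + Suc d)" using same(1) Suc.prems by auto
    then have "pg_step H n y N s u x (s + Suc d) = pg_step H n y N s u x' (s + Suc d)"
      by (intro ext) (simp only: pg_step_def w)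
    then show ?case using Suc by simp
  qed
  from this[of "u - s"] su show ?thesis unfolding pg_kernel_def w by simp
qed

text \<open>
  A group that neither meets the block nor contains one of its neighbours leaves the kernel unchanged,
  so only the integrand differs.
\<close>

lemma block_mean_unaffected:
  assumes su: "1 \<le> s" "s \<le> u" "u \<le> n" and x: "x \<in> space X" "z \<in> space X"
    and f: "f \<in> borel_measurable X" "\<And>v. v \<in> space X \<Longrightarrow> \<bar>f v\<bar> \<le> M"
    and gb: "group_bound G grp B f" "gr \<in> G"
    and same: "\<And>i. i \<notin> grp gr \<Longrightarrow> x i = z i"
    and away: "grp gr \<inter> {s..u} = {}" "s - 1 \<notin> grp gr" "u + 1 \<notin> grp gr"
  shows "block_mean s u f x - block_mean s u f z \<le> B gr"
proof -
  have k: "pg_kernel H n y N s u x = pg_kernel H n y N s u z"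
  proof (rule pg_kernel_cong[OF su])
    show "x i = z i" if "i \<in> {s..u}" for i using that away(1) same by blast
    show "x (s - 1) = z (s - 1)" "x (u + 1) = z (u + 1)" using away same by auto
  qed
  have ker: "sets (pg_kernel H n y N s u z) = sets (path H {s..u})" "prob_space (pg_kernel H n y N s u z)"
    using measurable_space[OF pg_kernel_kernel[OF su] x(2)] by (auto simp: space_prob_algebra)
  interpret p: prob_space "pg_kernel H n y N s u z" by (rule ker(2))
  have sp: "space (pg_kernel H n y N s u z) = space (path H {s..u})" by (rule sets_eq_imp_space_eq[OF ker(1)])
  have overm: "over s u w \<in> path H {s..u} \<rightarrow>\<^sub>M X" if "w \<in> space X" for w
    using that su by (intro merge_measurable[where g="\<lambda>_. w"]) auto
  have ints: "integrable (pg_kernel H n y N s u z) (\<lambda>\<zeta>. f (over s u w \<zeta>))" if w: "w \<in> space X" for w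
  proof -
    have "(\<lambda>\<zeta>. f (over s u w \<zeta>)) \<in> borel_measurable (path H {s..u})" using measurable_compose[OF overm[OF w] f(1)] .
    then show ?thesis
      using f(2) measurable_space[OF overm[OF w]] sp ker(1)
      by (intro p.integrable_const_bound[where B=M]) (auto cong: measurable_cong_sets)
  qed
  have "f (over s u x \<zeta>) \<le> f (over s u z \<zeta>) + B gr" if "\<zeta> \<in> space (path H {s..u})" for \<zeta>
  proof -
    have "over s u x \<zeta> \<in> space X" "over s u z \<zeta> \<in> space X" using measurable_space[OF overm that] x by auto
    moreover have "over s u x \<zeta> i = over s u z \<zeta> i" if "i \<notin> grp gr" for i
      using same[OF that] by (auto simp: merge_def)
    ultimately have "f (over s u x \<zeta>) - f (over s u z \<zeta>) \<le> B gr" using gb unfolding group_bound_def by auto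
    then show ?thesis by simp
  qed
  then have "(\<integral>\<zeta>. f (over s u x \<zeta>) \<partial>pg_kernel H n y N s u z) \<le> (\<integral>\<zeta>. f (over s u z \<zeta>) + B gr \<partial>pg_kernel H n y N s u z)"
    using ints[OF x(1)] ints[OF x(2)] sp by (intro integral_mono) auto
  then show ?thesis
    unfolding block_mean_eq[OF su x(1) f(1)] block_mean_eq[OF su x(2) f(1)] k
    using ints[OF x(2)] by (simp add: p.prob_space)
qed

text \<open>
  Inside the block a change alters only the retained trajectory. The ideal update does not see it, and
  the remainder of the mixture costs the full oscillation over the block.
\<close>

lemma block_mean_inside:
  assumes su: "1 \<le> s" "s \<le> u" "u \<le> n" and early: "u = n \<or> s + h \<le> u + 1" and x: "x \<in> space X" "z \<in> space X"
    and f: "f \<in> borel_measurable X" "\<And>v. v \<in> space X \<Longrightarrow> \<bar>f v\<bar> \<le> M"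
    and gb: "group_bound G grp B f" and A: "finite A" "A \<subseteq> G" "{s..u} = (\<Union>gr\<in>A. grp gr)"
    and same: "\<And>i. i \<notin> {s..u} \<Longrightarrow> x i = z i"
  shows "block_mean s u f x - block_mean s u f z \<le> (1 - \<kappa> (u - s + 1)) * (\<Sum>gr\<in>A. B gr)"
proof -
  define V where "V = {f v | v. v \<in> space X \<and> ((\<forall>i. i \<notin> {s..u} \<longrightarrow> v i = x i) \<or> (\<forall>i. i \<notin> {s..u} \<longrightarrow> v i = z i))}"
  have "V \<noteq> {}" using x unfolding V_def by auto
  moreover have "p - q \<le> (\<Sum>gr\<in>A. B gr)" if "p \<in> V" "q \<in> V" for p q
  proof -
    from that
    obtain v w where vw: "v \<in> space X" "w \<in> space X" "p = f v" "q = f w"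
      "\<And>i. i \<notin> {s..u} \<Longrightarrow> v i = x i" "\<And>i. i \<notin> {s..u} \<Longrightarrow> w i = x i"
      unfolding V_def using same by auto
    show "p - q \<le> (\<Sum>gr\<in>A. B gr)" unfolding vw(3,4)
      by (rule group_bound_union[OF gb A(1,2) vw(1,2)]) (use vw(5,6) A(3) in auto)
  qed
  ultimately have "\<exists>a b. (\<forall>p\<in>V. a \<le> p \<and> p \<le> b) \<and> b - a = (\<Sum>gr\<in>A. B gr)"
    by (rule range_in_interval)
  then obtain a b where "\<forall>p\<in>V. a \<le> p \<and> p \<le> b" and ab2: "b - a = (\<Sum>gr\<in>A. B gr)"
    by (elim exE conjE)
  then have ab: "\<And>p. p \<in> V \<Longrightarrow> a \<le> p \<and> p \<le> b" by simp
  have "block_mean s u f x - block_mean s u f z \<le> \<kappa> (u - s + 1) * 0 + (1 - \<kappa> (u - s + 1)) * (b - a)"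
  proof (rule block_difference[OF x su early f])
    show "a \<le> f v \<and> f v \<le> b" if "v \<in> space X" "(\<forall>i. i \<notin> {s..u} \<longrightarrow> v i = x i) \<or> (\<forall>i. i \<notin> {s..u} \<longrightarrow> v i = z i)" for v
      using that by (intro ab) (auto simp: V_def)
    fix F assume "F = (\<lambda>v. ennreal (f v - a))"
    then have "F \<in> borel_measurable X" using f(1) by simp
    from ideal_cong[OF x su same this] ideal_cong[OF x su same borel_measurable_const]
    show "ideal s u F x * ideal s u (\<lambda>_. 1) z \<le> ideal s u F z * ideal s u (\<lambda>_. 1) x
        + ennreal 0 * ideal s u (\<lambda>_. 1) x * ideal s u (\<lambda>_. 1) z" by simp
  qed auto
  then show ?thesis using ab2 by simp
qed

text \<open>
  A change outside the block that reaches one of its neighbours costs its own oscillation, and that of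
  each group inside the block with the weight at which the ideal update still remembers the boundary at
  distance \<open>d\<close>, plus the weight of the remainder. The two cases of \<open>side\<close> are the left and the right
  neighbour; the nearest site of the block is at distance 1.
\<close>

lemma block_mean_boundary:
  assumes su: "1 \<le> s" "s \<le> u" "u \<le> n" and early: "u = n \<or> s + h \<le> u + 1" and x: "x \<in> space X" "z \<in> space X"
    and f: "f \<in> borel_measurable X" "\<And>v. v \<in> space X \<Longrightarrow> \<bar>f v\<bar> \<le> M"
    and gb: "group_bound G grp B f" and B0: "\<And>gr. gr \<in> G \<Longrightarrow> 0 \<le> B gr"
    and A: "finite A" "A \<subseteq> G" "{s..u} = (\<Union>gr\<in>A. grp gr)"
    and gr: "gr \<in> G" "gr \<notin> A" and same: "\<And>i. i \<notin> grp gr \<Longrightarrow> x i = z i" and away: "grp gr \<inter> {s..u} = {}"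
    and side: "(1 < s \<and> u + 1 \<notin> grp gr \<and> (\<forall>gr'\<in>A. \<forall>i\<in>grp gr'. s + d gr' \<le> i + 1))
       \<or> (u < n \<and> s - 1 \<notin> grp gr \<and> (\<forall>gr'\<in>A. \<forall>i\<in>grp gr'. i + d gr' \<le> u + 1))"
  shows "block_mean s u f x - block_mean s u f z
     \<le> B gr + (\<Sum>gr'\<in>A. ((1 - \<theta>) ^ (d gr' div h) + (1 - \<kappa> (u - s + 1))) * B gr')"
proof -
  define V where "V = {f v | v. v \<in> space X \<and> ((\<forall>i. i \<notin> {s..u} \<longrightarrow> v i = x i) \<or> (\<forall>i. i \<notin> {s..u} \<longrightarrow> v i = z i))}"
  have gA: "finite (insert gr A)" "insert gr A \<subseteq> G" using A gr by auto
  have "V \<noteq> {}" using x unfolding V_def by auto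
  moreover have "p - q \<le> (\<Sum>gr\<in>insert gr A. B gr)" if "p \<in> V" "q \<in> V" for p q
  proof -
    from that
    obtain v w where vw: "v \<in> space X" "w \<in> space X" "p = f v" "q = f w"
      "(\<forall>i. i \<notin> {s..u} \<longrightarrow> v i = x i) \<or> (\<forall>i. i \<notin> {s..u} \<longrightarrow> v i = z i)"
      "(\<forall>i. i \<notin> {s..u} \<longrightarrow> w i = x i) \<or> (\<forall>i. i \<notin> {s..u} \<longrightarrow> w i = z i)"
      unfolding V_def by auto
    show "p - q \<le> (\<Sum>gr\<in>insert gr A. B gr)" unfolding vw(3,4)
    proof (rule group_bound_union[OF gb gA vw(1,2)])
      fix i assume "i \<notin> (\<Union>gr\<in>insert gr A. grp gr)"
      then have "i \<notin> {s..u}" "x i = z i" using A(3) same by auto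
      then show "v i = w i" using vw(5,6) by auto
    qed
  qed
  ultimately have "\<exists>a b. (\<forall>p\<in>V. a \<le> p \<and> p \<le> b) \<and> b - a = (\<Sum>gr\<in>insert gr A. B gr)"
    by (rule range_in_interval)
  then obtain a b where "\<forall>p\<in>V. a \<le> p \<and> p \<le> b" and ab2: "b - a = (\<Sum>gr\<in>insert gr A. B gr)"
    by (elim exE conjE)
  then have ab: "\<And>p. p \<in> V \<Longrightarrow> a \<le> p \<and> p \<le> b" by simp
  define C where "C = B gr + (\<Sum>gr'\<in>A. (1 - \<theta>) ^ (d gr' div h) * B gr')"
  have C0: "0 \<le> C" unfolding C_def using B0 A(2) gr \<theta> by (intro add_nonneg_nonneg sum_nonneg mult_nonneg_nonneg) auto
  \<comment> \<open>the changed group differs from the start, hence at distance 0\<close>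
  define d' where "d' gr' = (if gr' = gr then 0 else d gr')" for gr'
  have sumC: "(\<Sum>gr'\<in>insert gr A. ennreal (B gr') * ennreal (1 - \<theta>) ^ (d' gr' div h)) = ennreal C"
  proof -
    have "(\<Sum>gr'\<in>insert gr A. ennreal (B gr') * ennreal (1 - \<theta>) ^ (d' gr' div h)) =
       (\<Sum>gr'\<in>insert gr A. ennreal ((1 - \<theta>) ^ (d' gr' div h) * B gr'))"
      using \<theta> by (intro sum.cong) (auto simp: ennreal_power ennreal_mult'' ennreal_mult' mult.commute)
    also have "\<dots> = ennreal (\<Sum>gr'\<in>insert gr A. (1 - \<theta>) ^ (d' gr' div h) * B gr')"
      using B0 gA \<theta> by (intro sum_ennreal mult_nonneg_nonneg) auto
    also have "(\<Sum>gr'\<in>insert gr A. (1 - \<theta>) ^ (d' gr' div h) * B gr') = C"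
      using A(1) gr by (auto simp: C_def d'_def intro!: sum.cong)
    finally show ?thesis .
  qed
  have "block_mean s u f x - block_mean s u f z \<le> \<kappa> (u - s + 1) * C + (1 - \<kappa> (u - s + 1)) * (b - a)"
  proof (rule block_difference[OF x su early f])
    show "a \<le> f v \<and> f v \<le> b" if "v \<in> space X" "(\<forall>i. i \<notin> {s..u} \<longrightarrow> v i = x i) \<or> (\<forall>i. i \<notin> {s..u} \<longrightarrow> v i = z i)" for v
      using that by (intro ab) (auto simp: V_def)
    show "0 \<le> C" by (rule C0)
    fix F assume F: "F = (\<lambda>v. ennreal (f v - a))"
    have Fm: "F \<in> borel_measurable X" using f(1) unfolding F by simp
    have FB: "F v \<le> ennreal (M + \<bar>a\<bar>)" if "v \<in> space X" for v
    proof -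
      have "f v - a \<le> M + \<bar>a\<bar>" using f(2)[OF that] by linarith
      then show ?thesis unfolding F by (rule ennreal_leI)
    qed
    have hyp: "F v \<le> F v' + (\<Sum>gr' | gr' \<in> insert gr A \<and> d' gr' \<le> k. ennreal (B gr'))"
      if v: "v \<in> space X" "v' \<in> space X" and eq: "\<And>i. i \<notin> (\<Union>gr'\<in>{gr' \<in> insert gr A. d' gr' \<le> k}. grp gr') \<Longrightarrow> v i = v' i" for v v' k
    proof -
      define A' where "A' = {gr' \<in> insert gr A. d' gr' \<le> k}"
      have A': "finite A'" "A' \<subseteq> G" using gA by (auto simp: A'_def)
      have "f v - f v' \<le> (\<Sum>gr'\<in>A'. B gr')"
        by (rule group_bound_union[OF gb A' v]) (use eq in \<open>simp add: A'_def\<close>)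
      moreover have S0: "0 \<le> (\<Sum>gr'\<in>A'. B gr')" using A' B0 by (intro sum_nonneg) auto
      ultimately have "ennreal (f v - a) \<le> ennreal (max 0 (f v' - a) + (\<Sum>gr'\<in>A'. B gr'))"
        by (intro ennreal_leI) linarith
      also have "\<dots> = ennreal (max 0 (f v' - a)) + ennreal (\<Sum>gr'\<in>A'. B gr')" using S0 by (intro ennreal_plus) auto
      also have "ennreal (\<Sum>gr'\<in>A'. B gr') = (\<Sum>gr'\<in>A'. ennreal (B gr'))" using A' B0 by (intro sum_ennreal[symmetric]) auto
      also have "ennreal (max 0 (f v' - a)) = ennreal (f v' - a)" by (simp add: max_def ennreal_neg)
      finally show ?thesis unfolding F A'_def .
    qed
    show "ideal s u F x * ideal s u (\<lambda>_. 1) z \<le> ideal s u F z * ideal s u (\<lambda>_. 1) x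
        + ennreal C * ideal s u (\<lambda>_. 1) x * ideal s u (\<lambda>_. 1) z"
      using side
    proof
      assume l: "1 < s \<and> u + 1 \<notin> grp gr \<and> (\<forall>gr'\<in>A. \<forall>i\<in>grp gr'. s + d gr' \<le> i + 1)"
      show ?thesis unfolding sumC[symmetric]
      proof (rule ideal_contraction_left[OF x _ su(2,3) _ Fm FB gA(1)])
        fix v v' k assume v: "v \<in> space X" "v' \<in> space X" "\<And>i. i \<notin> {s..u} \<Longrightarrow> v i = x i" "\<And>i. i \<notin> {s..u} \<Longrightarrow> v' i = z i"
          "\<And>i. i \<in> {s + k..u} \<Longrightarrow> v i = v' i"
        show "F v \<le> F v' + (\<Sum>gr' | gr' \<in> insert gr A \<and> d' gr' \<le> k. ennreal (B gr'))"
        proof (rule hyp[OF v(1,2)])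
          fix i assume i: "i \<notin> (\<Union>gr'\<in>{gr' \<in> insert gr A. d' gr' \<le> k}. grp gr')"
          have "gr \<in> {gr' \<in> insert gr A. d' gr' \<le> k}" by (simp add: d'_def)
          with i have ig: "i \<notin> grp gr" by blast
          show "v i = v' i"
          proof (cases "i \<in> {s..u}")
            case False then show ?thesis using v(3,4) same[OF ig] by auto
          next
            case True
            then obtain gr' where gr': "gr' \<in> A" "i \<in> grp gr'" using A(3) by auto
            then have "gr' \<noteq> gr" using ig by auto
            moreover have "gr' \<notin> {gr' \<in> insert gr A. d' gr' \<le> k}" using i gr'(2) by blast
            ultimately have "k < d gr'" using gr'(1) by (simp add: d'_def)
            then have "s + k \<le> i" using l gr' by fastforce
            then show ?thesis using v(5) True by auto
          qed
        qed
      qed (use l same in auto)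
    next
      assume r: "u < n \<and> s - 1 \<notin> grp gr \<and> (\<forall>gr'\<in>A. \<forall>i\<in>grp gr'. i + d gr' \<le> u + 1)"
      show ?thesis unfolding sumC[symmetric]
      proof (rule ideal_contraction_right[OF x su(1,2) _ _ Fm FB gA(1)])
        fix v v' k assume v: "v \<in> space X" "v' \<in> space X" "\<And>i. i \<notin> {s..u} \<Longrightarrow> v i = x i" "\<And>i. i \<notin> {s..u} \<Longrightarrow> v' i = z i"
          "\<And>i. i \<in> {s..u} \<Longrightarrow> i + k \<le> u \<Longrightarrow> v i = v' i"
        show "F v \<le> F v' + (\<Sum>gr' | gr' \<in> insert gr A \<and> d' gr' \<le> k. ennreal (B gr'))"
        proof (rule hyp[OF v(1,2)])
          fix i assume i: "i \<notin> (\<Union>gr'\<in>{gr' \<in> insert gr A. d' gr' \<le> k}. grp gr')"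
          have "gr \<in> {gr' \<in> insert gr A. d' gr' \<le> k}" by (simp add: d'_def)
          with i have ig: "i \<notin> grp gr" by blast
          show "v i = v' i"
          proof (cases "i \<in> {s..u}")
            case False then show ?thesis using v(3,4) same[OF ig] by auto
          next
            case True
            then obtain gr' where gr': "gr' \<in> A" "i \<in> grp gr'" using A(3) by auto
            then have "gr' \<noteq> gr" using ig by auto
            moreover have "gr' \<notin> {gr' \<in> insert gr A. d' gr' \<le> k}" using i gr'(2) by blast
            ultimately have "k < d gr'" using gr'(1) by (simp add: d'_def)
            then have "i + k \<le> u" using r gr' by fastforce
            then show ?thesis using v(5) True by auto
          qed
        qed
      qed (use r same in auto)
    qed
  qed
  also have "\<dots> = \<kappa> (u - s + 1) * C + (1 - \<kappa> (u - s + 1)) * (B gr + (\<Sum>gr'\<in>A. B gr'))"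
    unfolding ab2 using A(1) gr by simp
  also have "\<dots> = \<kappa> (u - s + 1) * (C - B gr) + B gr + (1 - \<kappa> (u - s + 1)) * (\<Sum>gr'\<in>A. B gr')"
    by (simp add: algebra_simps)
  also have "\<dots> \<le> 1 * (C - B gr) + B gr + (1 - \<kappa> (u - s + 1)) * (\<Sum>gr'\<in>A. B gr')"
  proof -
    have "0 \<le> C - B gr" unfolding C_def using B0 A(2) \<theta> by (auto intro!: sum_nonneg mult_nonneg_nonneg)
    then show ?thesis using \<kappa> by (intro add_right_mono mult_right_mono) auto
  qed
  also have "\<dots> = B gr + (\<Sum>gr'\<in>A. ((1 - \<theta>) ^ (d gr' div h) + (1 - \<kappa> (u - s + 1))) * B gr')"
    unfolding C_def by (simp add: sum.distrib distrib_right sum_distrib_left)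
  finally show ?thesis .
qed

end

section \<open>Cores and overlaps of a block cover\<close>

text \<open>
  Equal lengths and increasing end points turn the cover into an arithmetic progression of intervals;
  the separation of blocks at index distance two leaves at least one time between them.
\<close>

lemma cover_structure:
  assumes cover: "block_cover n K L p J" and n: "1 \<le> n"
  shows "1 \<le> K" "1 \<le> L"
    and "\<And>k. k \<in> {1..K} \<Longrightarrow> J k = {Min (J k)..Max (J k)} \<and> 1 \<le> Min (J k) \<and> Max (J k) \<le> n \<and> Max (J k) + 1 = Min (J k) + L"
    and "Min (J 1) = 1" "Max (J K) = n"
    and "\<And>k. 1 \<le> k \<Longrightarrow> k < K \<Longrightarrow> Min (J (k + 1)) + p = Min (J k) + L"
    and "\<And>j k. 1 \<le> j \<Longrightarrow> j < k \<Longrightarrow> k \<le> K \<Longrightarrow> Min (J j) < Min (J k) \<and> Max (J j) < Max (J k)"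
    and "\<And>j k. 1 \<le> j \<Longrightarrow> j + 2 \<le> k \<Longrightarrow> k \<le> K \<Longrightarrow> Max (J j) + 1 < Min (J k)"
proof -
  have un: "(\<Union>k\<in>{1..K}. J k) = {1..n}"
    and int: "\<And>k. k \<in> {1..K} \<Longrightarrow> \<exists>s u. 1 \<le> s \<and> s \<le> u \<and> u \<le> n \<and> J k = {s..u}"
    and card: "\<And>k. k \<in> {1..K} \<Longrightarrow> card (J k) = L"
    and ov: "\<And>k. k \<in> {2..K} \<Longrightarrow> card (J (k - 1) \<inter> J k) = p"
    using cover unfolding block_cover_def by blast+
  show mono: "\<And>j k. 1 \<le> j \<Longrightarrow> j < k \<Longrightarrow> k \<le> K \<Longrightarrow> Min (J j) < Min (J k) \<and> Max (J j) < Max (J k)"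
    using cover unfolding block_cover_def by blast
  show "\<And>j k. 1 \<le> j \<Longrightarrow> j + 2 \<le> k \<Longrightarrow> k \<le> K \<Longrightarrow> Max (J j) + 1 < Min (J k)"
  proof -
    fix j k assume "1 \<le> j" "j + 2 \<le> k" "k \<le> K"
    then have "1 \<le> j \<and> j < k \<and> k \<le> K \<and> 2 \<le> k - j" by auto
    then have "Max (J j) < Min (J k) - 1" using cover unfolding block_cover_def by blast
    then show "Max (J j) + 1 < Min (J k)" by linarith
  qed
  show st: "J k = {Min (J k)..Max (J k)} \<and> 1 \<le> Min (J k) \<and> Max (J k) \<le> n \<and> Max (J k) + 1 = Min (J k) + L"
    if k: "k \<in> {1..K}" for k
  proof -
    obtain s u where su: "1 \<le> s" "s \<le> u" "u \<le> n" "J k = {s..u}" using int[OF k] by blast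
    have "Min (J k) = s" "Max (J k) = u" unfolding su(4) using su by (auto simp: Min_eq_iff Max_eq_iff)
    then show ?thesis using su card[OF k] by auto
  qed
  show K: "1 \<le> K" using un n by (cases "K = 0") auto
  show "1 \<le> L"
  proof -
    have "finite (J 1)" "J 1 \<noteq> {}" using int[of 1] K by auto
    then show ?thesis using card[of 1] K by (metis One_nat_def Suc_leI atLeastAtMost_iff card_gt_0_iff order_refl)
  qed
  show "Min (J 1) = 1"
  proof -
    have "1 \<in> (\<Union>k\<in>{1..K}. J k)" unfolding un using n by auto
    then obtain k where k: "k \<in> {1..K}" "1 \<in> J k" by blast
    then have "1 \<in> {Min (J k)..Max (J k)}" using st[OF k(1)] by blast
    then have "Min (J k) \<le> 1" by (simp only: atLeastAtMost_iff)
    then have "Min (J k) = 1" using st[OF k(1)] by linarith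
    moreover have "1 \<le> Min (J 1)" using st[of 1] K by auto
    ultimately show ?thesis using mono[of 1 k] k(1) by (cases "k = 1") auto
  qed
  show "Max (J K) = n"
  proof -
    have "n \<in> (\<Union>k\<in>{1..K}. J k)" unfolding un using n by auto
    then obtain k where k: "k \<in> {1..K}" "n \<in> J k" by blast
    then have "n \<in> {Min (J k)..Max (J k)}" using st[OF k(1)] by blast
    then have "n \<le> Max (J k)" by (simp only: atLeastAtMost_iff)
    then have "Max (J k) = n" using st[OF k(1)] by linarith
    moreover have "Max (J K) \<le> n" using st[of K] K by auto
    ultimately show ?thesis using mono[of k K] k(1) by (cases "k = K") auto
  qed
  show "Min (J (k + 1)) + p = Min (J k) + L" if k: "1 \<le> k" "k < K" for k
  proof -
    have k1: "k \<in> {1..K}" "k + 1 \<in> {1..K}" using k by auto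
    note s1 = st[OF k1(1)] and s2 = st[OF k1(2)]
    have lt: "Min (J k) < Min (J (k + 1))" "Max (J k) < Max (J (k + 1))" using mono[of k "k + 1"] k by auto
    have "Min (J (k + 1)) \<le> Max (J k) + 1"
    proof (rule ccontr)
      assume "\<not> ?thesis"
      then have gap: "Max (J k) + 1 < Min (J (k + 1))" by simp
      have "Min (J (k + 1)) \<le> Max (J (k + 1))" using s2 st[OF k1(2)] int[OF k1(2)]
        by (metis Max_ge Min_le finite_atLeastAtMost atLeastAtMost_iff order.trans order_refl)
      then have "Max (J k) + 1 \<in> {1..n}" using gap s2 by auto
      then obtain j where j: "j \<in> {1..K}" "Max (J k) + 1 \<in> J j" using un by blast
      then have jj: "Max (J k) + 1 \<in> {Min (J j)..Max (J j)}" using st[OF j(1)] by blast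
      show False
      proof (cases "j \<le> k")
        case True
        then have "Max (J j) \<le> Max (J k)" using mono[of j k] j(1) k by (cases "j = k") auto
        then show False using jj by auto
      next
        case False
        then have "Min (J (k + 1)) \<le> Min (J j)" using mono[of "k + 1" j] j(1) k by (cases "j = k + 1") auto
        then show False using jj gap by auto
      qed
    qed
    moreover have "J k \<inter> J (k + 1) = {Min (J (k + 1))..Max (J k)}"
    proof -
      have "J k \<inter> J (k + 1) = {Min (J k)..Max (J k)} \<inter> {Min (J (k + 1))..Max (J (k + 1))}"
        using s1 s2 by blast
      also have "\<dots> = {Min (J (k + 1))..Max (J k)}" using lt by auto
      finally show ?thesis .
    qed
    moreover have "card (J k \<inter> J (k + 1)) = p" using ov[of "k + 1"] k by simp
    ultimately show ?thesis using s1 by auto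
  qed
qed

text \<open>
  The condition \<open>h \<le> p + 1\<close> follows from the contraction hypothesis of the theorem: otherwise the
  exponent in \<open>\<lambda>\<close> is 0 and \<open>\<lambda> = 2\<close>. It makes every block but the last at least \<open>h\<close> long, so that its
  first time is not late.
\<close>

locale pg_cover = pg_model H y n N h \<sigma>m \<sigma>p \<delta>
  for H :: "('x, 'y) hmm" and y n N h \<sigma>m \<sigma>p \<delta> +
  fixes Kb L p :: nat and J :: "nat \<Rightarrow> nat set"
  assumes n: "1 \<le> n" and cover: "block_cover n Kb L p J" and hp: "2 \<le> Kb \<Longrightarrow> h \<le> p + 1"
begin

abbreviation lo where "lo k \<equiv> Min (J k)"
abbreviation hi where "hi k \<equiv> Max (J k)"

lemmas st = cover_structure[OF cover n]

lemma J_eq: "k \<in> {1..Kb} \<Longrightarrow> J k = {lo k..hi k}"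
  and lo_ge: "k \<in> {1..Kb} \<Longrightarrow> 1 \<le> lo k"
  and hi_le: "k \<in> {1..Kb} \<Longrightarrow> hi k \<le> n"
  and hi_lo: "k \<in> {1..Kb} \<Longrightarrow> hi k + 1 = lo k + L"
  using st(3) by blast+

lemma lo_hi: "k \<in> {1..Kb} \<Longrightarrow> lo k \<le> hi k"
  using hi_lo[of k] st(2) by linarith

lemma p_less: "2 \<le> Kb \<Longrightarrow> p < L"
  using st(6)[of 1] st(7)[of 1 2] by (simp add: numeral_2_eq_2)

lemma p_less2: "3 \<le> Kb \<Longrightarrow> 2 * p < L"
proof -
  assume K: "3 \<le> Kb"
  have "lo 2 + p = lo 1 + L" "lo 3 + p = lo 2 + L"
    using st(6)[of 1] st(6)[of 2] K by (simp_all add: numeral_eq_Suc)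
  moreover have "hi 1 + 1 < lo 3" using st(8)[of 1 3] K by simp
  moreover have "hi 1 + 1 = lo 1 + L" using hi_lo[of 1] K by simp
  ultimately show ?thesis by linarith
qed

lemma early: "k \<in> {1..Kb} \<Longrightarrow> hi k = n \<or> lo k + h \<le> hi k + 1"
proof -
  assume k: "k \<in> {1..Kb}"
  show ?thesis
  proof (cases "k = Kb")
    case True then show ?thesis using st(5) by simp
  next
    case False
    then have "h \<le> L" using hp p_less k by fastforce
    then show ?thesis using hi_lo[OF k] by linarith
  qed
qed

text \<open>
  The times are partitioned into the cores \<open>Inl k\<close>, the part of \<open>J k\<close> in no other block, and the overlaps
  \<open>Inr k\<close> of \<open>J k\<close> and \<open>J (k + 1)\<close>. Working with oscillations over these groups instead of single sites
  makes the error \<open>\<epsilon>\<close> of a block enter a bounded number of times, independently of the block length.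
\<close>

definition grp :: "nat + nat \<Rightarrow> nat set" where
  "grp gr = (case gr of
     Inl k \<Rightarrow> {(if k = 1 then 1 else hi (k - 1) + 1)..(if k = Kb then n else lo (k + 1) - 1)}
   | Inr k \<Rightarrow> {lo (k + 1)..hi k})"

definition groups :: "(nat + nat) set" where
  "groups = Inl ` {1..Kb} \<union> Inr ` {1..<Kb}"

text \<open>
  The groups that make up block \<open>k\<close>; its two neighbouring times lie in the cores \<open>Inl (k - 1)\<close> and
  \<open>Inl (k + 1)\<close>. The intersection drops the indices that do not exist at the two ends of the cover.
\<close>

definition members :: "nat \<Rightarrow> (nat + nat) set" where
  "members k = {Inl k, Inr (k - 1), Inr k} \<inter> groups"

lemma finite_groups: "finite groups" by (simp add: groups_def)
lemma finite_members: "finite (members k)" by (simp add: members_def)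
lemma members_groups: "members k \<subseteq> groups" by (simp add: members_def)
lemma in_groups: "Inl k \<in> groups \<longleftrightarrow> k \<in> {1..Kb}" "Inr k \<in> groups \<longleftrightarrow> 1 \<le> k \<and> k < Kb"
  by (auto simp: groups_def)

lemma overlap_eq: "1 \<le> k \<Longrightarrow> k < Kb \<Longrightarrow> lo (k + 1) + p = hi k + 1"
  using st(6)[of k] hi_lo[of k] by simp

lemma core_bounds:
  assumes "k \<in> {1..Kb}" "i \<in> grp (Inl k)"
  shows "k \<noteq> 1 \<Longrightarrow> lo k + p \<le> i" "k \<noteq> Kb \<Longrightarrow> i + p \<le> hi k" "lo k \<le> i" "i \<le> hi k" "1 \<le> i" "i \<le> n"
proof -
  have k: "k \<noteq> 1 \<Longrightarrow> 1 \<le> k - 1 \<and> k - 1 < Kb \<and> k - 1 + 1 = k" "k \<noteq> Kb \<Longrightarrow> 1 \<le> k \<and> k < Kb" using assms(1) by auto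
  have 1: "k \<noteq> 1 \<Longrightarrow> lo k + p = hi (k - 1) + 1" using overlap_eq[of "k - 1"] k(1) by simp
  have 2: "k \<noteq> Kb \<Longrightarrow> lo (k + 1) + p = hi k + 1" using overlap_eq[of k] k(2) by simp
  have 3: "k \<noteq> Kb \<Longrightarrow> 1 \<le> lo (k + 1)" using lo_ge[of "k + 1"] k(2) by simp
  show a: "k \<noteq> 1 \<Longrightarrow> lo k + p \<le> i" using 1 assms(2) by (simp add: grp_def)
  show b: "k \<noteq> Kb \<Longrightarrow> i + p \<le> hi k" using 2 3 assms(2) by (simp add: grp_def) linarith
  show l: "lo k \<le> i" using a assms(2) st(4) by (cases "k = 1") (auto simp: grp_def)
  show u: "i \<le> hi k" using b assms(2) st(5) by (cases "k = Kb") (auto simp: grp_def)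
  show "1 \<le> i" "i \<le> n" using l u lo_ge[OF assms(1)] hi_le[OF assms(1)] by auto
qed

lemma members_cover:
  assumes k: "k \<in> {1..Kb}"
  shows "{lo k..hi k} = (\<Union>gr\<in>members k. grp gr)"
proof (intro equalityI subsetI)
  fix i assume i: "i \<in> {lo k..hi k}"
  consider "k \<noteq> 1" "i \<le> hi (k - 1)" | "k \<noteq> Kb" "lo (k + 1) \<le> i"
    | "k = 1 \<or> hi (k - 1) < i" "k = Kb \<or> i < lo (k + 1)" by linarith
  then show "i \<in> (\<Union>gr\<in>members k. grp gr)"
  proof cases
    case 1
    then have "Inr (k - 1) \<in> members k" using k by (auto simp: members_def in_groups)
    moreover have "i \<in> grp (Inr (k - 1))" using 1 i k by (simp add: grp_def)
    ultimately show ?thesis by blast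
  next
    case 2
    then have "Inr k \<in> members k" using k by (auto simp: members_def in_groups)
    moreover have "i \<in> grp (Inr k)" using 2 i k by (simp add: grp_def)
    ultimately show ?thesis by blast
  next
    case 3
    have "Inl k \<in> members k" using k by (auto simp: members_def in_groups)
    moreover have "i \<in> grp (Inl k)" using 3 i lo_ge[OF k] hi_le[OF k] by (auto simp: grp_def)
    ultimately show ?thesis by blast
  qed
next
  fix i assume "i \<in> (\<Union>gr\<in>members k. grp gr)"
  then obtain gr where gr: "gr \<in> members k" "i \<in> grp gr" by blast
  then consider "gr = Inl k" | "gr = Inr (k - 1)" "1 \<le> k - 1" "k - 1 < Kb" | "gr = Inr k" "k < Kb"
    by (auto simp: members_def in_groups)
  then show "i \<in> {lo k..hi k}"
  proof cases
    case 1 then show ?thesis using core_bounds[OF k, of i] gr by auto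
  next
    case 2
    then have "hi (k - 1) < hi k" using st(7)[of "k - 1" k] k by auto
    then show ?thesis using 2 gr by (auto simp: grp_def)
  next
    case 3
    then have "lo k < lo (k + 1)" using st(7)[of k "k + 1"] k by auto
    then show ?thesis using 3 gr by (auto simp: grp_def)
  qed
qed

lemma other_groups:
  assumes k: "k \<in> {1..Kb}" and gr: "gr \<in> groups" "gr \<notin> members k" and i: "i \<in> grp gr"
  shows "i \<notin> {lo k..hi k}" "gr \<noteq> Inl (k - 1) \<Longrightarrow> i \<noteq> lo k - 1" "gr \<noteq> Inl (k + 1) \<Longrightarrow> i \<noteq> hi k + 1"
proof -
  have lh: "lo k \<le> hi k" "1 \<le> lo k" using lo_hi[OF k] lo_ge[OF k] by auto
  have "(i < lo k \<and> (gr \<noteq> Inl (k - 1) \<longrightarrow> i + 1 < lo k)) \<or> (hi k < i \<and> (gr \<noteq> Inl (k + 1) \<longrightarrow> hi k + 1 < i))"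
  proof (cases gr)
    case (Inl j)
    then have j: "j \<in> {1..Kb}" "j \<noteq> k" using gr k by (auto simp: in_groups members_def)
    show ?thesis
    proof (cases "j < k")
      case True
      then have jk: "j \<noteq> Kb" using k by auto
      have "1 \<le> lo (j + 1)" using lo_ge[of "j + 1"] True k by auto
      then have "i + 1 \<le> lo (j + 1)" using i Inl jk by (simp add: grp_def) linarith
      moreover have "lo (j + 1) \<le> lo k" using st(7)[of "j + 1" k] True k by (cases "j + 1 = k") auto
      moreover have "lo (j + 1) < lo k" if "j \<noteq> k - 1" using st(7)[of "j + 1" k] True k that by auto
      ultimately show ?thesis using Inl by fastforce
    next
      case False
      then have kj: "k < j" "j \<noteq> 1" using j k by auto
      have "hi (j - 1) + 1 \<le> i" using i Inl kj by (simp add: grp_def)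
      moreover have lt: "hi k < hi (j - 1)" if "j \<noteq> k + 1"
      proof -
        have "1 \<le> k" "k < j - 1" "j - 1 \<le> Kb" using kj j k that by auto
        then show ?thesis using st(7) by blast
      qed
      moreover have "hi k \<le> hi (j - 1)" using lt by (cases "j = k + 1") auto
      ultimately show ?thesis using Inl by fastforce
    qed
  next
    case (Inr j)
    then have j: "1 \<le> j" "j < Kb" "j \<noteq> k" "j \<noteq> k - 1" using gr k by (auto simp: in_groups members_def)
    have ij: "lo (j + 1) \<le> i" "i \<le> hi j" using i Inr by (auto simp: grp_def)
    show ?thesis
    proof (cases "j < k")
      case True
      then have "hi j + 1 < lo k" using st(8)[of j k] j k by auto
      then show ?thesis using ij by auto
    next
      case False
      then have "hi k + 1 < lo (j + 1)" using st(8)[of k "j + 1"] j k by auto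
      then show ?thesis using ij by auto
    qed
  qed
  then show "i \<notin> {lo k..hi k}" "gr \<noteq> Inl (k - 1) \<Longrightarrow> i \<noteq> lo k - 1" "gr \<noteq> Inl (k + 1) \<Longrightarrow> i \<noteq> hi k + 1"
    using lh by auto
qed

lemma grp_subset: "gr \<in> groups \<Longrightarrow> grp gr \<subseteq> {1..n}"
proof
  fix i assume gr: "gr \<in> groups" and i: "i \<in> grp gr"
  then show "i \<in> {1..n}"
  proof (cases gr)
    case (Inl k) then show ?thesis using gr i core_bounds[of k i] by (auto simp: in_groups)
  next
    case (Inr k)
    then have "1 \<le> lo (k + 1)" "hi k \<le> n" using gr lo_ge[of "k + 1"] hi_le[of k] by (auto simp: in_groups)
    then show ?thesis using i Inr by (auto simp: grp_def)
  qed
qed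

lemma groups_cover: "(\<Union>gr\<in>groups. grp gr) = {1..n}"
proof
  show "(\<Union>gr\<in>groups. grp gr) \<subseteq> {1..n}" using grp_subset by blast
  show "{1..n} \<subseteq> (\<Union>gr\<in>groups. grp gr)"
  proof
    fix i assume "i \<in> {1..n}"
    moreover have "(\<Union>k\<in>{1..Kb}. J k) = {1..n}" using cover unfolding block_cover_def by blast
    ultimately obtain k where "k \<in> {1..Kb}" "i \<in> J k" by blast
    then have "i \<in> (\<Union>gr\<in>members k. grp gr)" using J_eq members_cover by blast
    then show "i \<in> (\<Union>gr\<in>groups. grp gr)" using members_groups by blast
  qed
qed

lemma groups_disjoint:
  assumes gr: "gr \<in> groups" "gr' \<in> groups" "gr \<noteq> gr'" shows "grp gr \<inter> grp gr' = {}"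
proof -
  have core: "grp (Inl k) \<inter> grp gr' = {}" if k: "k \<in> {1..Kb}" and gr': "gr' \<in> groups" "gr' \<noteq> Inl k" for k gr'
  proof (rule ccontr)
    assume "\<not> ?thesis"
    then obtain i where i: "i \<in> grp (Inl k)" "i \<in> grp gr'" by blast
    have ik: "i \<in> {lo k..hi k}" using core_bounds[OF k i(1)] by auto
    then have "gr' \<in> members k" using other_groups(1)[OF k gr'(1) _ i(2)] by blast
    then consider "gr' = Inr (k - 1)" "1 \<le> k - 1" | "gr' = Inr k" "k < Kb" using gr' by (auto simp: members_def in_groups)
    then show False
    proof cases
      case 1
      then have "k \<noteq> 1" by auto
      then have "i \<le> hi (k - 1)" "hi (k - 1) + 1 \<le> i" using i 1 by (simp_all add: grp_def)
      then show False by simp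
    next
      case 2
      then have "lo (k + 1) \<le> i" "i \<le> lo (k + 1) - 1" "1 \<le> lo (k + 1)" using i lo_ge[of "k + 1"] by (auto simp: grp_def)
      then show False by linarith
    qed
  qed
  show ?thesis
  proof (cases gr)
    case (Inl k) then show ?thesis using core[of k gr'] gr by (auto simp: in_groups)
  next
    case g1: (Inr k)
    show ?thesis
    proof (cases gr')
      case (Inl k') then show ?thesis using core[of k' gr] gr by (auto simp: in_groups)
    next
      case g2: (Inr k')
      have kk: "1 \<le> k" "k < Kb" "1 \<le> k'" "k' < Kb" "k \<noteq> k'" using gr g1 g2 by (auto simp: in_groups)
      have "hi j < lo (j' + 1)" if "j < j'" "1 \<le> j" "j' < Kb" for j j'
        using st(8)[of j "j' + 1"] that by auto
      from this[of k k'] this[of k' k] kk show ?thesis unfolding g1 g2 by (cases "k < k'") (auto simp: grp_def)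
    qed
  qed
qed

end

section \<open>Transport of weighted oscillations\<close>

text \<open>
  Bounded real functions are shifted to be nonnegative, which transfers kernel measurability from the
  extended nonnegative integral.
\<close>

lemma nn_integral_shifted:
  assumes "prob_space \<mu>" and f [measurable]: "(f :: _ \<Rightarrow> real) \<in> borel_measurable \<mu>" and C: "\<And>v. v \<in> space \<mu> \<Longrightarrow> \<bar>f v\<bar> \<le> C"
  shows "(\<integral>\<^sup>+v. ennreal (f v + C) \<partial>\<mu>) = ennreal ((\<integral>v. f v \<partial>\<mu>) + C)" "\<bar>\<integral>v. f v \<partial>\<mu>\<bar> \<le> C" "integrable \<mu> f"
proof -
  interpret prob_space \<mu> by fact
  show i: "integrable \<mu> f" using C by (intro integrable_const_bound[where B=C]) auto
  have "(\<integral>\<^sup>+v. ennreal (f v + C) \<partial>\<mu>) = ennreal (\<integral>v. f v + C \<partial>\<mu>)"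
  proof (rule nn_integral_eq_integral)
    show "AE v in \<mu>. 0 \<le> f v + C"
    proof (rule AE_I2)
      fix v assume "v \<in> space \<mu>" from C[OF this] show "0 \<le> f v + C" by linarith
    qed
  qed (use i in simp)
  then show "(\<integral>\<^sup>+v. ennreal (f v + C) \<partial>\<mu>) = ennreal ((\<integral>v. f v \<partial>\<mu>) + C)"
    using i by (simp add: prob_space)
  have "(\<integral>v. f v \<partial>\<mu>) \<le> C" using i C by (intro integral_le_const) (auto simp: abs_le_iff)
  moreover have "- C \<le> (\<integral>v. f v \<partial>\<mu>)"
  proof (rule integral_ge_const[OF i], rule AE_I2)
    fix v assume "v \<in> space \<mu>" from C[OF this] show "- C \<le> f v" by linarith
  qed
  ultimately show "\<bar>\<integral>v. f v \<partial>\<mu>\<bar> \<le> C" by linarith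
qed

lemma kernel_mean:
  assumes P: "P \<in> L \<rightarrow>\<^sub>M prob_algebra T" and f [measurable]: "(f :: _ \<Rightarrow> real) \<in> borel_measurable T" and C: "\<And>v. v \<in> space T \<Longrightarrow> \<bar>f v\<bar> \<le> C"
  shows "(\<lambda>x. \<integral>v. f v \<partial>P x) \<in> borel_measurable L" "\<And>x. x \<in> space L \<Longrightarrow> \<bar>\<integral>v. f v \<partial>P x\<bar> \<le> C"
    "\<And>x. x \<in> space L \<Longrightarrow> (\<integral>\<^sup>+v. ennreal (f v + C) \<partial>P x) = ennreal ((\<integral>v. f v \<partial>P x) + C)"
proof -
  have Px: "sets (P x) = sets T" "prob_space (P x)" "space (P x) = space T" if "x \<in> space L" for x
    using measurable_space[OF P that] sets_eq_imp_space_eq by (auto simp: space_prob_algebra)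
  have fx: "f \<in> borel_measurable (P x)" if "x \<in> space L" for x
    using f measurable_cong_sets[OF Px(1)[OF that] refl] by blast
  show 1: "(\<integral>\<^sup>+v. ennreal (f v + C) \<partial>P x) = ennreal ((\<integral>v. f v \<partial>P x) + C)" and 2: "\<bar>\<integral>v. f v \<partial>P x\<bar> \<le> C"
    if x: "x \<in> space L" for x
    using nn_integral_shifted(1,2)[OF Px(2)[OF x] fx[OF x], of C] C Px(3)[OF x] by auto
  have "(\<lambda>x. \<integral>\<^sup>+v. ennreal (f v + C) \<partial>P x) \<in> borel_measurable L"
    by (rule nn_integral_measurable_subprob_algebra2[OF _ measurable_prob_algebraD[OF P]]) measurable
  then have "(\<lambda>x. enn2real (\<integral>\<^sup>+v. ennreal (f v + C) \<partial>P x) - C) \<in> borel_measurable L" by measurable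
  moreover have "enn2real (\<integral>\<^sup>+v. ennreal (f v + C) \<partial>P x) - C = (\<integral>v. f v \<partial>P x)" if "x \<in> space L" for x
    using 1[OF that] 2[OF that] by auto
  ultimately show "(\<lambda>x. \<integral>v. f v \<partial>P x) \<in> borel_measurable L" by (simp cong: measurable_cong)
qed

lemma integral_bind_bounded:
  assumes M: "M \<in> space (prob_algebra L)" and P: "P \<in> L \<rightarrow>\<^sub>M prob_algebra T"
    and f [measurable]: "(f :: _ \<Rightarrow> real) \<in> borel_measurable T" and C: "\<And>v. v \<in> space T \<Longrightarrow> \<bar>f v\<bar> \<le> C"
  shows "(\<integral>v. f v \<partial>(M \<bind> P)) = (\<integral>x. (\<integral>v. f v \<partial>P x) \<partial>M)"
proof -
  have M': "sets M = sets L" "prob_space M" "space M = space L" using M sets_eq_imp_space_eq by (auto simp: space_prob_algebra)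
  have PM: "P \<in> M \<rightarrow>\<^sub>M prob_algebra T" using P measurable_cong_sets[OF M'(1) refl] by blast
  have b: "M \<bind> P \<in> space (prob_algebra T)"
    using prob_space.prob_space_bind[OF M'(2), of P T] PM
      sets_bind[of M P T] prob_space.not_empty[OF M'(2)] measurable_space[OF PM] measurable_prob_algebraD[OF PM]
    by (auto simp: space_prob_algebra)
  have b': "prob_space (M \<bind> P)" "f \<in> borel_measurable (M \<bind> P)" "space (M \<bind> P) = space T"
    using b sets_eq_imp_space_eq f by (auto simp: space_prob_algebra cong: measurable_cong_sets)
  note km = kernel_mean[OF PM f C]
  have "ennreal ((\<integral>v. f v \<partial>(M \<bind> P)) + C) = (\<integral>\<^sup>+v. ennreal (f v + C) \<partial>(M \<bind> P))"
    using nn_integral_shifted(1)[OF b'(1,2), of C] b'(3) C by simp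
  also have "\<dots> = (\<integral>\<^sup>+x. (\<integral>\<^sup>+v. ennreal (f v + C) \<partial>P x) \<partial>M)"
    by (rule nn_integral_bind[OF _ measurable_prob_algebraD[OF PM]]) measurable
  also have "\<dots> = (\<integral>\<^sup>+x. ennreal ((\<integral>v. f v \<partial>P x) + C) \<partial>M)"
    by (intro nn_integral_cong) (simp add: km(3))
  also have "\<dots> = ennreal ((\<integral>x. (\<integral>v. f v \<partial>P x) \<partial>M) + C)"
    by (rule nn_integral_shifted(1)[OF M'(2) km(1,2)])
  finally have "ennreal ((\<integral>v. f v \<partial>(M \<bind> P)) + C) = \<dots>" .
  moreover have "0 \<le> (\<integral>v. f v \<partial>(M \<bind> P)) + C" using nn_integral_shifted(2)[OF b'(1,2), of C] b'(3) C by auto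
  moreover have "0 \<le> (\<integral>x. (\<integral>v. f v \<partial>P x) \<partial>M) + C" using nn_integral_shifted(2)[OF M'(2) km(1,2)] by auto
  ultimately show ?thesis by simp
qed

lemma kcomp_kernel: "P \<in> X \<rightarrow>\<^sub>M prob_algebra X \<Longrightarrow> Q \<in> X \<rightarrow>\<^sub>M prob_algebra X \<Longrightarrow> kcomp P Q \<in> X \<rightarrow>\<^sub>M prob_algebra X"
  unfolding kcomp_def[abs_def] by (rule measurable_bind_prob_space)

context pg_cover begin

text \<open>
  The weight \<open>\<rho> gr\<close> can be read as the size of a discrepancy in group \<open>gr\<close> before the kernel acts, and
  \<open>\<rho>'\<close> as its size afterwards; dually, bounds on group oscillations of \<open>f\<close> yield bounds for its image,
  whose \<open>\<rho>\<close>-weighted sum is controlled by the \<open>\<rho>'\<close>-weighted sum for \<open>f\<close>. In this form composition of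
  kernels is composition of weight transformations, in the order in which the kernels act.
\<close>

definition contracts :: "((nat \<Rightarrow> 'x) \<Rightarrow> (nat \<Rightarrow> 'x) measure) \<Rightarrow> (nat + nat \<Rightarrow> real) \<Rightarrow> (nat + nat \<Rightarrow> real) \<Rightarrow> bool" where
  "contracts P \<rho> \<rho>' \<longleftrightarrow> P \<in> X \<rightarrow>\<^sub>M prob_algebra X \<and>
     (\<forall>f B M. f \<in> borel_measurable X \<longrightarrow> (\<forall>v\<in>space X. \<bar>f v\<bar> \<le> M) \<longrightarrow> (\<forall>gr\<in>groups. 0 \<le> B gr) \<longrightarrow>
        group_bound groups grp B f \<longrightarrow>
        (\<exists>B'. (\<forall>gr\<in>groups. 0 \<le> B' gr) \<and> group_bound groups grp B' (\<lambda>x. \<integral>v. f v \<partial>P x) \<and>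
           (\<Sum>gr\<in>groups. \<rho> gr * B' gr) \<le> (\<Sum>gr\<in>groups. \<rho>' gr * B gr)))"

lemma contracts_return: "contracts (return X) \<rho> \<rho>"
  unfolding contracts_def
proof (intro conjI allI impI exI)
  fix f B and M :: real
  assume f: "f \<in> borel_measurable X" and B: "\<forall>gr\<in>groups. 0 \<le> B gr" "group_bound groups grp B f"
  show "\<forall>gr\<in>groups. 0 \<le> B gr" by fact
  have "(\<integral>v. f v \<partial>return X x) = f x" if "x \<in> space X" for x using f that by (simp add: integral_return)
  then show "group_bound groups grp B (\<lambda>x. \<integral>v. f v \<partial>return X x)"
    using B(2) unfolding group_bound_def by simp
qed auto

lemma contracts_kcomp:
  assumes P: "contracts P \<rho> \<rho>'" and Q: "contracts Q \<rho>' \<rho>''"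
  shows "contracts (kcomp P Q) \<rho> \<rho>''"
  unfolding contracts_def
proof (intro conjI allI impI)
  have PQ: "P \<in> X \<rightarrow>\<^sub>M prob_algebra X" "Q \<in> X \<rightarrow>\<^sub>M prob_algebra X" using P Q by (auto simp: contracts_def)
  then show "kcomp P Q \<in> X \<rightarrow>\<^sub>M prob_algebra X" by (rule kcomp_kernel)
  fix f B and M :: real
  assume f: "f \<in> borel_measurable X" and M: "\<forall>v\<in>space X. \<bar>f v\<bar> \<le> M"
    and B: "\<forall>gr\<in>groups. 0 \<le> B gr" "group_bound groups grp B f"
  obtain B1 where B1: "\<forall>gr\<in>groups. 0 \<le> B1 gr" "group_bound groups grp B1 (\<lambda>x. \<integral>v. f v \<partial>Q x)"
      "(\<Sum>gr\<in>groups. \<rho>' gr * B1 gr) \<le> (\<Sum>gr\<in>groups. \<rho>'' gr * B gr)"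
    using Q f M B unfolding contracts_def by blast
  have km: "(\<lambda>x. \<integral>v. f v \<partial>Q x) \<in> borel_measurable X" "\<forall>x\<in>space X. \<bar>\<integral>v. f v \<partial>Q x\<bar> \<le> M"
    using kernel_mean[OF PQ(2) f, of M] M by auto
  obtain B2 where B2: "\<forall>gr\<in>groups. 0 \<le> B2 gr" "group_bound groups grp B2 (\<lambda>x. \<integral>w. (\<integral>v. f v \<partial>Q w) \<partial>P x)"
      "(\<Sum>gr\<in>groups. \<rho> gr * B2 gr) \<le> (\<Sum>gr\<in>groups. \<rho>' gr * B1 gr)"
    using P km B1 unfolding contracts_def by blast
  have "(\<integral>v. f v \<partial>kcomp P Q x) = (\<integral>w. (\<integral>v. f v \<partial>Q w) \<partial>P x)" if "x \<in> space X" for x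
    unfolding kcomp_def using M by (intro integral_bind_bounded[OF measurable_space[OF PQ(1) that] PQ(2) f]) auto
  then have "group_bound groups grp B2 (\<lambda>x. \<integral>v. f v \<partial>kcomp P Q x)"
    using B2(2) unfolding group_bound_def by simp
  then show "\<exists>B'. (\<forall>gr\<in>groups. 0 \<le> B' gr) \<and> group_bound groups grp B' (\<lambda>x. \<integral>v. f v \<partial>kcomp P Q x) \<and>
      (\<Sum>gr\<in>groups. \<rho> gr * B' gr) \<le> (\<Sum>gr\<in>groups. \<rho>'' gr * B gr)"
    using B1(3) B2 by (intro exI[of _ B2]) auto
qed

lemma contracts_kprod:
  "(\<And>i. i < length Ps \<Longrightarrow> contracts (Ps ! i) (r i) (r (Suc i))) \<Longrightarrow> contracts (kprod X Ps) (r 0) (r (length Ps))"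
proof (induction Ps arbitrary: r)
  case Nil
  show ?case using contracts_return[of "r 0"] by (simp only: kprod_def foldr.simps id_apply list.size)
next
  case (Cons P Ps)
  have "contracts P (r 0) (r 1)" using Cons.prems[of 0] by simp
  moreover have "contracts (kprod X Ps) (r 1) (r (Suc (length Ps)))"
    using Cons.IH[of "\<lambda>i. r (Suc i)"] Cons.prems[of "Suc _"] by simp
  ultimately show ?case by (simp add: kprod_def contracts_kcomp)
qed

lemma contracts_mono:
  assumes P: "contracts P \<rho> \<rho>'" and le: "\<And>gr. gr \<in> groups \<Longrightarrow> \<rho>' gr \<le> \<rho>'' gr" and le0: "\<And>gr. gr \<in> groups \<Longrightarrow> \<rho>0 gr = \<rho> gr"
  shows "contracts P \<rho>0 \<rho>''"
  unfolding contracts_def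
proof (intro conjI allI impI)
  show "P \<in> X \<rightarrow>\<^sub>M prob_algebra X" using P by (simp add: contracts_def)
  fix f B and M :: real
  assume a: "f \<in> borel_measurable X" "\<forall>v\<in>space X. \<bar>f v\<bar> \<le> M" "\<forall>gr\<in>groups. 0 \<le> B gr" "group_bound groups grp B f"
  then obtain B' where B': "\<forall>gr\<in>groups. 0 \<le> B' gr" "group_bound groups grp B' (\<lambda>x. \<integral>v. f v \<partial>P x)"
      "(\<Sum>gr\<in>groups. \<rho> gr * B' gr) \<le> (\<Sum>gr\<in>groups. \<rho>' gr * B gr)"
    using P unfolding contracts_def by blast
  have "(\<Sum>gr\<in>groups. \<rho>' gr * B gr) \<le> (\<Sum>gr\<in>groups. \<rho>'' gr * B gr)"
    using le a by (intro sum_mono mult_right_mono) auto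
  moreover have "(\<Sum>gr\<in>groups. \<rho>0 gr * B' gr) = (\<Sum>gr\<in>groups. \<rho> gr * B' gr)" using le0 by (intro sum.cong) auto
  ultimately show "\<exists>B'. (\<forall>gr\<in>groups. 0 \<le> B' gr) \<and> group_bound groups grp B' (\<lambda>x. \<integral>v. f v \<partial>P x) \<and>
      (\<Sum>gr\<in>groups. \<rho>0 gr * B' gr) \<le> (\<Sum>gr\<in>groups. \<rho>'' gr * B gr)"
    using B' by (intro exI[of _ B']) auto
qed

lemma contracts_scale:
  assumes P: "contracts P (\<lambda>_. 1) (\<lambda>_. c)" and t: "0 \<le> t"
  shows "contracts P (\<lambda>_. t) (\<lambda>_. t * c)"
  unfolding contracts_def
proof (intro conjI allI impI)
  show "P \<in> X \<rightarrow>\<^sub>M prob_algebra X" using P by (simp add: contracts_def)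
  fix f B and M :: real
  assume a: "f \<in> borel_measurable X" "\<forall>v\<in>space X. \<bar>f v\<bar> \<le> M" "\<forall>gr\<in>groups. 0 \<le> B gr" "group_bound groups grp B f"
  then obtain B' where B': "\<forall>gr\<in>groups. 0 \<le> B' gr" "group_bound groups grp B' (\<lambda>x. \<integral>v. f v \<partial>P x)"
      "(\<Sum>gr\<in>groups. 1 * B' gr) \<le> (\<Sum>gr\<in>groups. c * B gr)"
    using P unfolding contracts_def by blast
  have "(\<Sum>gr\<in>groups. t * B' gr) \<le> (\<Sum>gr\<in>groups. t * c * B gr)"
    using mult_left_mono[OF B'(3) t] by (simp add: sum_distrib_left mult.assoc)
  then show "\<exists>B'. (\<forall>gr\<in>groups. 0 \<le> B' gr) \<and> group_bound groups grp B' (\<lambda>x. \<integral>v. f v \<partial>P x) \<and>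
      (\<Sum>gr\<in>groups. t * B' gr) \<le> (\<Sum>gr\<in>groups. t * c * B gr)"
    using B' by (intro exI[of _ B']) auto
qed

lemma contracts_kpow:
  assumes P: "contracts P (\<lambda>_. 1) (\<lambda>_. c)" and c: "0 \<le> c"
  shows "contracts (kpow X P k) (\<lambda>_. 1) (\<lambda>_. c ^ k)"
proof -
  have "contracts (kprod X (replicate k P)) ((\<lambda>i _. c ^ i) 0) ((\<lambda>i _. c ^ i) (length (replicate k P)))"
  proof (rule contracts_kprod)
    fix i assume "i < length (replicate k P)"
    then show "contracts (replicate k P ! i) (\<lambda>_. c ^ i) (\<lambda>_. c ^ Suc i)"
      using contracts_scale[OF P, of "c ^ i"] c by (simp add: mult.commute)
  qed
  then show ?thesis by (simp add: kpow_def)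
qed

lemma site_oscillation:
  assumes fin: "finite_oscillation X f" and i: "i \<in> {1..n}"
  shows "0 \<le> osc S {1..n} i f"
    "\<And>x z. x \<in> space X \<Longrightarrow> z \<in> space X \<Longrightarrow> (\<And>j. j \<noteq> i \<Longrightarrow> x j = z j) \<Longrightarrow> f x - f z \<le> osc S {1..n} i f"
proof -
  define V where "V = {\<bar>f x - f z\<bar> | x z. x \<in> space X \<and> z \<in> space X \<and> (\<forall>j\<in>{1..n} - {i}. x j = z j)}"
  have bdd: "bdd_above V"
    using fin unfolding finite_oscillation_def V_def by (rule bdd_above_mono) auto
  have o: "osc S {1..n} i f = Sup V" by (simp add: osc_def V_def)
  have up: "\<bar>f x - f z\<bar> \<le> osc S {1..n} i f" if "x \<in> space X" "z \<in> space X" "\<And>j. j \<noteq> i \<Longrightarrow> x j = z j" for x z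
    unfolding o by (rule cSup_upper[OF _ bdd]) (use that in \<open>auto simp: V_def\<close>)
  show "\<And>x z. x \<in> space X \<Longrightarrow> z \<in> space X \<Longrightarrow> (\<And>j. j \<noteq> i \<Longrightarrow> x j = z j) \<Longrightarrow> f x - f z \<le> osc S {1..n} i f"
    using up by fastforce
  obtain v where v: "v \<in> space S" using not_empty by auto
  have "(\<lambda>i\<in>{1..n}. v) \<in> space X" using v by (auto simp: space_PiM)
  from up[OF this this] show "0 \<le> osc S {1..n} i f" by simp
qed

text \<open>
  Within a group the sites are changed one at a time, so sums of site oscillations are admissible group
  bounds, and as the groups partition the times they add up to the sum over all sites.
\<close>

lemma oscillation_groups:
  assumes fin: "finite_oscillation X f"
  shows "group_bound groups grp (\<lambda>gr. \<Sum>i\<in>grp gr. osc S {1..n} i f) f"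
    "(\<Sum>gr\<in>groups. \<Sum>i\<in>grp gr. osc S {1..n} i f) = (\<Sum>i\<in>{1..n}. osc S {1..n} i f)"
proof -
  have gb: "group_bound {1..n} (\<lambda>i. {i}) (\<lambda>i. osc S {1..n} i f) f"
    using site_oscillation(2)[OF fin] unfolding group_bound_def by auto
  show "group_bound groups grp (\<lambda>gr. \<Sum>i\<in>grp gr. osc S {1..n} i f) f"
    unfolding group_bound_def
  proof (intro ballI impI)
    fix gr x z assume "gr \<in> groups" "x \<in> space X" "z \<in> space X" "\<forall>i. i \<notin> grp gr \<longrightarrow> x i = z i"
    then show "f x - f z \<le> (\<Sum>i\<in>grp gr. osc S {1..n} i f)"
      using grp_subset finite_subset[of "grp gr" "{1..n}"] by (intro group_bound_union[OF gb]) auto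
  qed
  have "(\<Sum>gr\<in>groups. \<Sum>i\<in>grp gr. osc S {1..n} i f) = (\<Sum>i\<in>(\<Union>gr\<in>groups. grp gr). osc S {1..n} i f)"
    using groups_disjoint finite_subset[OF grp_subset] by (intro sum.UNION_disjoint[symmetric] finite_groups) auto
  then show "(\<Sum>gr\<in>groups. \<Sum>i\<in>grp gr. osc S {1..n} i f) = (\<Sum>i\<in>{1..n}. osc S {1..n} i f)"
    unfolding groups_cover .
qed

text \<open>
  The sum of all group bounds of the iterated image is at most \<open>c ^ k\<close> times the sum of the site
  oscillations, and it bounds the difference of the image at any two configurations. This difference
  vanishes where the two coordinates of the coupling agree, which gives the factor \<open>\<Psi>(X \<noteq> Z)\<close>.
\<close>

theorem contracts_rate:
  assumes P: "contracts P (\<lambda>_. 1) (\<lambda>_. c)" and c: "0 \<le> c"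
    and diagonal: "{w \<in> space (S \<Otimes>\<^sub>M S). fst w = snd w} \<in> sets (S \<Otimes>\<^sub>M S)"
  shows "contracts_at_rate S {1..n} P c"
  unfolding contracts_at_rate_def Let_def
proof (intro ballI allI impI)
  fix \<mu> \<nu> \<Psi> f and k :: nat
  assume \<mu>: "\<mu> \<in> space (prob_algebra X)" and \<nu>: "\<nu> \<in> space (prob_algebra X)" and \<Psi>: "coupling X \<mu> \<nu> \<Psi>"
    and f: "f \<in> borel_measurable X" and fin: "finite_oscillation X f" and k: "1 \<le> k"
  have Pk: "contracts (kpow X P k) (\<lambda>_. 1) (\<lambda>_. c ^ k)" by (rule contracts_kpow[OF P c])
  then have ker: "kpow X P k \<in> X \<rightarrow>\<^sub>M prob_algebra X" by (simp add: contracts_def)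
  obtain v0 where v0: "v0 \<in> space S" using not_empty by auto
  define x0 where "x0 = (\<lambda>i\<in>{1..n}. v0)"
  have x0: "x0 \<in> space X" using v0 by (auto simp: x0_def space_PiM)
  obtain C where C: "\<And>x z. x \<in> space X \<Longrightarrow> z \<in> space X \<Longrightarrow> \<bar>f x - f z\<bar> \<le> C"
    using fin unfolding finite_oscillation_def bdd_above_def by blast
  define M where "M = C + \<bar>f x0\<bar>"
  have M: "\<And>v. v \<in> space X \<Longrightarrow> \<bar>f v\<bar> \<le> M" using C[OF _ x0] unfolding M_def by fastforce
  define B where "B gr = (\<Sum>i\<in>grp gr. osc S {1..n} i f)" for gr
  have "\<forall>gr\<in>groups. 0 \<le> B gr" unfolding B_def
    by (intro ballI sum_nonneg site_oscillation(1)[OF fin]) (rule subsetD[OF grp_subset])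
  then obtain B' where B': "\<forall>gr\<in>groups. 0 \<le> B' gr" "group_bound groups grp B' (\<lambda>x. \<integral>v. f v \<partial>kpow X P k x)"
      "(\<Sum>gr\<in>groups. 1 * B' gr) \<le> (\<Sum>gr\<in>groups. c ^ k * B gr)"
    using Pk f M oscillation_groups(1)[OF fin, folded B_def] unfolding contracts_def by blast
  define F where "F x = (\<integral>v. f v \<partial>kpow X P k x)" for x
  have Fm: "F \<in> borel_measurable X" and FM: "\<And>x. x \<in> space X \<Longrightarrow> \<bar>F x\<bar> \<le> M"
    unfolding F_def using kernel_mean[OF ker f M] by auto
  define T where "T = c ^ k * (\<Sum>i\<in>{1..n}. osc S {1..n} i f)"
  have BT: "(\<Sum>gr\<in>groups. B' gr) \<le> T"
    using B'(3) oscillation_groups(2)[OF fin] by (simp add: T_def B_def sum_distrib_left[symmetric])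
  have T0: "0 \<le> T" using BT B'(1) sum_nonneg[of groups B'] by (meson order_trans)
  have Fdiff: "F x - F z \<le> T" if "x \<in> space X" "z \<in> space X" for x z
  proof -
    have "F x - F z \<le> (\<Sum>gr\<in>groups. B' gr)"
    proof (rule group_bound_union[OF B'(2)[folded F_def] finite_groups order_refl that])
      fix i assume "i \<notin> (\<Union>gr\<in>groups. grp gr)"
      then show "x i = z i" unfolding groups_cover using that by (auto simp: space_PiM PiE_def extensional_def)
    qed
    then show ?thesis using BT by simp
  qed
  interpret \<Psi>: prob_space \<Psi> using \<Psi> by (simp add: coupling_def)
  have s\<Psi> [measurable_cong]: "sets \<Psi> = sets (X \<Otimes>\<^sub>M X)" and marg: "distr \<Psi> X fst = \<mu>" "distr \<Psi> X snd = \<nu>"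
    using \<Psi> by (auto simp: coupling_def)
  have sp\<Psi>: "space \<Psi> = space X \<times> space X" using sets_eq_imp_space_eq[OF s\<Psi>] by (simp add: space_pair_measure)
  note [measurable] = Fm
  define E where "E = {w \<in> space \<Psi>. fst w \<noteq> snd w}"
  have Em: "E \<in> sets \<Psi>"
  proof -
    have "E = (\<Union>i\<in>{1..n}. {w \<in> space \<Psi>. (fst w i, snd w i) \<notin> {w \<in> space (S \<Otimes>\<^sub>M S). fst w = snd w}})"
    proof (intro equalityI subsetI)
      fix w assume w: "w \<in> E"
      then have sp: "fst w \<in> space X" "snd w \<in> space X" by (auto simp: E_def sp\<Psi>)
      have "\<exists>i\<in>{1..n}. fst w i \<noteq> snd w i"
      proof (rule ccontr)
        assume "\<not> ?thesis"
        then have "fst w = snd w" using sp by (auto simp: space_PiM PiE_def extensional_def fun_eq_iff)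
        then show False using w by (simp add: E_def)
      qed
      then show "w \<in> (\<Union>i\<in>{1..n}. {w \<in> space \<Psi>. (fst w i, snd w i) \<notin> {w \<in> space (S \<Otimes>\<^sub>M S). fst w = snd w}})"
        using w by (auto simp: E_def)
    next
      fix w assume "w \<in> (\<Union>i\<in>{1..n}. {w \<in> space \<Psi>. (fst w i, snd w i) \<notin> {w \<in> space (S \<Otimes>\<^sub>M S). fst w = snd w}})"
      then obtain i where i: "i \<in> {1..n}" "w \<in> space \<Psi>" "(fst w i, snd w i) \<notin> {w \<in> space (S \<Otimes>\<^sub>M S). fst w = snd w}" by blast
      have "fst w i \<in> space S" "snd w i \<in> space S" using i comp_space by (auto simp: sp\<Psi>)
      then show "w \<in> E" using i by (auto simp: E_def space_pair_measure)
    qed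
    also have "\<dots> \<in> sets \<Psi>"
    proof (intro sets.finite_UN)
      fix i assume i: "i \<in> {1..n}"
      have "(\<lambda>w. (fst w i, snd w i)) \<in> \<Psi> \<rightarrow>\<^sub>M S \<Otimes>\<^sub>M S" using i by measurable
      then show "{w \<in> space \<Psi>. (fst w i, snd w i) \<notin> {w \<in> space (S \<Otimes>\<^sub>M S). fst w = snd w}} \<in> sets \<Psi>"
        using diagonal by measurable
    qed simp
    finally show ?thesis .
  qed
  have "(\<integral>x. F x \<partial>\<mu>) = (\<integral>w. F (fst w) \<partial>\<Psi>)"
    unfolding marg(1)[symmetric] by (rule integral_distr) measurable
  then have m1: "(\<integral>x. f x \<partial>(\<mu> \<bind> kpow X P k)) = (\<integral>w. F (fst w) \<partial>\<Psi>)"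
    using integral_bind_bounded[OF \<mu> ker f M] by (simp add: F_def)
  have "(\<integral>x. F x \<partial>\<nu>) = (\<integral>w. F (snd w) \<partial>\<Psi>)"
    unfolding marg(2)[symmetric] by (rule integral_distr) measurable
  then have m2: "(\<integral>x. f x \<partial>(\<nu> \<bind> kpow X P k)) = (\<integral>w. F (snd w) \<partial>\<Psi>)"
    using integral_bind_bounded[OF \<nu> ker f M] by (simp add: F_def)
  have i12: "integrable \<Psi> (\<lambda>w. F (fst w))" "integrable \<Psi> (\<lambda>w. F (snd w))"
    using FM by (auto intro!: \<Psi>.integrable_const_bound[where B=M] simp: sp\<Psi>)
  have "\<bar>(\<integral>w. F (fst w) \<partial>\<Psi>) - (\<integral>w. F (snd w) \<partial>\<Psi>)\<bar> = \<bar>\<integral>w. F (fst w) - F (snd w) \<partial>\<Psi>\<bar>"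
    using i12 by simp
  also have "\<dots> \<le> (\<integral>w. \<bar>F (fst w) - F (snd w)\<bar> \<partial>\<Psi>)" by (rule integral_abs_bound)
  also have "\<dots> \<le> (\<integral>w. T * indicator E w \<partial>\<Psi>)"
  proof (rule integral_mono)
    show "integrable \<Psi> (\<lambda>w. \<bar>F (fst w) - F (snd w)\<bar>)" using i12 by simp
    show "integrable \<Psi> (\<lambda>w. T * indicator E w)" using Em by (simp add: \<Psi>.emeasure_eq_measure)
    fix w assume w: "w \<in> space \<Psi>"
    then show "\<bar>F (fst w) - F (snd w)\<bar> \<le> T * indicator E w"
      using Fdiff[of "fst w" "snd w"] Fdiff[of "snd w" "fst w"] by (auto simp: sp\<Psi> E_def indicator_def abs_le_iff)
  qed
  also have "\<dots> = T * measure \<Psi> E" using Em by simp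
  finally show "\<bar>(\<integral>x. f x \<partial>(\<mu> \<bind> kpow X P k)) - (\<integral>x. f x \<partial>(\<nu> \<bind> kpow X P k))\<bar>
    \<le> c ^ k * (measure \<Psi> {w \<in> space \<Psi>. fst w \<noteq> snd w} * (\<Sum>i\<in>{1..n}. osc S {1..n} i f))"
    unfolding m1 m2 by (simp add: T_def E_def ac_simps)
qed

end

section \<open>The effect of one block update on the weights\<close>

context pg_cover begin

definition \<alpha> where "\<alpha> = 1 - \<theta>"
definition \<epsilon> where "\<epsilon> = 1 - \<kappa> L"
text \<open>
  What a core and the two overlaps of a block remember of a change at a neighbour of the block: a core
  is at distance at least \<open>p + 1\<close> from either side (\<open>ca\<close>), the near overlap at distance 1 (\<open>c1\<close>), the far
  overlap at distance \<open>L - p + 1\<close> (\<open>c2\<close>).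
\<close>

definition ca where "ca = \<alpha> ^ ((p + 1) div h)"
definition c1 where "c1 = \<alpha> ^ (1 div h)"
definition c2 where "c2 = \<alpha> ^ nat \<lfloor>(real L - real p + 1) / real h\<rfloor>"

lemma \<alpha>: "0 \<le> \<alpha>" "\<alpha> \<le> 1" using \<theta> by (auto simp: \<alpha>_def)
lemma \<epsilon>: "0 \<le> \<epsilon>" "\<epsilon> \<le> 1" using \<kappa> by (auto simp: \<epsilon>_def)
lemma coeff_nonneg: "0 \<le> ca" "0 \<le> c1" "0 \<le> c2" using \<alpha> by (auto simp: ca_def c1_def c2_def)

lemma c2_eq: "2 \<le> Kb \<Longrightarrow> c2 = \<alpha> ^ ((L - p + 1) div h)"
proof -
  assume "2 \<le> Kb"
  then have "p < L" by (rule p_less)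
  then have "(real L - real p + 1) / real h = real (L - p + 1) / real h" by (simp add: of_nat_diff)
  then have "nat \<lfloor>(real L - real p + 1) / real h\<rfloor> = (L - p + 1) div h"
    by (simp only: floor_divide_of_nat_eq nat_int)
  then show ?thesis by (simp add: c2_def)
qed

text \<open>
  With three blocks or more, the first and the third do not meet, which forces \<open>2 * p < L\<close>.
\<close>

lemma c2_le_ca: "3 \<le> Kb \<Longrightarrow> c2 \<le> ca"
  using p_less2 c2_eq unfolding ca_def by (auto intro!: power_decreasing div_le_mono \<alpha>)

definition left_coeff where "left_coeff k gr = (if gr = Inl k then ca else if gr = Inr k then c2 else c1)"
definition right_coeff where "right_coeff k gr = (if gr = Inl k then ca else if gr = Inr k then c1 else c2)"

text \<open>
  The three kinds of groups seen by an update of block \<open>k\<close>: the discrepancy in its members is wiped out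
  up to \<open>\<epsilon>\<close> times their total; the cores next to the block pass on their discrepancy, damped by distance;
  all other groups are unaffected. The bounds for the image are given by \<open>block_mean_inside\<close>,
  \<open>block_mean_boundary\<close> and \<open>block_mean_unaffected\<close>.
\<close>

lemma block_contracts:
  assumes k: "k \<in> {1..Kb}" and \<rho>: "\<And>gr. 0 \<le> \<rho> gr"
    and off: "\<And>gr. gr \<in> groups \<Longrightarrow> gr \<notin> members k \<Longrightarrow> \<rho> gr \<le> \<rho>' gr"
    and on: "\<And>gr. gr \<in> members k \<Longrightarrow> \<epsilon> * (\<rho> (Inl k) + \<rho> (Inr (k - 1)) + \<rho> (Inr k))
       + (left_coeff k gr + \<epsilon>) * \<rho> (Inl (k - 1)) + (right_coeff k gr + \<epsilon>) * \<rho> (Inl (k + 1)) \<le> \<rho>' gr"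
  shows "contracts (pg_block H n y N (J k)) \<rho> \<rho>'"
  unfolding contracts_def
proof (intro conjI allI impI)
  have su: "1 \<le> lo k" "lo k \<le> hi k" "hi k \<le> n" using lo_ge[OF k] lo_hi[OF k] hi_le[OF k] .
  have len: "hi k - lo k + 1 = L" using hi_lo[OF k] su by simp
  show "pg_block H n y N (J k) \<in> X \<rightarrow>\<^sub>M prob_algebra X"
    using pg_block_kernel[OF su] J_eq[OF k] by simp
  fix f B and M :: real
  assume f: "f \<in> borel_measurable X" and M: "\<forall>v\<in>space X. \<bar>f v\<bar> \<le> M"
    and B: "\<forall>gr\<in>groups. 0 \<le> B gr" "group_bound groups grp B f"
  have M': "\<And>v. v \<in> space X \<Longrightarrow> \<bar>f v\<bar> \<le> M" and B0: "\<And>gr. gr \<in> groups \<Longrightarrow> 0 \<le> B gr" using M B by auto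
  define T where "T = (\<Sum>gr\<in>members k. B gr)"
  define TL where "TL = (\<Sum>gr\<in>members k. (left_coeff k gr + \<epsilon>) * B gr)"
  define TR where "TR = (\<Sum>gr\<in>members k. (right_coeff k gr + \<epsilon>) * B gr)"
  have Bm: "\<And>gr. gr \<in> members k \<Longrightarrow> 0 \<le> B gr" using B0 members_groups by blast
  have lc: "0 \<le> left_coeff k gr" "0 \<le> right_coeff k gr" for gr
    using coeff_nonneg by (auto simp: left_coeff_def right_coeff_def)
  have T: "0 \<le> T" "0 \<le> TL" "0 \<le> TR"
    unfolding T_def TL_def TR_def using Bm lc \<epsilon> by (auto intro!: sum_nonneg mult_nonneg_nonneg add_nonneg_nonneg)
  \<comment> \<open>group bounds of the image; the two extra terms are the influence of the neighbours of the block\<close>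
  define B' where "B' gr = (if gr \<in> members k then \<epsilon> * T
     else B gr + (if gr = Inl (k - 1) then TL else 0) + (if gr = Inl (k + 1) then TR else 0))" for gr
  have B'0: "\<forall>gr\<in>groups. 0 \<le> B' gr" using B0 T \<epsilon> by (auto simp: B'_def)
  let ?Pf = "\<lambda>x. \<integral>v. f v \<partial>pg_block H n y N (J k) x"
  have Pf: "?Pf x = block_mean (lo k) (hi k) f x" for x using J_eq[OF k] by simp
  note mc = members_cover[OF k]
  have gb': "group_bound groups grp B' ?Pf"
    unfolding group_bound_def
  proof (intro ballI impI)
    fix gr x z assume gr: "gr \<in> groups" and x: "x \<in> space X" "z \<in> space X" and same: "\<forall>i. i \<notin> grp gr \<longrightarrow> x i = z i"
    have same': "\<And>i. i \<notin> grp gr \<Longrightarrow> x i = z i" using same by blast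
    show "?Pf x - ?Pf z \<le> B' gr"
    proof (cases "gr \<in> members k")
      case True
      have "x i = z i" if "i \<notin> {lo k..hi k}" for i using that same' True mc by blast
      from block_mean_inside[OF su early[OF k] x f M' B(2) finite_members members_groups mc this]
      show ?thesis using True unfolding Pf len by (simp add: B'_def T_def \<epsilon>_def)
    next
      case False
      have away: "grp gr \<inter> {lo k..hi k} = {}" using other_groups(1)[OF k gr False] by blast
      consider "gr = Inl (k - 1)" | "gr = Inl (k + 1)" | "gr \<noteq> Inl (k - 1)" "gr \<noteq> Inl (k + 1)" by blast
      then show ?thesis
      proof cases
        case 1
        then have k1: "1 < k" using gr k by (auto simp: in_groups)
        then have Kb2: "2 \<le> Kb" using k by auto
        have ne: "gr \<noteq> Inl (k + 1)" using 1 by auto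
        have lt: "1 < lo k" using st(7)[of 1 k] st(4) k k1 by auto
        have nr: "hi k + 1 \<notin> grp gr" using other_groups(3)[OF k gr False _ ne] by blast
        define d where "d gr' = (if gr' = Inl k then p + 1 else if gr' = Inr k then L - p + 1 else 1)" for gr' :: "nat + nat"
        have d: "\<forall>gr'\<in>members k. \<forall>i\<in>grp gr'. lo k + d gr' \<le> i + 1"
        proof (intro ballI)
          fix gr' i assume g': "gr' \<in> members k" "i \<in> grp gr'"
          consider "gr' = Inl k" | "gr' = Inr k" "k < Kb" | "gr' = Inr (k - 1)" "gr' \<noteq> Inr k" using g' by (auto simp: members_def in_groups)
          then show "lo k + d gr' \<le> i + 1"
          proof cases
            case 1 then show ?thesis using core_bounds(1)[OF k, of i] g' k1 by (simp add: d_def)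
          next
            case 2
            then have "lo (k + 1) + p = lo k + L" using st(6)[of k] k by auto
            then show ?thesis using 2 g' p_less[OF Kb2] by (auto simp: d_def grp_def)
          next
            case 3
            have "i \<in> {lo k..hi k}" using g' mc by blast
            then show ?thesis using 3 by (auto simp: d_def)
          qed
        qed
        have coeff: "(1 - \<theta>) ^ (d gr' div h) = left_coeff k gr'" for gr'
          using c2_eq[OF Kb2] by (simp add: d_def left_coeff_def ca_def c1_def \<alpha>_def)
        have "block_mean (lo k) (hi k) f x - block_mean (lo k) (hi k) f z
           \<le> B gr + (\<Sum>gr'\<in>members k. ((1 - \<theta>) ^ (d gr' div h) + (1 - \<kappa> (hi k - lo k + 1))) * B gr')"
          by (rule block_mean_boundary[OF su early[OF k] x f M' B(2) B0 finite_members members_groups mc gr False same' away])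
            (use lt nr d in auto)
        then show ?thesis using False 1 ne unfolding Pf len coeff by (simp add: B'_def TL_def \<epsilon>_def)
      next
        case 2
        then have k1: "k < Kb" using gr k by (auto simp: in_groups)
        then have Kb2: "2 \<le> Kb" using k by auto
        have ne: "gr \<noteq> Inl (k - 1)" using 2 by auto
        have lt: "hi k < n" using st(7)[of k "k + 1"] hi_le[of "k + 1"] k k1 by auto
        have nl: "lo k - 1 \<notin> grp gr" using other_groups(2)[OF k gr False _ ne] by blast
        define d where "d gr' = (if gr' = Inl k then p + 1 else if gr' = Inr k then 1 else L - p + 1)" for gr' :: "nat + nat"
        have d: "\<forall>gr'\<in>members k. \<forall>i\<in>grp gr'. i + d gr' \<le> hi k + 1"
        proof (intro ballI)
          fix gr' i assume g': "gr' \<in> members k" "i \<in> grp gr'"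
          consider "gr' = Inl k" | "gr' = Inr k" | "gr' = Inr (k - 1)" "gr' \<noteq> Inr k" "1 \<le> k - 1" using g' by (auto simp: members_def in_groups)
          then show "i + d gr' \<le> hi k + 1"
          proof cases
            case 1 then show ?thesis using core_bounds(2)[OF k, of i] g' k1 by (simp add: d_def)
          next
            case 2
            have "i \<in> {lo k..hi k}" using g' mc by blast
            then show ?thesis using 2 by (auto simp: d_def)
          next
            case 3
            then have "k - 1 + 1 = k" "1 \<le> k - 1" "k - 1 < Kb" using k by auto
            then have "lo k + p = hi (k - 1) + 1" using overlap_eq[of "k - 1"] by simp
            then show ?thesis using 3 g' p_less[OF Kb2] hi_lo[OF k] by (auto simp: d_def grp_def)
          qed
        qed
        have coeff: "(1 - \<theta>) ^ (d gr' div h) = right_coeff k gr'" for gr'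
          using c2_eq[OF Kb2] by (simp add: d_def right_coeff_def ca_def c1_def \<alpha>_def)
        have "block_mean (lo k) (hi k) f x - block_mean (lo k) (hi k) f z
           \<le> B gr + (\<Sum>gr'\<in>members k. ((1 - \<theta>) ^ (d gr' div h) + (1 - \<kappa> (hi k - lo k + 1))) * B gr')"
          by (rule block_mean_boundary[OF su early[OF k] x f M' B(2) B0 finite_members members_groups mc gr False same' away])
            (use lt nl d in auto)
        then show ?thesis using False 2 ne unfolding Pf len coeff by (simp add: B'_def TR_def \<epsilon>_def)
      next
        case 3
        have "lo k - 1 \<notin> grp gr" "hi k + 1 \<notin> grp gr"
          using other_groups(2)[OF k gr False _ 3(1)] other_groups(3)[OF k gr False _ 3(2)] by blast+
        from block_mean_unaffected[OF su x f M' B(2) gr same' away this]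
        show ?thesis using False 3 unfolding Pf by (simp add: B'_def)
      qed
    qed
  qed
  have split: "(\<Sum>gr\<in>groups. F gr) = (\<Sum>gr\<in>members k. F gr) + (\<Sum>gr\<in>groups - members k. F gr)" for F :: "nat + nat \<Rightarrow> real"
    using sum.subset_diff[OF members_groups finite_groups, of F k] by simp
  have sum_on: "(\<Sum>gr\<in>members k. \<rho> gr) \<le> \<rho> (Inl k) + \<rho> (Inr (k - 1)) + \<rho> (Inr k)"
  proof -
    have "(\<Sum>gr\<in>members k. \<rho> gr) \<le> (\<Sum>gr\<in>{Inl k, Inr (k - 1), Inr k}. \<rho> gr)"
      using \<rho> by (intro sum_mono2) (auto simp: members_def)
    also have "\<dots> = \<rho> (Inl k) + \<rho> (Inr (k - 1)) + \<rho> (Inr k)"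
    proof -
      have "k - 1 \<noteq> k" using k by auto
      then show ?thesis by (simp add: add.assoc)
    qed
    finally show ?thesis .
  qed
  have "(\<Sum>gr\<in>groups - members k. \<rho> gr * B' gr) =
     (\<Sum>gr\<in>groups - members k. \<rho> gr * B gr) + (\<Sum>gr\<in>groups - members k. (if gr = Inl (k - 1) then \<rho> gr * TL else 0))
      + (\<Sum>gr\<in>groups - members k. (if gr = Inl (k + 1) then \<rho> gr * TR else 0))"
    unfolding sum.distrib[symmetric] by (intro sum.cong) (auto simp: B'_def algebra_simps)
  also have "\<dots> \<le> (\<Sum>gr\<in>groups - members k. \<rho>' gr * B gr) + \<rho> (Inl (k - 1)) * TL + \<rho> (Inl (k + 1)) * TR"
  proof (intro add_mono)
    show "(\<Sum>gr\<in>groups - members k. \<rho> gr * B gr) \<le> (\<Sum>gr\<in>groups - members k. \<rho>' gr * B gr)"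
      using off B0 by (intro sum_mono mult_right_mono) auto
    have fg: "finite (groups - members k)" using finite_groups by simp
    show "(\<Sum>gr\<in>groups - members k. (if gr = Inl (k - 1) then \<rho> gr * TL else 0)) \<le> \<rho> (Inl (k - 1)) * TL"
      using T \<rho> fg by (subst sum.delta) auto
    show "(\<Sum>gr\<in>groups - members k. (if gr = Inl (k + 1) then \<rho> gr * TR else 0)) \<le> \<rho> (Inl (k + 1)) * TR"
      using T \<rho> fg by (subst sum.delta) auto
  qed
  finally have off': "(\<Sum>gr\<in>groups - members k. \<rho> gr * B' gr) \<le> \<dots>" .
  have "(\<Sum>gr\<in>members k. \<rho> gr * B' gr) = (\<Sum>gr\<in>members k. \<rho> gr) * (\<epsilon> * T)"
    by (simp add: B'_def sum_distrib_right)
  also have "\<dots> \<le> (\<rho> (Inl k) + \<rho> (Inr (k - 1)) + \<rho> (Inr k)) * (\<epsilon> * T)"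
    using sum_on \<epsilon> T by (intro mult_right_mono) auto
  finally have on': "(\<Sum>gr\<in>members k. \<rho> gr * B' gr) \<le> \<dots>" .
  have "(\<rho> (Inl k) + \<rho> (Inr (k - 1)) + \<rho> (Inr k)) * (\<epsilon> * T) + \<rho> (Inl (k - 1)) * TL + \<rho> (Inl (k + 1)) * TR
      = (\<Sum>gr\<in>members k. (\<epsilon> * (\<rho> (Inl k) + \<rho> (Inr (k - 1)) + \<rho> (Inr k))
       + (left_coeff k gr + \<epsilon>) * \<rho> (Inl (k - 1)) + (right_coeff k gr + \<epsilon>) * \<rho> (Inl (k + 1))) * B gr)"
    unfolding T_def TL_def TR_def sum_distrib_left sum.distrib[symmetric]
    by (intro sum.cong) (auto simp: algebra_simps)
  also have "\<dots> \<le> (\<Sum>gr\<in>members k. \<rho>' gr * B gr)"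
    by (intro sum_mono mult_right_mono on Bm)
  finally have "(\<Sum>gr\<in>groups. \<rho> gr * B' gr) \<le> (\<Sum>gr\<in>groups. \<rho>' gr * B gr)"
    unfolding split using off' on' by linarith
  then show "\<exists>B'. (\<forall>gr\<in>groups. 0 \<le> B' gr) \<and> group_bound groups grp B' ?Pf \<and>
      (\<Sum>gr\<in>groups. \<rho> gr * B' gr) \<le> (\<Sum>gr\<in>groups. \<rho>' gr * B gr)"
    using B'0 gb' by blast
qed

end

section \<open>The Left-to-Right sweep\<close>

context pg_cover begin

definition lam where "lam = 2 * ca"
definition \<beta> where "\<beta> = c1 + c2"
definition \<beta>1 where "\<beta>1 = max \<beta> 1"

lemma kernel_list_contracts:
  assumes "\<And>i. i < length ks \<Longrightarrow> contracts (pg_block H n y N (J (ks ! i))) (r i) (r (Suc i))"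
  shows "contracts (kprod X (map (\<lambda>k. pg_block H n y N (J k)) ks)) (r 0) (r (length ks))"
  using contracts_kprod[of "map (\<lambda>k. pg_block H n y N (J k)) ks" r] assms by simp

text \<open>
  The weights after the first \<open>k\<close> blocks of the sweep: \<open>x\<close> on the cores already visited, \<open>oa\<close> on the overlap
  that has been updated once, \<open>ob\<close> on the overlaps updated twice, and 1 on what is still untouched. Groups
  that do not exist have weight 0, which treats the first and the last block along with the others.
\<close>

definition lr_weight where
  "lr_weight x oa ob k gr = (case gr of
     Inl j \<Rightarrow> if j \<notin> {1..Kb} then 0 else if j \<le> k then x else 1
   | Inr j \<Rightarrow> if j = 0 \<or> Kb \<le> j then 0 else if j < k then ob else if j = k then oa else (1::real))"

text \<open>
  When block \<open>k\<close> is updated, its left neighbour lies in a visited core of weight \<open>x\<close>, its right neighbour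
  in an untouched core of weight 1, and its members have weights \<open>1\<close> (core), \<open>oa\<close> (left overlap) and \<open>1\<close>
  (right overlap). The conditions say that \<open>x\<close>, \<open>oa\<close>, \<open>ob\<close> are stationary under this step; \<open>first\<close> is
  the case of the first block, which has no left neighbour.
\<close>

lemma lr_step:
  assumes k: "k \<in> {1..Kb}" and pos: "0 \<le> x" "0 \<le> oa" "0 \<le> ob"
    and core: "\<epsilon> * (oa + 2) + (ca + \<epsilon>) * x + (ca + \<epsilon>) \<le> x"
    and left: "2 \<le> Kb \<Longrightarrow> \<epsilon> * (oa + 2) + (c1 + \<epsilon>) * x + (c2 + \<epsilon>) \<le> ob"
    and first: "3 * \<epsilon> + c1 \<le> oa" and right: "3 \<le> Kb \<Longrightarrow> \<epsilon> * (oa + 2) + (c2 + \<epsilon>) * x + (c1 + \<epsilon>) \<le> oa"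
  shows "contracts (pg_block H n y N (J k)) (lr_weight x oa ob (k - 1)) (lr_weight x oa ob k)"
proof (rule block_contracts[OF k])
  let ?\<rho> = "lr_weight x oa ob (k - 1)"
  show pos': "0 \<le> ?\<rho> gr" for gr using pos by (auto simp: lr_weight_def split: sum.split)
  show "?\<rho> gr \<le> lr_weight x oa ob k gr" if "gr \<in> groups" "gr \<notin> members k" for gr
    using that by (auto simp: lr_weight_def members_def in_groups split: sum.split)
  have v: "?\<rho> (Inl k) = 1" "?\<rho> (Inl (k - 1)) = (if k = 1 then 0 else x)" "?\<rho> (Inl (k + 1)) = (if k = Kb then 0 else 1)"
    "?\<rho> (Inr (k - 1)) = (if k = 1 then 0 else oa)" "?\<rho> (Inr k) = (if k = Kb then 0 else 1)"
    using k by (auto simp: lr_weight_def)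
  have S: "\<epsilon> * (?\<rho> (Inl k) + ?\<rho> (Inr (k - 1)) + ?\<rho> (Inr k)) \<le> \<epsilon> * ((if k = 1 then 0 else oa) + 2)"
    unfolding v using \<epsilon> by (intro mult_left_mono) auto
  fix gr assume gr: "gr \<in> members k"
  define cl where "cl = left_coeff k gr + \<epsilon>"
  define cr where "cr = right_coeff k gr + \<epsilon>"
  have c0: "0 \<le> cl" "0 \<le> cr" using coeff_nonneg \<epsilon> by (auto simp: cl_def cr_def left_coeff_def right_coeff_def)
  have cr1: "cr * ?\<rho> (Inl (k + 1)) \<le> cr" unfolding v using c0 by auto
  have "\<epsilon> * (?\<rho> (Inl k) + ?\<rho> (Inr (k - 1)) + ?\<rho> (Inr k)) + cl * ?\<rho> (Inl (k - 1)) + cr * ?\<rho> (Inl (k + 1))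
    \<le> \<epsilon> * ((if k = 1 then 0 else oa) + 2) + cl * (if k = 1 then 0 else x) + cr"
    using S cr1 unfolding v(2) by linarith
  also have "\<dots> \<le> lr_weight x oa ob k gr"
  proof -
    consider "gr = Inl k" | "gr = Inr (k - 1)" "1 < k" | "gr = Inr k" "k < Kb"
      using gr by (auto simp: members_def in_groups)
    then show ?thesis
    proof cases
      case 1
      then have w: "lr_weight x oa ob k gr = x" "cl = ca + \<epsilon>" "cr = ca + \<epsilon>"
        using k by (auto simp: lr_weight_def cl_def cr_def left_coeff_def right_coeff_def)
      have "\<epsilon> * ((if k = 1 then 0 else oa) + 2) \<le> \<epsilon> * (oa + 2)" "cl * (if k = 1 then 0 else x) \<le> cl * x"
        using \<epsilon> pos c0 by (auto intro!: mult_left_mono)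
      then show ?thesis using core w by simp
    next
      case 2
      then have ne: "Inr (k - 1) \<noteq> (Inr k :: nat + nat)" by auto
      have w: "lr_weight x oa ob k gr = ob" "cl = c1 + \<epsilon>" "cr = c2 + \<epsilon>"
        using k 2 ne by (auto simp: lr_weight_def cl_def cr_def left_coeff_def right_coeff_def)
      have "2 \<le> Kb" "k \<noteq> 1" using k 2 by auto
      then show ?thesis using left w by simp
    next
      case 3
      then have w: "lr_weight x oa ob k gr = oa" "cl = c2 + \<epsilon>" "cr = c1 + \<epsilon>"
        using k by (auto simp: lr_weight_def cl_def cr_def left_coeff_def right_coeff_def)
      show ?thesis
      proof (cases "k = 1")
        case True then show ?thesis using first w by simp
      next
        case False
        then have "3 \<le> Kb" using 3 k by auto
        then show ?thesis using right w False by simp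
      qed
    qed
  qed
  finally show "\<epsilon> * (?\<rho> (Inl k) + ?\<rho> (Inr (k - 1)) + ?\<rho> (Inr k)) + (left_coeff k gr + \<epsilon>) * ?\<rho> (Inl (k - 1))
     + (right_coeff k gr + \<epsilon>) * ?\<rho> (Inl (k + 1)) \<le> lr_weight x oa ob k gr"
    unfolding cl_def cr_def .
qed

lemma lr_contracts:
  assumes pos: "0 \<le> x" "0 \<le> oa" "0 \<le> ob"
    and core: "\<epsilon> * (oa + 2) + (ca + \<epsilon>) * x + (ca + \<epsilon>) \<le> x"
    and left: "2 \<le> Kb \<Longrightarrow> \<epsilon> * (oa + 2) + (c1 + \<epsilon>) * x + (c2 + \<epsilon>) \<le> ob"
    and first: "3 * \<epsilon> + c1 \<le> oa" and right: "3 \<le> Kb \<Longrightarrow> \<epsilon> * (oa + 2) + (c2 + \<epsilon>) * x + (c1 + \<epsilon>) \<le> oa"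
    and c: "x \<le> c" "2 \<le> Kb \<Longrightarrow> ob \<le> c"
  shows "contracts (pg_LR H n y N J Kb) (\<lambda>_. 1) (\<lambda>_. c)"
proof (rule contracts_mono)
  show "contracts (pg_LR H n y N J Kb) (lr_weight x oa ob 0) (lr_weight x oa ob (length [1..<Kb + 1]))"
    unfolding pg_LR_def
  proof (rule kernel_list_contracts)
    fix i assume "i < length [1..<Kb + 1]"
    then have i: "i < Kb" by (simp del: upt_Suc)
    then have "[1..<Kb + 1] ! i = i + 1" by (simp del: upt_Suc)
    then show "contracts (pg_block H n y N (J ([1..<Kb + 1] ! i))) (lr_weight x oa ob i) (lr_weight x oa ob (Suc i))"
      using lr_step[of "i + 1", OF _ pos core left first right] i by simp
  qed
  show "lr_weight x oa ob (length [1..<Kb + 1]) gr \<le> c" if "gr \<in> groups" for gr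
    using that c by (cases gr) (auto simp: lr_weight_def in_groups)
  show "1 = lr_weight x oa ob 0 gr" if "gr \<in> groups" for gr
    using that by (cases gr) (auto simp: lr_weight_def in_groups)
qed

text \<open>
  Without the particle error the weights would stay below \<open>lam\<close> on the cores and \<open>\<beta>1\<close> on the last
  overlap. The error is a common surplus \<open>w\<close> on both; since a surplus \<open>w\<close> returns as \<open>(2 * \<epsilon> + ca) * w\<close> from one
  block to the next, it is a geometric sum, and the denominator of the rate is positive exactly when this
  sum converges.
\<close>

lemma lr_rate:
  assumes lam1: "lam < 1" and D: "0 < 1 - 2 * \<epsilon> - ca"
  defines "T \<equiv> lam + c2 + 2 * \<epsilon> * ((3 * \<beta>1 + 1 + lam) / (1 - 2 * \<epsilon> - ca))"
  shows "0 \<le> T" "contracts (pg_LR H n y N J Kb) (\<lambda>_. 1) (\<lambda>_. T)"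
proof -
  define d where "d = 1 - 2 * \<epsilon> - ca"
  have d: "0 < d" "d \<le> 1" using D \<epsilon> coeff_nonneg by (auto simp: d_def)
  \<comment> \<open>fixed point of \<open>w = \<epsilon> * (3 + \<beta>1 + lam) + (2 * \<epsilon> + ca) * w\<close>\<close>
  define w where "w = \<epsilon> * (3 + \<beta>1 + lam) / d"
  have b: "1 \<le> \<beta>1" "c1 + c2 \<le> \<beta>1" by (auto simp: \<beta>1_def \<beta>_def)
  note nn = coeff_nonneg \<epsilon>
  have lam0: "0 \<le> lam" using nn by (simp add: lam_def)
  have w0: "0 \<le> w" unfolding w_def using nn b lam0 d by simp
  have wd: "w * d = \<epsilon> * (3 + \<beta>1 + lam)" using d by (simp add: w_def)
  have wd': "\<epsilon> * (3 + \<beta>1 + lam) = w - 2 * (\<epsilon> * w) - ca * w" using wd by (simp add: d_def algebra_simps)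
  have calam: "ca * lam \<le> ca" using lam1 nn mult_left_mono[of lam 1 ca] by simp
  have Tw: "lam + c2 + 2 * w \<le> T"
  proof -
    have "w \<le> \<epsilon> * ((3 * \<beta>1 + 1 + lam) / d)"
    proof -
      have "\<epsilon> * (3 + \<beta>1 + lam) \<le> \<epsilon> * (3 * \<beta>1 + 1 + lam)" using b nn by (intro mult_left_mono) auto
      then show ?thesis unfolding w_def using d by (simp add: divide_right_mono)
    qed
    then show ?thesis unfolding T_def d_def by linarith
  qed
  show "0 \<le> T" using Tw w0 lam0 nn by linarith
  have core: "\<epsilon> * (\<beta>1 + w + 2) + (ca + \<epsilon>) * (lam + w) + (ca + \<epsilon>) \<le> lam + w"
  proof -
    have "\<epsilon> * (\<beta>1 + w + 2) + (ca + \<epsilon>) * (lam + w) + (ca + \<epsilon>)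
       = \<epsilon> * (3 + \<beta>1 + lam) + 2 * (\<epsilon> * w) + ca * w + ca * lam + ca" by (simp add: algebra_simps)
    also have "\<dots> = w + ca * lam + ca" unfolding wd' by simp
    also have "\<dots> \<le> lam + w" using calam by (simp add: lam_def)
    finally show ?thesis .
  qed
  have first: "3 * \<epsilon> + c1 \<le> \<beta>1 + w"
  proof -
    have "\<epsilon> * 3 \<le> \<epsilon> * (3 + \<beta>1 + lam)" using nn b lam0 by (intro mult_left_mono) auto
    also have "\<dots> = w * d" using wd by simp
    also have "\<dots> \<le> w * 1" using d w0 by (intro mult_left_mono) auto
    finally show ?thesis using b nn by simp
  qed
  have right: "\<epsilon> * (\<beta>1 + w + 2) + (c2 + \<epsilon>) * (lam + w) + (c1 + \<epsilon>) \<le> \<beta>1 + w" if "3 \<le> Kb"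
  proof -
    have "c2 * w \<le> ca * w" using c2_le_ca[OF that] w0 by (rule mult_right_mono)
    moreover have "c2 * lam \<le> c2" using lam1 nn mult_left_mono[of lam 1 c2] by simp
    moreover have "\<epsilon> * (\<beta>1 + w + 2) + (c2 + \<epsilon>) * (lam + w) + (c1 + \<epsilon>)
       = \<epsilon> * (3 + \<beta>1 + lam) + 2 * (\<epsilon> * w) + c2 * w + c2 * lam + c1" by (simp add: algebra_simps)
    ultimately show ?thesis using wd' b by linarith
  qed
  have left: "\<epsilon> * (\<beta>1 + w + 2) + (c1 + \<epsilon>) * (lam + w) + (c2 + \<epsilon>) \<le> lam + c2 + 2 * w"
  proof -
    have c11: "c1 \<le> 1" unfolding c1_def using \<alpha> by (intro power_le_one)
    have "c1 * lam \<le> 1 * lam" "c1 * w \<le> 1 * w" using c11 lam0 w0 by (intro mult_right_mono; simp)+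
    moreover have "0 \<le> ca * w" using nn w0 by simp
    moreover have "\<epsilon> * (\<beta>1 + w + 2) + (c1 + \<epsilon>) * (lam + w) + (c2 + \<epsilon>)
       = \<epsilon> * (3 + \<beta>1 + lam) + 2 * (\<epsilon> * w) + c1 * w + c1 * lam + c2" by (simp add: algebra_simps)
    ultimately show ?thesis using wd' by linarith
  qed
  show "contracts (pg_LR H n y N J Kb) (\<lambda>_. 1) (\<lambda>_. T)"
  proof (rule lr_contracts[where x="lam + w" and oa="\<beta>1 + w" and ob="lam + c2 + 2 * w"])
    show "lam + w \<le> T" using Tw w0 nn by linarith
    show "lam + c2 + 2 * w \<le> T" by (rule Tw)
  qed (use lam0 w0 b nn core left first right in \<open>auto simp: add.assoc\<close>)
qed

text \<open>
  Every sweep has some finite rate, which settles the Left-to-Right sampler when the denominator of its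
  explicit rate is not positive.
\<close>

lemma trivial_contracts:
  assumes "set ks \<subseteq> {1..Kb}"
  shows "\<exists>c\<ge>0. contracts (kprod X (map (\<lambda>k. pg_block H n y N (J k)) ks)) (\<lambda>_. 1) (\<lambda>_. c)"
proof -
  define q where "q = 1 + 3 * \<epsilon> + 2 * (ca + c1 + c2 + \<epsilon>)"
  have nn: "0 \<le> ca" "0 \<le> c1" "0 \<le> c2" "0 \<le> \<epsilon>" using coeff_nonneg \<epsilon> by auto
  have q: "1 \<le> q" using nn by (simp add: q_def)
  have "contracts (kprod X (map (\<lambda>k. pg_block H n y N (J k)) ks)) ((\<lambda>i _. q ^ i) 0) ((\<lambda>i _. q ^ i) (length ks))"
  proof (rule kernel_list_contracts)
    fix i assume i: "i < length ks"
    have k: "ks ! i \<in> {1..Kb}" using assms i nth_mem by blast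
    have "contracts (pg_block H n y N (J (ks ! i))) (\<lambda>_. 1) (\<lambda>_. q)"
    proof (rule block_contracts[OF k])
      show "\<epsilon> * (1 + 1 + 1) + (left_coeff (ks ! i) gr + \<epsilon>) * 1 + (right_coeff (ks ! i) gr + \<epsilon>) * 1 \<le> q" for gr
        using nn by (auto simp: left_coeff_def right_coeff_def q_def)
    qed (use q in auto)
    then show "contracts (pg_block H n y N (J (ks ! i))) (\<lambda>_. q ^ i) (\<lambda>_. q ^ Suc i)"
      using contracts_scale[of _ q "q ^ i"] q by (simp add: mult.commute)
  qed
  moreover have "0 \<le> q ^ length ks" using q by simp
  ultimately show ?thesis by auto
qed

section \<open>The Parallel sweep\<close>

text \<open>
  The weights during a half sweep over blocks of one parity, after the blocks in \<open>P\<close>: \<open>x0\<close> and \<open>o0\<close> are the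
  weights of cores and overlaps before the half sweep, \<open>x1\<close> and \<open>o1\<close> those after it.
\<close>

definition par_weight where
  "par_weight P x0 x1 o0 o1 gr = (case gr of
     Inl j \<Rightarrow> if j \<notin> {1..Kb} then 0 else if j \<in> P then x1 else x0 j
   | Inr j \<Rightarrow> if j = 0 \<or> Kb \<le> j then 0 else if j \<in> P \<or> Suc j \<in> P then o1 else (o0::real))"

text \<open>
  Blocks of one parity share no group, and the neighbours of a block lie in cores of the other parity.
  Hence every block of the half sweep finds its members in the initial state (core 1, overlaps \<open>o0\<close>) and
  its neighbours at the weight \<open>xb\<close> that they keep throughout.
\<close>

lemma par_step:
  assumes k: "k \<in> {1..Kb}" "k \<notin> P" and P: "\<And>j. j \<in> P \<Longrightarrow> even j \<longleftrightarrow> even k"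
    and pos: "\<And>j. 0 \<le> x0 j" "0 \<le> x1" "0 \<le> o0" "0 \<le> o1"
    and x0: "x0 k = 1" "\<And>j. (even j \<longleftrightarrow> odd k) \<Longrightarrow> x0 j = xb"
    and core: "\<epsilon> * (1 + o0 + o0) + (ca + \<epsilon>) * xb + (ca + \<epsilon>) * xb \<le> x1"
    and overlap: "\<epsilon> * (1 + o0 + o0) + (c1 + \<epsilon>) * xb + (c2 + \<epsilon>) * xb \<le> o1"
  shows "contracts (pg_block H n y N (J k)) (par_weight P x0 x1 o0 o1) (par_weight (insert k P) x0 x1 o0 o1)"
proof (rule block_contracts[OF k(1)])
  let ?\<rho> = "par_weight P x0 x1 o0 o1"
  have notP: "k - 1 \<notin> P" "Suc k \<notin> P" using P[of "k - 1"] P[of "Suc k"] k by auto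
  show pos': "0 \<le> ?\<rho> gr" for gr using pos by (auto simp: par_weight_def split: sum.split)
  show "?\<rho> gr \<le> par_weight (insert k P) x0 x1 o0 o1 gr" if "gr \<in> groups" "gr \<notin> members k" for gr
    using that by (auto simp: par_weight_def members_def in_groups split: sum.split)
  have xb: "x0 (k - 1) = xb" "x0 (k + 1) = xb" using k by (auto intro!: x0(2))
  have xb0: "0 \<le> xb" using pos(1)[of "k + 1"] xb by simp
  have "Suc (k - 1) = k" using k by auto
  then have v: "?\<rho> (Inl k) \<le> 1" "?\<rho> (Inl (k - 1)) \<le> xb" "?\<rho> (Inl (k + 1)) \<le> xb"
    "?\<rho> (Inr (k - 1)) \<le> o0" "?\<rho> (Inr k) \<le> o0"
    using k notP xb xb0 x0(1) pos by (auto simp: par_weight_def)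
  fix gr assume gr: "gr \<in> members k"
  define cl where "cl = left_coeff k gr + \<epsilon>"
  define cr where "cr = right_coeff k gr + \<epsilon>"
  have c0: "0 \<le> cl" "0 \<le> cr" using coeff_nonneg \<epsilon> by (auto simp: cl_def cr_def left_coeff_def right_coeff_def)
  have "\<epsilon> * (?\<rho> (Inl k) + ?\<rho> (Inr (k - 1)) + ?\<rho> (Inr k)) + cl * ?\<rho> (Inl (k - 1)) + cr * ?\<rho> (Inl (k + 1))
    \<le> \<epsilon> * (1 + o0 + o0) + cl * xb + cr * xb"
    using v c0 \<epsilon> by (intro add_mono mult_left_mono) auto
  also have "\<dots> \<le> par_weight (insert k P) x0 x1 o0 o1 gr"
  proof -
    consider "gr = Inl k" | "gr = Inr (k - 1)" "1 < k" | "gr = Inr k" "k < Kb"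
      using gr by (auto simp: members_def in_groups)
    then show ?thesis
    proof cases
      case 1
      then have w: "par_weight (insert k P) x0 x1 o0 o1 gr = x1" "cl = ca + \<epsilon>" "cr = ca + \<epsilon>"
        using k by (auto simp: par_weight_def cl_def cr_def left_coeff_def right_coeff_def)
      show ?thesis unfolding w by (rule core)
    next
      case 2
      then have ne: "Inr (k - 1) \<noteq> (Inr k :: nat + nat)" by auto
      have w: "par_weight (insert k P) x0 x1 o0 o1 gr = o1" "cl = c1 + \<epsilon>" "cr = c2 + \<epsilon>"
        using k 2 ne by (auto simp: par_weight_def cl_def cr_def left_coeff_def right_coeff_def)
      show ?thesis unfolding w by (rule overlap)
    next
      case 3
      then have w: "par_weight (insert k P) x0 x1 o0 o1 gr = o1" "cl = c2 + \<epsilon>" "cr = c1 + \<epsilon>"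
        using k by (auto simp: par_weight_def cl_def cr_def left_coeff_def right_coeff_def)
      show ?thesis unfolding w using overlap by linarith
    qed
  qed
  finally show "\<epsilon> * (?\<rho> (Inl k) + ?\<rho> (Inr (k - 1)) + ?\<rho> (Inr k)) + (left_coeff k gr + \<epsilon>) * ?\<rho> (Inl (k - 1))
     + (right_coeff k gr + \<epsilon>) * ?\<rho> (Inl (k + 1)) \<le> par_weight (insert k P) x0 x1 o0 o1 gr"
    unfolding cl_def cr_def .
qed

lemma par_half:
  assumes ks: "distinct ks" "set ks \<subseteq> {1..Kb}" and par: "\<And>j. j \<in> set ks \<Longrightarrow> even j \<longleftrightarrow> b"
    and pos: "\<And>j. 0 \<le> x0 j" "0 \<le> x1" "0 \<le> o0" "0 \<le> o1"
    and x0: "\<And>j. x0 j = (if even j \<longleftrightarrow> b then 1 else xb)"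
    and core: "\<epsilon> * (1 + o0 + o0) + (ca + \<epsilon>) * xb + (ca + \<epsilon>) * xb \<le> x1"
    and overlap: "\<epsilon> * (1 + o0 + o0) + (c1 + \<epsilon>) * xb + (c2 + \<epsilon>) * xb \<le> o1"
  shows "contracts (kprod X (map (\<lambda>k. pg_block H n y N (J k)) ks)) (par_weight {} x0 x1 o0 o1) (par_weight (set ks) x0 x1 o0 o1)"
proof -
  have "contracts (kprod X (map (\<lambda>k. pg_block H n y N (J k)) ks))
     ((\<lambda>i. par_weight (set (take i ks)) x0 x1 o0 o1) 0) ((\<lambda>i. par_weight (set (take i ks)) x0 x1 o0 o1) (length ks))"
  proof (rule kernel_list_contracts)
    fix i assume i: "i < length ks"
    have k: "ks ! i \<in> set ks" using i by simp
    have notin: "ks ! i \<notin> set (take i ks)" using ks(1) i by (auto simp: in_set_conv_nth nth_eq_iff_index_eq)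
    have "set (take (Suc i) ks) = insert (ks ! i) (set (take i ks))" using i by (simp add: take_Suc_conv_app_nth)
    moreover have "contracts (pg_block H n y N (J (ks ! i))) (par_weight (set (take i ks)) x0 x1 o0 o1)
       (par_weight (insert (ks ! i) (set (take i ks))) x0 x1 o0 o1)"
    proof (rule par_step[where xb=xb])
      show "ks ! i \<in> {1..Kb}" using k ks(2) by blast
      show "even j \<longleftrightarrow> even (ks ! i)" if "j \<in> set (take i ks)" for j
        using par[OF k] par[OF in_set_takeD[OF that]] by simp
      show "x0 (ks ! i) = 1" using par[OF k] by (simp add: x0)
      show "x0 j = xb" if "even j \<longleftrightarrow> odd (ks ! i)" for j using that par[OF k] by (auto simp: x0)
    qed (fact notin pos core overlap)+
    ultimately show "contracts (pg_block H n y N (J (ks ! i))) (par_weight (set (take i ks)) x0 x1 o0 o1)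
       (par_weight (set (take (Suc i) ks)) x0 x1 o0 o1)" by simp
  qed
  then show ?thesis by simp
qed

text \<open>
  The odd half sweep starts from all weights 1 and leaves \<open>lam + 5 * \<epsilon>\<close> on the odd cores and \<open>\<beta> + 5 * \<epsilon>\<close> on
  all overlaps, since each overlap belongs to exactly one odd block. The even half sweep has these small
  values as boundary weights, so it multiplies them by the same coefficients once more.
\<close>

lemma par_rate:
  assumes lam1: "lam < 1"
  defines "T \<equiv> lam * \<beta>1 + \<epsilon> * (2 * lam + 25 * \<epsilon> + 8 * \<beta>1)"
  shows "0 \<le> T" "contracts (pg_PAR H n y N J Kb) (\<lambda>_. 1) (\<lambda>_. T)"
proof -
  have nn: "0 \<le> ca" "0 \<le> c1" "0 \<le> c2" "0 \<le> \<epsilon>" "\<epsilon> \<le> 1" using coeff_nonneg \<epsilon> by auto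
  have lam0: "0 \<le> lam" using nn by (simp add: lam_def)
  have b: "1 \<le> \<beta>1" "\<beta> \<le> \<beta>1" by (auto simp: \<beta>1_def)
  have \<beta>0: "0 \<le> \<beta>" using nn by (simp add: \<beta>_def)
  show T0: "0 \<le> T" unfolding T_def using nn lam0 b by simp
  define xo where "xo = lam + 5 * \<epsilon>"
  define ov where "ov = \<beta> + 5 * \<epsilon>"
  have xo0: "0 \<le> xo" "0 \<le> ov" using nn lam0 \<beta>0 by (auto simp: xo_def ov_def)
  let ?odd = "filter odd [1..<Kb + 1]" and ?even = "filter even [1..<Kb + 1]"
  have xoT: "xo \<le> T"
  proof -
    have "lam * 1 \<le> lam * \<beta>1" using lam0 b by (intro mult_left_mono) auto
    moreover have "\<epsilon> * 5 \<le> \<epsilon> * (2 * lam + 25 * \<epsilon> + 8 * \<beta>1)" using nn lam0 b by (intro mult_left_mono) auto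
    ultimately show ?thesis unfolding xo_def T_def by linarith
  qed
  have e2: "0 \<le> \<epsilon> * \<epsilon>" using nn by simp
  have el: "\<epsilon> * lam \<le> \<epsilon> * 1" using nn lam1 by (intro mult_left_mono) auto
  have eb: "\<epsilon> * \<beta> \<le> \<epsilon> * \<beta>1" "\<epsilon> * 1 \<le> \<epsilon> * \<beta>1" using nn b by (intro mult_left_mono; simp)+
  have T_eq: "T = lam * \<beta>1 + 2 * (\<epsilon> * lam) + 25 * (\<epsilon> * \<epsilon>) + 8 * (\<epsilon> * \<beta>1)"
    by (simp add: T_def algebra_simps)
  have core: "\<epsilon> * (1 + ov + ov) + (ca + \<epsilon>) * xo + (ca + \<epsilon>) * xo \<le> T"
  proof -
    have "\<epsilon> * (1 + ov + ov) + (ca + \<epsilon>) * xo + (ca + \<epsilon>) * xo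
       = \<epsilon> + 2 * (\<epsilon> * \<beta>) + 20 * (\<epsilon> * \<epsilon>) + lam * lam + 7 * (\<epsilon> * lam)"
      by (simp add: ov_def xo_def lam_def algebra_simps)
    moreover have "lam * lam \<le> lam * \<beta>1" using lam0 lam1 b by (intro mult_left_mono) auto
    ultimately show ?thesis unfolding T_eq using e2 el eb by linarith
  qed
  have overlap: "\<epsilon> * (1 + ov + ov) + (c1 + \<epsilon>) * xo + (c2 + \<epsilon>) * xo \<le> T"
  proof -
    have "\<epsilon> * (1 + ov + ov) + (c1 + \<epsilon>) * xo + (c2 + \<epsilon>) * xo
       = \<epsilon> + 7 * (\<epsilon> * \<beta>) + 20 * (\<epsilon> * \<epsilon>) + lam * \<beta> + 2 * (\<epsilon> * lam)"
      by (simp add: ov_def xo_def \<beta>_def algebra_simps)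
    moreover have "lam * \<beta> \<le> lam * \<beta>1" using lam0 b by (intro mult_left_mono) auto
    ultimately show ?thesis unfolding T_eq using e2 eb by linarith
  qed
  have odd: "contracts (kprod X (map (\<lambda>k. pg_block H n y N (J k)) ?odd))
     (par_weight {} (\<lambda>_. 1) xo 1 ov) (par_weight (set ?odd) (\<lambda>_. 1) xo 1 ov)"
  proof (rule par_half[where b=False and xb=1])
    show "\<epsilon> * (1 + 1 + 1) + (ca + \<epsilon>) * 1 + (ca + \<epsilon>) * 1 \<le> xo" by (simp add: xo_def lam_def)
    show "\<epsilon> * (1 + 1 + 1) + (c1 + \<epsilon>) * 1 + (c2 + \<epsilon>) * 1 \<le> ov" by (simp add: ov_def \<beta>_def)
  qed (use xo0 in auto)
  have even: "contracts (kprod X (map (\<lambda>k. pg_block H n y N (J k)) ?even))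
     (par_weight {} (\<lambda>j. if even j then 1 else xo) T ov T) (par_weight (set ?even) (\<lambda>j. if even j then 1 else xo) T ov T)"
    by (rule par_half[where b=True and xb=xo]) (use xo0 T0 core overlap in auto)
  have even': "contracts (kprod X (map (\<lambda>k. pg_block H n y N (J k)) ?even))
     (par_weight (set ?odd) (\<lambda>_. 1) xo 1 ov) (\<lambda>_. T)"
  proof (rule contracts_mono[OF even])
    fix gr assume gr: "gr \<in> groups"
    show "par_weight (set ?even) (\<lambda>j. if even j then 1 else xo) T ov T gr \<le> T"
      using gr xoT by (cases gr) (auto simp: par_weight_def in_groups simp del: upt_Suc)
    show "par_weight (set ?odd) (\<lambda>_. 1) xo 1 ov gr = par_weight {} (\<lambda>j. if even j then 1 else xo) T ov T gr"
      using gr by (cases gr) (auto simp: par_weight_def in_groups simp del: upt_Suc)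
  qed
  have odd': "contracts (kprod X (map (\<lambda>k. pg_block H n y N (J k)) ?odd)) (\<lambda>_. 1) (par_weight (set ?odd) (\<lambda>_. 1) xo 1 ov)"
  proof (rule contracts_mono[OF odd order_refl])
    fix gr assume gr: "gr \<in> groups"
    then show "1 = par_weight {} (\<lambda>_. 1) xo 1 ov gr" by (cases gr) (auto simp: par_weight_def in_groups)
  qed
  show "contracts (pg_PAR H n y N J Kb) (\<lambda>_. 1) (\<lambda>_. T)"
    unfolding pg_PAR_def by (rule contracts_kcomp[OF odd' even'])
qed

end

section \<open>Contraction rates of the two samplers\<close>

lemma nat_floor_div: "nat \<lfloor>(real p + 1) / real h\<rfloor> = (p + 1) div h" "nat \<lfloor>1 / real h\<rfloor> = 1 div h"
proof -
  have "(real p + 1) / real h = real (p + 1) / real h" by simp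
  then show "nat \<lfloor>(real p + 1) / real h\<rfloor> = (p + 1) div h" by (simp only: floor_divide_of_nat_eq nat_int)
  have "1 / real h = real 1 / real h" by simp
  then show "nat \<lfloor>1 / real h\<rfloor> = 1 div h" by (simp only: floor_divide_of_nat_eq nat_int)
qed

theorem theorem8:
  fixes H :: "('x, 'y) hmm" and y :: "nat \<Rightarrow> 'y" and J :: "nat \<Rightarrow> nat set"
    and n m L p h N :: nat
    and \<sigma>m \<sigma>p \<delta> \<alpha> c lam \<beta> \<epsilon> :: real
  assumes hmm: "hidden_markov_model H"
    and diagonal: "{w \<in> space (state_ref H \<Otimes>\<^sub>M state_ref H). fst w = snd w}
                     \<in> sets (state_ref H \<Otimes>\<^sub>M state_ref H)"
    and n: "1 \<le> n"
    and obs: "\<forall>t\<in>{1..n}. y t \<in> space (obs_ref H)"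
    and smoothing: "prob_space (smoothing H n y)"
    and cover: "block_cover n m L p J"
    and S1: "mixing_S1 H \<sigma>m \<sigma>p h"
    and S2: "mixing_S2 H \<delta> h"
    and alpha: "\<alpha> = 1 - \<delta> powr ((1 - real h) / real h) * \<sigma>m / \<sigma>p"
    and c: "c = inverse (2 * \<delta> * \<sigma>p / \<sigma>m - 1)"
    and lam: "lam = 2 * \<alpha> ^ nat \<lfloor>(real p + 1) / real h\<rfloor>"
    and beta: "\<beta> = \<alpha> ^ nat \<lfloor>1 / real h\<rfloor> + \<alpha> ^ nat \<lfloor>(real L - real p + 1) / real h\<rfloor>"
    and eps: "\<epsilon> = 1 - (1 - 1 / (c * (real N - 1) + 1)) ^ L"
    and lam_less: "lam < 1"
    and N: "2 \<le> N"
  shows "(\<exists>lam_PG::real.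
       lam_PG \<le> lam * max \<beta> 1 + \<epsilon> * (2 * lam + 25 * \<epsilon> + 8 * max \<beta> 1) \<and>
       contracts_at_rate (state_ref H) {1..n} (pg_PAR H n y N J m) lam_PG) \<and>
     (\<exists>lam_PG::real.
       (2 * \<epsilon> + \<alpha> ^ nat \<lfloor>(real p + 1) / real h\<rfloor> < 1 \<longrightarrow>
          lam_PG \<le> lam + \<alpha> ^ nat \<lfloor>(real L - real p + 1) / real h\<rfloor> +
            2 * \<epsilon> * ((3 * max \<beta> 1 + 1 + lam) /
              (1 - 2 * \<epsilon> - \<alpha> ^ nat \<lfloor>(real p + 1) / real h\<rfloor>))) \<and>
       contracts_at_rate (state_ref H) {1..n} (pg_LR H n y N J m) lam_PG)"
proof -
  have h: "1 \<le> h" using S1 by (simp add: mixing_S1_def)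
  have hp: "h \<le> p + 1"
  proof (rule ccontr)
    assume "\<not> h \<le> p + 1"
    then have "(p + 1) div h = 0" by simp
    then show False using lam lam_less by (simp add: nat_floor_div)
  qed
  interpret pg_cover H y n N h \<sigma>m \<sigma>p \<delta> m L p J
    by (intro pg_cover.intro pg_model.intro pg_cover_axioms.intro hmm obs smoothing S1 S2 N n cover hp)
  have \<alpha>': "local.\<alpha> = \<alpha>" using alpha by (simp add: \<alpha>_def \<theta>_def)
  have \<epsilon>': "local.\<epsilon> = \<epsilon>"
  proof -
    define b where "b = \<delta> * \<sigma>p / \<sigma>m"
    have b: "1 \<le> b" using B_ge by (simp add: b_def)
    have c': "c = 1 / (2 * b - 1)" using c by (simp add: b_def inverse_eq_divide)
    have N1: "0 < real N - 2 + 2 * b" using b N by simp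
    have "c * (real N - 1) + 1 = (real N - 2 + 2 * b) / (2 * b - 1)"
      unfolding c' using b by (simp add: field_simps)
    moreover have "1 - 1 / ((real N - 2 + 2 * b) / (2 * b - 1)) = (real N - 1) / (real N - 2 + 2 * b)"
      using N1 b by (simp add: field_simps)
    ultimately have "1 - 1 / (c * (real N - 1) + 1) = (real N - 1) / (real N - 2 + 2 * b)" by simp
    then show ?thesis unfolding eps by (simp add: \<epsilon>_def \<kappa>_def b_def)
  qed
  have cs: "ca = \<alpha> ^ nat \<lfloor>(real p + 1) / real h\<rfloor>" "c2 = \<alpha> ^ nat \<lfloor>(real L - real p + 1) / real h\<rfloor>"
    "c1 = \<alpha> ^ nat \<lfloor>1 / real h\<rfloor>"
    unfolding ca_def c1_def c2_def nat_floor_div \<alpha>' by auto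
  have ls: "local.lam = lam" "\<beta>1 = max \<beta> 1"
    unfolding lam_def \<beta>1_def \<beta>_def cs lam beta by auto
  note rate = contracts_rate[OF _ _ diagonal]
  show ?thesis
  proof
    show "\<exists>lam_PG::real. lam_PG \<le> lam * max \<beta> 1 + \<epsilon> * (2 * lam + 25 * \<epsilon> + 8 * max \<beta> 1) \<and>
       contracts_at_rate (state_ref H) {1..n} (pg_PAR H n y N J m) lam_PG"
      using rate[OF par_rate(2,1)] lam_less unfolding ls \<epsilon>' by blast
    show "\<exists>lam_PG::real.
       (2 * \<epsilon> + \<alpha> ^ nat \<lfloor>(real p + 1) / real h\<rfloor> < 1 \<longrightarrow>
          lam_PG \<le> lam + \<alpha> ^ nat \<lfloor>(real L - real p + 1) / real h\<rfloor> +
            2 * \<epsilon> * ((3 * max \<beta> 1 + 1 + lam) /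
              (1 - 2 * \<epsilon> - \<alpha> ^ nat \<lfloor>(real p + 1) / real h\<rfloor>))) \<and>
       contracts_at_rate (state_ref H) {1..n} (pg_LR H n y N J m) lam_PG"
    proof (cases "2 * \<epsilon> + \<alpha> ^ nat \<lfloor>(real p + 1) / real h\<rfloor> < 1")
      case True
      then have "0 < 1 - 2 * local.\<epsilon> - ca" "local.lam < 1" using lam_less unfolding ls \<epsilon>' cs by auto
      from rate[OF lr_rate(2,1)[OF this(2,1)]] this show ?thesis unfolding ls \<epsilon>' cs by blast
    next
      case False
      have "set [1..<m + 1] \<subseteq> {1..m}" by auto
      from trivial_contracts[OF this] obtain q where "0 \<le> q" "contracts (pg_LR H n y N J m) (\<lambda>_. 1) (\<lambda>_. q)"
        unfolding pg_LR_def by blast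
      then show ?thesis using rate False by blast
    qed
  qed
qed

end
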